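(* Let $n,m\in\mathbb{N}$, $\alpha>0$ and $d=\binom{n+m-1}{n}$. Then the maps $$\Lambda_{\mathcal{H}_m}\colon L^\infty(\mathbb{R}^n)^{d\times d}\to\mathcal{C}(\rho_{\mathcal{H}_m}),\qquad \Lambda_{\mathcal{H}_m}(\sigma)=R_{\mathcal{H}_m}^\ast M_\sigma R_{\mathcal{H}_m},$$ $$\Lambda_{\mathcal{F}_{\alpha,m}}\colon L^\infty(\mathbb{R}^n)^{d\times d}\to\mathcal{C}(\rho_{\mathcal{F}_{\alpha,m}}),\qquad \Lambda_{\mathcal{F}_{\alpha,m}}(\sigma)=R_{\mathcal{F}_{\alpha,m}}^\ast M_\sigma R_{\mathcal{F}_{\alpha,m}},$$ are well-defined isometric isomorphisms (of von Neumann algebras). Hence $\mathcal{C}(\rho_{\mathcal{F}_{\alpha,m}})$ and $\mathcal{C}(\rho_{\mathcal{H}_m})$ are isometrically isomorphic to $L^\infty(\mathbb{R}^n)^{d\times d}$.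
   Context: Notation: $\mathbb{N}=\{1,2,\ldots\}$, $\mathbb{N}_0=\{0,1,2,\ldots\}$; $|k|=k_1+\cdots+k_n$ for $k\in\mathbb{N}_0^n$; $\langle z,w\rangle=\sum_{r=1}^n z_r\overline{w_r}$ and $|z|=\sqrt{\langle z,z\rangle}$ on $\mathbb{C}^n$; $\mu_n$ is Lebesgue measure on $\mathbb{R}^n$, $\mu_{2n}$ is Lebesgue measure on $\mathbb{C}^n\cong\mathbb{R}^{2n}$, and $\widetilde{\mu}_n=(2\pi)^{-n/2}\mu_n$ (so $\widetilde\mu_{2n}=(2\pi)^{-n}\mu_{2n}$). Spaces. A smooth function $f\colon\mathbb{C}^n\to\mathbb{C}$ is $m$-analytic if $\overline{D}^k f=0$ for every $k\in\mathbb{N}_0^n$ with $|k|=m$, where $\overline{D}^k=\partial_{\overline{z}_1}^{k_1}\cdots\partial_{\overline{z}_n}^{k_n}$ (Wirtinger derivatives). $\mathcal{F}_{\alpha,m}$ is the Hilbert space of all $m$-analytic functions $f\colon\mathbb{C}^n\to\mathbb{C}$ with $\|f\|^2_{\mathcal{F}_{\alpha,m}}=\frac{\alpha^n}{\pi^n}\int_{\mathbb{C}^n}|f(z)|^2e^{-\alpha|z|^2}\,d\mu_{2n}(z)<\infty$. For $f\in\mathcal{F}_{\alpha,m}$ put $$(U_{\mathcal{F}_{\alpha,m}}^{\mathcal{H}_m}f)(x,y)=2^{n/2}e^{-\frac12|x|^2-\frac12|y|^2-i\langle x,y\rangle}f\Bigl(\frac{x+iy}{\sqrt\alpha}\Bigr)\qquad(x,y\in\mathbb{R}^n).$$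 $\mathcal{H}_m$ is the image of $U_{\mathcal{F}_{\alpha,m}}^{\mathcal{H}_m}$ (it does not depend on $\alpha$), with the inner product of $L^2(\mathbb{R}^{2n},\widetilde\mu_{2n})$. Representations of $\mathbb{R}^n$. For $a\in\mathbb{R}^n$: $(\rho_{\mathcal{F}_{\alpha,m}}(a)f)(z)=f(z-a)e^{\alpha\langle z,a\rangle-\frac{\alpha}{2}|a|^2}$ on $\mathcal{F}_{\alpha,m}$, and $(\rho_{\mathcal{H}_m}(a)f)(x,y)=f(x-a,y)$ on $\mathcal{H}_m$. For a unitary representation $(\rho,H)$ of $\mathbb{R}^n$, $\mathcal{C}(\rho)$ is the von Neumann algebra of all bounded linear operators on $H$ commuting with $\rho(a)$ for all $a\in\mathbb{R}^n$. The operators $R$. Let $J_{n,m}=\{k\in\mathbb{N}_0^n\colon |k|\le m-1\}$, which has $d$ elements, and let $\varphi\colon\{1,\ldots,d\}\to J_{n,m}$ be the bijection enumerating $J_{n,m}$ in lexicographic order. Hermite functions: $\psi_j(t)=(2^j j!\sqrt\pi)^{-1/2}e^{-t^2/2}H_j(t)$, with $H_j$ the physicists' Hermite polynomial. For $k\in J_{n,m}$, $\xi,v\in\mathbb{R}^n$, let $q_{k,\xi}(v)=2^{n/2}\pi^{n/4}\prod_{r=1}^n\psi_{k_r}\bigl(\frac{\xi_r+2v_r}{\sqrt2}\bigr)$. Let $F$ be the Fourier–Plancherel transform on $L^2(\mathbb{R}^n,\widetilde\mu_n)$, $(Fh)(\xi)=\int_{\mathbb{R}^n}h(u)e^{-i\langle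 u,\xi\rangle}\,d\widetilde\mu_n(u)$ for $h\in L^1\cap L^2$, and let $F\otimes I$ be the unitary operator on $L^2(\mathbb{R}^{2n},\widetilde\mu_{2n})$ applying $F$ in the first $n$ variables. Let $\widehat{\mathcal{H}}_m=(F\otimes I)(\mathcal{H}_m)$ and $N\colon\widehat{\mathcal{H}}_m\to L^2(\mathbb{R}^n,\widetilde\mu_n)^d$, $(Ng)(\xi)_j=\int_{\mathbb{R}^n}g(\xi,v)\,q_{\varphi(j),\xi}(v)\,d\widetilde\mu_n(v)$. Define $R_{\mathcal{H}_m}=N(F\otimes I)\colon\mathcal{H}_m\to L^2(\mathbb{R}^n,\widetilde\mu_n)^d$ and $R_{\mathcal{F}_{\alpha,m}}=R_{\mathcal{H}_m}U_{\mathcal{F}_{\alpha,m}}^{\mathcal{H}_m}\colon\mathcal{F}_{\alpha,m}\to L^2(\mathbb{R}^n,\widetilde\mu_n)^d$. Matrix multiplication operators. $L^\infty(\mathbb{R}^n)^{d\times d}=L^\infty(\mathbb{R}^n,\mathcal{M}_d)$ is the W*-algebra of (classes of) essentially bounded measurable functions from $\mathbb{R}^n$ to the algebra $\mathcal{M}_d$ of complex $d\times d$ matrices, with norm $\operatorname{ess\,sup}_\xi\|\sigma(\xi)\|$ (operator norm on $\mathbb{C}^d$). For $\sigma\in L^\infty(\mathbb{R}^n)^{d\times d}$, $M_\sigma$ acts on $L^2(\mathbb{R}^n,\widetilde\mu_n)^d$ by $(M_\sigma f)(\xi)=\sigma(\xi)f(\xi)$. *)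

theory Defs
  imports "HOL-Analysis.Analysis" "HOL-Probability.Essential_Supremum"
begin

section \<open>Hilbert spaces and their operators\<close>

text \<open>
  Complex inner product spaces are given by explicit carriers, so that spaces of functions and
  spaces of a.e. classes are treated alike. The inner product is linear in the first argument.
\<close>

record 'a hilb =
  hcarrier :: "'a set"
  hadd :: "'a \<Rightarrow> 'a \<Rightarrow> 'a"
  hscale :: "complex \<Rightarrow> 'a \<Rightarrow> 'a"
  hinner :: "'a \<Rightarrow> 'a \<Rightarrow> complex"

definition hnorm :: "'a hilb \<Rightarrow> 'a \<Rightarrow> real" where
  "hnorm H x = sqrt (Re (hinner H x x))"

text \<open>
  Operators are extensional (\<open>undefined\<close> outside the carrier), so that HOL equality of operators
  is equality on the carrier.
\<close>

definition bounded_ops :: "'a hilb \<Rightarrow> 'b hilb \<Rightarrow> ('a \<Rightarrow> 'b) set" where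
  "bounded_ops H K = {T \<in> hcarrier H \<rightarrow>\<^sub>E hcarrier K.
     (\<forall>x\<in>hcarrier H. \<forall>y\<in>hcarrier H. T (hadd H x y) = hadd K (T x) (T y)) \<and>
     (\<forall>c. \<forall>x\<in>hcarrier H. T (hscale H c x) = hscale K c (T x)) \<and>
     (\<exists>C. \<forall>x\<in>hcarrier H. hnorm K (T x) \<le> C * hnorm H x)}"

definition opnorm :: "'a hilb \<Rightarrow> 'b hilb \<Rightarrow> ('a \<Rightarrow> 'b) \<Rightarrow> real" where
  "opnorm H K T = Sup {hnorm K (T x) | x. x \<in> hcarrier H \<and> hnorm H x \<le> 1}"

definition hadjoint :: "'a hilb \<Rightarrow> 'b hilb \<Rightarrow> ('a \<Rightarrow> 'b) \<Rightarrow> 'b \<Rightarrow> 'a" where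
  "hadjoint H K T = (\<lambda>y\<in>hcarrier K.
     THE x. x \<in> hcarrier H \<and> (\<forall>z\<in>hcarrier H. hinner K (T z) y = hinner H z x))"


section \<open>Normed star-algebras and their isomorphisms\<close>

record 'a staralg =
  acarrier :: "'a set"
  aadd :: "'a \<Rightarrow> 'a \<Rightarrow> 'a"
  ascale :: "complex \<Rightarrow> 'a \<Rightarrow> 'a"
  amult :: "'a \<Rightarrow> 'a \<Rightarrow> 'a"
  aone :: "'a"
  astar :: "'a \<Rightarrow> 'a"
  anorm :: "'a \<Rightarrow> real"

text \<open>
  An isomorphism of von Neumann algebras is a star-isomorphism; normality is automatic.
\<close>

definition isometric_star_iso :: "'a staralg \<Rightarrow> 'b staralg \<Rightarrow> ('a \<Rightarrow> 'b) \<Rightarrow> bool" where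
  "isometric_star_iso A B \<Phi> \<longleftrightarrow>
     bij_betw \<Phi> (acarrier A) (acarrier B) \<and>
     (\<forall>s\<in>acarrier A. \<forall>t\<in>acarrier A. \<Phi> (aadd A s t) = aadd B (\<Phi> s) (\<Phi> t)) \<and>
     (\<forall>c. \<forall>s\<in>acarrier A. \<Phi> (ascale A c s) = ascale B c (\<Phi> s)) \<and>
     (\<forall>s\<in>acarrier A. \<forall>t\<in>acarrier A. \<Phi> (amult A s t) = amult B (\<Phi> s) (\<Phi> t)) \<and>
     \<Phi> (aone A) = aone B \<and>
     (\<forall>s\<in>acarrier A. \<Phi> (astar A s) = astar B (\<Phi> s)) \<and>
     (\<forall>s\<in>acarrier A. anorm B (\<Phi> s) = anorm A s)"

definition isometrically_isomorphic :: "'a staralg \<Rightarrow> 'b staralg \<Rightarrow> bool" where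
  "isometrically_isomorphic A B \<longleftrightarrow> (\<exists>\<Phi>. isometric_star_iso A B \<Phi>)"

text \<open>The algebra \<open>\<C>(\<rho>)\<close> of a representation \<open>\<rho>\<close> on \<open>H\<close>.\<close>

definition commutant :: "'a hilb \<Rightarrow> ('g \<Rightarrow> 'a \<Rightarrow> 'a) \<Rightarrow> ('a \<Rightarrow> 'a) staralg" where
  "commutant H \<rho> = \<lparr>
     acarrier = {S \<in> bounded_ops H H. \<forall>a. \<forall>f\<in>hcarrier H. S (\<rho> a f) = \<rho> a (S f)},
     aadd = (\<lambda>S T. \<lambda>f\<in>hcarrier H. hadd H (S f) (T f)),
     ascale = (\<lambda>c S. \<lambda>f\<in>hcarrier H. hscale H c (S f)),
     amult = (\<lambda>S T. compose (hcarrier H) S T),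
     aone = (\<lambda>f\<in>hcarrier H. f),
     astar = hadjoint H H,
     anorm = opnorm H H\<rparr>"


section \<open>Measurable functions modulo a.e. equality\<close>

text \<open>
  Borel representatives lose nothing: every Lebesgue measurable function agrees a.e. with a
  Borel measurable one. Applying \<open>cls\<close> to a non-measurable function gives no
  information.
\<close>

definition ae_eq :: "('a::euclidean_space \<Rightarrow> 'b::topological_space) \<Rightarrow> ('a \<Rightarrow> 'b) \<Rightarrow> bool" where
  "ae_eq f g \<longleftrightarrow> f \<in> borel_measurable lborel \<and> g \<in> borel_measurable lborel \<and>
     (AE x in lborel. f x = g x)"

quotient_type (overloaded) ('a, 'b) L0 =
  "'a::euclidean_space \<Rightarrow> 'b::topological_space" / partial: ae_eq
  morphisms rep cls
proof (rule part_equivpI)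
  show "\<exists>f :: 'a \<Rightarrow> 'b. ae_eq f f"
    by (rule exI[of _ "\<lambda>_. undefined"]) (simp add: ae_eq_def)
  show "symp (ae_eq :: ('a \<Rightarrow> 'b) \<Rightarrow> _)"
    by (auto simp: symp_def ae_eq_def elim: eventually_mono)
  show "transp (ae_eq :: ('a \<Rightarrow> 'b) \<Rightarrow> _)"
    by (auto simp: transp_def ae_eq_def elim: eventually_elim2)
qed

definition L0_map :: "('b::topological_space \<Rightarrow> 'c::topological_space) \<Rightarrow>
    ('a::euclidean_space, 'b) L0 \<Rightarrow> ('a, 'c) L0" where
  "L0_map F f = cls (\<lambda>x. F (rep f x))"

definition L0_map2 :: "('b::topological_space \<Rightarrow> 'c::topological_space \<Rightarrow> 'e::topological_space) \<Rightarrow>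
    ('a::euclidean_space, 'b) L0 \<Rightarrow> ('a, 'c) L0 \<Rightarrow> ('a, 'e) L0" where
  "L0_map2 F f g = cls (\<lambda>x. F (rep f x) (rep g x))"


section \<open>The spaces \<open>L\<^sup>2\<close> and the algebra \<open>L\<^sup>\<infinity>\<close>\<close>

text \<open>\<open>(2\<pi>)\<^sup>-\<^sup>N\<^sup>/\<^sup>2\<close> times Lebesgue measure, where \<open>N\<close> is the real dimension of the space.\<close>

definition mut :: "'a::euclidean_space measure" where
  "mut = density lborel (\<lambda>_. ennreal ((2 * pi) powr (- real DIM('a) / 2)))"

definition cip :: "complex ^ 'k \<Rightarrow> complex ^ 'k \<Rightarrow> complex" where
  "cip z w = (\<Sum>r\<in>UNIV. z $ r * cnj (w $ r))"

definition L2_carrier :: "('a::euclidean_space, 'b::real_normed_vector) L0 set" where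
  "L2_carrier = {f. integrable mut (\<lambda>x. (norm (rep f x))\<^sup>2)}"

definition L2 :: "('a::euclidean_space, complex) L0 hilb" where
  "L2 = \<lparr>
     hcarrier = L2_carrier,
     hadd = L0_map2 (+),
     hscale = (\<lambda>c. L0_map ((*) c)),
     hinner = (\<lambda>f g. integral\<^sup>L mut (\<lambda>x. rep f x * cnj (rep g x)))\<rparr>"

text \<open>\<open>L\<^sup>2(\<real>\<^sup>n)\<^sup>d\<close>, as classes of \<open>\<complex>\<^sup>d\<close>-valued functions.\<close>

definition L2vec :: "('a::euclidean_space, complex ^ 'd) L0 hilb" where
  "L2vec = \<lparr>
     hcarrier = L2_carrier,
     hadd = L0_map2 (+),
     hscale = (\<lambda>c. L0_map ((*s) c)),
     hinner = (\<lambda>f g. integral\<^sup>L mut (\<lambda>x. cip (rep f x) (rep g x)))\<rparr>"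

definition esssup_norm :: "('a::euclidean_space, complex ^ 'd ^ 'd) L0 \<Rightarrow> ereal" where
  "esssup_norm \<sigma> = esssup lborel (\<lambda>\<xi>. ereal (onorm (\<lambda>v. rep \<sigma> \<xi> *v v)))"

definition Linf_mat :: "('a::euclidean_space, complex ^ 'd ^ 'd) L0 staralg" where
  "Linf_mat = \<lparr>
     acarrier = {\<sigma>. esssup_norm \<sigma> < \<infinity>},
     aadd = L0_map2 (+),
     ascale = (\<lambda>c. L0_map (map_matrix ((*) c))),
     amult = L0_map2 (**),
     aone = cls (\<lambda>_. mat 1),
     astar = L0_map (\<lambda>A. map_matrix cnj (transpose A)),
     anorm = (\<lambda>\<sigma>. real_of_ereal (esssup_norm \<sigma>))\<rparr>"

definition mult_op :: "('a::euclidean_space, complex ^ 'd ^ 'd) L0 \<Rightarrow>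
    ('a, complex ^ 'd) L0 \<Rightarrow> ('a, complex ^ 'd) L0" where
  "mult_op \<sigma> = (\<lambda>f\<in>hcarrier L2vec. L0_map2 (*v) \<sigma> f)"


section \<open>The Fourier--Plancherel transform\<close>

definition plancherel :: "('a::euclidean_space, complex) L0 \<Rightarrow> ('a, complex) L0" where
  "plancherel = (THE T. T \<in> bounded_ops L2 L2 \<and>
     (\<forall>h\<in>hcarrier L2. integrable mut (rep h) \<longrightarrow>
        T h = cls (\<lambda>\<xi>. integral\<^sup>L mut (\<lambda>u. rep h u * exp (- \<i> * of_real (u \<bullet> \<xi>))))))"

definition tensor :: "('a::euclidean_space, complex) L0 \<Rightarrow> ('b::euclidean_space, complex) L0 \<Rightarrow>
    ('a \<times> 'b, complex) L0" where
  "tensor h k = cls (\<lambda>(x, y). rep h x * rep k y)"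

text \<open>\<open>F \<otimes> I\<close>: the bounded operator determined by its values on elementary tensors.\<close>

definition plancherel1 :: "('a::euclidean_space \<times> 'b::euclidean_space, complex) L0 \<Rightarrow>
    ('a \<times> 'b, complex) L0" where
  "plancherel1 = (THE T. T \<in> bounded_ops L2 L2 \<and>
     (\<forall>h\<in>hcarrier L2. \<forall>k\<in>hcarrier L2. T (tensor h k) = tensor (plancherel h) k))"


section \<open>Polyanalytic functions of several variables\<close>

primrec C_k :: "nat \<Rightarrow> ('a::real_normed_vector \<Rightarrow> 'b::real_normed_vector) \<Rightarrow> bool" where
  "C_k 0 f \<longleftrightarrow> continuous_on UNIV f"
| "C_k (Suc k) f \<longleftrightarrow> (\<forall>x. f differentiable (at x)) \<and>
     (\<forall>v. C_k k (\<lambda>x. frechet_derivative f (at x) v))"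

definition smooth :: "('a::real_normed_vector \<Rightarrow> 'b::real_normed_vector) \<Rightarrow> bool" where
  "smooth f \<longleftrightarrow> (\<forall>k. C_k k f)"

text \<open>
  The indices of the coordinates form a linearly ordered finite type \<open>'n\<close>; the order enters
  in the lexicographic order of multi-indices below. In \<open>dbar\<close>, the vectors \<open>axis r 1\<close> and
  \<open>axis r \<i>\<close> are the real coordinate directions of \<open>x\<^sub>r\<close> and \<open>y\<^sub>r\<close> for \<open>z\<^sub>r = x\<^sub>r + \<i> y\<^sub>r\<close>.
\<close>

definition dbar :: "'n::finite \<Rightarrow> (complex ^ 'n \<Rightarrow> complex) \<Rightarrow> complex ^ 'n \<Rightarrow> complex" where
  "dbar r f = (\<lambda>z. (frechet_derivative f (at z) (axis r 1) +
     \<i> * frechet_derivative f (at z) (axis r \<i>)) / 2)"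

definition dbar_multi :: "nat ^ 'n::{finite,linorder} \<Rightarrow> (complex ^ 'n::{finite,linorder} \<Rightarrow> complex) \<Rightarrow>
    complex ^ 'n::{finite,linorder} \<Rightarrow> complex" where
  "dbar_multi k f = foldr (\<lambda>r. dbar r ^^ (k $ r)) (sorted_list_of_set UNIV) f"

definition mi_size :: "nat ^ 'n::finite \<Rightarrow> nat" where
  "mi_size k = (\<Sum>r\<in>UNIV. k $ r)"

definition m_analytic :: "nat \<Rightarrow> (complex ^ 'n::{finite,linorder} \<Rightarrow> complex) \<Rightarrow> bool" where
  "m_analytic m f \<longleftrightarrow> smooth f \<and> (\<forall>k. mi_size k = m \<longrightarrow> (\<forall>z. dbar_multi k f z = 0))"

definition Fock :: "real \<Rightarrow> nat \<Rightarrow> (complex ^ 'n::{finite,linorder} \<Rightarrow> complex) hilb" where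
  "Fock \<alpha> m = \<lparr>
     hcarrier = {f. m_analytic m f \<and>
       integrable lborel (\<lambda>z. (cmod (f z))\<^sup>2 * exp (- \<alpha> * (norm z)\<^sup>2))},
     hadd = (\<lambda>f g z. f z + g z),
     hscale = (\<lambda>c f z. c * f z),
     hinner = (\<lambda>f g. of_real (\<alpha> ^ CARD('n) / pi ^ CARD('n)) *
       integral\<^sup>L lborel (\<lambda>z. f z * cnj (g z) * of_real (exp (- \<alpha> * (norm z)\<^sup>2))))\<rparr>"

definition Fock_to_H :: "real \<Rightarrow> (complex ^ 'n \<Rightarrow> complex) \<Rightarrow> (real ^ 'n) \<times> (real ^ 'n) \<Rightarrow> complex" where
  "Fock_to_H \<alpha> f = (\<lambda>(x, y). of_real (2 powr (real CARD('n) / 2)) *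
     exp (of_real (- (norm x)\<^sup>2 / 2 - (norm y)\<^sup>2 / 2) - \<i> * of_real (x \<bullet> y)) *
     f (\<chi> r. Complex (x $ r) (y $ r) / of_real (sqrt \<alpha>)))"

text \<open>
  \<open>\<H>\<^sub>m\<close>, realised as the image of \<open>\<F>\<^sub>\<alpha>\<^sub>,\<^sub>m\<close>. The space does not depend on \<open>\<alpha> > 0\<close>; the argument
  records which Fock space is used to obtain it.
\<close>

definition Hsp :: "real \<Rightarrow> nat \<Rightarrow> ((real ^ 'n::{finite,linorder}) \<times> (real ^ 'n::{finite,linorder}) \<Rightarrow> complex) hilb" where
  "Hsp \<alpha> m = \<lparr>
     hcarrier = Fock_to_H \<alpha> ` hcarrier (Fock \<alpha> m),
     hadd = (\<lambda>f g p. f p + g p),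
     hscale = (\<lambda>c f p. c * f p),
     hinner = (\<lambda>f g. integral\<^sup>L mut (\<lambda>p. f p * cnj (g p)))\<rparr>"

definition vec_of_real :: "real ^ 'n \<Rightarrow> complex ^ 'n" where
  "vec_of_real a = (\<chi> r. of_real (a $ r))"

definition rho_F :: "real \<Rightarrow> real ^ 'n \<Rightarrow> (complex ^ 'n \<Rightarrow> complex) \<Rightarrow> complex ^ 'n \<Rightarrow> complex" where
  "rho_F \<alpha> a f = (\<lambda>z. f (z - vec_of_real a) *
     exp (of_real \<alpha> * cip z (vec_of_real a) - of_real (\<alpha> / 2 * (norm a)\<^sup>2)))"

definition rho_H :: "real ^ 'n \<Rightarrow> ((real ^ 'n) \<times> (real ^ 'n) \<Rightarrow> complex) \<Rightarrow>
    (real ^ 'n) \<times> (real ^ 'n) \<Rightarrow> complex" where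
  "rho_H a f = (\<lambda>(x, y). f (x - a, y))"


section \<open>Hermite functions and the operators \<open>R\<close>\<close>

fun hermite :: "nat \<Rightarrow> real \<Rightarrow> real" where
  "hermite 0 t = 1"
| "hermite (Suc 0) t = 2 * t"
| "hermite (Suc (Suc j)) t = 2 * t * hermite (Suc j) t - 2 * real (Suc j) * hermite j t"

definition hermite_fun :: "nat \<Rightarrow> real \<Rightarrow> real" where
  "hermite_fun j t = (2 ^ j * fact j * sqrt pi) powr (- 1 / 2) * exp (- t\<^sup>2 / 2) * hermite j t"

definition q_fun :: "nat ^ 'n \<Rightarrow> real ^ 'n \<Rightarrow> real ^ 'n \<Rightarrow> real" where
  "q_fun k \<xi> v = 2 powr (real CARD('n) / 2) * pi powr (real CARD('n) / 4) *
     (\<Prod>r\<in>UNIV. hermite_fun (k $ r) ((\<xi> $ r + 2 * v $ r) / sqrt 2))"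

definition J_set :: "nat \<Rightarrow> (nat ^ 'n::finite) set" where
  "J_set m = {k. mi_size k \<le> m - 1}"

text \<open>The order \<open><\<close> that the library puts on vectors is the componentwise one.\<close>

definition lex_less :: "nat ^ 'n::{finite,linorder} \<Rightarrow> nat ^ 'n::{finite,linorder} \<Rightarrow> bool" where
  "lex_less k l \<longleftrightarrow> (\<exists>r. k $ r < l $ r \<and> (\<forall>s<r. k $ s = l $ s))"

text \<open>
  The linearly ordered finite type \<open>'d\<close> plays the role of \<open>{1,\<dots>,d}\<close>; the enumeration exists
  when \<open>CARD('d)\<close> is the cardinality of \<open>J_set m\<close>.
\<close>

definition lex_enum :: "nat \<Rightarrow> 'd::{finite,linorder} \<Rightarrow> nat ^ 'n::{finite,linorder}" where
  "lex_enum m = (THE \<phi>. bij_betw \<phi> UNIV (J_set m) \<and> (\<forall>i j. i < j \<longrightarrow> lex_less (\<phi> i) (\<phi> j)))"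

definition H_hat :: "real \<Rightarrow> nat \<Rightarrow> ((real ^ 'n::{finite,linorder}) \<times> (real ^ 'n::{finite,linorder}), complex) L0 set" where
  "H_hat \<alpha> m = (\<lambda>f. plancherel1 (cls f)) ` hcarrier (Hsp \<alpha> m)"

definition N_op :: "real \<Rightarrow> nat \<Rightarrow> ((real ^ 'n::{finite,linorder}) \<times> (real ^ 'n::{finite,linorder}), complex) L0 \<Rightarrow>
    (real ^ 'n::{finite,linorder}, complex ^ 'd::{finite,linorder}) L0" where
  "N_op \<alpha> m = (\<lambda>g\<in>H_hat \<alpha> m. cls (\<lambda>\<xi>. \<chi> j.
     integral\<^sup>L mut (\<lambda>v. rep g (\<xi>, v) * of_real (q_fun (lex_enum m j) \<xi> v))))"

definition R_H :: "real \<Rightarrow> nat \<Rightarrow> ((real ^ 'n::{finite,linorder}) \<times> (real ^ 'n::{finite,linorder}) \<Rightarrow> complex) \<Rightarrow>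
    (real ^ 'n::{finite,linorder}, complex ^ 'd::{finite,linorder}) L0" where
  "R_H \<alpha> m = (\<lambda>f\<in>hcarrier (Hsp \<alpha> m). N_op \<alpha> m (plancherel1 (cls f)))"

definition R_F :: "real \<Rightarrow> nat \<Rightarrow> (complex ^ 'n::{finite,linorder} \<Rightarrow> complex) \<Rightarrow>
    (real ^ 'n::{finite,linorder}, complex ^ 'd::{finite,linorder}) L0" where
  "R_F \<alpha> m = (\<lambda>f\<in>hcarrier (Fock \<alpha> m). R_H \<alpha> m (Fock_to_H \<alpha> f))"

definition Lambda_H :: "real \<Rightarrow> nat \<Rightarrow>
    (real ^ 'n::{finite,linorder}, complex ^ 'd::{finite,linorder} ^ 'd::{finite,linorder}) L0 \<Rightarrow>
    ((real ^ 'n::{finite,linorder}) \<times> (real ^ 'n::{finite,linorder}) \<Rightarrow> complex) \<Rightarrow> (real ^ 'n::{finite,linorder}) \<times> (real ^ 'n::{finite,linorder}) \<Rightarrow> complex" where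
  "Lambda_H \<alpha> m \<sigma> = (\<lambda>f\<in>hcarrier (Hsp \<alpha> m).
     hadjoint (Hsp \<alpha> m) L2vec (R_H \<alpha> m) (mult_op \<sigma> (R_H \<alpha> m f)))"

definition Lambda_F :: "real \<Rightarrow> nat \<Rightarrow>
    (real ^ 'n::{finite,linorder}, complex ^ 'd::{finite,linorder} ^ 'd::{finite,linorder}) L0 \<Rightarrow>
    (complex ^ 'n::{finite,linorder} \<Rightarrow> complex) \<Rightarrow> complex ^ 'n::{finite,linorder} \<Rightarrow> complex" where
  "Lambda_F \<alpha> m \<sigma> = (\<lambda>f\<in>hcarrier (Fock \<alpha> m).
     hadjoint (Fock \<alpha> m) L2vec (R_F \<alpha> m) (mult_op \<sigma> (R_F \<alpha> m f)))"

end

theory Submission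
 imports Defs "HOL-Probability.Probability"
begin

text \<open>
The translations that act on \<open>\<H>\<^sub>m\<close> become multiplications by characters under the Fourier transform in
the first variable, so the theorem comes down to two facts: \<open>R\<close> is unitary onto \<open>L\<^sup>2(\<real>\<^sup>n)\<^sup>d\<close>, and an
operator on \<open>L\<^sup>2(\<real>\<^sup>n)\<^sup>d\<close> that commutes with all characters is multiplication by a matrix function.

For the first fact one has to see that, for \<open>f\<close> in \<open>\<H>\<^sub>m\<close> and almost every \<open>xi\<close>, the section at \<open>xi\<close> of the
transform of \<open>f\<close> is a combination of the orthonormal functions \<open>q\<^bsub>k,xi\<^esub>\<close> with \<open>|k| < m\<close>. These functions
are complete over all \<open>k\<close> (\<open>q_complete\<close>), so the coefficients with \<open>|k| \<ge> m\<close> must vanish. Multiplied by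
a Gaussian they are integrable, and their Fourier transform at \<open>-c\<close> is the pairing of \<open>f\<close> with an
explicit function (\<open>FT1_wtest\<close>, \<open>hweight_FT1\<close>): a Gaussian times the monomial of degree \<open>k\<close> in \<open>z - c\<close>.
This is a \<open>k\<close>-fold Wirtinger derivative of a Gaussian (\<open>dbar_Pf\<close>), so partial integration moves \<open>m\<close>
derivatives to the \<open>m\<close>-analytic function, which they annihilate (\<open>fock_orthogonal\<close>, \<open>ncoef_vanishes\<close>,
\<open>R_expansion\<close>). Conversely, the inverse transform of \<open>\<Sum>\<^sub>j h\<^sub>j(xi) q\<^bsub>ph j,xi\<^esub>(v)\<close> is, up to the weight, an
integral of \<open>exp(i z \<bullet> xi)\<close> against polynomials of degree below \<open>m\<close> in the imaginary part of \<open>z\<close>, hence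
\<open>m\<close>-analytic (\<open>HP_An\<close>, \<open>S_in\<close>); this gives surjectivity of \<open>R\<close>.

For the second fact, let \<open>A\<close> commute with the characters. The difference of \<open>\<langle>A f, k\<rangle>\<close> and \<open>\<langle>f, A\<^sup>* k\<rangle>\<close>,
taken pointwise, is an integrable function with Fourier transform zero. Hence the two agree almost
everywhere, and testing with Gaussian multiples of the unit vectors reads off a matrix
(\<open>commutant_is_mult\<close>), which is bounded almost everywhere by any bound for \<open>A\<close> (\<open>mult_op_bound_imp\<close>).

Conjugation by a unitary operator carries commutants to commutants (\<open>transport\<close>). The Fock space is
reached through \<open>Fock_to_H\<close>, which turns the shift by \<open>a\<close> into the translation by \<open>\<surd>\<alpha> a\<close> (\<open>Fock_to_H_rho\<close>).\<close>

section \<open>Normalised Lebesgue measure\<close>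

abbreviation "Imut f \<equiv> integral\<^sup>L mut f"
abbreviation "Ilb f \<equiv> integral\<^sup>L lborel f"
abbreviation "imut f \<equiv> integrable mut f"
abbreviation "bmeas \<equiv> borel_measurable borel"
abbreviation "cor \<equiv> complex_of_real"

abbreviation "HV \<equiv> hcarrier L2vec"
abbreviation "H2 \<equiv> hcarrier L2"
abbreviation lim_to (infix "~~>" 60) where "X ~~> l \<equiv> X \<longlonglongrightarrow> l"

definition mutc :: "'a::euclidean_space itself => real" where
 "mutc _ = (2 * pi) powr (- real DIM('a) / 2)"

lemma mutc_pos [simp]: "mutc TYPE('a::euclidean_space) > 0"
 by (simp add: mutc_def)

lemma mutc_nonneg [simp]: "mutc TYPE('a::euclidean_space) >= 0"
 using mutc_pos[where 'a='a] by (rule less_imp_le)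

lemma mutc_neq0 [simp]: "mutc TYPE('a::euclidean_space) ~= 0"
 using mutc_pos[where 'a='a] by (rule less_imp_neq[symmetric])

lemma mut_eq: "(mut :: 'a::euclidean_space measure) = density lborel (%_. ennreal (mutc TYPE('a)))"
 by (simp add: mut_def mutc_def)

lemma sets_mut [simp, measurable_cong]: "sets (mut :: 'a::euclidean_space measure) = sets borel"
 by (simp add: mut_eq)

lemma space_mut [simp]: "space (mut :: 'a::euclidean_space measure) = UNIV"
 by (simp add: mut_eq)

lemma AE_mut [simp]: "(AE x in (mut :: 'a::euclidean_space measure). P x) \<longleftrightarrow> (AE x in lborel. P x)"
 unfolding mut_eq by (subst AE_density) auto

lemma measurable_mut [simp]: "borel_measurable (mut :: 'a::euclidean_space measure) = bmeas"
 by (intro measurable_cong_sets) auto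

lemma integrable_scaleR_iff:
 fixes f :: "'a => 'b::{banach,second_countable_topology}" and c :: real
 assumes "c ~= 0"
 shows "integrable M (%x. c *\<^sub>R f x) \<longleftrightarrow> integrable M f"
proof
 assume "integrable M (%x. c *\<^sub>R f x)"
 then have "integrable M (%x. (1 / c) *\<^sub>R (c *\<^sub>R f x))"
  by (rule integrable_scaleR_right)
 then show "integrable M f" using assms by simp
qed (use assms in simp)

lemma sigma_finite_mut: "sigma_finite_measure (mut :: 'a::euclidean_space measure)"
 unfolding mut_eq
 by (subst sigma_finite_measure.sigma_finite_iff_density_finite) (auto intro!: sigma_finite_lborel)

lemma mut_prod: "(mut :: 'a::euclidean_space measure) \<Otimes>\<^sub>M (mut :: 'b::euclidean_space measure) = mut"
proof -
 have "mutc TYPE('a \<times> 'b) = mutc TYPE('a) * mutc TYPE('b)"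
  by (simp add: mutc_def powr_add[symmetric] add_divide_distrib diff_divide_distrib)
 then show ?thesis
  unfolding mut_eq
  by (subst pair_measure_density)
  (auto simp: lborel_prod ennreal_mult'[symmetric] split_beta'
  intro!: sigma_finite_lborel sigma_finite_mut[unfolded mut_eq])
qed

interpretation mut: sigma_finite_measure "mut :: 'a::euclidean_space measure"
 by (rule sigma_finite_mut)

interpretation mutp: pair_sigma_finite "mut :: 'a::euclidean_space measure" "mut :: 'b::euclidean_space measure"
 ..

lemma integrable_mut:
 fixes f :: "'a::euclidean_space => 'b::{banach,second_countable_topology}"
 shows "imut f \<longleftrightarrow> integrable lborel f"
proof (cases "f \<in> bmeas")
 case True
 then show ?thesis unfolding mut_eq
  by (subst integrable_density) (auto simp: less_imp_le integrable_scaleR_iff)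
next
 case False
 then show ?thesis using borel_measurable_integrable[of mut f] borel_measurable_integrable[of lborel f] by auto
qed

lemma integral_mut:
 fixes f :: "'a::euclidean_space => 'b::{banach,second_countable_topology}"
 shows "Imut f = mutc TYPE('a) *\<^sub>R Ilb f"
proof (cases "f \<in> bmeas")
 case True
 then show ?thesis unfolding mut_eq
  by (subst integral_density) (auto simp: less_imp_le)
next
 case False
 then show ?thesis
  using borel_measurable_integrable[of mut f] borel_measurable_integrable[of lborel f]
  by (metis measurable_mut measurable_lborel2 not_integrable_integral_eq scaleR_zero_right)
qed

lemma lborel_euclid_affine:
 fixes f :: "'a::euclidean_space => 'b::{banach,second_countable_topology}"
 assumes c: "c ~= 0"
 shows "integrable lborel (%x. f (t + c *\<^sub>R x)) \<longleftrightarrow> integrable lborel f"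
  and "Ilb f = \<bar>c\<bar> ^ DIM('a) *\<^sub>R Ilb (%x. f (t + c *\<^sub>R x))"
proof -
 have inv: "(%x. f (t + c *\<^sub>R x)) \<in> bmeas ==> f \<in> bmeas"
 proof -
  assume a: "(%x. f (t + c *\<^sub>R x)) \<in> bmeas"
  have "(%y. (%x. f (t + c *\<^sub>R x)) ((1/c) *\<^sub>R (y - t))) \<in> bmeas"
  by (rule measurable_compose[OF _ a]) simp
  then show ?thesis using c by simp
 qed
 have *: "lborel = density (distr lborel borel (%x::'a. t + c *\<^sub>R x)) (%_. ennreal (\<bar>c\<bar>^DIM('a)))"
  by (rule lborel_affine[OF c])
 show I: "integrable lborel (%x. f (t + c *\<^sub>R x)) \<longleftrightarrow> integrable lborel f"
 proof (cases "f \<in> bmeas")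
  case [measurable]: True
  have "integrable lborel f \<longleftrightarrow> integrable lborel (%x. \<bar>c\<bar>^DIM('a) *\<^sub>R f (t + c *\<^sub>R x))"
  by (subst *, subst integrable_density) (auto simp: integrable_distr_eq)
  then show ?thesis using c by (simp only: integrable_scaleR_iff power_not_zero abs_eq_0 not_False_eq_True)
 next
  case False
  then show ?thesis using inv by (metis borel_measurable_integrable measurable_lborel2)
 qed
 show "Ilb f = \<bar>c\<bar> ^ DIM('a) *\<^sub>R Ilb (%x. f (t + c *\<^sub>R x))"
 proof (cases "integrable lborel f")
  case True
  then have m [measurable]: "f \<in> bmeas" using borel_measurable_integrable by fastforce
  have m2: "(%x. f (t + c *\<^sub>R x)) \<in> bmeas" by measurable
  have "Ilb f = integral\<^sup>L (distr lborel borel (%x::'a. t + c *\<^sub>R x)) (%x. \<bar>c\<bar>^DIM('a) *\<^sub>R f x)"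
  by (subst *, subst integral_density) simp_all
  also have "... = Ilb (%x. \<bar>c\<bar>^DIM('a) *\<^sub>R f (t + c *\<^sub>R x))"
  by (subst integral_distr) simp_all
  finally show ?thesis by simp
 next
  case False then show ?thesis using I by (simp add: not_integrable_integral_eq)
 qed
qed

lemma mut_affine:
 fixes f :: "'a::euclidean_space => 'b::{banach,second_countable_topology}"
 assumes c: "c ~= 0"
 shows "imut (%x. f (t + c *\<^sub>R x)) \<longleftrightarrow> imut f"
  and "Imut f = \<bar>c\<bar> ^ DIM('a) *\<^sub>R Imut (%x. f (t + c *\<^sub>R x))"
 using lborel_euclid_affine[OF c, of f t] by (simp_all add: integrable_mut integral_mut)

text \<open>Fubini for products of one-dimensional factors.\<close>

lemma lborel_prod_Basis:
 fixes f :: "'a::euclidean_space => real => complex"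
 assumes f: "!!b. b \<in> Basis ==> integrable lborel (f b)"
 shows "integrable lborel (%x::'a. PROD b:Basis. f b (x \<bullet> b))"
  and "Ilb (%x::'a. PROD b:Basis. f b (x \<bullet> b)) = (PROD b:Basis. Ilb (f b))"
proof -
 interpret product_sigma_finite "%_::'a. lborel::real measure"
  by (simp add: product_sigma_finite_def sigma_finite_lborel)
 have [measurable]: "!!b. b \<in> Basis ==> f b \<in> bmeas"
  using f by (metis borel_measurable_integrable measurable_lborel2)
 have s: "(SUM b:Basis. g b *\<^sub>R b) \<bullet> c = g c" if "c \<in> Basis" for g and c :: 'a
  using that by (simp add: inner_sum_left_Basis)
 have eq: "(PROD b:Basis. f b ((SUM b:Basis. g b *\<^sub>R b) \<bullet> b)) = (PROD b:Basis. f b (g b))" for g :: "'a => real"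
  by (intro prod.cong refl) (simp add: s)
 have m: "(%x::'a. PROD b:Basis. f b (x \<bullet> b)) \<in> bmeas"
  by (intro borel_measurable_prod measurable_compose[OF _ \<open>!!b. b \<in> Basis ==> f b \<in> bmeas\<close>]) auto
 have d: "(%f. SUM b:Basis. f b *\<^sub>R b) \<in> (\<Pi>\<^sub>M b\<in>Basis. lborel) \<rightarrow>\<^sub>M (borel :: 'a measure)"
  by measurable
 show "integrable lborel (%x::'a. PROD b:Basis. f b (x \<bullet> b))"
  by (subst lborel_eq, subst integrable_distr_eq[OF d m], unfold eq, rule product_integrable_prod) (auto intro: f)
 show "Ilb (%x::'a. PROD b:Basis. f b (x \<bullet> b)) = (PROD b:Basis. Ilb (f b))"
  by (subst lborel_eq, subst integral_distr[OF d m], unfold eq, rule product_integral_prod) (auto intro: f)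
qed

lemma mutc_power: "mutc TYPE('a::euclidean_space) = mutc TYPE(real) ^ DIM('a)"
proof -
 have "mutc TYPE(real) ^ DIM('a) = mutc TYPE(real) powr (real DIM('a))"
  by (simp add: powr_realpow)
 also have "... = mutc TYPE('a)"
  unfolding mutc_def by (subst powr_powr) simp
 finally show ?thesis by simp
qed

lemma mut_prod_Basis:
 fixes f :: "'a::euclidean_space => real => complex"
 assumes f: "!!b. b \<in> Basis ==> imut (f b)"
 shows "imut (%x::'a. PROD b:Basis. f b (x \<bullet> b))"
  and "Imut (%x::'a. PROD b:Basis. f b (x \<bullet> b)) = (PROD b:Basis. Imut (f b))"
 using lborel_prod_Basis[of f] f
 by (simp_all add: integrable_mut integral_mut scaleR_conv_of_real prod.distrib mutc_power[where 'a='a])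

lemma Basis_vec_real: "(Basis :: (real^'n) set) = range (%i. axis i 1)"
 by (auto simp: Basis_vec_def)

lemma mut_prod_vec:
 fixes f :: "'n::finite => real => complex"
 assumes f: "!!i. imut (f i)"
 shows "imut (%x::real^'n. PROD i:UNIV. f i (x $ i))"
  and "Imut (%x::real^'n. PROD i:UNIV. f i (x $ i)) = (PROD i:UNIV. Imut (f i))"
proof -
 have inj: "inj (%i::'n. axis i (1::real))"
  by (auto simp: inj_def axis_eq_axis)
 let ?inv = "the_inv (%i::'n. axis i (1::real))"
 let ?g = "%b. f (?inv b)"
 have [simp]: "?inv (axis i 1) = i" for i by (rule the_inv_f_f[OF inj])
 have eq: "(PROD b:Basis. h b) = (PROD i:UNIV. h (axis i 1))" for h :: "real^'n => complex"
  unfolding Basis_vec_real by (subst prod.reindex) (auto simp: inj)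
 show "imut (%x::real^'n. PROD i:UNIV. f i (x $ i))"
  using mut_prod_Basis(1)[of ?g] f by (simp add: eq inner_axis)
 show "Imut (%x::real^'n. PROD i:UNIV. f i (x $ i)) = (PROD i:UNIV. Imut (f i))"
  using mut_prod_Basis(2)[of ?g] f by (simp add: eq inner_axis)
qed

section \<open>Gaussian integrals\<close>

lemma gauss_imag:
 "imut (%x::real. exp (of_real (- x\<^sup>2 / 2) + \<i> * of_real (t * x)))"
 "Imut (%x::real. exp (of_real (- x\<^sup>2 / 2) + \<i> * of_real (t * x))) = exp (of_real (- t\<^sup>2 / 2))"
proof -
 have c: "mutc TYPE(real) = 1 / sqrt (2 * pi)"
  unfolding mutc_def DIM_real by (simp only: powr_minus powr_half_sqrt divide_inverse of_nat_1 minus_mult_left[symmetric] mult_1_left)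
  (simp add: powr_half_sqrt powr_minus flip: divide_inverse)
 have eq: "std_normal_density x *\<^sub>R iexp (t * x) = (1 / sqrt (2 * pi)) *\<^sub>R exp (of_real (- x\<^sup>2 / 2) + \<i> * of_real (t * x))" for x
  unfolding std_normal_density_def exp_add exp_of_real scaleR_conv_of_real of_real_mult by (simp only: mult.assoc)
 have "integrable lborel (%x. std_normal_density x *\<^sub>R iexp (t * x))"
  by (rule Bochner_Integration.integrable_bound[OF integrable_std_normal_moment[of 0]]) (auto simp: normal_density_nonneg)
 then have I: "integrable lborel (%x. exp (of_real (- x\<^sup>2 / 2) + \<i> * of_real (t * x)))"
  unfolding eq by (subst (asm) integrable_scaleR_iff) auto
 then show "imut (%x::real. exp (of_real (- x\<^sup>2 / 2) + \<i> * of_real (t * x)))"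
  unfolding integrable_mut .
 have "char std_normal_distribution t = Ilb (%x. std_normal_density x *\<^sub>R iexp (t * x))"
  unfolding char_def by (subst integral_density) (auto simp: normal_density_nonneg)
 also have "... = Imut (%x::real. exp (of_real (- x\<^sup>2 / 2) + \<i> * of_real (t * x)))"
  unfolding eq integral_mut c by (rule integral_scaleR_right)
 finally show "Imut (%x::real. exp (of_real (- x\<^sup>2 / 2) + \<i> * of_real (t * x))) = exp (of_real (- t\<^sup>2 / 2))"
  unfolding char_std_normal_distribution exp_of_real by (rule sym)
qed

lemma gauss_1d:
 fixes b :: complex
 shows "imut (%x::real. exp (of_real (- x\<^sup>2 / 2) + b * of_real x))"
  and "Imut (%x::real. exp (of_real (- x\<^sup>2 / 2) + b * of_real x)) = exp (b^2 / 2)"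
proof -
 let ?f = "%x::real. exp (of_real (- x\<^sup>2 / 2) + b * of_real x)"
 obtain p q where b: "b = Complex p q" by (cases b)
 have b': "b = of_real p + \<i> * of_real q" unfolding b by (rule Complex_eq)
 have eq: "?f (p + 1 *\<^sub>R x) = exp (of_real (p^2 / 2) + \<i> * of_real (p * q)) * exp (of_real (- x\<^sup>2 / 2) + \<i> * of_real (q * x))" for x
  unfolding exp_add[symmetric] b' by (rule arg_cong[where f=exp]) (simp add: field_simps power2_eq_square)
 have i: "imut (%x. ?f (p + 1 *\<^sub>R x))"
  unfolding eq by (intro integrable_mult_right gauss_imag)
 show "imut ?f"
  using i mut_affine(1)[of 1 ?f p] by simp
 have "Imut ?f = Imut (%x. ?f (p + 1 *\<^sub>R x))"
  by (subst mut_affine(2)[of 1 ?f p]) auto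
 also have "... = exp (of_real (p^2 / 2) + \<i> * of_real (p * q)) * exp (of_real (- q\<^sup>2 / 2))"
  unfolding eq by (subst integral_mult_right_zero, subst gauss_imag) simp
 also have "... = exp (b^2 / 2)"
  unfolding exp_add[symmetric] b' by (rule arg_cong[where f=exp]) (simp add: field_simps power2_eq_square)
 finally show "Imut ?f = exp (b^2 / 2)" .
qed

lemma norm_sq_Basis: "(norm (x::'a::euclidean_space))\<^sup>2 = (SUM b:Basis. (x \<bullet> b)\<^sup>2)"
 unfolding power2_norm_eq_inner by (subst euclidean_inner) (simp only: power2_eq_square)

lemma gauss_euclid:
 fixes \<beta> :: "'a::euclidean_space => complex"
 shows "imut (%x::'a. exp (of_real (- (norm x)\<^sup>2 / 2) + (SUM b:Basis. \<beta> b * of_real (x \<bullet> b))))"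
  and "Imut (%x::'a. exp (of_real (- (norm x)\<^sup>2 / 2) + (SUM b:Basis. \<beta> b * of_real (x \<bullet> b)))) = exp ((SUM b:Basis. (\<beta> b)\<^sup>2) / 2)"
proof -
 have eq: "exp (of_real (- (norm x)\<^sup>2 / 2) + (SUM b:Basis. \<beta> b * of_real (x \<bullet> b))) =
  (PROD b:Basis. exp (of_real (- (x \<bullet> b)\<^sup>2 / 2) + \<beta> b * of_real (x \<bullet> b)))" for x :: 'a
 proof -
  have "of_real (- (norm x)\<^sup>2 / 2) = (SUM b:Basis. cor (- (x \<bullet> b)\<^sup>2 / 2))"
  unfolding norm_sq_Basis of_real_sum[symmetric] sum_divide_distrib[symmetric] sum_negf ..
  then have *: "of_real (- (norm x)\<^sup>2 / 2) + (SUM b:Basis. \<beta> b * of_real (x \<bullet> b)) = (SUM b:Basis. of_real (- (x \<bullet> b)\<^sup>2 / 2) + \<beta> b * of_real (x \<bullet> b))"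
  by (subst sum.distrib) (rule arg_cong2[where f="(+)"], auto)
  show ?thesis unfolding * by (rule exp_sum) simp
 qed
 show "imut (%x::'a. exp (of_real (- (norm x)\<^sup>2 / 2) + (SUM b:Basis. \<beta> b * of_real (x \<bullet> b))))"
  unfolding eq by (intro mut_prod_Basis gauss_1d)
 have "exp ((SUM b:Basis. (\<beta> b)\<^sup>2) / 2) = (PROD b:(Basis::'a set). exp ((\<beta> b)^2 / 2))"
  unfolding sum_divide_distrib by (rule exp_sum) simp
 then show "Imut (%x::'a. exp (of_real (- (norm x)\<^sup>2 / 2) + (SUM b:Basis. \<beta> b * of_real (x \<bullet> b)))) = exp ((SUM b:Basis. (\<beta> b)\<^sup>2) / 2)"
  unfolding eq mut_prod_Basis(2)[OF gauss_1d(1)] gauss_1d(2) by (rule sym)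
qed

lemma gauss_fourier:
 fixes w :: "'a::euclidean_space"
 assumes e: "e > 0"
 shows "imut (%x::'a. exp (of_real (- (e * norm x)\<^sup>2 / 2) - \<i> * of_real (w \<bullet> x)))"
  and "Imut (%x::'a. exp (of_real (- (e * norm x)\<^sup>2 / 2) - \<i> * of_real (w \<bullet> x))) =
  of_real ((1 / e) ^ DIM('a) * exp (- (norm w / e)\<^sup>2 / 2))"
proof -
 let ?f = "%x::'a. exp (of_real (- (e * norm x)\<^sup>2 / 2) - \<i> * of_real (w \<bullet> x))"
 let ?\<beta> = "%b. - \<i> * of_real ((w \<bullet> b) / e)"
 have s: "(SUM b:Basis. ?\<beta> b * of_real (x \<bullet> b)) = - \<i> * of_real ((w \<bullet> x) / e)" for x
 proof -
  have "(SUM b:Basis. ?\<beta> b * of_real (x \<bullet> b)) = (SUM b:Basis. - \<i> * of_real (((w \<bullet> b) * (x \<bullet> b)) / e))"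
  by (intro sum.cong) auto
  also have "... = - \<i> * of_real ((SUM b:Basis. (w \<bullet> b) * (x \<bullet> b)) / e)"
  by (simp only: sum_distrib_left[symmetric] of_real_sum[symmetric] sum_divide_distrib[symmetric])
  finally show ?thesis by (simp only: euclidean_inner[symmetric])
 qed
 have eq: "?f (0 + (1/e) *\<^sub>R x) = exp (of_real (- (norm x)\<^sup>2 / 2) + (SUM b:Basis. ?\<beta> b * of_real (x \<bullet> b)))" for x
  unfolding s using e by (intro arg_cong[where f=exp]) simp
 have i: "imut (%x. ?f (0 + (1/e) *\<^sub>R x))" unfolding eq by (rule gauss_euclid)
 show "imut ?f"
  using i mut_affine(1)[of "1/e" ?f 0] e by simp
 have "Imut ?f = (1/e)^DIM('a) *\<^sub>R Imut (%x. ?f (0 + (1/e) *\<^sub>R x))"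
  using e by (subst mut_affine(2)[of "1/e" ?f 0]) auto
 also have "... = (1/e)^DIM('a) *\<^sub>R exp ((SUM b:Basis. (?\<beta> b)\<^sup>2) / 2)"
  unfolding eq by (subst gauss_euclid) (rule refl)
 also have "(SUM b:Basis. (?\<beta> b)\<^sup>2) = of_real (- (norm w / e)\<^sup>2)"
 proof -
  have "(SUM b:Basis. (?\<beta> b)\<^sup>2) = (SUM b:Basis. of_real (- ((w \<bullet> b)^2 / e^2)))"
  by (intro sum.cong refl) (simp add: power_mult_distrib power_divide)
  then show ?thesis
  by (simp only: of_real_sum[symmetric] sum_negf sum_divide_distrib[symmetric] norm_sq_Basis[symmetric] power_divide)
 qed
 also have "of_real (- (norm w / e)\<^sup>2) / 2 = cor (- (norm w / e)\<^sup>2 / 2)" by simp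
 finally show "Imut ?f = of_real ((1 / e) ^ DIM('a) * exp (- (norm w / e)\<^sup>2 / 2))"
  by (simp only: scaleR_conv_of_real exp_of_real of_real_mult)
qed

definition gk :: "real => 'a::euclidean_space => real" where
 "gk e w = (1 / e) ^ DIM('a) * exp (- (norm w / e)\<^sup>2 / 2)"

lemma gk_integral:
 assumes e: "e > 0"
 shows "imut (gk e :: 'a::euclidean_space => real)" "Imut (gk e :: 'a => real) = 1"
proof -
 have i: "imut (%x::'a. exp (of_real (- (1/e * norm x)\<^sup>2 / 2) - \<i> * of_real (0 \<bullet> x)))"
  using e by (intro gauss_fourier) auto
 have eq: "gk e = (%x::'a. (1/e)^DIM('a) * Re (exp (of_real (- (1/e * norm x)\<^sup>2 / 2) - \<i> * of_real (0 \<bullet> x))))"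
  by (auto simp: gk_def fun_eq_iff Re_exp)
 show "imut (gk e :: 'a => real)" unfolding eq by (intro integrable_mult_right integrable_Re i)
 show "Imut (gk e :: 'a => real) = 1"
  unfolding eq using e i gauss_fourier(2)[of "1/e" "0::'a"]
  by (simp add: power_divide)
qed

lemma gk_pos: "e > 0 ==> gk e w > 0" by (simp add: gk_def)

lemma gk_measurable [measurable]: "gk e \<in> bmeas"
 unfolding gk_def by measurable

section \<open>The integral of a derivative vanishes\<close>

lemma integral_directional_derivative_eq_0:
 fixes g :: "'a::euclidean_space => complex" and v :: 'a
 assumes d: "!!x. (g has_derivative g' x) (at x)"
  and c: "continuous_on UNIV (%x. g' x v)"
  and i: "integrable lborel g" and i': "integrable lborel (%x. g' x v)"
 shows "Ilb (%x. g' x v) = 0"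
proof -
 have gc: "continuous_on UNIV g"
  by (intro continuous_at_imp_continuous_on ballI has_derivative_continuous[OF d])
 have [measurable]: "(%x. g' x v) \<in> bmeas" "g \<in> bmeas"
  using c gc by (auto intro: borel_measurable_continuous_onI)
 have line: "((%s. g (x + s *\<^sub>R v)) has_vector_derivative g' (x + s *\<^sub>R v) v) (at s within S)" for x s S
 proof -
  have "((%s. g (x + s *\<^sub>R v)) has_derivative (%t. g' (x + s *\<^sub>R v) (t *\<^sub>R v))) (at s within S)"
  by (rule has_derivative_compose[OF _ d, of "%s. x + s *\<^sub>R v"]) (auto intro!: derivative_eq_intros)
  moreover have "g' (x + s *\<^sub>R v) (t *\<^sub>R v) = t *\<^sub>R g' (x + s *\<^sub>R v) v" for t
  using d[of "x + s *\<^sub>R v"] by (simp add: linear_cmul has_derivative_linear)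
  ultimately show ?thesis by (simp add: has_vector_derivative_def)
 qed
 have ftc: "Ilb (%s. indicator {0..1} s *\<^sub>R g' (x + s *\<^sub>R v) v) = g (x + v) - g x" for x
 proof -
  have "Ilb (%s. indicator {0..1} s *\<^sub>R g' (x + s *\<^sub>R v) v) = g (x + 1 *\<^sub>R v) - g (x + 0 *\<^sub>R v)"
  proof (rule integral_FTC_Icc[of 0 1 "%s. g (x + s *\<^sub>R v)"])
  show "continuous_on {0..1} (%s. g' (x + s *\<^sub>R v) v)"
  by (rule continuous_on_compose2[OF c]) (auto intro!: continuous_intros)
  qed (auto intro: line)
  then show ?thesis by simp
 qed
 let ?F = "%x s. indicator {0..1::real} s *\<^sub>R g' (x + s *\<^sub>R v) v"
 have tr: "integrable lborel (%x. f (x + w)) \<longleftrightarrow> integrable lborel f" "Ilb (%x. f (x + w)) = Ilb f"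
  for f :: "'a => 'b::{banach,second_countable_topology}" and w
  using lborel_euclid_affine[of 1 f w] by (simp_all add: add.commute)
 have int: "integrable (lborel \<Otimes>\<^sub>M lborel) (%(s, x). ?F x s)"
 proof (rule lborel_pair.Fubini_integrable)
  have "(%p. g' (snd p + fst p *\<^sub>R v) v) \<in> bmeas"
  by (intro borel_measurable_continuous_onI continuous_on_compose2[OF c] continuous_intros) auto
  then have "(%p. g' (snd p + fst p *\<^sub>R v) v) \<in> borel_measurable (lborel \<Otimes>\<^sub>M lborel)"
  by (simp add: lborel_prod)
  then show "(%(s, x). ?F x s) \<in> borel_measurable (lborel \<Otimes>\<^sub>M lborel)"
  by (simp add: split_beta')
  have "(LINT x|lborel. norm (?F x s)) = indicator {0..1} s * (LINT x|lborel. norm (g' x v))" for s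
  using tr(2)[of "%x. norm (g' x v)" "s *\<^sub>R v"] by (simp add: )
  then have "(%s. LINT x|lborel. norm (case (s, x) of (s, x) => ?F x s)) = (%s. indicator {0..1} s * (LINT x|lborel. norm (g' x v)))"
  by (simp only: prod.case)
  then show "integrable lborel (%s. LINT x|lborel. norm (case (s, x) of (s, x) => ?F x s))"
  by simp
  show "AE s in lborel. integrable lborel (%x. case (s, x) of (s, x) => ?F x s)"
  using i' tr(1)[of "%x. g' x v"] by simp
 qed
 have "0 = (LINT x|lborel. g (x + v) - g x)"
  using i tr[of g v] by (subst Bochner_Integration.integral_diff) auto
 also have "... = (LINT x|lborel. LINT s|lborel. ?F x s)" by (simp add: ftc)
 also have "... = (LINT s|lborel. LINT x|lborel. ?F x s)"
  using lborel_pair.Fubini_integral[of "%s x. ?F x s"] int by simp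
 also have "... = (LINT s|lborel. indicator {0..1::real} s *\<^sub>R (LINT x|lborel. g' x v))"
  using tr(2)[of "%x. g' x v"] by simp
 also have "... = (LINT x|lborel. g' x v)" by simp
 finally show ?thesis by simp
qed

section \<open>Injectivity of the Fourier transform on integrable functions\<close>

lemma AE_eq_0_if_integrals_vanish_real:
 fixes f :: "'a::euclidean_space => real"
 assumes f: "imut f"
  and z: "!!A. A \<in> sets borel ==> Imut (%x. indicator A x *\<^sub>R f x) = 0"
 shows "AE x in lborel. f x = 0"
proof -
 have [measurable]: "f \<in> bmeas"
  using borel_measurable_integrable[OF f] by simp
 have "AE x in mut. f x <= 0" if g: "imut f" "f \<in> bmeas"
  "!!A. A \<in> sets borel ==> Imut (%x. indicator A x *\<^sub>R f x) = 0" for f :: "'a => real"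
 proof -
  let ?A = "{x. f x > 0}"
  have A: "?A \<in> sets borel" using g(2) by measurable
  have "imut (%x. indicator ?A x *\<^sub>R f x)"
  using A g(1) by (intro integrable_mult_indicator) auto
  moreover have "AE x in mut. 0 <= indicator ?A x *\<^sub>R f x" by (auto simp: indicator_def)
  ultimately have "AE x in mut. indicator ?A x *\<^sub>R f x = 0"
  using g(3)[OF A] integral_nonneg_eq_0_iff_AE by blast
  then show ?thesis by (rule AE_mp) (auto simp: indicator_def split: if_splits)
 qed note le = this
 have "AE x in mut. f x <= 0" using f z by (intro le) auto
 moreover have "AE x in mut. - f x <= 0" using f z by (intro le) auto
 ultimately have "AE x in mut. f x = 0" by eventually_elim simp
 then show ?thesis by simp
qed

lemma AE_eq_0_if_integrals_vanish:
 fixes f :: "'a::euclidean_space => complex"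
 assumes f: "imut f"
  and z: "!!A. A \<in> sets borel ==> Imut (%x. indicator A x *\<^sub>R f x) = 0"
 shows "AE x in lborel. f x = 0"
proof -
 have i: "imut (%x. indicator A x *\<^sub>R f x)" if "A \<in> sets borel" for A
  using that f by (intro integrable_mult_indicator) auto
 have "AE x in lborel. Re (f x) = 0"
 proof (rule AE_eq_0_if_integrals_vanish_real)
  show "imut (%x. Re (f x))" using f by (rule integrable_Re)
  fix A :: "'a set" assume A: "A \<in> sets borel"
  show "Imut (%x. indicator A x *\<^sub>R Re (f x)) = 0"
  using integral_Re[OF i[OF A]] z[OF A] by simp
 qed
 moreover have "AE x in lborel. Im (f x) = 0"
 proof (rule AE_eq_0_if_integrals_vanish_real)
  show "imut (%x. Im (f x))" using f by (rule integrable_Im)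
  fix A :: "'a set" assume A: "A \<in> sets borel"
  show "Imut (%x. indicator A x *\<^sub>R Im (f x)) = 0"
  using integral_Im[OF i[OF A]] z[OF A] by simp
 qed
 ultimately show ?thesis by eventually_elim (simp add: complex_eq_iff)
qed

lemma integrals_vanish_if_boxes:
 fixes f :: "'a::euclidean_space => complex"
 assumes f: "imut f" and f0: "Imut f = 0"
  and box: "!!a b. Imut (%x. indicator (box a b) x *\<^sub>R f x) = 0"
  and A: "A \<in> sets borel"
 shows "Imut (%x. indicator A x *\<^sub>R f x) = 0"
proof -
 have i: "imut (%x. indicator A x *\<^sub>R f x)" if "A \<in> sets borel" for A
  using that f by (intro integrable_mult_indicator) auto
 let ?G = "range (%(a, b). box a b :: 'a set)"
 have "Int_stable ?G" by (auto simp: Int_stable_def box_Int_box)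
 moreover have "?G \<subseteq> Pow UNIV" by simp
 moreover have s: "sets borel = sigma_sets UNIV ?G" by (simp add: borel_eq_box)
 then have "A \<in> sigma_sets UNIV ?G" using A by simp
 ultimately show ?thesis
 proof (induct rule: sigma_sets_induct_disjoint)
  case (basic B)
  then show ?case using box by auto
 next
  case empty
  then show ?case by simp
 next
  case (compl B)
  then have B: "B \<in> sets borel" using s by simp
  have "Imut (%x. indicator (UNIV - B) x *\<^sub>R f x) = Imut (%x. f x - indicator B x *\<^sub>R f x)"
  by (intro Bochner_Integration.integral_cong) (auto simp: indicator_def)
  also have "... = 0" using compl(2) f0 f i[OF B] by (subst Bochner_Integration.integral_diff) auto
  finally show ?case .
 next
  case (union B)
  then have B: "B i \<in> sets borel" for i using s by auto
  have d: "disjoint_family B" by (rule union)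
  have "set_lebesgue_integral mut (\<Union>i. B i) f = (\<Sum>i. set_lebesgue_integral mut (B i) f)"
  using B d f
  by (intro lebesgue_integral_countable_add) (auto simp: disjoint_family_on_def set_integrable_def intro!: integrable_mult_indicator)
  then show ?case using union(3) by (simp add: set_lebesgue_integral_def)
 qed
qed

lemma gk_nonneg: "e > 0 ==> 0 <= gk e w"
 by (simp add: gk_def)

lemma gk_smoothing_tendsto:
 fixes x :: "'a::euclidean_space"
 assumes x: "x \<notin> cbox a b - box a b"
 shows "(%k. Imut (%y. indicator (box a b) y * gk (1 / Suc k) (x - y))) ~~> indicator (box a b) x"
proof -
 have eq: "Imut (%y. indicator (box a b) y * gk (1 / Suc k) (x - y)) =
  Imut (%t. indicator (box a b) (x + (- (1 / Suc k)) *\<^sub>R t) * gk 1 t)" for k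
 proof -
  let ?c = "- (1 / real (Suc k))"
  have "Imut (%y. indicator (box a b) y * gk (1 / Suc k) (x - y)) =
  \<bar>?c\<bar> ^ DIM('a) *\<^sub>R Imut (%t. indicator (box a b) (x + ?c *\<^sub>R t) * gk (1 / Suc k) (x - (x + ?c *\<^sub>R t)))"
  by (rule mut_affine(2)) simp
  also have "... = Imut (%t. \<bar>?c\<bar> ^ DIM('a) *\<^sub>R (indicator (box a b) (x + ?c *\<^sub>R t) * gk (1 / Suc k) (x - (x + ?c *\<^sub>R t))))"
  by simp
  also have "... = Imut (%t. indicator (box a b) (x + ?c *\<^sub>R t) * gk 1 t)"
  by (intro Bochner_Integration.integral_cong refl) (auto simp: gk_def power_divide)
  finally show ?thesis .
 qed
 have "(%k. Imut (%t. indicator (box a b) (x + (- (1 / Suc k)) *\<^sub>R t) * gk 1 t)) ~~> Imut (%t::'a. indicator (box a b) x * gk 1 t)"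
 proof (rule integral_dominated_convergence[where w="gk 1"])
  show "imut (gk 1 :: 'a => real)" by (rule gk_integral) simp
  show "AE t in mut. (%k. indicator (box a b) (x + (- (1 / Suc k)) *\<^sub>R t) * gk 1 t) ~~> indicator (box a b) x * gk 1 t"
  proof (rule AE_I2)
  fix t :: 'a
  have l: "(%k. x + (- (1 / real (Suc k))) *\<^sub>R t) ~~> x + (- 0) *\<^sub>R t"
  by (intro tendsto_intros LIMSEQ_Suc[OF lim_1_over_n])
  have "\<forall>\<^sub>F k in sequentially. indicator (box a b) (x + (- (1 / real (Suc k))) *\<^sub>R t) = (indicator (box a b) x :: real)"
  proof (cases "x \<in> box a b")
  case True
  have "\<forall>\<^sub>F k in sequentially. x + (- (1 / real (Suc k))) *\<^sub>R t \<in> box a b"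
  by (rule topological_tendstoD[OF l]) (use True in \<open>auto simp: open_box\<close>)
  then show ?thesis by eventually_elim (use True in simp)
  next
  case False
  then have "x \<notin> cbox a b" using x by auto
  then have "\<forall>\<^sub>F k in sequentially. x + (- (1 / real (Suc k))) *\<^sub>R t \<in> - cbox a b"
  by (intro topological_tendstoD[OF l]) (auto simp: closed_cbox)
  then show ?thesis by eventually_elim (use False box_subset_cbox[of a b] in \<open>auto simp: indicator_def\<close>)
  qed
  then have "\<forall>\<^sub>F k in sequentially. indicator (box a b) (x + (- (1 / real (Suc k))) *\<^sub>R t) * gk 1 t = indicator (box a b) x * gk 1 t"
  by eventually_elim simp
  then show "(%k. indicator (box a b) (x + (- (1 / Suc k)) *\<^sub>R t) * gk 1 t) ~~> indicator (box a b) x * gk 1 t"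
  by (rule tendsto_eventually)
  qed
 qed (auto simp: indicator_def gk_pos less_imp_le)
 also have "Imut (%t::'a. indicator (box a b) x * gk 1 t) = indicator (box a b) x"
  by (simp add: gk_integral)
 finally show ?thesis unfolding eq .
qed

text \<open>If the transform of \<open>w\<close> vanishes, so do all convolutions of \<open>w\<close> with Gaussians, because a
 Gaussian is a superposition of characters; letting the Gaussians shrink kills the integral of
 \<open>w\<close> over every box.\<close>

theorem fourier_L1_injective:
 fixes w :: "'a::euclidean_space => complex"
 assumes w: "imut w"
  and z: "!!y. Imut (%x. w x * exp (- \<i> * of_real (x \<bullet> y))) = 0"
 shows "AE x in lborel. w x = 0"
proof -
 have [measurable]: "w \<in> bmeas"
  using borel_measurable_integrable[OF w] by simp
 have g0: "Imut (%x. w x * of_real (gk e (x - y))) = 0" if e: "e > 0" for e and y :: 'a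
 proof -
  let ?G = "%(x::'a) xi. exp (of_real (- (e * norm xi)\<^sup>2 / 2) - \<i> * of_real ((x - y) \<bullet> xi))"
  have gn: "imut (%xi::'a. exp (- (e * norm xi)\<^sup>2 / 2))"
  using integrable_norm[OF gauss_fourier(1)[OF e, of "0::'a"]] by simp
  have int: "integrable (mut \<Otimes>\<^sub>M mut) (%(x, xi). w x * ?G x xi)"
  proof (rule mutp.Fubini_integrable)
  show "(%(x, xi). w x * ?G x xi) \<in> borel_measurable (mut \<Otimes>\<^sub>M mut)"
  by measurable
  show "imut (%x. LINT xi|mut. cmod (case (x, xi) of (x, xi) => w x * ?G x xi))"
  using w by (simp add: norm_mult)
  show "AE x in mut. imut (%xi. case (x, xi) of (x, xi) => w x * ?G x xi)"
  unfolding prod.case by (intro AE_I2 integrable_mult_right gauss_fourier(1)[OF e])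
  qed
  have "Imut (%x. w x * of_real (gk e (x - y))) = (LINT x|mut. LINT xi|mut. w x * ?G x xi)"
  by (simp only: gk_def gauss_fourier(2)[OF e] integral_mult_right_zero)
  also have "... = (LINT xi|mut. LINT x|mut. w x * ?G x xi)"
  using mutp.Fubini_integral[of "%x xi. w x * ?G x xi"] int by simp
  also have "... = (LINT xi|(mut::'a measure). 0)"
  proof (intro Bochner_Integration.integral_cong refl)
  fix xi :: 'a
  have "(LINT x|mut. w x * ?G x xi) = (LINT x|mut. exp (of_real (- (e * norm xi)\<^sup>2 / 2) + \<i> * of_real (y \<bullet> xi)) * (w x * exp (- \<i> * of_real (x \<bullet> xi))))"
  by (intro Bochner_Integration.integral_cong refl) (simp add: exp_add[symmetric] inner_diff_left algebra_simps flip: exp_add)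
  then show "(LINT x|mut. w x * ?G x xi) = 0" using z[of xi] by simp
  qed
  finally show ?thesis by simp
 qed
 have b0: "Imut (%x. indicator (box a b) x *\<^sub>R w x) = 0" for a b
 proof -
  let ?\<psi> = "%k x. Imut (%y. indicator (box a b) y * gk (1 / real (Suc k)) (x - y))"
  have gi: "imut (%y. gk e (x - y))" "Imut (%y. gk e (x - y)) = 1" if "e > 0" for e and x :: 'a
  using mut_affine[of "-1" "%y. gk e (x - y)" x] gk_integral[OF that, where 'a='a] by simp_all
  have ii: "imut (%y. indicator (box a b) y * gk e (x - y))" if "e > 0" for e and x :: 'a
  using integrable_mult_indicator[OF _ gi(1)[OF that], of "box a b"] by simp
  have z': "Imut (%x. w x * of_real (?\<psi> k x)) = 0" for k
  proof -
  define e where "e = 1 / real (Suc k)"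
  have e: "e > 0" by (simp add: e_def)
  have int: "integrable (mut \<Otimes>\<^sub>M mut) (%(x, y). w x * of_real (indicator (box a b) y * gk e (x - y)))"
  proof (rule mutp.Fubini_integrable)
  show "(%(x, y). w x * of_real (indicator (box a b) y * gk e (x - y))) \<in> borel_measurable (mut \<Otimes>\<^sub>M mut)"
  by measurable
  have p: "norm (w x * of_real (indicator (box a b) y * gk e (x - y))) = norm (w x) * (indicator (box a b) y * gk e (x - y))" for x y
  using gk_pos[OF e, of "x - y"] by (simp add: norm_mult)
  show "imut (%x. LINT y|mut. cmod (case (x, y) of (x, y) => w x * of_real (indicator (box a b) y * gk e (x - y))))"
  unfolding prod.case p
  proof (rule Bochner_Integration.integrable_bound[OF integrable_norm[OF w]])
  have "(LINT y|mut. indicator (box a b) y * gk e (x - y)) <= (LINT y|mut. gk e (x - y))" for x :: 'a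
  by (intro integral_mono ii gi e) (use gk_nonneg[OF e] in \<open>auto simp: indicator_def\<close>)
  moreover have "0 <= (LINT y|mut. indicator (box a b) y * gk e (x - y))" for x :: 'a
  by (intro Bochner_Integration.integral_nonneg) (use gk_nonneg[OF e] in \<open>auto simp: indicator_def\<close>)
  ultimately show "AE x in mut. norm (LINT y|mut. norm (w x) * (indicator (box a b) y * gk e (x - y))) <= norm (norm (w x))"
  by (auto simp: gi[OF e] abs_mult mult_left_le)
  qed measurable
  show "AE x in mut. imut (%y. case (x, y) of (x, y) => w x * of_real (indicator (box a b) y * gk e (x - y)))"
  using ii[OF e] unfolding prod.case by (intro AE_I2 integrable_mult_right integrable_of_real)
  qed
  have "Imut (%x. w x * of_real (?\<psi> k x)) = (LINT x|mut. LINT y|mut. w x * of_real (indicator (box a b) y * gk e (x - y)))"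
  unfolding e_def[symmetric] by (simp only: integral_mult_right_zero integral_complex_of_real)
  also have "... = (LINT y|mut. LINT x|mut. w x * of_real (indicator (box a b) y * gk e (x - y)))"
  using mutp.Fubini_integral[of "%x y. w x * of_real (indicator (box a b) y * gk e (x - y))"] int by simp
  also have "... = (LINT y|mut. of_real (indicator (box a b) y) * (LINT x|mut. w x * of_real (gk e (x - y))))"
  by (simp only: integral_mult_right_zero[symmetric] of_real_mult mult.left_commute)
  also have "... = 0" by (simp add: g0[OF e])
  finally show ?thesis .
  qed
  have "(%k. Imut (%x. w x * of_real (?\<psi> k x))) ~~> Imut (%x. w x * of_real (indicator (box a b) x))"
  proof (rule integral_dominated_convergence[where w="%x. norm (w x)"])
  show "imut (%x. norm (w x))" using w by simp
  show "AE x in mut. (%k. w x * of_real (?\<psi> k x)) ~~> w x * of_real (indicator (box a b) x)"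
  proof -
  have "AE x in lborel. x \<notin> cbox a b - box a b"
  using null_sets_cbox_Diff_box by (rule AE_not_in)
  then have "AE x in mut. x \<notin> cbox a b - box a b" by simp
  then show ?thesis
  by eventually_elim (intro tendsto_mult tendsto_const tendsto_of_real gk_smoothing_tendsto)
  qed
  show "AE x in mut. cmod (w x * of_real (?\<psi> k x)) <= cmod (w x)" for k
  proof -
  have e: "1 / real (Suc k) > 0" by simp
  have "?\<psi> k x <= (LINT y|mut. gk (1 / real (Suc k)) (x - y))" for x :: 'a
  by (intro integral_mono ii gi e) (use gk_nonneg[OF e] in \<open>auto simp: indicator_def\<close>)
  then have "?\<psi> k x <= 1" for x unfolding gi(2)[OF e] .
  moreover have "0 <= ?\<psi> k x" for x :: 'a
  by (intro Bochner_Integration.integral_nonneg) (use gk_nonneg[OF e] in \<open>auto simp: indicator_def\<close>)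
  ultimately show ?thesis by (intro AE_I2) (simp add: norm_mult mult_left_le)
  qed
  qed measurable
  then have "Imut (%x. w x * of_real (indicator (box a b) x)) = 0"
  unfolding z' by (metis LIMSEQ_unique tendsto_const)
  then show ?thesis by (simp add: scaleR_conv_of_real mult.commute)
 qed
 have w0: "Imut w = 0" using z[of 0] by simp
 show ?thesis
  by (rule AE_eq_0_if_integrals_vanish[OF w integrals_vanish_if_boxes[OF w w0 b0]])
qed

section \<open>Abstract Hilbert spaces\<close>

locale prehilbert =
 fixes H :: "'a hilb"
 assumes add_closed: "!!x y. x \<in> hcarrier H ==> y \<in> hcarrier H ==> hadd H x y \<in> hcarrier H"
  and scale_closed: "!!c x. x \<in> hcarrier H ==> hscale H c x \<in> hcarrier H"
  and inner_add: "!!x y z. x \<in> hcarrier H ==> y \<in> hcarrier H ==> z \<in> hcarrier H ==>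
  hinner H (hadd H x y) z = hinner H x z + hinner H y z"
  and inner_scale: "!!c x z. x \<in> hcarrier H ==> z \<in> hcarrier H ==> hinner H (hscale H c x) z = c * hinner H x z"
  and inner_sym: "!!x y. x \<in> hcarrier H ==> y \<in> hcarrier H ==> hinner H y x = cnj (hinner H x y)"
  and inner_pos: "!!x. x \<in> hcarrier H ==> 0 <= Re (hinner H x x)"
  and inner_sep: "!!x y. x \<in> hcarrier H ==> y \<in> hcarrier H ==>
  (!!z. z \<in> hcarrier H ==> hinner H x z = hinner H y z) ==> x = y"
begin

abbreviation sub :: "'a => 'a => 'a" where "sub x y \<equiv> hadd H x (hscale H (-1) y)"

lemmas closed = add_closed scale_closed

lemma inner_add_right: "x \<in> hcarrier H ==> y \<in> hcarrier H ==> z \<in> hcarrier H ==>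
  hinner H z (hadd H x y) = hinner H z x + hinner H z y"
 by (subst (1 2 3) inner_sym) (simp_all add: closed inner_add)

lemma inner_scale_right: "x \<in> hcarrier H ==> z \<in> hcarrier H ==> hinner H z (hscale H c x) = cnj c * hinner H z x"
 by (subst (1 2) inner_sym) (simp_all add: closed inner_scale)

lemmas inner_simps' = inner_add inner_scale inner_add_right inner_scale_right closed

lemma inner_self: "x \<in> hcarrier H ==> hinner H x x = of_real ((hnorm H x)^2)"
 using inner_pos[of x] inner_sym[of x x] by (auto simp: hnorm_def complex_eq_iff)

lemma norm_sq: "x \<in> hcarrier H ==> (hnorm H x)\<^sup>2 = Re (hinner H x x)"
 by (simp add: inner_self)

lemma norm_nonneg: "x \<in> hcarrier H ==> 0 <= hnorm H x"
 using inner_pos by (simp add: hnorm_def)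

lemma norm_scale: "x \<in> hcarrier H ==> hnorm H (hscale H c x) = cmod c * hnorm H x"
proof -
 assume x: "x \<in> hcarrier H"
 have "hinner H (hscale H c x) (hscale H c x) = c * cnj c * hinner H x x"
  using x by (simp add: inner_simps')
 also have "... = of_real ((cmod c)^2 * (hnorm H x)^2)"
  unfolding inner_self[OF x] of_real_mult complex_norm_square ..
 finally have "hinner H (hscale H c x) (hscale H c x) = of_real ((cmod c)^2 * (hnorm H x)^2)" .
 then show ?thesis using norm_nonneg[OF x] by (simp add: hnorm_def[of H "hscale H c x"] real_sqrt_mult)
qed

lemma norm_add_sq: "x \<in> hcarrier H ==> y \<in> hcarrier H ==>
 (hnorm H (hadd H x y))\<^sup>2 = (hnorm H x)^2 + 2 * Re (hinner H x y) + (hnorm H y)^2"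
 using inner_sym[of x y] by (simp add: norm_sq inner_simps')

lemma cauchy_schwarz:
 assumes x: "x \<in> hcarrier H" and y: "y \<in> hcarrier H"
 shows "cmod (hinner H x y) <= hnorm H x * hnorm H y"
proof -
 obtain u where u: "cmod u = 1" "u * hinner H x y = of_real (cmod (hinner H x y))"
 proof (cases "hinner H x y = 0")
  case True then show ?thesis using that[of 1] by simp
 next
  case False
  show ?thesis by (rule that[of "of_real (cmod (hinner H x y)) / hinner H x y"]) (use False in \<open>auto simp: norm_divide\<close>)
 qed
 define a where "a = (hnorm H x)^2"
 define b where "b = (hnorm H y)^2"
 define c where "c = cmod (hinner H x y)"
 have q: "0 <= t^2 * a - 2 * t * s * c + s^2 * b" for t s :: real
 proof -
  let ?w = "hadd H (hscale H (of_real t * u) x) (hscale H (of_real (-s)) y)"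
  have "0 <= (hnorm H ?w)^2" by simp
  also have "(hnorm H ?w)\<^sup>2 = t^2 * a - 2 * t * s * c + s^2 * b"
  using x y u(1) by (subst norm_add_sq) (simp_all add: closed norm_scale norm_mult power_mult_distrib a_def b_def inner_simps' mult.assoc u(2) c_def)
  finally show ?thesis .
 qed
 have "c\<^sup>2 <= a * b"
 proof (cases "b = 0")
  case True
  have "c = 0"
  proof (rule ccontr)
  assume "c ~= 0"
  then have "c > 0" by (simp add: c_def)
  have "0 <= 1^2 * a - 2 * 1 * ((a + 1) / (2 * c)) * c + ((a + 1) / (2 * c))^2 * b" by (rule q)
  then show False using True \<open>c > 0\<close> by simp
  qed
  then show ?thesis using True by simp
 next
  case False
  then have b: "b > 0" by (simp add: b_def)
  have "0 <= b^2 * a - 2 * b * c * c + c^2 * b" by (rule q)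
  also have "... = b * (a * b - c\<^sup>2)" by (simp add: power2_eq_square algebra_simps)
  finally show ?thesis using b by (simp add: zero_le_mult_iff)
 qed
 then have "c <= sqrt (a * b)" by (rule real_le_rsqrt)
 then show ?thesis using norm_nonneg x y by (simp add: a_def b_def c_def real_sqrt_mult)
qed

lemma norm_triangle:
 assumes x: "x \<in> hcarrier H" and y: "y \<in> hcarrier H"
 shows "hnorm H (hadd H x y) <= hnorm H x + hnorm H y"
proof (rule power2_le_imp_le)
 have "Re (hinner H x y) <= hnorm H x * hnorm H y"
  using cauchy_schwarz[OF x y] complex_Re_le_cmod order_trans by blast
 then show "(hnorm H (hadd H x y))\<^sup>2 <= (hnorm H x + hnorm H y)^2"
  using x y by (simp add: norm_add_sq power2_sum)
qed (use norm_nonneg x y in simp)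

lemma norm_eq_0D:
 assumes x: "x \<in> hcarrier H" and y: "y \<in> hcarrier H" and "hnorm H (sub x y) = 0"
 shows "x = y"
proof (rule inner_sep[OF x y])
 fix z assume z: "z \<in> hcarrier H"
 have "cmod (hinner H (sub x y) z) <= 0"
  using cauchy_schwarz[of "sub x y" z] assms z by (simp add: closed)
 then show "hinner H x z = hinner H y z" using x y z by (simp add: inner_simps')
qed

text \<open>Vector identities hold as soon as they hold after pairing with every vector.\<close>

lemma sub_sub:
 assumes "x \<in> hcarrier H" "y \<in> hcarrier H" "z \<in> hcarrier H"
 shows "sub x z = hadd H (sub x y) (sub y z)"
  by (rule inner_sep) (use assms in \<open>simp_all add: inner_simps'\<close>)

lemma sub_add_add:
 assumes "x \<in> hcarrier H" "y \<in> hcarrier H" "x' \<in> hcarrier H" "y' \<in> hcarrier H"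
 shows "sub (hadd H x x') (hadd H y y') = hadd H (sub x y) (sub x' y')"
  by (rule inner_sep) (use assms in \<open>simp_all add: inner_simps' algebra_simps\<close>)

lemma sub_scale_scale:
 assumes "x \<in> hcarrier H" "y \<in> hcarrier H"
 shows "sub (hscale H c x) (hscale H c y) = hscale H c (sub x y)"
  by (rule inner_sep) (use assms in \<open>simp_all add: inner_simps' algebra_simps\<close>)

lemma norm_sub_triangle:
 assumes "x \<in> hcarrier H" "y \<in> hcarrier H" "z \<in> hcarrier H"
 shows "hnorm H (sub x z) <= hnorm H (sub x y) + hnorm H (sub y z)"
 by (subst sub_sub[OF assms], rule norm_triangle) (use assms in \<open>simp_all add: closed\<close>)

lemma norm_sub_commute:
 assumes "x \<in> hcarrier H" "y \<in> hcarrier H"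
 shows "hnorm H (sub x y) = hnorm H (sub y x)"
proof -
 have "sub x y = hscale H (-1) (sub y x)"
  by (rule inner_sep) (use assms in \<open>simp_all add: inner_simps'\<close>)
 then show ?thesis using assms by (simp add: norm_scale closed)
qed

lemma norm_sub_self: "x \<in> hcarrier H ==> hnorm H (sub x x) = 0"
 by (simp add: hnorm_def inner_simps')

lemma norm_le_sub_add:
 assumes "x \<in> hcarrier H" "y \<in> hcarrier H"
 shows "hnorm H x <= hnorm H (sub x y) + hnorm H y"
proof -
 have "x = hadd H (sub x y) y"
  by (rule inner_sep) (use assms in \<open>simp_all add: inner_simps'\<close>)
 then show ?thesis using norm_triangle[of "sub x y" y] assms by (simp add: closed)
qed

definition tends :: "(nat => 'a) => 'a => bool" where
 "tends X x \<longleftrightarrow> (ALL n. X n \<in> hcarrier H) & x \<in> hcarrier H & (%n. hnorm H (sub (X n) x)) ~~> 0"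

lemma tends_const: "x \<in> hcarrier H ==> tends (%_. x) x"
 by (simp add: tends_def norm_sub_self)

lemma tends_add:
 assumes X: "tends X x" and Y: "tends Y y" shows "tends (%n. hadd H (X n) (Y n)) (hadd H x y)"
proof -
 have c: "X n \<in> hcarrier H" "Y n \<in> hcarrier H" "x \<in> hcarrier H" "y \<in> hcarrier H" for n
  using X Y by (auto simp: tends_def)
 have "(%n. hnorm H (sub (hadd H (X n) (Y n)) (hadd H x y))) ~~> 0"
 proof (rule tendsto_sandwich[OF _ _ tendsto_const])
  have "(%n. hnorm H (sub (X n) x) + hnorm H (sub (Y n) y)) ~~> 0 + 0"
  using X Y unfolding tends_def by (intro tendsto_add) auto
  then show "(%n. hnorm H (sub (X n) x) + hnorm H (sub (Y n) y)) ~~> 0" by simp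
 qed (use c in \<open>auto simp: sub_add_add closed intro!: always_eventually norm_triangle norm_nonneg\<close>)
 then show ?thesis using c by (simp add: tends_def closed)
qed

lemma tends_scale:
 assumes X: "tends X x" shows "tends (%n. hscale H c (X n)) (hscale H c x)"
proof -
 have c: "X n \<in> hcarrier H" "x \<in> hcarrier H" for n
  using X by (auto simp: tends_def)
 have "(%n. cmod c * hnorm H (sub (X n) x)) ~~> cmod c * 0"
  using X unfolding tends_def by (intro tendsto_intros) auto
 then show ?thesis using c by (simp add: tends_def closed sub_scale_scale norm_scale)
qed

lemma tends_norm:
 assumes X: "tends X x" shows "(%n. hnorm H (X n)) ~~> hnorm H x"
proof -
 have c: "X n \<in> hcarrier H" "x \<in> hcarrier H" for n
  using X by (auto simp: tends_def)
 have "\<bar>hnorm H (X n) - hnorm H x\<bar> <= hnorm H (sub (X n) x)" for n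
  using norm_le_sub_add[OF c(1)[of n] c(2)] norm_le_sub_add[OF c(2) c(1)[of n]] norm_sub_commute[OF c(1)[of n] c(2)] by linarith
 moreover have "(%n. hnorm H (sub (X n) x)) ~~> 0" using X by (simp add: tends_def)
 ultimately have "(%n. hnorm H (X n) - hnorm H x) ~~> 0"
  by (intro Lim_null_comparison[of "%n. hnorm H (X n) - hnorm H x"]) (auto intro: always_eventually)
 then show ?thesis by (simp add: LIM_zero_iff)
qed

lemma tends_inner:
 assumes X: "tends X x" and z: "z \<in> hcarrier H" shows "(%n. hinner H (X n) z) ~~> hinner H x z"
proof -
 have c: "X n \<in> hcarrier H" "x \<in> hcarrier H" for n
  using X by (auto simp: tends_def)
 have "cmod (hinner H (X n) z - hinner H x z) <= hnorm H (sub (X n) x) * hnorm H z" for n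
  using cauchy_schwarz[of "sub (X n) x" z] c z by (simp add: inner_simps')
 moreover have "(%n. hnorm H (sub (X n) x) * hnorm H z) ~~> 0 * hnorm H z"
  using X by (intro tendsto_intros) (simp add: tends_def)
 ultimately have "(%n. hinner H (X n) z - hinner H x z) ~~> 0"
  by (intro Lim_null_comparison[of "%n. hinner H (X n) z - hinner H x z"]) (auto intro: always_eventually)
 then show ?thesis by (simp add: LIM_zero_iff)
qed

lemma tends_unique: "tends X x ==> tends X y ==> x = y"
proof (rule inner_sep)
 assume X: "tends X x" "tends X y"
 then show "x \<in> hcarrier H" "y \<in> hcarrier H" by (auto simp: tends_def)
 fix z assume "z \<in> hcarrier H"
 then show "hinner H x z = hinner H y z"
  using LIMSEQ_unique[OF tends_inner tends_inner] X by blast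
qed

lemma tends_cauchy:
 assumes X: "tends X x" and e: "e > 0"
 shows "EX N. ALL m>=N. ALL n>=N. hnorm H (sub (X m) (X n)) < e"
proof -
 have c: "X n \<in> hcarrier H" "x \<in> hcarrier H" for n
  using X by (auto simp: tends_def)
 have "(%n. hnorm H (sub (X n) x)) ~~> 0" using X by (simp add: tends_def)
 then obtain N where N: "ALL n>=N. norm (hnorm H (sub (X n) x) - 0) < e / 2"
  using e by (meson LIMSEQ_D half_gt_zero)
 have "hnorm H (sub (X m) (X n)) < e" if "m >= N" "n >= N" for m n
 proof -
  have "norm (hnorm H (sub (X m) x) - 0) < e / 2" "norm (hnorm H (sub (X n) x) - 0) < e / 2" using N that by auto
  moreover have "hnorm H (sub (X m) (X n)) <= hnorm H (sub (X m) x) + hnorm H (sub (X n) x)"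
  using norm_sub_triangle[OF c(1)[of m] c(2) c(1)[of n]] norm_sub_commute[OF c(1)[of n] c(2)] by simp
  ultimately show ?thesis by (simp add: abs_less_iff)
 qed
 then show ?thesis by blast
qed

end

locale hilbert = prehilbert +
 assumes complete: "!!X. (!!n. X n \<in> hcarrier H) ==>
  (!!e. e > 0 ==> EX N. ALL m>=N. ALL n>=N. hnorm H (hadd H (X m) (hscale H (-1) (X n))) < e) ==>
  EX x. tends X x"
begin

text \<open>Riesz representation: the representing vector minimises \<open>\<parallel>x\<parallel>\<^sup>2 - 2 Re (l x)\<close>, and by the
 parallelogram law every minimising sequence is Cauchy.\<close>

theorem riesz:
 assumes add: "!!x y. x \<in> hcarrier H ==> y \<in> hcarrier H ==> l (hadd H x y) = l x + l y"
  and scale: "!!c x. x \<in> hcarrier H ==> l (hscale H c x) = c * l x"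
  and bd: "!!x. x \<in> hcarrier H ==> cmod (l x) <= B * hnorm H x"
  and ne: "hcarrier H ~= {}"
 obtains x where "x \<in> hcarrier H" "!!z. z \<in> hcarrier H ==> l z = hinner H z x"
proof -
 define J where "J x = (hnorm H x)^2 - 2 * Re (l x)" for x
 have low: "J x >= - B\<^sup>2" if x: "x \<in> hcarrier H" for x
 proof -
  have "Re (l x) <= B * hnorm H x"
  using bd[OF x] complex_Re_le_cmod order_trans by blast
  moreover have "0 <= (hnorm H x)^2 - 2 * (B * hnorm H x) + B^2"
  using zero_le_power2[of "hnorm H x - B"] by (simp add: power2_diff mult.commute)
  ultimately show ?thesis unfolding J_def by linarith
 qed
 define d where "d = (INF x\<in>hcarrier H. J x)"
 have bdd: "bdd_below (J ` hcarrier H)" using low by (auto intro!: bdd_belowI)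
 have dl: "d <= J x" if "x \<in> hcarrier H" for x
  unfolding d_def using that bdd by (intro cINF_lower)
 have "EX x:hcarrier H. J x < d + 1 / Suc n" for n
  using cINF_less_iff[OF ne bdd, of "d + 1 / Suc n"] by (simp add: d_def)
 then obtain X where X: "!!n. X n \<in> hcarrier H" "!!n. J (X n) < d + 1 / Suc n" by metis
 have par: "(hnorm H (sub x y))\<^sup>2 <= 2 * (J x - d) + 2 * (J y - d)" if x: "x \<in> hcarrier H" and y: "y \<in> hcarrier H" for x y
 proof -
  let ?m = "hscale H (1/2) (hadd H x y)"
  have m: "?m \<in> hcarrier H" using x y by (simp add: closed)
  have "J ?m = (hnorm H (hadd H x y))^2 / 4 - Re (l x) - Re (l y)"
  using x y by (simp add: J_def norm_scale closed power_divide scale add norm_divide add_divide_distrib)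
  moreover have "(hnorm H (hadd H x y))\<^sup>2 + (hnorm H (sub x y))^2 = 2 * (hnorm H x)^2 + 2 * (hnorm H y)^2"
  using x y by (simp add: norm_add_sq closed norm_scale inner_simps')
  ultimately have "(hnorm H (sub x y))\<^sup>2 = 2 * J x + 2 * J y - 4 * J ?m"
  by (simp add: J_def)
  moreover define jm where "jm = J ?m"
  ultimately show ?thesis using dl[OF m] unfolding jm_def[symmetric] by argo
 qed
 have "EX x. tends X x"
 proof (rule complete[OF X(1)])
  fix e :: real assume e: "e > 0"
  obtain N where N: "1 / Suc N < e^2 / 4" using e reals_Archimedean[of "e\<^sup>2/4"] by (auto simp: inverse_eq_divide)
  have "hnorm H (sub (X m) (X n)) < e" if mn: "m >= N" "n >= N" for m n
  proof -
  have "1 / real (Suc m) <= 1 / Suc N" "1 / real (Suc n) <= 1 / Suc N" using mn by (auto intro!: divide_left_mono)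
  then have "(hnorm H (sub (X m) (X n)))\<^sup>2 < e^2"
  using par[OF X(1)[of m] X(1)[of n]] X(2)[of m] X(2)[of n] N by argo
  then show ?thesis using e by (simp add: power_less_imp_less_base)
  qed
  then show "EX N. ALL m>=N. ALL n>=N. hnorm H (sub (X m) (X n)) < e" by blast
 qed
 then obtain x where t: "tends X x" by blast
 then have x: "x \<in> hcarrier H" by (simp add: tends_def)
 have "(%n. Re (l (X n)) - Re (l x)) ~~> 0"
 proof (rule Lim_null_comparison)
  have "\<bar>Re (l (X n)) - Re (l x)\<bar> <= B * hnorm H (sub (X n) x)" for n
  proof -
  have "Re (l (X n)) - Re (l x) = Re (l (sub (X n) x))" using X(1) x by (simp add: add scale closed)
  then show ?thesis using bd[of "sub (X n) x"] abs_Re_le_cmod[of "l (sub (X n) x)"] X(1) x by (simp add: closed)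
  qed
  then show "\<forall>\<^sub>F n in sequentially. norm (Re (l (X n)) - Re (l x)) <= B * hnorm H (sub (X n) x)" by simp
  have "(%n. B * hnorm H (sub (X n) x)) ~~> B * 0" using t by (intro tendsto_intros) (simp add: tends_def)
  then show "(%n. B * hnorm H (sub (X n) x)) ~~> 0" by simp
 qed
 then have lX: "(%n. Re (l (X n))) ~~> Re (l x)" by (simp add: LIM_zero_iff)
 have "(%n. J (X n)) ~~> J x" unfolding J_def by (intro tendsto_diff tendsto_power tendsto_mult tendsto_const tends_norm[OF t] lX)
 moreover have "(%n. d + 1 / Suc n) ~~> d + 0" by (intro tendsto_intros LIMSEQ_Suc[OF lim_1_over_n])
 ultimately have Jx: "J x <= d"
  by (intro LIMSEQ_le[of "%n. J (X n)" "J x" "%n. d + 1 / Suc n" d]) (use X(2) in \<open>auto intro: less_imp_le\<close>)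
 have re: "Re (l z) = Re (hinner H z x)" if z: "z \<in> hcarrier H" for z
 proof -
  define p where "p = (hnorm H z)^2"
  define q where "q = Re (hinner H z x) - Re (l z)"
  have q: "0 <= t^2 * p + 2 * t * q" for t :: real
  proof -
  have "J x <= J (hadd H x (hscale H (of_real t) z))" using Jx dl[of "hadd H x (hscale H (of_real t) z)"] x z by (simp add: closed)
  also have "... = J x + (t^2 * p + 2 * t * q)"
  using x z inner_sym[of z x] by (simp add: J_def norm_add_sq closed norm_scale add scale inner_simps' p_def q_def power_mult_distrib algebra_simps)
  finally show ?thesis by simp
  qed
  have "q = 0"
  proof (rule ccontr)
  assume "q ~= 0"
  have p0: "p >= 0" by (simp add: p_def)
  define t where "t = - q / (p + 1)"
  have t: "t * (p + 1) = - q" using p0 by (simp add: t_def)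
  have "t\<^sup>2 * p + 2 * t * q = t * (t * (p + 1)) - t\<^sup>2 + 2 * (t * q)" by (simp add: power2_eq_square algebra_simps)
  also have "... = t * q - t\<^sup>2" unfolding t by simp
  finally have eq: "t\<^sup>2 * p + 2 * t * q = t * q - t\<^sup>2" .
  have "t\<^sup>2 <= t * q" using q[of t] unfolding eq by simp
  moreover have "t * q < 0" unfolding t_def using p0 \<open>q ~= 0\<close> by (simp add: divide_neg_pos flip: power2_eq_square)
  ultimately show False using zero_le_power2[of t] by simp
  qed
  then show ?thesis by (simp add: q_def)
 qed
 have "l z = hinner H z x" if z: "z \<in> hcarrier H" for z
 proof -
  have "Re (l (hscale H (-\<i>) z)) = Re (hinner H (hscale H (-\<i>) z) x)" by (rule re) (simp add: z closed)
  then show ?thesis using re[OF z] z x by (simp add: scale inner_simps' complex_eq_iff)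
 qed
 then show ?thesis using that x by blast
qed

end

lemma bounded_opsD:
 assumes "T \<in> bounded_ops H K"
 shows "!!x. x \<in> hcarrier H ==> T x \<in> hcarrier K"
  "!!x y. x \<in> hcarrier H ==> y \<in> hcarrier H ==> T (hadd H x y) = hadd K (T x) (T y)"
  "!!c x. x \<in> hcarrier H ==> T (hscale H c x) = hscale K c (T x)"
  "EX C. ALL x:hcarrier H. hnorm K (T x) <= C * hnorm H x"
  "T \<in> extensional (hcarrier H)"
 using assms unfolding bounded_ops_def PiE_iff by blast+

lemma bounded_ops_tends:
 assumes H: "prehilbert H" and K: "prehilbert K" and T: "T \<in> bounded_ops H K" and X: "prehilbert.tends H X x"
 shows "prehilbert.tends K (%n. T (X n)) (T x)"
proof -
 interpret H: prehilbert H by fact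
 interpret K: prehilbert K by fact
 note T' = bounded_opsD[OF T]
 have c: "X n \<in> hcarrier H" "x \<in> hcarrier H" for n
  using X by (auto simp: H.tends_def)
 obtain C where C: "!!x. x\<in>hcarrier H ==> hnorm K (T x) <= C * hnorm H x" using T'(4) by blast
 have "(%n. hnorm K (K.sub (T (X n)) (T x))) ~~> 0"
 proof (rule tendsto_sandwich[OF _ _ tendsto_const])
  have "K.sub (T (X n)) (T x) = T (H.sub (X n) x)" for n using c by (simp add: T' H.closed)
  then show "\<forall>\<^sub>F n in sequentially. hnorm K (K.sub (T (X n)) (T x)) <= C * hnorm H (H.sub (X n) x)"
  using c C by (simp add: H.closed)
  have "(%n. C * hnorm H (H.sub (X n) x)) ~~> C * 0" using X by (intro tendsto_intros) (simp add: H.tends_def)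
  then show "(%n. C * hnorm H (H.sub (X n) x)) ~~> 0" by simp
 qed (use c T' in \<open>auto intro!: always_eventually K.norm_nonneg K.closed\<close>)
 then show ?thesis using c by (simp add: K.tends_def T')
qed

lemma bounded_ops_eqI_dense:
 assumes H: "prehilbert H" and K: "prehilbert K" and T: "T \<in> bounded_ops H K" and T': "T' \<in> bounded_ops H K"
  and eq: "!!x. x \<in> D ==> T x = T' x"
  and dense: "!!x. x \<in> hcarrier H ==> EX X. (ALL n. X n \<in> D) & prehilbert.tends H X x"
 shows "T = T'"
proof (rule extensionalityI[OF bounded_opsD(5)[OF T] bounded_opsD(5)[OF T']])
 fix x assume "x \<in> hcarrier H"
 then obtain X where X: "!!n. X n \<in> D" "prehilbert.tends H X x" using dense by blast
 have "prehilbert.tends K (%n. T (X n)) (T x)" "prehilbert.tends K (%n. T' (X n)) (T' x)"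
  by (intro bounded_ops_tends[OF H K _ X(2)] T T')+
 then show "T x = T' x" using prehilbert.tends_unique[OF K] eq[OF X(1)] by auto
qed

lemma contraction_extension:
 assumes H: "prehilbert H" and K: "hilbert K"
  and D: "D \<subseteq> hcarrier H"
  and D_add: "!!x y. x \<in> D ==> y \<in> D ==> hadd H x y \<in> D"
  and D_scale: "!!c x. x \<in> D ==> hscale H c x \<in> D"
  and T0: "!!x. x \<in> D ==> T0 x \<in> hcarrier K"
  and T0_add: "!!x y. x \<in> D ==> y \<in> D ==> T0 (hadd H x y) = hadd K (T0 x) (T0 y)"
  and T0_scale: "!!c x. x \<in> D ==> T0 (hscale H c x) = hscale K c (T0 x)"
  and T0_le: "!!x. x \<in> D ==> hnorm K (T0 x) <= hnorm H x"
  and dense: "!!x. x \<in> hcarrier H ==> EX X. (ALL n. X n \<in> D) & prehilbert.tends H X x"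
 obtains T where "T \<in> bounded_ops H K" "!!x. x \<in> D ==> T x = T0 x"
  "!!x. x \<in> hcarrier H ==> hnorm K (T x) <= hnorm H x"
proof -
 interpret H: prehilbert H by fact
 interpret K: hilbert K by fact
 define P where "P x y \<longleftrightarrow> (EX X. (ALL n. X n \<in> D) & H.tends X x & K.tends (%n. T0 (X n)) y)" for x y
 have Pc: "y \<in> hcarrier K" "x \<in> hcarrier H" if "P x y" for x y using that by (auto simp: P_def K.tends_def H.tends_def)
 have P_add: "P (hadd H x x') (hadd K y y')" if xy: "P x y" "P x' y'" for x y x' y'
 proof -
  obtain X X' where "!!n. X n \<in> D" "H.tends X x" "K.tends (%n. T0 (X n)) y"
  "!!n. X' n \<in> D" "H.tends X' x'" "K.tends (%n. T0 (X' n)) y'" using xy by (auto simp: P_def)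
  then show ?thesis unfolding P_def
  by (intro exI[of _ "%n. hadd H (X n) (X' n)"]) (auto simp: T0_add D_add intro: H.tends_add K.tends_add)
 qed
 have P_scale: "P (hscale H c x) (hscale K c y)" if xy: "P x y" for x y c
 proof -
  obtain X where "!!n. X n \<in> D" "H.tends X x" "K.tends (%n. T0 (X n)) y" using xy by (auto simp: P_def)
  then show ?thesis unfolding P_def
  by (intro exI[of _ "%n. hscale H c (X n)"]) (auto simp: T0_scale D_scale intro: H.tends_scale K.tends_scale)
 qed
 have P_le: "hnorm K y <= hnorm H x" if xy: "P x y" for x y
 proof -
  obtain X where X: "!!n. X n \<in> D" "H.tends X x" "K.tends (%n. T0 (X n)) y" using xy by (auto simp: P_def)
  show ?thesis by (rule LIMSEQ_le[OF K.tends_norm[OF X(3)] H.tends_norm[OF X(2)]]) (use T0_le X(1) in auto)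
 qed
 have P_ex: "EX y. P x y" if x: "x \<in> hcarrier H" for x
 proof -
  obtain X where X: "!!n. X n \<in> D" "H.tends X x" using dense[OF x] by blast
  have "EX y. K.tends (%n. T0 (X n)) y"
  proof (rule K.complete)
  fix e :: real assume "e > 0"
  then obtain N where N: "ALL m>=N. ALL n>=N. hnorm H (H.sub (X m) (X n)) < e" using H.tends_cauchy[OF X(2)] by blast
  have "K.sub (T0 (X m)) (T0 (X n)) = T0 (H.sub (X m) (X n))" for m n using X(1) by (simp add: T0_add T0_scale D_scale)
  then have "hnorm K (K.sub (T0 (X m)) (T0 (X n))) <= hnorm H (H.sub (X m) (X n))" for m n
  using T0_le[of "H.sub (X m) (X n)"] X(1) by (simp add: D_add D_scale)
  then show "EX N. ALL m>=N. ALL n>=N. hnorm K (K.sub (T0 (X m)) (T0 (X n))) < e" using N by (meson le_less_trans)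
  qed (use X T0 in auto)
  then show ?thesis using X by (auto simp: P_def)
 qed
 have P_un: "y = y'" if "P x y" "P x y'" for x y y'
 proof (rule K.norm_eq_0D)
  show c: "y \<in> hcarrier K" "y' \<in> hcarrier K" using that Pc by auto
  have "P (H.sub x x) (K.sub y y')" using that by (intro P_add P_scale)
  then have "hnorm K (K.sub y y') <= 0" using P_le H.norm_sub_self Pc(2)[OF that(1)] by metis
  then show "hnorm K (K.sub y y') = 0" using K.norm_nonneg[of "K.sub y y'"] c by (simp add: K.closed)
 qed
 have P_D: "P x (T0 x)" if "x \<in> D" for x
  unfolding P_def by (rule exI[of _ "%_. x"]) (use that D T0 in \<open>auto intro!: H.tends_const K.tends_const\<close>)
 define T where "T = (\<lambda>x\<in>hcarrier H. SOME y. P x y)"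
 have TP: "P x (T x)" if "x \<in> hcarrier H" for x
  unfolding T_def using that P_ex[OF that] by (simp add: someI_ex)
 show ?thesis
 proof (rule that)
  show "T \<in> bounded_ops H K"
  unfolding bounded_ops_def
  proof (intro CollectI conjI ballI allI)
  show "T \<in> hcarrier H \<rightarrow>\<^sub>E hcarrier K" using Pc(1)[OF TP] by (auto simp: T_def)
  show "T (hadd H x y) = hadd K (T x) (T y)" if "x \<in> hcarrier H" "y \<in> hcarrier H" for x y
  by (rule P_un[OF TP P_add[OF TP TP]]) (use that in \<open>auto simp: H.closed\<close>)
  show "T (hscale H c x) = hscale K c (T x)" if "x \<in> hcarrier H" for x c
  by (rule P_un[OF TP P_scale[OF TP]]) (use that in \<open>auto simp: H.closed\<close>)
  show "EX C. ALL x:hcarrier H. hnorm K (T x) <= C * hnorm H x"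
  by (rule exI[of _ 1]) (use P_le[OF TP] in auto)
  qed
  show "T x = T0 x" if "x \<in> D" for x by (rule P_un[OF TP P_D]) (use that D in auto)
  show "hnorm K (T x) <= hnorm H x" if "x \<in> hcarrier H" for x by (rule P_le[OF TP[OF that]])
 qed
qed

section \<open>The Hilbert spaces of square integrable functions\<close>

lemma rep_measurable [measurable]: "rep f \<in> bmeas"
 using Quotient3_rep_reflp[OF Quotient3_L0, of f] by (simp add: ae_eq_def)

lemma rep_cls: "f \<in> bmeas ==> AE x in lborel. rep (cls f) x = f x"
 using Quotient3_rep_abs[OF Quotient3_L0, of f] by (simp add: ae_eq_def)

lemma cls_rep [simp]: "cls (rep f) = f"
 by (rule Quotient3_abs_rep[OF Quotient3_L0])

lemma cls_eqI:
 "f \<in> bmeas ==> g \<in> bmeas ==> AE x in lborel. f x = g x ==> cls f = cls g"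
 using Quotient3_rel[OF Quotient3_L0, of f g] by (simp add: ae_eq_def)

lemma cls_eqD: "f \<in> bmeas ==> g \<in> bmeas ==> cls f = cls g ==> AE x in lborel. f x = g x"
 using Quotient3_rel[OF Quotient3_L0, of f g] by (simp add: ae_eq_def)

lemma L0_eqI: "AE x in lborel. rep f x = rep g x ==> f = g"
 using cls_eqI[of "rep f" "rep g"] by simp

lemma rep_L0_map:
 assumes "F \<in> bmeas"
 shows "AE x in lborel. rep (L0_map F f) x = F (rep f x)"
 unfolding L0_map_def by (rule rep_cls) (rule measurable_compose[OF rep_measurable assms])

lemma rep_L0_map2:
 fixes F :: "'b::{second_countable_topology} => 'c::{second_countable_topology} => 'e::topological_space"
 assumes F: "(%(x, y). F x y) \<in> bmeas"
 shows "AE x in lborel. rep (L0_map2 F f g) x = F (rep f x) (rep g x)"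
proof -
 have "(%x. (rep f x, rep g x)) \<in> borel \<rightarrow>\<^sub>M (borel \<Otimes>\<^sub>M borel)"
  by measurable
 then have "(%x. (rep f x, rep g x)) \<in> bmeas"
  by (simp add: borel_prod)
 from measurable_compose[OF this F] show ?thesis
  unfolding L0_map2_def by (intro rep_cls) simp
qed

definition sq :: "('a::euclidean_space => 'b::euclidean_space) => bool" where
 "sq f \<longleftrightarrow> f \<in> bmeas & imut (%x. (norm (f x))^2)"

lemma sq_measurable [measurable_dest]: "sq f ==> f \<in> bmeas" by (simp add: sq_def)

lemma sq_bound:
 assumes f: "imut F" and [measurable]: "g \<in> bmeas" and b: "AE x in lborel. (norm (g x))\<^sup>2 <= F x"
 shows "sq g"
 unfolding sq_def
proof
 show "imut (%x. (norm (g x))^2)"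
  by (rule Bochner_Integration.integrable_bound[OF f]) (use b in \<open>auto elim!: eventually_mono\<close>)
qed fact

lemma norm_add_sq_le: "(norm (u + v :: 'b::real_normed_vector))\<^sup>2 <= 2 * (norm u)^2 + 2 * (norm v)^2"
proof -
 have "(norm (u + v))\<^sup>2 <= (norm u + norm v)^2" by (intro power_mono norm_triangle_ineq) auto
 also have "... <= 2 * (norm u)^2 + 2 * (norm v)^2"
  using zero_le_power2[of "norm u - norm v"] by (simp add: power2_diff power2_sum)
 finally show ?thesis .
qed

lemma norm_diff_sq_le: "(norm (u - v :: 'b::real_normed_vector))\<^sup>2 <= 2 * (norm u)^2 + 2 * (norm v)^2"
 using norm_add_sq_le[of u "- v"] by simp

lemma sq_add: "sq f ==> sq g ==> sq (%x. f x + g x)"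
 by (rule sq_bound[where F="%x. 2 * (norm (f x))^2 + 2 * (norm (g x))^2"]) (auto simp: sq_def norm_add_sq_le)

lemma sq_diff: "sq f ==> sq g ==> sq (%x. f x - g x)"
 by (rule sq_bound[where F="%x. 2 * (norm (f x))^2 + 2 * (norm (g x))^2"]) (auto simp: sq_def norm_diff_sq_le)

lemma sq_norm_bound:
 assumes f: "sq f" and [measurable]: "g \<in> bmeas" and b: "AE x in lborel. norm (g x) <= C * norm (f x)"
 shows "sq g"
proof (rule sq_bound[where F="%x. C^2 * (norm (f x))^2"])
 show "imut (%x. C^2 * (norm (f x))^2)" using f by (simp add: sq_def)
 show "AE x in lborel. (norm (g x))\<^sup>2 <= C^2 * (norm (f x))^2" using b
  by eventually_elim (metis norm_ge_zero power_mono power_mult_distrib)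
qed fact

lemma sq_cong_AE:
 assumes "sq f" "g \<in> bmeas" "AE x in lborel. g x = f x" shows "sq g"
 by (rule sq_norm_bound[OF assms(1,2), of 1]) (use assms(3) in \<open>auto elim!: eventually_mono\<close>)

lemma mult_le_sq: "norm u * norm v <= ((norm u)^2 + (norm v)^2) / 2"
 using zero_le_power2[of "norm u - norm v"] by (simp add: power2_diff)

lemma sq_product_integrable:
 assumes f: "sq f" and g: "sq g" and [measurable]: "h \<in> bmeas"
  and b: "AE x in lborel. norm (h x) <= norm (f x) * norm (g x)"
 shows "imut (h :: 'a::euclidean_space => 'c::{banach,second_countable_topology})"
proof (rule Bochner_Integration.integrable_bound[where f="%x. ((norm (f x))^2 + (norm (g x))^2) / 2"])
 show "AE x in mut. norm (h x) <= norm (((norm (f x))^2 + (norm (g x))^2) / 2)"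
  using b unfolding AE_mut
  by eventually_elim (use order_trans[OF _ mult_le_sq] in fastforce)
qed (use f g in \<open>auto simp: sq_def\<close>)

text \<open>Riesz--Fischer. Along a subsequence with rapidly decreasing differences \<open>d\<^sub>k\<close>, the integral
 of \<open>\<Sum> 2\<^sup>k |d\<^sub>k|\<^sup>2\<close> is finite, which forces pointwise convergence almost everywhere; Fatou's lemma
 then gives convergence in mean.\<close>

lemma riesz_fischer:
 fixes X :: "nat => 'a::euclidean_space => 'b::euclidean_space"
 assumes X: "!!n. sq (X n)"
  and cauchy: "!!e. e > 0 ==> EX N. ALL m>=N. ALL n>=N. Imut (%x. (norm (X m x - X n x))^2) < e"
 obtains f where "sq f" "(%n. Imut (%x. (norm (X n x - f x))^2)) ~~> 0"
proof -
 have [measurable]: "X n \<in> bmeas" for n using X by (simp add: sq_def)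
 have "EX N. N >= k & (ALL m>=N. ALL n>=N. Imut (%x. (norm (X m x - X n x))^2) < (1/4)^k)" for k
  using cauchy[of "(1/4)^k"] by (metis max.bounded_iff max.cobounded1 zero_less_divide_1_iff zero_less_numeral zero_less_power)
 then obtain N where N: "!!k. N k >= k" "!!k m n. m >= N k ==> n >= N k ==> Imut (%x. (norm (X m x - X n x))^2) < (1/4)^k"
  by metis
 define r where "r k = (\<Sum>i\<le>k. N i)" for k
 have rN: "r j >= N k" if "j >= k" for j k
  unfolding r_def using that by (intro member_le_sum) auto
 define d where "d k x = X (r (Suc k)) x - X (r k) x" for k x
 have [measurable]: "d k \<in> bmeas" for k unfolding d_def by measurable
 have sqd: "sq (d k)" for k unfolding d_def by (intro sq_diff X)
 have "(\<integral>\<^sup>+x. (\<Sum>k. ennreal (2^k * (norm (d k x))^2)) \<partial>mut) = (\<Sum>k. \<integral>\<^sup>+x. ennreal (2^k * (norm (d k x))^2) \<partial>mut)"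
  by (rule nn_integral_suminf) measurable
 also have "... <= (\<Sum>k. ennreal ((1/2)^k))"
 proof (rule suminf_le)
  fix k
  have "(\<integral>\<^sup>+x. ennreal (2^k * (norm (d k x))^2) \<partial>mut) = ennreal (Imut (%x. 2^k * (norm (d k x))^2))"
  by (rule nn_integral_eq_integral) (use sqd in \<open>auto simp: sq_def\<close>)
  also have "Imut (%x. 2^k * (norm (d k x))^2) <= 2^k * (1/4)^k"
  using N(2)[OF rN[of k "Suc k"] rN[of k k]] by (simp add: d_def)
  also have "2^k * (1/4)^k = (1/2 :: real)^k" by (simp flip: power_mult_distrib)
  finally show "(\<integral>\<^sup>+x. ennreal (2^k * (norm (d k x))^2) \<partial>mut) <= ennreal ((1/2)^k)"
  by (simp add: ennreal_leI)
 qed auto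
 also have "... < \<infinity>"
  by (subst suminf_ennreal2) (auto intro: summable_geometric)
 finally have fin: "(\<integral>\<^sup>+x. (\<Sum>k. ennreal (2^k * (norm (d k x))^2)) \<partial>mut) ~= \<infinity>" by simp
 have "AE x in mut. (\<Sum>k. ennreal (2^k * (norm (d k x))^2)) ~= \<infinity>"
  by (rule nn_integral_PInf_AE[OF _ fin]) measurable
 then have conv: "AE x in mut. convergent (%k. X (r k) x)"
 proof eventually_elim
  case (elim x)
  have s: "summable (%k. 2^k * (norm (d k x))^2)"
  by (rule summable_suminf_not_top) (use elim in auto)
  then have "(%k. 2^k * (norm (d k x))^2) ~~> 0" by (rule summable_LIMSEQ_zero)
  then have "Bseq (%k. 2^k * (norm (d k x))^2)" by (intro convergent_imp_Bseq) (auto simp: convergent_def)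
  then obtain C where C: "!!k. norm (2^k * (norm (d k x))^2) <= C" by (auto simp: Bseq_def)
  have le: "norm (d k x) <= sqrt C * (sqrt (1/2))^k" for k
  proof -
  have "(norm (d k x))\<^sup>2 <= C * (1/2)^k"
  using C[of k] by (simp add: abs_mult field_simps power_divide)
  then have "norm (d k x) <= sqrt (C * (1/2)^k)" by (rule real_le_rsqrt)
  then show ?thesis by (simp add: real_sqrt_mult real_sqrt_power)
  qed
  have "summable (%k. norm (d k x))"
  proof (rule summable_comparison_test')
  show "summable (%k. sqrt C * (sqrt (1/2))^k)"
  by (intro summable_mult summable_geometric) (simp add: real_sqrt_divide)
  show "norm (norm (d k x)) <= sqrt C * (sqrt (1/2))^k" if "k >= 0" for k using le by simp
  qed
  then have "summable (%k. d k x)" by (rule summable_norm_cancel)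
  then have "convergent (%n. \<Sum>k<n. d k x)" by (simp add: summable_iff_convergent)
  moreover have "(\<Sum>k<n. d k x) = X (r n) x - X (r 0) x" for n
  unfolding d_def by (rule sum_lessThan_telescope)
  ultimately have "convergent (%n. X (r n) x - X (r 0) x)" by simp
  then have "convergent (%n. (X (r n) x - X (r 0) x) + X (r 0) x)"
  by (intro convergent_add convergent_const)
  then show "convergent (%k. X (r k) x)" by simp
 qed
 define f where "f x = lim (%k. X (r k) x)" for x
 have [measurable]: "f \<in> bmeas"
  unfolding f_def by (rule borel_measurable_lim_metric) measurable
 have lim: "AE x in mut. (%k. X (r k) x) ~~> f x"
  using conv by eventually_elim (simp add: f_def convergent_LIMSEQ_iff)
 have fatou: "(\<integral>\<^sup>+x. ennreal ((norm (X n x - f x))^2) \<partial>mut) <= ennreal ((1/4)^k)" if n: "n >= N k" for n k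
 proof -
  have "(\<integral>\<^sup>+x. ennreal ((norm (X n x - f x))^2) \<partial>mut) = (\<integral>\<^sup>+x. liminf (%j. ennreal ((norm (X n x - X (r j) x))^2)) \<partial>mut)"
  proof (rule nn_integral_cong_AE)
  show "AE x in mut. ennreal ((norm (X n x - f x))^2) = liminf (%j. ennreal ((norm (X n x - X (r j) x))^2))"
  using lim
  proof eventually_elim
  case (elim x)
  then have "(%j. ennreal ((norm (X n x - X (r j) x))^2)) ~~> ennreal ((norm (X n x - f x))^2)"
  by (intro tendsto_intros)
  then show ?case by (intro lim_imp_Liminf[symmetric]) auto
  qed
  qed
  also have "... <= liminf (%j. \<integral>\<^sup>+x. ennreal ((norm (X n x - X (r j) x))^2) \<partial>mut)"
  by (rule nn_integral_liminf) measurable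
  also have "... <= ennreal ((1/4)^k)"
  proof (rule Liminf_le)
  show "\<forall>\<^sub>F j in sequentially. (\<integral>\<^sup>+x. ennreal ((norm (X n x - X (r j) x))^2) \<partial>mut) <= ennreal ((1/4)^k)"
  using eventually_ge_at_top[of k]
  proof eventually_elim
  case (elim j)
  have "(\<integral>\<^sup>+x. ennreal ((norm (X n x - X (r j) x))^2) \<partial>mut) = ennreal (Imut (%x. (norm (X n x - X (r j) x))^2))"
  by (rule nn_integral_eq_integral) (use sq_diff[OF X X] in \<open>auto simp: sq_def\<close>)
  also have "... <= ennreal ((1/4)^k)" using N(2)[OF n rN[OF elim]] by (intro ennreal_leI) simp
  finally show ?case .
  qed
  qed simp
  finally show ?thesis .
 qed
 have sqnf: "sq (%x. X n x - f x)" if n: "n >= N k" for n k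
  unfolding sq_def
 proof (intro conjI integrableI_bounded)
  have "(\<integral>\<^sup>+x. ennreal (norm ((norm (X n x - f x))^2)) \<partial>mut) <= ennreal ((1/4)^k)" using fatou[OF n] by simp
  also have "... < \<infinity>" by simp
  finally show "(\<integral>\<^sup>+x. ennreal (norm ((norm (X n x - f x))^2)) \<partial>mut) < \<infinity>" .
 qed measurable
 have le: "Imut (%x. (norm (X n x - f x))^2) <= (1/4)^k" if n: "n >= N k" for n k
 proof -
  have "(\<integral>\<^sup>+x. ennreal ((norm (X n x - f x))^2) \<partial>mut) = ennreal (Imut (%x. (norm (X n x - f x))^2))"
  by (rule nn_integral_eq_integral) (use sqnf[OF n] in \<open>auto simp: sq_def\<close>)
  then show ?thesis using fatou[OF n] by (simp add: ennreal_le_iff)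
 qed
 show ?thesis
 proof (rule that)
  have "sq (%x. X (N 0) x - (X (N 0) x - f x))" by (intro sq_diff X sqnf[of 0]) simp
  then show "sq f" by simp
  show "(%n. Imut (%x. (norm (X n x - f x))^2)) ~~> 0"
  proof (rule LIMSEQ_I)
  fix e :: real assume "e > 0"
  then obtain k where k: "(1/4)^k < e" using real_arch_pow_inv[of e "1/4"] by auto
  have "norm (Imut (%x. (norm (X n x - f x))^2) - 0) < e" if "n >= N k" for n
  using le[OF that] k by (simp add: abs_of_nonneg)
  then show "EX no. ALL n>=no. norm (Imut (%x. (norm (X n x - f x))^2) - 0) < e" by blast
  qed
 qed
qed

text \<open>Both \<open>L\<^sup>2(\<real>\<^sup>N)\<close> and \<open>L\<^sup>2(\<real>\<^sup>N)\<^sup>d\<close> are instances of the same construction, for an inner product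
 on the space of values.\<close>

locale value_space =
 fixes ip :: "'b::euclidean_space => 'b => complex" and sc :: "complex => 'b => 'b"
 assumes ip_add: "ip (u + v) w = ip u w + ip v w"
  and ip_sc: "ip (sc c u) w = c * ip u w"
  and ip_sym: "ip v u = cnj (ip u v)"
  and ip_self: "ip u u = of_real ((norm u)^2)"
  and ip_le: "cmod (ip u v) <= norm u * norm v"
  and ip_cont: "continuous_on UNIV (%p. ip (fst p) (snd p))"
  and sc_cont: "continuous_on UNIV (sc c)"
  and sc_minus: "sc (-1) u = - u"
begin

definition L2g :: "('a::euclidean_space, 'b) L0 hilb" where
 "L2g = \<lparr>
  hcarrier = L2_carrier,
  hadd = L0_map2 (+),
  hscale = (%c. L0_map (sc c)),
  hinner = (%f g. Imut (%x. ip (rep f x) (rep g x)))\<rparr>"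

lemma L2g_carrier: "f \<in> hcarrier L2g \<longleftrightarrow> sq (rep f)"
 by (simp add: L2g_def L2_carrier_def sq_def)

lemma rep_add: "AE x in lborel. rep (hadd L2g f g) x = rep f x + rep g x"
 unfolding L2g_def hilb.select_convs by (rule rep_L0_map2) (auto intro!: borel_measurable_continuous_onI continuous_intros simp: split_beta')

lemma rep_scale: "AE x in lborel. rep (hscale L2g c f) x = sc c (rep f x)"
 unfolding L2g_def hilb.select_convs by (rule rep_L0_map) (auto intro!: borel_measurable_continuous_onI sc_cont)

lemma sc_measurable [measurable]: "sc c \<in> bmeas"
 by (rule borel_measurable_continuous_onI[OF sc_cont])

lemma ip_measurable:
 assumes [measurable]: "f \<in> borel_measurable M" "g \<in> borel_measurable M"
 shows "(%x. ip (f x) (g x)) \<in> borel_measurable M"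
proof -
 have "(%x. (f x, g x)) \<in> M \<rightarrow>\<^sub>M (borel \<Otimes>\<^sub>M borel)" by measurable
 then have "(%x. (f x, g x)) \<in> borel_measurable M" by (simp add: borel_prod)
 from measurable_compose[OF this borel_measurable_continuous_onI[OF ip_cont]] show ?thesis by simp
qed

lemma norm_sc: "norm (sc c u) = cmod c * norm u"
proof -
 have "of_real ((norm (sc c u))^2) = c * cnj c * ip u u"
  unfolding ip_self[symmetric] using ip_sym[of "sc c u" u] ip_sym[of u u]
  by (metis (no_types, lifting) complex_cnj_mult ip_sc ip_sym mult.assoc)
 also have "... = of_real ((cmod c * norm u)^2)"
  unfolding ip_self power_mult_distrib of_real_mult complex_norm_square ..
 finally have "(norm (sc c u))\<^sup>2 = (cmod c * norm u)^2" by (simp only: of_real_eq_iff)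
 then show ?thesis by (simp add: power2_eq_iff_nonneg)
qed

lemma ip_integrable: "sq f ==> sq g ==> imut (%x. ip (f x) (g x))"
 by (rule sq_product_integrable[of f g]) (auto intro!: ip_measurable ip_le simp: sq_def)

lemma inner_eq: "hinner L2g f g = Imut (%x. ip (rep f x) (rep g x))"
 by (simp add: L2g_def)

lemma norm_eq: "hnorm L2g f = sqrt (Imut (%x. (norm (rep f x))^2))"
 by (simp add: hnorm_def inner_eq ip_self del: of_real_power)

lemma integral_cong_AE_rep:
 assumes "AE x in lborel. F x = (G x :: complex)" "F \<in> bmeas" "G \<in> bmeas"
 shows "Imut F = Imut G"
 by (rule integral_cong_AE) (use assms in auto)

lemma L2g_prehilbert: "prehilbert (L2g :: ('a::euclidean_space, 'b) L0 hilb)"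
proof
 fix f g h :: "('a, 'b) L0" and c
 assume f: "f \<in> hcarrier L2g"
 then have f': "sq (rep f)" by (simp add: L2g_carrier)
 show "hscale L2g c f \<in> hcarrier L2g"
  unfolding L2g_carrier by (rule sq_norm_bound[OF f', of _ "cmod c"]) (use rep_scale[of c f] in \<open>auto elim!: eventually_mono simp: norm_sc\<close>)
 show "0 <= Re (hinner L2g f f)"
  by (simp add: inner_eq ip_self del: of_real_power)
 assume g: "g \<in> hcarrier L2g"
 then have g': "sq (rep g)" by (simp add: L2g_carrier)
 show "hadd L2g f g \<in> hcarrier L2g"
  unfolding L2g_carrier by (rule sq_cong_AE[OF sq_add[OF f' g']]) (use rep_add[of f g] in auto)
 show "hinner L2g g f = cnj (hinner L2g f g)"
 proof -
  have "Imut (%x. ip (rep g x) (rep f x)) = Imut (%x. cnj (ip (rep f x) (rep g x)))"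
  by (rule Bochner_Integration.integral_cong[OF refl]) (rule ip_sym)
  also have "... = cnj (Imut (%x. ip (rep f x) (rep g x)))" by simp
  finally show ?thesis unfolding inner_eq .
 qed
 show "hinner L2g (hscale L2g c f) g = c * hinner L2g f g"
 proof -
  have "hinner L2g (hscale L2g c f) g = Imut (%x. ip (sc c (rep f x)) (rep g x))"
  unfolding inner_eq
  by (rule integral_cong_AE_rep) (use rep_scale[of c f] in \<open>auto elim!: eventually_mono intro!: ip_measurable\<close>)
  then show ?thesis by (simp add: ip_sc inner_eq)
 qed
 { assume eq: "!!z. z \<in> hcarrier L2g ==> hinner L2g f z = hinner L2g g z"
  let ?d = "%x. rep f x - rep g x"
  have d: "sq ?d" by (rule sq_diff[OF f' g'])
  have dc: "AE x in lborel. rep (cls ?d) x = ?d x" by (rule rep_cls) measurable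
  have z: "cls ?d \<in> hcarrier L2g" unfolding L2g_carrier by (rule sq_cong_AE[OF d _ dc]) measurable
  have i: "hinner L2g k (cls ?d) = Imut (%x. ip (rep k x) (?d x))" for k
  unfolding inner_eq
  by (rule integral_cong_AE_rep) (use dc in \<open>auto elim!: eventually_mono intro!: ip_measurable\<close>)
  have ipd: "ip (u - v) w = ip u w - ip v w" for u v w
  using ip_add[of "u - v" v w] by simp
  have "of_real (Imut (%x. (norm (?d x))^2)) = Imut (%x. ip (?d x) (?d x))"
  unfolding ip_self by (rule integral_complex_of_real[symmetric])
  also have "... = Imut (%x. ip (rep f x) (?d x)) - Imut (%x. ip (rep g x) (?d x))"
  unfolding ipd by (rule Bochner_Integration.integral_diff) (intro ip_integrable f' g' d)+
  also have "... = 0" using eq[OF z] by (simp add: i)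
  finally have "Imut (%x. (norm (?d x))^2) = 0" by simp
  then have "AE x in mut. (norm (?d x))\<^sup>2 = 0"
  using d by (subst (asm) integral_nonneg_eq_0_iff_AE) (auto simp: sq_def)
  then show "f = g" by (intro L0_eqI) (auto elim!: eventually_mono) }
 assume h: "h \<in> hcarrier L2g"
 then have h': "sq (rep h)" by (simp add: L2g_carrier)
 show "hinner L2g (hadd L2g f g) h = hinner L2g f h + hinner L2g g h"
 proof -
  have "hinner L2g (hadd L2g f g) h = Imut (%x. ip (rep f x + rep g x) (rep h x))"
  unfolding inner_eq
  by (rule integral_cong_AE_rep) (use rep_add[of f g] in \<open>auto elim!: eventually_mono intro!: ip_measurable\<close>)
  then show ?thesis unfolding ip_add inner_eq
  by (subst (asm) Bochner_Integration.integral_add) (auto intro!: ip_integrable f' g' h')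
 qed
qed

sublocale L2g: prehilbert "L2g :: ('a::euclidean_space, 'b) L0 hilb"
 by (rule L2g_prehilbert)

lemma rep_sub: "AE x in lborel. rep (hadd L2g f (hscale L2g (-1) g)) x = rep f x - rep g x"
 using rep_add[of f "hscale L2g (-1) g"] rep_scale[of "-1" g]
 by eventually_elim (simp add: sc_minus)

lemma norm_sub: "hnorm L2g (L2g.sub f g) = sqrt (Imut (%x. (norm (rep f x - rep g x))^2))"
proof -
 have "Imut (%x. (norm (rep (L2g.sub f g) x))^2) = Imut (%x. (norm (rep f x - rep g x))^2)"
  by (rule integral_cong_AE) (use rep_sub[of f g] in \<open>auto elim!: eventually_mono\<close>)
 then show ?thesis unfolding norm_eq by simp
qed

lemma cls_carrier: "sq f ==> cls f \<in> hcarrier L2g"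
 unfolding L2g_carrier by (rule sq_cong_AE[OF _ rep_measurable rep_cls]) (simp_all add: sq_def)

lemma L2g_hilbert: "hilbert (L2g :: ('a::euclidean_space, 'b) L0 hilb)"
proof (intro hilbert.intro hilbert_axioms.intro L2g_prehilbert)
 fix X :: "nat => ('a, 'b) L0"
 assume X: "!!n. X n \<in> hcarrier L2g"
  and c: "!!e. e > 0 ==> EX N. ALL m>=N. ALL n>=N. hnorm L2g (L2g.sub (X m) (X n)) < e"
 obtain f where f: "sq f" "(%n. Imut (%x. (norm (rep (X n) x - f x))^2)) ~~> 0"
 proof (rule riesz_fischer[of "%n. rep (X n)"])
  show "sq (rep (X n))" for n using X by (simp add: L2g_carrier)
  fix e :: real assume "e > 0"
  then have "sqrt e > 0" by simp
  from c[OF this] show "EX N. ALL m>=N. ALL n>=N. Imut (%x. (norm (rep (X m) x - rep (X n) x))^2) < e"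
  unfolding norm_sub by (simp only: real_sqrt_less_iff)
 qed
 have "(%n. sqrt (Imut (%x. (norm (rep (X n) x - f x))^2))) ~~> sqrt 0"
  by (intro tendsto_intros f)
 moreover have "Imut (%x. (norm (rep (X n) x - f x))^2) = Imut (%x. (norm (rep (X n) x - rep (cls f) x))^2)" for n
  by (rule integral_cong_AE) (use rep_cls[of f] f(1) in \<open>auto elim!: eventually_mono simp: sq_def\<close>)
 ultimately have "L2g.tends X (cls f)"
  using X cls_carrier[OF f(1)] by (simp add: L2g.tends_def norm_sub)
 then show "EX x. L2g.tends X x" by blast
qed

lemma tends_dominated:
 assumes f: "sq f" and g: "sq g" and [measurable]: "!!n. X n \<in> bmeas"
  and b: "!!n. AE x in lborel. norm (X n x) <= norm (g x)"
  and l: "AE x in lborel. (%n. X n x) ~~> f x"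
 shows "L2g.tends (%n. cls (X n)) (cls f)"
proof -
 have [measurable]: "f \<in> bmeas" using f by (simp add: sq_def)
 have X: "sq (X n)" for n by (rule sq_norm_bound[OF g, of _ 1]) (use b in auto)
 have "(%n. Imut (%x. (norm (X n x - f x))^2)) ~~> Imut (%x::'a. 0)"
 proof (rule integral_dominated_convergence[where w="%x. 2 * (norm (g x))^2 + 2 * (norm (f x))^2"])
  show "imut (%x. 2 * (norm (g x))^2 + 2 * (norm (f x))^2)" using f g by (simp add: sq_def)
  show "AE x in mut. (%n. (norm (X n x - f x))^2) ~~> 0"
  using l unfolding AE_mut
  proof eventually_elim
  case (elim x)
  then have "(%n. (norm (X n x - f x))^2) ~~> (norm (f x - f x))\<^sup>2" by (intro tendsto_intros)
  then show ?case by simp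
  qed
  show "AE x in mut. norm ((norm (X n x - f x))^2) <= 2 * (norm (g x))^2 + 2 * (norm (f x))^2" for n
  using b[of n] unfolding AE_mut
  proof eventually_elim
  case (elim x)
  have "(norm (X n x))\<^sup>2 <= (norm (g x))^2" using elim by (intro power_mono) auto
  then have "(norm (X n x - f x))\<^sup>2 <= 2 * (norm (g x))^2 + 2 * (norm (f x))^2" using norm_diff_sq_le[of "X n x" "f x"] by linarith
  then show ?case by simp
  qed
 qed measurable
 then have "(%n. sqrt (Imut (%x. (norm (X n x - f x))^2))) ~~> sqrt 0"
  by (intro tendsto_intros) simp
 moreover have "Imut (%x. (norm (X n x - f x))^2) = Imut (%x. (norm (rep (cls (X n)) x - rep (cls f) x))^2)" for n
 proof (rule integral_cong_AE)
  have "AE x in lborel. rep (cls f) x = f x" "AE x in lborel. rep (cls (X n)) x = X n x" by (intro rep_cls; measurable)+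
  then show "AE x in mut. (norm (X n x - f x))\<^sup>2 = (norm (rep (cls (X n)) x - rep (cls f) x))^2"
  unfolding AE_mut by eventually_elim simp
 qed measurable
 ultimately show ?thesis
  using cls_carrier[OF f] cls_carrier[OF X] by (simp add: L2g.tends_def norm_sub)
qed

end

interpretation scalar: value_space "%a b :: complex. a * cnj b" "(*)"
 by unfold_locales (auto simp: algebra_simps complex_norm_square norm_mult simp del: of_real_power intro!: continuous_intros)

lemma L2_eq: "L2 = scalar.L2g"
 by (simp add: L2_def scalar.L2g_def)

lemma cip_le: "cmod (cip u v) <= norm u * norm v"
proof -
 have "cmod (cip u v) <= (SUM r:UNIV. cmod (u $ r * cnj (v $ r)))"
  unfolding cip_def by (rule norm_sum)
 also have "... = (SUM r:UNIV. \<bar>cmod (u $ r)\<bar> * \<bar>cmod (v $ r)\<bar>)" by (simp add: norm_mult)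
 also have "... <= norm u * norm v" unfolding norm_vec_def by (rule L2_set_mult_ineq)
 finally show ?thesis .
qed

lemma cip_self: "cip u u = of_real ((norm u)^2)"
 by (simp add: cip_def norm_vec_def L2_set_def sum_nonneg complex_norm_square del: of_real_power)

interpretation vec: value_space "cip :: complex^'d => complex^'d => complex" "(*s)"
proof unfold_locales
 fix u v w :: "complex^'d" and c
 show "cip (u + v) w = cip u w + cip v w" by (simp add: cip_def algebra_simps sum.distrib)
 show "cip (c *s u) w = c * cip u w" by (simp add: cip_def sum_distrib_left mult.assoc)
 show "cip v u = cnj (cip u v)" by (simp add: cip_def mult.commute)
 show "cip u u = of_real ((norm u)^2)" by (rule cip_self)
 show "cmod (cip u v) <= norm u * norm v" by (rule cip_le)
 show "continuous_on UNIV (%p. cip (fst p) (snd p :: complex^'d))" unfolding cip_def by (intro continuous_intros)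
 show "continuous_on UNIV ((*s) c :: complex^'d => _)" unfolding vector_scalar_mult_def by (intro continuous_intros)
 show "(-1) *s u = - u" by (simp add: vec_eq_iff)
qed

lemma L2vec_eq: "L2vec = vec.L2g"
 by (simp add: L2vec_def vec.L2g_def)

section \<open>The Fourier--Plancherel transform\<close>

lemma cnj_measurable [measurable (raw)]:
 assumes "f \<in> borel_measurable M" shows "(%x. cnj (f x)) \<in> borel_measurable M"
 by (rule measurable_compose[OF assms borel_measurable_continuous_onI]) (intro continuous_intros)

lemma integral_norm_bound_ennreal_all:
 fixes f :: "'a => 'b::{banach,second_countable_topology}"
 shows "ennreal (norm (integral\<^sup>L M f)) <= (\<integral>\<^sup>+x. ennreal (norm (f x)) \<partial>M)"
 by (cases "integrable M f") (simp_all add: integral_norm_bound_ennreal not_integrable_integral_eq)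

definition FT :: "('a::euclidean_space => complex) => 'a => complex" where
 "FT f xi = Imut (%u. f u * exp (- \<i> * of_real (u \<bullet> xi)))"

lemma FT_measurable [measurable]:
 assumes [measurable]: "f \<in> bmeas"
 shows "FT f \<in> bmeas"
 unfolding FT_def by measurable

lemma norm_char [simp]: "cmod (exp (- (\<i> * of_real t))) = 1" "cmod (exp (\<i> * of_real t)) = 1"
 by simp_all

lemma FT_integrable:
 assumes f: "imut f"
 shows "imut (%u. f u * exp (- \<i> * of_real (u \<bullet> xi)))"
proof -
 have [measurable]: "f \<in> bmeas" using borel_measurable_integrable[OF f] by simp
 show ?thesis by (rule Bochner_Integration.integrable_bound[OF f]) (simp_all add: norm_mult)
qed

lemma FT_bound: "cmod (FT f xi) <= Imut (%u. cmod (f u))"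
proof -
 have "cmod (FT f xi) <= Imut (%u. cmod (f u * exp (- \<i> * of_real (u \<bullet> xi))))"
  unfolding FT_def by (rule integral_norm_bound)
 then show ?thesis by (simp add: norm_mult)
qed

lemma FT_mult_formula:
 fixes f g :: "'a::euclidean_space => complex"
 assumes f: "imut f" and g: "imut g"
 shows "Imut (%xi. FT f xi * g xi) = Imut (%x. f x * FT g x)"
proof -
 have [measurable]: "f \<in> bmeas" "g \<in> bmeas" using borel_measurable_integrable f g by auto
 let ?h = "%x xi. f x * g xi * exp (- \<i> * of_real (x \<bullet> xi))"
 have int: "integrable (mut \<Otimes>\<^sub>M mut) (%(x, xi). ?h x xi)"
 proof (rule mutp.Fubini_integrable)
  show "(%(x, xi). ?h x xi) \<in> borel_measurable (mut \<Otimes>\<^sub>M mut)" by measurable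
  show "imut (%x. LINT xi|mut. cmod (case (x, xi) of (x, xi) => ?h x xi))"
  using f by (simp add: norm_mult)
  show "AE x in mut. imut (%xi. case (x, xi) of (x, xi) => ?h x xi)"
  proof (rule AE_I2)
  fix x
  have "imut (%xi. f x * (g xi * exp (- \<i> * of_real (xi \<bullet> x))))"
  by (intro integrable_mult_right FT_integrable g)
  then show "imut (%xi. case (x, xi) of (x, xi) => ?h x xi)" by (simp add: inner_commute mult.assoc)
  qed
 qed
 have "Imut (%xi. FT f xi * g xi) = (LINT xi|mut. LINT x|mut. ?h x xi)"
  unfolding FT_def integral_mult_left_zero[symmetric] by (simp only: mult_ac)
 also have "... = (LINT x|mut. LINT xi|mut. ?h x xi)"
  using mutp.Fubini_integral[of ?h] int by simp
 also have "... = Imut (%x. f x * FT g x)"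
  unfolding FT_def integral_mult_right_zero[symmetric] by (simp only: mult_ac inner_commute)
 finally show ?thesis .
qed

lemma nn_gk:
 fixes u :: "'a::euclidean_space"
 assumes e: "e > 0"
 shows "(\<integral>\<^sup>+v. ennreal (gk e (u - v)) \<partial>mut) = 1" "(\<integral>\<^sup>+v. ennreal (gk e (v - u)) \<partial>mut) = 1"
proof -
 have i: "imut (%y. gk e (u - y))" "Imut (%y. gk e (u - y)) = 1"
  using mut_affine[of "-1" "%y. gk e (u - y)" u] gk_integral[OF e, where 'a='a] by simp_all
 then show *: "(\<integral>\<^sup>+v. ennreal (gk e (u - v)) \<partial>mut) = 1"
  using nn_integral_eq_integral[OF i(1)] gk_nonneg[OF e, where 'a='a] by simp
 have "gk e (v - u) = gk e (u - v)" for v by (simp add: gk_def norm_minus_commute)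
 then show "(\<integral>\<^sup>+v. ennreal (gk e (v - u)) \<partial>mut) = 1" using * by simp
qed

text \<open>The transform is a contraction for the \<open>L\<^sup>2\<close> norm. Damping \<open>|FT f|\<^sup>2\<close> by a Gaussian turns its
 integral into the form \<open>\<integral>\<integral> f(u) cnj (f v) gk(u - v)\<close>, to which \<open>|f u| |f v| <= (|f u|\<^sup>2 + |f v|\<^sup>2)/2\<close>
 applies. That the transform is isometric follows later, from Fourier inversion.\<close>

lemma FT_contraction:
 fixes f :: "'a::euclidean_space => complex"
 assumes f: "imut f"
 shows "(\<integral>\<^sup>+xi. ennreal ((cmod (FT f xi))^2) \<partial>mut) <= (\<integral>\<^sup>+x. ennreal ((cmod (f x))^2) \<partial>mut)"
proof -
 have [measurable]: "f \<in> bmeas" using borel_measurable_integrable f by auto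
 define G where "G e xi = exp (- (e * norm xi)\<^sup>2 / 2)" for e and xi :: 'a
 have [measurable]: "G e \<in> bmeas" for e unfolding G_def by measurable
 have Gi: "imut (G e)" if "e > 0" for e
  using integrable_norm[OF gauss_fourier(1)[OF that, of "0::'a"]] by (simp add: G_def[abs_def])
 have damp: "(\<integral>\<^sup>+xi. ennreal (G e xi * (cmod (FT f xi))^2) \<partial>mut) <= (\<integral>\<^sup>+x. ennreal ((cmod (f x))^2) \<partial>mut)" if e: "e > 0" for e
 proof -
  define g where "g xi = of_real (G e xi) * cnj (FT f xi)" for xi
  have [measurable]: "g \<in> bmeas" unfolding g_def by measurable
  have gi: "imut g"
  proof (rule Bochner_Integration.integrable_bound)
  show "imut (%xi. G e xi * Imut (%u. cmod (f u)))" using Gi[OF e] by simp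
  show "AE xi in mut. cmod (g xi) <= norm (G e xi * Imut (%u. cmod (f u)))"
  by (rule AE_I2) (auto simp: g_def norm_mult G_def intro!: mult_left_mono order_trans[OF FT_bound])
  qed simp
  have FTg: "FT g u = Imut (%v. cnj (f v) * of_real (gk e (u - v)))" for u
  proof -
  let ?h = "%v xi. cnj (f v) * exp (of_real (- (e * norm xi)\<^sup>2 / 2) - \<i> * of_real ((u - v) \<bullet> xi))"
  have int: "integrable (mut \<Otimes>\<^sub>M mut) (%(v, xi). ?h v xi)"
  proof (rule mutp.Fubini_integrable)
  show "(%(v, xi). ?h v xi) \<in> borel_measurable (mut \<Otimes>\<^sub>M mut)" by measurable
  show "imut (%v. LINT xi|mut. cmod (case (v, xi) of (v, xi) => ?h v xi))"
  using f by (simp add: norm_mult)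
  show "AE v in mut. imut (%xi. case (v, xi) of (v, xi) => ?h v xi)"
  unfolding prod.case by (intro AE_I2 integrable_mult_right gauss_fourier(1)[OF e])
  qed
  have "g xi * exp (- \<i> * of_real (xi \<bullet> u)) = Imut (%v. ?h v xi)" for xi
  proof -
  have "cnj (FT f xi) = Imut (%v. cnj (f v * exp (- \<i> * of_real (v \<bullet> xi))))"
  unfolding FT_def by (simp only: Bochner_Integration.integral_cnj)
  then have "g xi * exp (- \<i> * of_real (xi \<bullet> u)) = Imut (%v. of_real (G e xi) * exp (- \<i> * of_real (xi \<bullet> u)) * cnj (f v * exp (- \<i> * of_real (v \<bullet> xi))))"
  unfolding g_def by (simp only: integral_mult_right_zero mult_ac)
  also have "... = Imut (%v. ?h v xi)"
  proof (intro Bochner_Integration.integral_cong refl)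
  fix v
  have c: "cnj (exp (- \<i> * of_real (v \<bullet> xi))) = exp (\<i> * of_real (v \<bullet> xi))" by (simp add: exp_cnj)
  have p: "exp (of_real (- (e * norm xi)\<^sup>2 / 2)) * exp (- \<i> * of_real (xi \<bullet> u)) * exp (\<i> * of_real (v \<bullet> xi)) =
  exp (of_real (- (e * norm xi)\<^sup>2 / 2) - \<i> * of_real ((u - v) \<bullet> xi))"
  unfolding exp_add[symmetric] by (rule arg_cong[where f=exp]) (simp add: inner_diff_left inner_commute algebra_simps)
  show "of_real (G e xi) * exp (- \<i> * of_real (xi \<bullet> u)) * cnj (f v * exp (- \<i> * of_real (v \<bullet> xi))) = ?h v xi"
  unfolding G_def exp_of_real[symmetric] complex_cnj_mult c p[symmetric] by (simp only: mult_ac)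
  qed
  finally show ?thesis .
  qed
  then have "FT g u = (LINT xi|mut. LINT v|mut. ?h v xi)" unfolding FT_def by simp
  also have "... = (LINT v|mut. LINT xi|mut. ?h v xi)"
  using mutp.Fubini_integral[of ?h] int by simp
  also have "... = Imut (%v. cnj (f v) * of_real (gk e (u - v)))"
  by (simp only: gk_def gauss_fourier(2)[OF e] integral_mult_right_zero)
  finally show ?thesis .
  qed
  have "of_real (G e xi * (cmod (FT f xi))^2) = FT f xi * g xi" for xi
  unfolding g_def of_real_mult complex_norm_square by (simp only: mult_ac)
  then have "cor (Imut (%xi. G e xi * (cmod (FT f xi))^2)) = Imut (%xi. FT f xi * g xi)"
  unfolding integral_complex_of_real[symmetric] by simp
  also have "... = Imut (%u. f u * FT g u)" by (rule FT_mult_formula[OF f gi])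
  finally have eq: "cor (Imut (%xi. G e xi * (cmod (FT f xi))^2)) = Imut (%u. f u * FT g u)" .
  have pos: "0 <= Imut (%xi. G e xi * (cmod (FT f xi))^2)"
  by (intro Bochner_Integration.integral_nonneg) (simp add: G_def)
  have int1: "imut (%xi. G e xi * (cmod (FT f xi))^2)"
  proof (rule Bochner_Integration.integrable_bound)
  show "imut (%xi. G e xi * (Imut (%u. cmod (f u)))^2)" using Gi[OF e] by simp
  show "AE xi in mut. norm (G e xi * (cmod (FT f xi))^2) <= norm (G e xi * (Imut (%u. cmod (f u)))^2)"
  by (rule AE_I2) (auto simp: norm_mult G_def intro!: mult_left_mono power_mono order_trans[OF FT_bound])
  qed measurable
  have m: "ennreal ((cmod (f u))^2 / 2 * gk e w) = ennreal ((cmod (f u))^2 / 2) * ennreal (gk e w)" for u w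
  by (rule ennreal_mult) (simp_all add: gk_nonneg e)
  have inner1: "(\<integral>\<^sup>+v. ennreal ((cmod (f u))^2 / 2 * gk e (u - v)) \<partial>mut) = ennreal ((cmod (f u))^2 / 2)" for u
  unfolding m by (subst nn_integral_cmult) (simp_all add: nn_gk[OF e])
  have inner2: "(\<integral>\<^sup>+u. ennreal ((cmod (f v))^2 / 2 * gk e (u - v)) \<partial>mut) = ennreal ((cmod (f v))^2 / 2)" for v
  unfolding m by (subst nn_integral_cmult) (simp_all add: nn_gk[OF e])
  have "(\<integral>\<^sup>+xi. ennreal (G e xi * (cmod (FT f xi))^2) \<partial>mut) = ennreal (Imut (%xi. G e xi * (cmod (FT f xi))^2))"
  by (rule nn_integral_eq_integral[OF int1]) (simp add: G_def)
  also have "... = ennreal (cmod (Imut (%u. f u * FT g u)))"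
  using pos unfolding eq[symmetric] by simp
  also have "... <= (\<integral>\<^sup>+u. ennreal (cmod (f u * FT g u)) \<partial>mut)"
  by (rule integral_norm_bound_ennreal_all)
  also have "... <= (\<integral>\<^sup>+u. \<integral>\<^sup>+v. ennreal ((cmod (f u))^2 / 2 * gk e (u - v)) + ennreal ((cmod (f v))^2 / 2 * gk e (u - v)) \<partial>mut \<partial>mut)"
  proof (rule nn_integral_mono)
  fix u
  have "f u * FT g u = Imut (%v. f u * (cnj (f v) * of_real (gk e (u - v))))"
  unfolding FTg by (rule integral_mult_right_zero[symmetric])
  then have "ennreal (cmod (f u * FT g u)) <= (\<integral>\<^sup>+v. ennreal (cmod (f u * (cnj (f v) * of_real (gk e (u - v))))) \<partial>mut)"
  using integral_norm_bound_ennreal_all by metis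
  also have "... <= (\<integral>\<^sup>+v. ennreal ((cmod (f u))^2 / 2 * gk e (u - v)) + ennreal ((cmod (f v))^2 / 2 * gk e (u - v)) \<partial>mut)"
  proof (rule nn_integral_mono)
  fix v
  have "cmod (f u * (cnj (f v) * of_real (gk e (u - v)))) = (cmod (f u) * cmod (f v)) * gk e (u - v)"
  using gk_nonneg[OF e, of "u - v"] by (simp add: norm_mult)
  also have "... <= (((cmod (f u))^2 + (cmod (f v))^2) / 2) * gk e (u - v)"
  by (intro mult_right_mono mult_le_sq gk_nonneg e)
  also have "... = (cmod (f u))^2 / 2 * gk e (u - v) + (cmod (f v))^2 / 2 * gk e (u - v)"
  by (simp add: field_simps)
  finally show "ennreal (cmod (f u * (cnj (f v) * of_real (gk e (u - v))))) <= ennreal ((cmod (f u))^2 / 2 * gk e (u - v)) + ennreal ((cmod (f v))^2 / 2 * gk e (u - v))"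
  using gk_nonneg[OF e, of "u - v"] by (simp add: ennreal_leI flip: ennreal_plus)
  qed
  finally show "ennreal (cmod (f u * FT g u)) <= ..." .
  qed
  also have "... = (\<integral>\<^sup>+u. \<integral>\<^sup>+v. ennreal ((cmod (f u))^2 / 2 * gk e (u - v)) \<partial>mut \<partial>mut) + (\<integral>\<^sup>+u. \<integral>\<^sup>+v. ennreal ((cmod (f v))^2 / 2 * gk e (u - v)) \<partial>mut \<partial>mut)"
  by (simp add: nn_integral_add)
  also have "(\<integral>\<^sup>+u. \<integral>\<^sup>+v. ennreal ((cmod (f v))^2 / 2 * gk e (u - v)) \<partial>mut \<partial>mut) = (\<integral>\<^sup>+v. \<integral>\<^sup>+u. ennreal ((cmod (f v))^2 / 2 * gk e (u - v)) \<partial>mut \<partial>mut)"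
  by (rule mutp.Fubini') measurable
  also have "(\<integral>\<^sup>+u. \<integral>\<^sup>+v. ennreal ((cmod (f u))^2 / 2 * gk e (u - v)) \<partial>mut \<partial>mut) = (\<integral>\<^sup>+u. ennreal ((cmod (f u))^2 / 2) \<partial>mut)"
  by (simp only: inner1 inner2)
  also have "(\<integral>\<^sup>+v. \<integral>\<^sup>+u. ennreal ((cmod (f v))^2 / 2 * gk e (u - v)) \<partial>mut \<partial>mut) = (\<integral>\<^sup>+u. ennreal ((cmod (f u))^2 / 2) \<partial>mut)"
  by (simp only: inner1 inner2)
  also have "(\<integral>\<^sup>+u. ennreal ((cmod (f u))^2 / 2) \<partial>mut) + (\<integral>\<^sup>+u. ennreal ((cmod (f u))^2 / 2) \<partial>mut) = (\<integral>\<^sup>+u. ennreal ((cmod (f u))^2) \<partial>mut)"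
  by (subst nn_integral_add[symmetric]) (auto simp flip: ennreal_plus)
  finally show ?thesis .
 qed
 have "(\<integral>\<^sup>+xi. ennreal ((cmod (FT f xi))^2) \<partial>mut) = (\<integral>\<^sup>+xi. liminf (%k. ennreal (G (1 / Suc k) xi * (cmod (FT f xi))^2)) \<partial>mut)"
 proof (rule nn_integral_cong)
  fix xi
  have "(%k. ennreal (G (1 / Suc k) xi * (cmod (FT f xi))^2)) ~~> ennreal (exp (- (0 * norm xi)\<^sup>2 / 2) * (cmod (FT f xi))^2)"
  unfolding G_def by (intro tendsto_intros LIMSEQ_Suc[OF lim_1_over_n])  simp
  then show "ennreal ((cmod (FT f xi))^2) = liminf (%k. ennreal (G (1 / Suc k) xi * (cmod (FT f xi))^2))"
  by (intro lim_imp_Liminf[symmetric]) auto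
 qed
 also have "... <= liminf (%k. \<integral>\<^sup>+xi. ennreal (G (1 / Suc k) xi * (cmod (FT f xi))^2) \<partial>mut)"
  by (rule nn_integral_liminf) measurable
 also have "... <= (\<integral>\<^sup>+x. ennreal ((cmod (f x))^2) \<partial>mut)"
  by (rule Liminf_le) (auto intro!: damp always_eventually)
 finally show ?thesis .
qed

definition FT1 :: "('a::euclidean_space \<times> 'b::euclidean_space => complex) => 'a \<times> 'b => complex" where
 "FT1 f = (%(xi, y). FT (%x. f (x, y)) xi)"

lemma borel_pair_mut: "borel_measurable (mut \<Otimes>\<^sub>M mut :: ('a::euclidean_space \<times> 'b::euclidean_space) measure) = bmeas"
 unfolding mut_prod by simp

lemma section_measurable [measurable (raw)]:
 assumes "f \<in> borel_measurable (borel :: ('a::euclidean_space \<times> 'b::euclidean_space) measure)"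
  and [measurable]: "g \<in> M \<rightarrow>\<^sub>M borel" "h \<in> M \<rightarrow>\<^sub>M borel"
 shows "(%x. f (g x, h x)) \<in> borel_measurable M"
proof -
 have "(%x. (g x, h x)) \<in> M \<rightarrow>\<^sub>M (borel \<Otimes>\<^sub>M borel)" by measurable
 then have "(%x. (g x, h x)) \<in> M \<rightarrow>\<^sub>M borel" by (simp add: borel_prod)
 from measurable_compose[OF this assms(1)] show ?thesis .
qed

lemma FT1_measurable:
 fixes f :: "'a::euclidean_space \<times> 'b::euclidean_space => complex"
 assumes [measurable]: "f \<in> bmeas"
 shows "FT1 f \<in> bmeas"
proof -
 have "(%p. FT (%x. f (x, snd p)) (fst p)) \<in> borel_measurable (mut \<Otimes>\<^sub>M mut)"
  unfolding FT_def by measurable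
 then show ?thesis unfolding borel_pair_mut FT1_def by (simp add: split_beta')
qed

lemma nn_integral_mut_pair:
 fixes F :: "'a::euclidean_space \<times> 'b::euclidean_space => ennreal"
 assumes "F \<in> bmeas"
 shows "(\<integral>\<^sup>+p. F p \<partial>mut) = (\<integral>\<^sup>+y. \<integral>\<^sup>+x. F (x, y) \<partial>mut \<partial>mut)" "(\<integral>\<^sup>+p. F p \<partial>mut) = (\<integral>\<^sup>+x. \<integral>\<^sup>+y. F (x, y) \<partial>mut \<partial>mut)"
proof -
 have F: "F \<in> borel_measurable (mut \<Otimes>\<^sub>M mut)" using assms by (simp add: borel_pair_mut)
 show "(\<integral>\<^sup>+p. F p \<partial>mut) = (\<integral>\<^sup>+y. \<integral>\<^sup>+x. F (x, y) \<partial>mut \<partial>mut)"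
  using mutp.nn_integral_snd[of F] F by (simp add: mut_prod)
 show "(\<integral>\<^sup>+p. F p \<partial>mut) = (\<integral>\<^sup>+x. \<integral>\<^sup>+y. F (x, y) \<partial>mut \<partial>mut)"
  using mut.nn_integral_fst[of F mut] F by (simp add: mut_prod)
qed

lemma FT1_contraction:
 fixes f :: "'a::euclidean_space \<times> 'b::euclidean_space => complex"
 assumes [measurable]: "f \<in> bmeas" and i: "AE y in lborel. imut (%x. f (x, y))"
 shows "(\<integral>\<^sup>+p. ennreal ((cmod (FT1 f p))^2) \<partial>mut) <= (\<integral>\<^sup>+p. ennreal ((cmod (f p))^2) \<partial>mut)"
proof -
 have [measurable]: "FT1 f \<in> bmeas" by (rule FT1_measurable) measurable
 have "(\<integral>\<^sup>+p. ennreal ((cmod (FT1 f p))^2) \<partial>mut) = (\<integral>\<^sup>+y. \<integral>\<^sup>+xi. ennreal ((cmod (FT1 f (xi, y)))^2) \<partial>mut \<partial>mut)"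
  by (rule nn_integral_mut_pair(1)) measurable
 also have "... <= (\<integral>\<^sup>+y. \<integral>\<^sup>+x. ennreal ((cmod (f (x, y)))^2) \<partial>mut \<partial>mut)"
 proof (rule nn_integral_mono_AE)
  show "AE y in mut. (\<integral>\<^sup>+xi. ennreal ((cmod (FT1 f (xi, y)))^2) \<partial>mut) <= (\<integral>\<^sup>+x. ennreal ((cmod (f (x, y)))^2) \<partial>mut)"
  using i unfolding AE_mut by eventually_elim (simp add: FT1_def FT_contraction)
 qed
 also have "... = (\<integral>\<^sup>+p. ennreal ((cmod (f p))^2) \<partial>mut)"
  by (rule nn_integral_mut_pair(1)[symmetric]) measurable
 finally show ?thesis .
qed

lemma sq_nn: "sq f \<longleftrightarrow> f \<in> bmeas & (\<integral>\<^sup>+p. ennreal ((norm (f p))^2) \<partial>mut) < \<infinity>"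
 unfolding sq_def integrable_iff_bounded by auto

lemma sq_nn_eq: "sq f ==> (\<integral>\<^sup>+p. ennreal ((norm (f p))^2) \<partial>mut) = ennreal (Imut (%p. (norm (f p))^2))"
 by (rule nn_integral_eq_integral) (auto simp: sq_def)

lemma sq_FT:
 assumes "imut f" "sq f"
 shows "sq (FT f)" "Imut (%p. (norm (FT f p))^2) <= Imut (%p. (norm (f p))^2)"
proof -
 have [measurable]: "f \<in> bmeas" using assms by (simp add: sq_def)
 show s: "sq (FT f)" using FT_contraction[OF assms(1)] assms(2) by (auto simp: sq_nn intro: le_less_trans)
 show "Imut (%p. (norm (FT f p))^2) <= Imut (%p. (norm (f p))^2)"
  using FT_contraction[OF assms(1)] unfolding sq_nn_eq[OF s] sq_nn_eq[OF assms(2)] by (simp add: ennreal_le_iff)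
qed

lemma sq_FT1:
 assumes "AE y in lborel. imut (%x. f (x, y))" "sq f"
 shows "sq (FT1 f)" "Imut (%p. (norm (FT1 f p))^2) <= Imut (%p. (norm (f p))^2)"
proof -
 have m [measurable]: "f \<in> bmeas" using assms by (simp add: sq_def)
 show s: "sq (FT1 f)" using FT1_contraction[OF m assms(1)] assms(2) FT1_measurable[OF m] by (auto simp: sq_nn intro: le_less_trans)
 show "Imut (%p. (norm (FT1 f p))^2) <= Imut (%p. (norm (f p))^2)"
  using FT1_contraction[OF m assms(1)] unfolding sq_nn_eq[OF s] sq_nn_eq[OF assms(2)] by (simp add: ennreal_le_iff)
qed

lemma AE_pair_D:
 fixes P :: "'a::euclidean_space \<times> 'b::euclidean_space => bool"
 assumes "AE p in lborel. P p"
 shows "AE y in lborel. AE x in lborel. P (x, y)" "AE x in lborel. AE y in lborel. P (x, y)"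
proof -
 have "AE p in (mut \<Otimes>\<^sub>M mut :: ('a \<times> 'b) measure). P p" using assms unfolding mut_prod AE_mut .
 from mutp.AE_pair[OF this] show "AE x in lborel. AE y in lborel. P (x, y)" by simp
 have "AE p in (mut \<Otimes>\<^sub>M mut :: ('a \<times> 'b) measure). P p" using assms unfolding mut_prod AE_mut .
 then have "AE p in distr (mut \<Otimes>\<^sub>M mut :: ('b \<times> 'a) measure) (mut \<Otimes>\<^sub>M mut :: ('a \<times> 'b) measure) (%(x, y). (y, x)). P p"
  by (subst (asm) mutp.distr_pair_swap)
 from AE_distrD[OF measurable_pair_swap' this] have "AE p in (mut \<Otimes>\<^sub>M mut :: ('b \<times> 'a) measure). P (snd p, fst p)"
  by (simp only: split_beta')
 from mutp.AE_pair[OF this] show "AE y in lborel. AE x in lborel. P (x, y)" by simp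
qed

lemma AE_fst_lborel:
 fixes P :: "'a::euclidean_space => bool"
 assumes "AE x in lborel. P x"
 shows "AE p in (lborel :: ('a \<times> 'b::euclidean_space) measure). P (fst p)"
proof -
 obtain N where N: "N \<in> null_sets (mut :: 'a measure)" "{x. \<not> P x} \<subseteq> N" using AE_mut[THEN iffD2, OF assms] unfolding eventually_ae_filter by auto
 have "N \<times> UNIV \<in> null_sets (mut \<Otimes>\<^sub>M mut :: ('a \<times> 'b) measure)"
  using N(1) by (intro mut.times_in_null_sets1) auto
 then have "AE p in (mut :: ('a \<times> 'b) measure). p \<notin> N \<times> UNIV" unfolding mut_prod by (rule AE_not_in)
 then show ?thesis unfolding AE_mut by eventually_elim (use N in auto)
qed

lemma AE_snd_lborel:
 fixes P :: "'b::euclidean_space => bool"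
 assumes "AE x in lborel. P x"
 shows "AE p in (lborel :: ('a::euclidean_space \<times> 'b) measure). P (snd p)"
proof -
 obtain N where N: "N \<in> null_sets (mut :: 'b measure)" "{x. \<not> P x} \<subseteq> N" using AE_mut[THEN iffD2, OF assms] unfolding eventually_ae_filter by auto
 have "UNIV \<times> N \<in> null_sets (mut \<Otimes>\<^sub>M mut :: ('a \<times> 'b) measure)"
  using N(1) by (intro mut.times_in_null_sets2) auto
 then have "AE p in (mut :: ('a \<times> 'b) measure). p \<notin> UNIV \<times> N" unfolding mut_prod by (rule AE_not_in)
 then show ?thesis unfolding AE_mut by eventually_elim (use N in auto)
qed

interpretation L2: hilbert "L2 :: ('a::euclidean_space, complex) L0 hilb"
 unfolding L2_eq by (rule scalar.L2g_hilbert)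

lemmas L2_pre = scalar.L2g_prehilbert[folded L2_eq]
lemmas L2_hilbert = scalar.L2g_hilbert[folded L2_eq]
lemmas L2_carrier_iff = scalar.L2g_carrier[folded L2_eq]
lemmas L2_rep_add = scalar.rep_add[folded L2_eq]
lemmas L2_rep_scale = scalar.rep_scale[folded L2_eq]
lemmas L2_cls_carrier = scalar.cls_carrier[folded L2_eq]
lemmas L2_norm = scalar.norm_eq[folded L2_eq]
lemmas L2_inner = scalar.inner_eq[folded L2_eq]
lemmas L2_tends = scalar.tends_dominated[folded L2_eq]

lemma L2_cls_add: "f \<in> bmeas ==> g \<in> bmeas ==> hadd L2 (cls f) (cls g) = cls (%x. f x + g x :: complex)"
proof (rule L0_eqI)
 assume [measurable]: "f \<in> bmeas" "g \<in> bmeas"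
 have "AE x in lborel. rep (cls (%x. f x + g x)) x = f x + g x" by (rule rep_cls) measurable
 with L2_rep_add[of "cls f" "cls g"] rep_cls[OF \<open>f \<in> _\<close>] rep_cls[OF \<open>g \<in> _\<close>]
 show "AE x in lborel. rep (hadd L2 (cls f) (cls g)) x = rep (cls (%x. f x + g x)) x"
  by eventually_elim simp
qed

lemma L2_cls_scale: "f \<in> bmeas ==> hscale L2 c (cls f) = cls (%x. c * f x)"
proof (rule L0_eqI)
 assume [measurable]: "f \<in> bmeas"
 have "AE x in lborel. rep (cls (%x. c * f x)) x = c * f x" by (rule rep_cls) measurable
 with L2_rep_scale[of c "cls f"] rep_cls[OF \<open>f \<in> _\<close>]
 show "AE x in lborel. rep (hscale L2 c (cls f)) x = rep (cls (%x. c * f x)) x"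
  by eventually_elim simp
qed

lemma L2_norm_cls: "f \<in> bmeas ==> hnorm L2 (cls f) = sqrt (Imut (%x. (cmod (f x))^2))"
 unfolding L2_norm
 by (rule arg_cong[where f=sqrt], rule integral_cong_AE) (use rep_cls[of f] in \<open>auto elim!: eventually_mono\<close>)

subsection \<open>Truncations\<close>

lemma finite_mut: "emeasure lborel A < \<infinity> ==> A \<in> sets borel ==> imut (indicator A :: 'a::euclidean_space => real)"
 unfolding integrable_mut by (rule integrable_real_indicator) auto

lemma sq_truncate_integrable:
 fixes f :: "'a::euclidean_space => complex"
 assumes f: "sq f" and A[measurable]: "A \<in> sets borel" and fin: "emeasure lborel A < \<infinity>"
 shows "imut (%x. indicator A x *\<^sub>R f x)"
proof (rule Bochner_Integration.integrable_bound)
 show "imut (%x. indicator A x + (cmod (f x))^2)"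
  using f finite_mut[OF fin A] by (simp add: sq_def)
 have [measurable]: "f \<in> bmeas" using f by (simp add: sq_def)
 show "(%x. indicator A x *\<^sub>R f x) \<in> borel_measurable mut" by simp
 have "t <= 1 + t^2" for t :: real using zero_le_power2[of "t - 1/2"] by (simp add: power2_diff power_divide)
 then show "AE x in mut. cmod (indicator A x *\<^sub>R f x) <= norm (indicator A x + (cmod (f x))^2)"
  by (intro AE_I2) (auto simp: indicator_def)
qed

lemma truncate_tends:
 fixes f :: "'a::euclidean_space => complex"
 assumes f: "sq f" and A[measurable]: "!!n. A n \<in> sets borel" and ev: "!!x. \<forall>\<^sub>F n in sequentially. x \<in> A n"
 shows "L2.tends (%n. cls (%x. indicator (A n) x *\<^sub>R f x)) (cls f)"
proof (rule L2_tends[OF f f])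
 have [measurable]: "f \<in> bmeas" using f by (simp add: sq_def)
 show "(%x. indicator (A n) x *\<^sub>R f x) \<in> bmeas" for n by measurable
 show "AE x in lborel. cmod (indicator (A n) x *\<^sub>R f x) <= cmod (f x)" for n by (auto simp: indicator_def)
 show "AE x in lborel. (%n. indicator (A n) x *\<^sub>R f x) ~~> f x"
 proof (rule AE_I2)
  fix x
  have "\<forall>\<^sub>F n in sequentially. indicator (A n) x *\<^sub>R f x = f x" using ev[of x] by eventually_elim simp
  then show "(%n. indicator (A n) x *\<^sub>R f x) ~~> f x" by (rule tendsto_eventually)
 qed
qed

lemma sq_truncate: "sq f ==> A \<in> sets borel ==> sq (%x. indicator A x *\<^sub>R f x)"
 by (rule sq_norm_bound[of f _ 1]) (auto simp: sq_def indicator_def)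

lemma eventually_cball: "\<forall>\<^sub>F n in sequentially. (x :: 'a::euclidean_space) \<in> cball 0 (real n)"
proof -
 obtain N :: nat where "norm x <= real N" using real_arch_simple by blast
 then show ?thesis by (intro eventually_sequentiallyI[of N]) auto
qed

subsection \<open>The operator on square integrable functions\<close>

lemma FT_eq: "FT f = (%xi. Imut (%u. f u * exp (- \<i> * of_real (u \<bullet> xi))))"
 by (simp add: FT_def fun_eq_iff)

lemma FT_cong:
 assumes "AE x in lborel. f x = g x" "f \<in> bmeas" "g \<in> bmeas"
 shows "FT f = FT g"
 unfolding FT_eq by (rule ext, rule integral_cong_AE) (use assms in \<open>auto elim!: eventually_mono\<close>)

lemma FT_add: "imut f ==> imut g ==> FT (%x. f x + g x) xi = FT f xi + FT g xi"
 unfolding FT_def distrib_right by (rule Bochner_Integration.integral_add) (auto intro: FT_integrable[simplified])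

lemma FT_scale: "FT (%x. c * f x) xi = c * FT f xi"
 unfolding FT_def mult.assoc by (rule integral_mult_right_zero)

lemma integrable_cong_lborel:
 assumes "AE x in lborel. f x = g x" "f \<in> bmeas" "g \<in> bmeas" "imut f"
 shows "imut (g :: 'a::euclidean_space => complex)"
 using assms by (subst integrable_cong_AE[of g mut f]) (auto elim!: eventually_mono)

lemma L1_dense:
 fixes h :: "('a::euclidean_space, complex) L0"
 assumes h: "h \<in> H2"
 shows "EX X. (ALL n. X n \<in> {h \<in> H2. imut (rep h)}) & L2.tends X h"
proof -
 have sq: "sq (rep h)" using h by (simp add: L2_carrier_iff)
 let ?f = "%n x. indicator (cball 0 (real n)) x *\<^sub>R rep h x"
 have "cls (?f n) \<in> {h \<in> H2. imut (rep h)}" for n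
 proof (intro CollectI conjI)
  show "cls (?f n) \<in> H2" by (intro L2_cls_carrier sq_truncate sq) simp
  have i: "imut (?f n)" by (rule sq_truncate_integrable[OF sq]) (simp_all add: emeasure_lborel_cball_finite[simplified])
  have [measurable]: "cball 0 (real n) \<in> sets (borel :: 'a measure)" by simp
  have m: "?f n \<in> bmeas" by measurable
  show "imut (rep (cls (?f n)))"
  by (rule integrable_cong_lborel[OF _ m _ i]) (use rep_cls[OF m] in \<open>auto elim!: eventually_mono\<close>)
 qed
 moreover have "L2.tends (%n. cls (?f n)) h"
  using truncate_tends[OF sq _ eventually_cball] by simp
 ultimately show ?thesis by (intro exI[of _ "%n. cls (?f n)"] conjI allI)
qed

lemma plancherel_props:
 shows "(plancherel :: ('a::euclidean_space, complex) L0 => _) \<in> bounded_ops L2 L2" (is ?A)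
  and "!!h :: ('a, complex) L0. h \<in> H2 ==> imut (rep h) ==> plancherel h = cls (FT (rep h))"
proof -
 let ?D = "{h :: ('a, complex) L0. h \<in> H2 & imut (rep h)}"
 let ?P = "%T. T \<in> bounded_ops L2 L2 & (ALL h:H2. imut (rep h) --> T h = cls (FT (rep (h :: ('a, complex) L0))))"
 obtain T where T: "T \<in> bounded_ops L2 L2" "!!h. h \<in> ?D ==> T h = cls (FT (rep h))"
 proof (rule contraction_extension[OF L2_pre L2_hilbert, where D = ?D and ?T0.0="%h. cls (FT (rep h))"])
  fix x y :: "('a, complex) L0" and c
  assume x: "x \<in> ?D"
  then have x': "x \<in> H2" "imut (rep x)" "sq (rep x)" by (auto simp: L2_carrier_iff)
  note fx = FT_measurable[OF rep_measurable, of x]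
  show "cls (FT (rep x)) \<in> H2" by (intro L2_cls_carrier sq_FT x')
  show "hnorm L2 (cls (FT (rep x))) <= hnorm L2 x"
  unfolding L2_norm_cls[OF fx] unfolding L2_norm by (intro real_sqrt_le_mono sq_FT x')
  have i: "imut (%u. c * rep x u)" using x'(2) by simp
  show "hscale L2 c x \<in> ?D" using x' L2.scale_closed[of x c]
  by (auto intro!: integrable_cong_lborel[OF _ _ _ i] eventually_mono[OF L2_rep_scale[of c x]])
  have "FT (rep (hscale L2 c x)) = FT (%u. c * rep x u)" by (rule FT_cong[OF L2_rep_scale]) measurable
  then show "cls (FT (rep (hscale L2 c x))) = hscale L2 c (cls (FT (rep x)))"
  by (subst L2_cls_scale) (simp_all add: FT_scale[abs_def] fx)
  assume y: "y \<in> ?D"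
  then have y': "y \<in> H2" "imut (rep y)" by auto
  note fy = FT_measurable[OF rep_measurable, of y]
  have i: "imut (%u. rep x u + rep y u)" using x'(2) y'(2) by simp
  show "hadd L2 x y \<in> ?D" using x' y' L2.add_closed[of x y]
  by (auto intro!: integrable_cong_lborel[OF _ _ _ i] eventually_mono[OF L2_rep_add[of x y]])
  have "FT (rep (hadd L2 x y)) = FT (%u. rep x u + rep y u)" by (rule FT_cong[OF L2_rep_add]) measurable
  then show "cls (FT (rep (hadd L2 x y))) = hadd L2 (cls (FT (rep x))) (cls (FT (rep y)))"
  by (subst L2_cls_add) (simp_all add: FT_add[OF x'(2) y'(2), abs_def] fx fy)
 qed (use L1_dense in auto)
 have ex: "?P T" using T by auto
 have un: "S = T" if "?P S" for S
  by (rule bounded_ops_eqI_dense[OF L2_pre L2_pre, where D = ?D]) (use that T L1_dense in auto)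
 have "plancherel = (THE T. ?P T)" unfolding plancherel_def FT_eq ..
 also have "... = T" by (rule the_equality[of ?P, OF ex un])
 finally have eq: "plancherel = T" .
 show ?A unfolding eq by (rule T(1))
 show "plancherel h = cls (FT (rep h))" if "h \<in> H2" "imut (rep h)" for h :: "('a, complex) L0"
  unfolding eq using T(2)[of h] that by simp
qed

subsection \<open>The transform in the first variable\<close>

lemma FT1_cong:
 fixes f g :: "'a::euclidean_space \<times> 'b::euclidean_space => complex"
 assumes "AE p in lborel. f p = g p" and [measurable]: "f \<in> bmeas" "g \<in> bmeas"
 shows "AE p in lborel. FT1 f p = FT1 g p"
proof -
 have "AE y in lborel. ALL xi. FT1 f (xi, y) = FT1 g (xi, y)"
  using AE_pair_D(1)[OF assms(1)]
 proof eventually_elim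
  case (elim y)
  have "FT (%x. f (x, y)) = FT (%x. g (x, y))" by (rule FT_cong[OF elim]) measurable
  then show ?case by (simp add: FT1_def)
 qed
 from AE_snd_lborel[OF this, where 'a='a] show ?thesis by eventually_elim auto
qed

lemma FT1_add:
 fixes f g :: "'a::euclidean_space \<times> 'b::euclidean_space => complex"
 assumes "AE y in lborel. imut (%x. f (x, y))" "AE y in lborel. imut (%x. g (x, y))"
 shows "AE p in lborel. FT1 (%p. f p + g p) p = FT1 f p + FT1 g p"
proof -
 have "AE y in lborel. ALL xi. FT1 (%p. f p + g p) (xi, y) = FT1 f (xi, y) + FT1 g (xi, y)"
  using assms by eventually_elim (simp add: FT1_def FT_add)
 from AE_snd_lborel[OF this, where 'a='a] show ?thesis by eventually_elim auto
qed

lemma FT1_scale: "FT1 (%p. c * f p) = (%p. c * FT1 f p)"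
 by (auto simp: FT1_def FT_scale)

lemma sections_cong:
 fixes f g :: "'a::euclidean_space \<times> 'b::euclidean_space => complex"
 assumes "AE p in lborel. f p = g p" and [measurable]: "f \<in> bmeas" "g \<in> bmeas"
  and "AE y in lborel. imut (%x. f (x, y))"
 shows "AE y in lborel. imut (%x. g (x, y))"
 using AE_pair_D(1)[OF assms(1)] assms(4)
proof eventually_elim
 case (elim y)
 show ?case by (rule integrable_cong_lborel[OF elim(1) _ _ elim(2)]) measurable
qed

lemma sq_sections:
 fixes f :: "'a::euclidean_space \<times> 'b::euclidean_space => complex"
 assumes "sq f"
 shows "AE y in lborel. sq (%x. f (x, y))" "AE x in lborel. sq (%y. f (x, y))"
proof -
 have [measurable]: "f \<in> bmeas" using assms by (simp add: sq_def)
 have m: "(%p. (cmod (f p))^2) \<in> bmeas" by measurable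
 have fin: "(\<integral>\<^sup>+p. ennreal ((cmod (f p))^2) \<partial>mut) < \<infinity>" using assms by (simp add: sq_nn)
 have mm: "(%p. ennreal ((cmod (f p))^2)) \<in> bmeas" by measurable
 have i: "integrable (mut \<Otimes>\<^sub>M mut) (%p. (cmod (f p))^2)" using assms by (simp add: sq_def mut_prod)
 have "AE y in mut. imut (%x. (cmod (f (x, y)))^2)"
  using mutp.AE_integrable_snd[of "%x y. (cmod (f (x, y)))\<^sup>2"] i by (simp add: split_beta')
 then show "AE y in lborel. sq (%x. f (x, y))"
  unfolding AE_mut by eventually_elim (simp add: sq_def)
 have "AE x in mut. imut (%y. (cmod (f (x, y)))^2)"
  using mutp.AE_integrable_fst[of "%x y. (cmod (f (x, y)))\<^sup>2"] i by (simp add: split_beta')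
 then show "AE x in lborel. sq (%y. f (x, y))"
  unfolding AE_mut by eventually_elim (simp add: sq_def)
qed

definition sec_L1 :: "('a::euclidean_space \<times> 'b::euclidean_space, complex) L0 set" where
 "sec_L1 = {h \<in> H2. AE y in lborel. imut (%x. rep h (x, y))}"

lemma cls_sec_L1:
 assumes "sq f" "AE y in lborel. imut (%x. f (x, y))"
 shows "cls f \<in> sec_L1"
proof -
 have m: "f \<in> bmeas" using assms by (simp add: sq_def)
 have "AE p in lborel. f p = rep (cls f) p" using rep_cls[OF m] by (auto elim!: eventually_mono)
 from sections_cong[OF this m rep_measurable assms(2)] show ?thesis
  unfolding sec_L1_def by (auto intro!: L2_cls_carrier assms)
qed

lemma sec_L1_dense:
 fixes h :: "('a::euclidean_space \<times> 'b::euclidean_space, complex) L0"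
 assumes h: "h \<in> H2"
 shows "EX X. (ALL n. X n \<in> sec_L1) & L2.tends X h"
proof -
 have sq: "sq (rep h)" using h by (simp add: L2_carrier_iff)
 let ?A = "%n. cball 0 (real n) \<times> UNIV :: ('a \<times> 'b) set"
 have A: "?A n \<in> sets borel" for n by (intro borel_closed closed_Times) auto
 let ?f = "%n x. indicator (?A n) x *\<^sub>R rep h x"
 have "cls (?f n) \<in> sec_L1" for n
 proof (rule cls_sec_L1)
  show "sq (?f n)" by (intro sq_truncate sq A)
  show "AE y in lborel. imut (%x. ?f n (x, y))"
  using sq_sections(1)[OF sq]
  proof eventually_elim
  case (elim y)
  have "imut (%x. indicator (cball 0 (real n)) x *\<^sub>R rep h (x, y))"
  by (rule sq_truncate_integrable[OF elim]) (simp_all add: emeasure_lborel_cball_finite[simplified])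
  moreover have "indicator (?A n) (x, y) = (indicator (cball 0 (real n)) x :: real)" for x by (auto simp: indicator_def)
  ultimately show ?case by simp
  qed
 qed
 moreover have "L2.tends (%n. cls (?f n)) h"
 proof -
  have "\<forall>\<^sub>F n in sequentially. p \<in> ?A n" for p :: "'a \<times> 'b" using eventually_cball[of "fst p"]
  by eventually_elim (auto simp: mem_Times_iff)
  then show ?thesis using truncate_tends[OF sq, of ?A] A by simp
 qed
 ultimately show ?thesis by (intro exI[of _ "%n. cls (?f n)"] conjI allI)
qed

lemma sec_L1_extension:
 obtains T :: "('a::euclidean_space \<times> 'b::euclidean_space, complex) L0 => _"
 where "T \<in> bounded_ops L2 L2" "!!h. h \<in> sec_L1 ==> T h = cls (FT1 (rep h))"
proof (rule contraction_extension[OF L2_pre L2_hilbert, where D = "sec_L1 :: ('a \<times> 'b, complex) L0 set" and ?T0.0="%h. cls (FT1 (rep h))"])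
 fix x y :: "('a \<times> 'b, complex) L0" and c
 assume x: "x \<in> sec_L1"
 then have x': "x \<in> H2" "AE y in lborel. imut (%u. rep x (u, y))" "sq (rep x)" by (auto simp: L2_carrier_iff sec_L1_def)
 note fx = FT1_measurable[OF rep_measurable, of x]
 show "cls (FT1 (rep x)) \<in> H2" by (intro L2_cls_carrier sq_FT1 x')
 show "hnorm L2 (cls (FT1 (rep x))) <= hnorm L2 x"
  unfolding L2_norm_cls[OF fx] unfolding L2_norm by (intro real_sqrt_le_mono sq_FT1 x')
 have s: "hscale L2 c x = cls (%u. c * rep x u)" using L2_cls_scale[OF rep_measurable, of c x] by simp
 have sq: "sq (%u. c * rep x u)" by (rule sq_norm_bound[OF x'(3), of _ "cmod c"]) (auto simp: norm_mult)
 show "hscale L2 c x \<in> sec_L1" unfolding s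
  by (rule cls_sec_L1[OF sq]) (use x'(2) in \<open>auto elim!: eventually_mono\<close>)
 have "AE p in lborel. FT1 (rep (hscale L2 c x)) p = FT1 (%u. c * rep x u) p" by (rule FT1_cong[OF L2_rep_scale]) measurable
 then show "cls (FT1 (rep (hscale L2 c x))) = hscale L2 c (cls (FT1 (rep x)))"
  unfolding L2_cls_scale[OF fx] FT1_scale by (intro cls_eqI FT1_measurable) (use fx in measurable)
 assume y: "y \<in> sec_L1"
 then have y': "y \<in> H2" "AE z in lborel. imut (%u. rep y (u, z))" "sq (rep y)" by (auto simp: L2_carrier_iff sec_L1_def)
 note fy = FT1_measurable[OF rep_measurable, of y]
 have s: "hadd L2 x y = cls (%u. rep x u + rep y u)" using L2_cls_add[OF rep_measurable rep_measurable, of x y] by simp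
 have i: "AE z in lborel. imut (%u. rep x (u, z) + rep y (u, z))"
  using x'(2) y'(2) by eventually_elim simp
 show "hadd L2 x y \<in> sec_L1" unfolding s
  by (rule cls_sec_L1[OF sq_add[OF x'(3) y'(3)] i])
 have "AE p in lborel. FT1 (rep (hadd L2 x y)) p = FT1 (%u. rep x u + rep y u) p" by (rule FT1_cong[OF L2_rep_add]) measurable
 then have "AE p in lborel. FT1 (rep (hadd L2 x y)) p = FT1 (rep x) p + FT1 (rep y) p"
  using FT1_add[OF x'(2) y'(2)] by eventually_elim simp
 then show "cls (FT1 (rep (hadd L2 x y))) = hadd L2 (cls (FT1 (rep x))) (cls (FT1 (rep y)))"
  unfolding L2_cls_add[OF fx fy] by (intro cls_eqI FT1_measurable) (use fx fy in measurable)
next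
 show "(sec_L1 :: ('a \<times> 'b, complex) L0 set) \<subseteq> H2" by (auto simp: sec_L1_def)
qed (use sec_L1_dense that in auto)

subsection \<open>Elementary tensors\<close>

lemma sq_tensor:
 fixes f :: "'a::euclidean_space => complex" and g :: "'b::euclidean_space => complex"
 assumes f: "sq f" and g: "sq g"
 shows "sq (%(x, y). f x * g y)"
  "Imut (%p. (cmod (case p of (x, y) => f x * g y))^2) = Imut (%x. (cmod (f x))^2) * Imut (%y. (cmod (g y))^2)"
proof -
 have [measurable]: "f \<in> bmeas" "g \<in> bmeas" using f g by (auto simp: sq_def)
 have m: "(%(x, y). f x * g y) \<in> bmeas"
  unfolding borel_pair_mut[symmetric] by measurable
 have mm: "(%p. ennreal ((cmod (case p of (x, y) => f x * g y))^2)) \<in> bmeas"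
  by (intro measurable_compose[OF m]) measurable
 have "(\<integral>\<^sup>+p. ennreal ((cmod (case p of (x, y) => f x * g y))^2) \<partial>mut) = (\<integral>\<^sup>+x. \<integral>\<^sup>+y. ennreal ((cmod (f x))^2) * ennreal ((cmod (g y))^2) \<partial>mut \<partial>mut)"
  unfolding nn_integral_mut_pair(2)[OF mm] by (simp add: norm_mult power_mult_distrib ennreal_mult)
 also have "... = (\<integral>\<^sup>+x. ennreal ((cmod (f x))^2) \<partial>mut) * (\<integral>\<^sup>+y. ennreal ((cmod (g y))^2) \<partial>mut)"
  by (simp add: nn_integral_cmult nn_integral_multc)
 also have "... = ennreal (Imut (%x. (cmod (f x))^2) * Imut (%y. (cmod (g y))^2))"
  unfolding sq_nn_eq[OF f] sq_nn_eq[OF g] by (simp add: ennreal_mult)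
 finally have eq: "(\<integral>\<^sup>+p. ennreal ((cmod (case p of (x, y) => f x * g y))^2) \<partial>mut) = ..." .
 show s: "sq (%(x, y). f x * g y)" unfolding sq_nn using m eq by simp
 show "Imut (%p. (cmod (case p of (x, y) => f x * g y))^2) = Imut (%x. (cmod (f x))^2) * Imut (%y. (cmod (g y))^2)"
  using eq unfolding sq_nn_eq[OF s] by (simp add: ennreal_inj)
qed

lemma tensor_cls:
 assumes "f \<in> bmeas" "g \<in> bmeas"
 shows "tensor (cls f) (cls g) = cls (%(x, y). f x * g y)"
 unfolding tensor_def
proof (rule cls_eqI)
 note [measurable] = assms
 show "(%(x, y). rep (cls f) x * rep (cls g) y) \<in> bmeas"
  "(%(x, y). f x * g y) \<in> bmeas"
  unfolding borel_pair_mut[symmetric] by measurable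
 show "AE p in lborel. (case p of (x, y) => rep (cls f) x * rep (cls g) y) = (case p of (x, y) => f x * g y)"
  using AE_fst_lborel[OF rep_cls[OF assms(1)], where 'b='b] AE_snd_lborel[OF rep_cls[OF assms(2)], where 'a='a]
  by eventually_elim auto
qed

lemma tensor_bounded_op:
 fixes k :: "('b::euclidean_space, complex) L0"
 assumes k: "k \<in> H2"
 shows "(\<lambda>h\<in>H2. tensor (h :: ('a::euclidean_space, complex) L0) k) \<in> bounded_ops L2 L2"
 unfolding bounded_ops_def
proof (intro CollectI conjI ballI allI)
 have k': "sq (rep k)" using k by (simp add: L2_carrier_iff)
 have m: "(%(x, y). rep (h :: ('a, complex) L0) x * rep k y) \<in> bmeas" for h
  unfolding borel_pair_mut[symmetric] by measurable
 show "(\<lambda>h\<in>H2. tensor (h :: ('a, complex) L0) k) \<in> H2 \<rightarrow>\<^sub>E H2"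
 proof -
  have "tensor h k \<in> H2" if "h \<in> H2" for h :: "('a, complex) L0"
  unfolding tensor_def using that by (intro L2_cls_carrier sq_tensor(1) k') (simp add: L2_carrier_iff)
  then show ?thesis by auto
 qed
 fix x y :: "('a, complex) L0" and c
 assume x: "x \<in> H2"
 have s: "hscale L2 c x = cls (%u. c * rep x u)" using L2_cls_scale[OF rep_measurable, of c x] by simp
 have "tensor (hscale L2 c x) k = cls (%(u, v). (c * rep x u) * rep k v)"
  unfolding s using tensor_cls[of "%u. c * rep x u" "rep k"] by simp
 also have "... = hscale L2 c (tensor x k)"
  unfolding tensor_def L2_cls_scale[OF m] by (simp add: split_beta' mult.assoc)
 finally show "(\<lambda>h\<in>H2. tensor h k) (hscale L2 c x) = hscale L2 c ((\<lambda>h\<in>H2. tensor h k) x)"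
  using x by (simp add: L2.closed)
 assume y: "y \<in> H2"
 have s: "hadd L2 x y = cls (%u. rep x u + rep y u)" using L2_cls_add[OF rep_measurable rep_measurable, of x y] by simp
 have "tensor (hadd L2 x y) k = cls (%(u, v). (rep x u + rep y u) * rep k v)"
  unfolding s using tensor_cls[of "%u. rep x u + rep y u" "rep k"] by simp
 also have "... = hadd L2 (tensor x k) (tensor y k)"
  unfolding tensor_def L2_cls_add[OF m m] by (simp add: split_beta' distrib_right)
 finally show "(\<lambda>h\<in>H2. tensor h k) (hadd L2 x y) = hadd L2 ((\<lambda>h\<in>H2. tensor h k) x) ((\<lambda>h\<in>H2. tensor h k) y)"
  using x y by (simp add: L2.closed)
next
 have k': "sq (rep k)" using k by (simp add: L2_carrier_iff)
 have m: "(%(x, y). rep (h :: ('a, complex) L0) x * rep k y) \<in> bmeas" for h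
  unfolding borel_pair_mut[symmetric] by measurable
 have "hnorm L2 (tensor h k) <= hnorm L2 k * hnorm L2 h" if "h \<in> H2" for h :: "('a, complex) L0"
 proof -
  have "hnorm L2 (tensor h k) = sqrt (Imut (%x. (cmod (rep h x))^2) * Imut (%y. (cmod (rep k y))^2))"
  unfolding tensor_def L2_norm_cls[OF m] by (subst sq_tensor(2)) (use that k' in \<open>auto simp: L2_carrier_iff\<close>)
  then show ?thesis by (simp add: L2_norm real_sqrt_mult mult.commute)
 qed
 then show "EX C. ALL x:H2. hnorm L2 ((\<lambda>h\<in>H2. tensor (h :: ('a, complex) L0) k) x) <= C * hnorm L2 x" by auto
qed

lemma bounded_ops_compose:
 assumes H: "prehilbert H" and K: "prehilbert K" and L: "prehilbert L" and S: "S \<in> bounded_ops H K" and T: "T \<in> bounded_ops K L"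
 shows "compose (hcarrier H) T S \<in> bounded_ops H L"
 unfolding bounded_ops_def
proof (intro CollectI conjI ballI allI)
 interpret H: prehilbert H by fact
 interpret K: prehilbert K by fact
 interpret L: prehilbert L by fact
 note S' = bounded_opsD[OF S] and T' = bounded_opsD[OF T]
 show "compose (hcarrier H) T S \<in> hcarrier H \<rightarrow>\<^sub>E hcarrier L" using S'(1) T'(1) by (auto simp: compose_def)
 show "compose (hcarrier H) T S (hadd H x y) = hadd L (compose (hcarrier H) T S x) (compose (hcarrier H) T S y)"
  if "x \<in> hcarrier H" "y \<in> hcarrier H" for x y using that S' T' by (simp add: compose_def H.closed)
 show "compose (hcarrier H) T S (hscale H c x) = hscale L c (compose (hcarrier H) T S x)"
  if "x \<in> hcarrier H" for x c using that S' T' by (simp add: compose_def H.closed)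
 obtain C C' where C: "!!x. x\<in>hcarrier H ==> hnorm K (S x) <= C * hnorm H x" "!!x. x\<in>hcarrier K ==> hnorm L (T x) <= C' * hnorm K x"
  using S'(4) T'(4) by blast
 have "hnorm L (compose (hcarrier H) T S x) <= (\<bar>C'\<bar> * C) * hnorm H x" if x: "x \<in> hcarrier H" for x
 proof -
  have "hnorm L (T (S x)) <= C' * hnorm K (S x)" using C(2) S'(1) x by auto
  also have "... <= \<bar>C'\<bar> * hnorm K (S x)" using K.norm_nonneg S'(1) x by (intro mult_right_mono) auto
  also have "... <= \<bar>C'\<bar> * (C * hnorm H x)" using C(1)[OF x] by (intro mult_left_mono) auto
  finally show ?thesis using x by (simp add: compose_def mult.assoc)
 qed
 then show "EX C. ALL x:hcarrier H. hnorm L (compose (hcarrier H) T S x) <= C * hnorm H x" by blast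
qed

lemma sec_L1_extension_tensor:
 fixes T :: "('a::euclidean_space \<times> 'b::euclidean_space, complex) L0 => _"
 assumes T: "T \<in> bounded_ops L2 L2" and TD: "!!h. h \<in> sec_L1 ==> T h = cls (FT1 (rep h))"
  and h: "h \<in> H2" and k: "k \<in> H2"
 shows "T (tensor h k) = tensor (plancherel h) k"
proof -
 let ?t = "\<lambda>h\<in>H2. tensor h k"
 have k': "sq (rep k)" using k by (simp add: L2_carrier_iff)
 have "compose (H2) T ?t = compose (H2) ?t plancherel"
 proof (rule bounded_ops_eqI_dense[OF L2_pre L2_pre, where D = "{h \<in> H2. imut (rep h)}"])
  show "compose (H2) T ?t \<in> bounded_ops L2 L2" by (intro bounded_ops_compose[OF L2_pre L2_pre L2_pre] T tensor_bounded_op k)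
  show "compose (H2) ?t plancherel \<in> bounded_ops L2 L2" by (intro bounded_ops_compose[OF L2_pre L2_pre L2_pre] plancherel_props tensor_bounded_op k)
  fix h :: "('a, complex) L0" assume h: "h \<in> {h \<in> H2. imut (rep h)}"
  then have h': "sq (rep h)" "h \<in> H2" "imut (rep h)" by (simp_all add: L2_carrier_iff)
  let ?f = "%(x, y). rep h x * rep k y"
  have m: "?f \<in> bmeas"
  unfolding borel_pair_mut[symmetric] by measurable
  have "tensor h k \<in> sec_L1" unfolding tensor_def by (rule cls_sec_L1[OF sq_tensor(1)[OF h'(1) k']]) (use h' in auto)
  then have "T (tensor h k) = cls (FT1 (rep (tensor h k)))" by (rule TD)
  also have "... = cls (FT1 ?f)"
  unfolding tensor_def by (intro cls_eqI FT1_measurable m FT1_cong rep_cls) auto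
  also have "FT1 ?f = (%(x, y). FT (rep h) x * rep k y)"
  by (auto simp: FT1_def fun_eq_iff mult.commute[of _ "rep k _"] FT_scale)
  also have "cls ... = tensor (cls (FT (rep h))) (cls (rep k))"
  by (rule tensor_cls[symmetric]) measurable
  also have "... = tensor (plancherel h) k" using plancherel_props(2)[OF h'(2,3)] by simp
  finally show "compose (H2) T ?t h = compose (H2) ?t plancherel h"
  using h' bounded_opsD(1)[OF plancherel_props(1) h'(2)] by (simp add: compose_def)
 qed (rule L1_dense)
 from fun_cong[OF this, of h] show ?thesis
  using h bounded_opsD(1)[OF plancherel_props(1) h] by (simp add: compose_def)
qed

subsection \<open>Elementary tensors are total\<close>

lemma sq_indicator:
 assumes "A \<in> sets borel" "emeasure lborel A < \<infinity>"
 shows "sq (%x::'a::euclidean_space. indicator A x :: complex)"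
proof -
 have "(%x. (cmod (indicator A x))^2) = (indicator A :: 'a => real)" by (auto simp: indicator_def fun_eq_iff)
 then show ?thesis using finite_mut[OF assms(2,1)] assms(1) by (simp add: sq_def)
qed

lemma bounded_ops_eqI_tensor:
 fixes T S :: "('a::euclidean_space \<times> 'b::euclidean_space, complex) L0 => ('c::euclidean_space, complex) L0"
 assumes T: "T \<in> bounded_ops L2 L2" and S: "S \<in> bounded_ops L2 L2"
  and eq: "!!h k. h \<in> H2 ==> k \<in> H2 ==> T (tensor h k) = S (tensor h k)"
 shows "T = S"
proof -
 note T' = bounded_opsD[OF T] and S' = bounded_opsD[OF S]
 define E where "E x \<longleftrightarrow> x \<in> H2 & T x = S x" for x
 have E_add: "E (hadd L2 x y)" if "E x" "E y" for x y using that by (simp add: E_def T' S' L2.closed)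
 have E_scale: "E (hscale L2 c x)" if "E x" for x c using that by (simp add: E_def T' S' L2.closed)
 have E_tends: "E x" if X: "!!n. E (X n)" and t: "L2.tends X x" for X x
 proof -
  have "L2.tends (%n. T (X n)) (T x)" "L2.tends (%n. S (X n)) (S x)"
  by (intro bounded_ops_tends[OF L2_pre L2_pre _ t] T S)+
  moreover have "(%n. T (X n)) = (%n. S (X n))" using X by (simp add: E_def)
  ultimately have "T x = S x" using L2.tends_unique by metis
  then show ?thesis using t by (simp add: E_def L2.tends_def)
 qed
 let ?B = "%n. cball 0 (real n) \<times> cball 0 (real n) :: ('a \<times> 'b) set"
 have B: "?B n \<in> sets borel" for n by (intro borel_closed closed_Times) auto
 have Bfin: "emeasure lborel (?B n) < \<infinity>" for n
  by (rule emeasure_compact_finite) (intro compact_Times compact_cball)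
 have sqB: "sq (%p. indicator (A \<inter> ?B n) p :: complex)" if "A \<in> sets borel" for A n
 proof (rule sq_indicator)
  show "A \<inter> ?B n \<in> sets borel" using that B by auto
  have "emeasure lborel (A \<inter> ?B n) <= emeasure lborel (?B n)" using B by (intro emeasure_mono) auto
  then show "emeasure lborel (A \<inter> ?B n) < \<infinity>" using Bfin by (rule le_less_trans)
 qed
 define ind where "ind A n = cls (%p. indicator (A \<inter> ?B n) p :: complex)" for A n
 have rect: "E (ind (a \<times> b) n)" if ab: "a \<in> sets borel" "b \<in> sets borel" for a b n
 proof -
  have "cball 0 (real n) \<in> sets (borel :: 'a measure)" "cball 0 (real n) \<in> sets (borel :: 'b measure)" by auto
  then have s: "a \<inter> cball 0 (real n) \<in> sets borel" "b \<inter> cball 0 (real n) \<in> sets borel" using ab by auto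
  have fa: "emeasure lborel (a \<inter> cball 0 (real n)) < \<infinity>"
  by (rule le_less_trans[OF emeasure_mono emeasure_lborel_cball_finite[of 0 "real n"]]) auto
  have fb: "emeasure lborel (b \<inter> cball 0 (real n)) < \<infinity>"
  by (rule le_less_trans[OF emeasure_mono emeasure_lborel_cball_finite[of 0 "real n"]]) auto
  let ?h = "%x. indicator (a \<inter> cball 0 (real n)) x :: complex" and ?k = "%x. indicator (b \<inter> cball 0 (real n)) x :: complex"
  have hk: "sq ?h" "sq ?k" using s fa fb by (auto intro!: sq_indicator)
  have "tensor (cls ?h) (cls ?k) = cls (%(x, y). ?h x * ?k y)" using hk by (intro tensor_cls) (auto simp: sq_def)
  also have "(%(x, y). ?h x * ?k y) = (%p. indicator ((a \<times> b) \<inter> ?B n) p)" by (auto simp: indicator_def fun_eq_iff)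
  finally have "tensor (cls ?h) (cls ?k) = ind (a \<times> b) n" by (simp add: ind_def)
  then show ?thesis using eq[of "cls ?h" "cls ?k"] hk sqB[of "a \<times> b" n] ab
  by (simp add: E_def L2_cls_carrier ind_def borel_Times)
 qed
 have all: "E (ind A n)" if "A \<in> sets borel" for A n
 proof -
  let ?G = "{a \<times> b |a b. a \<in> sets (borel :: 'a measure) & b \<in> sets (borel :: 'b measure)}"
  have s: "sets (borel :: ('a \<times> 'b) measure) = sigma_sets UNIV ?G"
  unfolding borel_prod[symmetric] sets_pair_measure by simp
  have "Int_stable ?G" by (rule Int_stable_pair_measure_generator)
  moreover have "?G \<subseteq> Pow UNIV" by simp
  moreover have "A \<in> sigma_sets UNIV ?G" using that s by simp
  ultimately show ?thesis
  proof (induct rule: sigma_sets_induct_disjoint)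
  case (basic A)
  then show ?case using rect by auto
  next
  case empty
  show ?case using rect[of "{}" "{}" n] by simp
  next
  case (compl A)
  then have A: "A \<in> sets borel" using s by simp
  have m: "(%p. indicator (A \<inter> ?B n) p :: complex) \<in> bmeas" if "A \<in> sets borel" for A
  using sqB[OF that] by (simp add: sq_def)
  have "ind (UNIV - A) n = cls (%p. indicator (UNIV \<inter> ?B n) p + (-1) * indicator (A \<inter> ?B n) p)"
  unfolding ind_def by (rule arg_cong[where f=cls]) (auto simp: indicator_def fun_eq_iff)
  also have "... = hadd L2 (ind (UNIV \<times> UNIV) n) (hscale L2 (-1) (ind A n))"
  unfolding ind_def L2_cls_scale[OF m[OF A]] UNIV_Times_UNIV
  by (rule L2_cls_add[symmetric]) (use m[OF A] m[of UNIV] in \<open>auto intro!: borel_measurable_times\<close>)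
  finally show ?case using E_add[OF rect[of UNIV UNIV n] E_scale[OF compl(2), of "-1"]] by simp
  next
  case (union A)
  then have A: "A i \<in> sets borel" for i using s by auto
  have d: "disjoint_family A" by (rule union)
  have m: "(%p. indicator (A \<inter> ?B n) p :: complex) \<in> bmeas" if "A \<in> sets borel" for A
  using sqB[OF that] by (simp add: sq_def)
  have U: "(\<Union>i<N. A i) \<in> sets borel" for N using A by auto
  have part: "E (ind (\<Union>i<N. A i) n)" for N
  proof (induct N)
  case 0
  show ?case using rect[of "{}" "{}" n] by simp
  next
  case (Suc N)
  have disj: "x \<notin> A i" if "x \<in> A N" "i < N" for x i
  proof -
  have "A N \<inter> A i = {}" using d that(2) by (simp add: disjoint_family_on_def)
  then show ?thesis using that(1) by auto
  qed
  have "ind (\<Union>i<Suc N. A i) n = cls (%p. indicator ((\<Union>i<N. A i) \<inter> ?B n) p + indicator (A N \<inter> ?B n) p)"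
  unfolding ind_def by (rule arg_cong[where f=cls]) (auto simp: indicator_def fun_eq_iff less_Suc_eq dest: disj)
  also have "... = hadd L2 (ind (\<Union>i<N. A i) n) (ind (A N) n)"
  unfolding ind_def by (rule L2_cls_add[symmetric]) (intro m A U)+
  finally show ?case using E_add[OF Suc union(3)[of N]] by simp
  qed
  show ?case
  proof (rule E_tends[OF part])
  show "L2.tends (%N. ind (\<Union>i<N. A i) n) (ind (\<Union>i. A i) n)"
  unfolding ind_def
  proof (rule L2_tends)
  show "sq (%p. indicator ((\<Union>i. A i) \<inter> ?B n) p :: complex)" using A by (intro sqB) auto
  show "sq (%p. indicator (UNIV \<inter> ?B n) p :: complex)" by (intro sqB) auto
  show "(%p. indicator ((\<Union>i<N. A i) \<inter> ?B n) p :: complex) \<in> bmeas" for N by (intro m U)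
  show "AE p in lborel. cmod (indicator ((\<Union>i<N. A i) \<inter> ?B n) p) <= cmod (indicator (UNIV \<inter> ?B n) p)" for N
  by (auto simp: indicator_def)
  show "AE p in lborel. (%N. indicator ((\<Union>i<N. A i) \<inter> ?B n) p :: complex) ~~> indicator ((\<Union>i. A i) \<inter> ?B n) p"
  proof (rule AE_I2)
  fix p
  have "\<forall>\<^sub>F N in sequentially. indicator ((\<Union>i<N. A i) \<inter> ?B n) p = (indicator ((\<Union>i. A i) \<inter> ?B n) p :: complex)"
  proof (cases "p \<in> (\<Union>i. A i)")
  case True
  then obtain i where "p \<in> A i" by auto
  then show ?thesis by (intro eventually_sequentiallyI[of "Suc i"]) (force simp: indicator_def)
  qed (auto simp: indicator_def)
  then show "(%N. indicator ((\<Union>i<N. A i) \<inter> ?B n) p :: complex) ~~> indicator ((\<Union>i. A i) \<inter> ?B n) p"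
  by (rule tendsto_eventually)
  qed
  qed
  qed
  qed
 qed
 have simp: "E (cls (%p. SUM c:C. c * indicator (s -` {c} \<inter> ?B n) p))"
  if C: "finite C" and s: "s \<in> bmeas" for C n and s :: "'a \<times> 'b => complex"
  using C
 proof (induct C)
  case empty
  show ?case using rect[of "{}" "{}" n] by (simp add: ind_def)
 next
  case (insert c C)
  have v: "s -` {c} \<in> sets borel" for c using measurable_sets[OF s, of "{c}"] by simp
  have m: "(%p. indicator (s -` {c} \<inter> ?B n) p :: complex) \<in> bmeas" for c
  using sqB[OF v, of c n] by (simp add: sq_def)
  have "cls (%p. SUM c:insert c C. c * indicator (s -` {c} \<inter> ?B n) p) = cls (%p. c * indicator (s -` {c} \<inter> ?B n) p + (SUM c:C. c * indicator (s -` {c} \<inter> ?B n) p))"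
  by (simp only: sum.insert[OF insert(1,2)])
  also have "... = hadd L2 (hscale L2 c (ind (s -` {c}) n)) (cls (%p. SUM c:C. c * indicator (s -` {c} \<inter> ?B n) p))"
  unfolding ind_def L2_cls_scale[OF m]
  by (rule L2_cls_add[symmetric]) (intro borel_measurable_times borel_measurable_const m borel_measurable_sum)+
  finally show ?case using E_add[OF E_scale[OF all[OF v[of c]], of c n] insert(3)] by simp
 qed
 show ?thesis
 proof (rule extensionalityI[OF T'(5) S'(5)])
  fix f :: "('a \<times> 'b, complex) L0" assume f: "f \<in> H2"
  then have sqf: "sq (rep f)" by (simp add: L2_carrier_iff)
  obtain F where F: "!!i. simple_function borel (F i)" "!!x. (%i. F i x) ~~> rep f x" "!!i x. dist (F i x) 0 <= 2 * dist (rep f x) 0"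
  using borel_measurable_implies_sequence_metric[OF rep_measurable, of f 0] by auto
  have Fm: "F i \<in> bmeas" for i by (rule borel_measurable_simple_function[OF F(1)])
  let ?X = "%i p. SUM c:range (F i). c * indicator (F i -` {c} \<inter> ?B i) p"
  have fin: "finite (range (F i))" for i using F(1)[of i] by (simp add: simple_function_def)
  have Xeq: "?X i = (%p. indicator (?B i) p *\<^sub>R F i p)" for i
  proof
  fix p
  have "?X i p = (SUM c:range (F i). if c = F i p then indicator (?B i) p *\<^sub>R F i p else 0)"
  by (intro sum.cong) (auto simp: indicator_def)
  also have "... = indicator (?B i) p *\<^sub>R F i p" by (subst sum.delta) (auto simp: fin)
  finally show "?X i p = indicator (?B i) p *\<^sub>R F i p" .
  qed
  have m: "(%p. indicator (?B i) p *\<^sub>R F i p) \<in> bmeas" for i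
  using B Fm by (intro borel_measurable_scaleR) auto
  have "L2.tends (%i. cls (?X i)) (cls (rep f))"
  unfolding Xeq
  proof (rule L2_tends[OF sqf])
  show "sq (%p. 2 * rep f p)" by (rule sq_norm_bound[OF sqf, of _ 2]) (auto simp: norm_mult)
  show "AE p in lborel. cmod (indicator (?B i) p *\<^sub>R F i p) <= cmod (2 * rep f p)" for i
  using F(3)[of i] by (auto simp: indicator_def norm_mult)
  show "AE p in lborel. (%i. indicator (?B i) p *\<^sub>R F i p) ~~> rep f p"
  proof (rule AE_I2)
  fix p
  have "\<forall>\<^sub>F i in sequentially. p \<in> ?B i"
  using eventually_cball[of "fst p"] eventually_cball[of "snd p"] by eventually_elim (auto simp: mem_Times_iff)
  then have "\<forall>\<^sub>F i in sequentially. F i p = indicator (?B i) p *\<^sub>R F i p" by eventually_elim simp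
  then show "(%i. indicator (?B i) p *\<^sub>R F i p) ~~> rep f p"
  using F(2)[of p] by (rule Lim_transform_eventually[rotated])
  qed
  qed (rule m)
  from E_tends[OF simp[OF fin Fm] this] have "E f" by simp
  then show "T f = S f" by (simp add: E_def)
 qed
qed

lemma plancherel1_props:
 shows "(plancherel1 :: ('a::euclidean_space \<times> 'b::euclidean_space, complex) L0 => _) \<in> bounded_ops L2 L2" (is ?A)
  and "!!h :: ('a \<times> 'b, complex) L0. h \<in> sec_L1 ==> plancherel1 h = cls (FT1 (rep h))"
proof -
 let ?P = "%T. T \<in> bounded_ops L2 L2 & (ALL h:H2. ALL k:H2. T (tensor (h :: ('a, complex) L0) (k :: ('b, complex) L0)) = tensor (plancherel h) k)"
 obtain T where T: "T \<in> bounded_ops L2 L2" "!!h :: ('a \<times> 'b, complex) L0. h \<in> sec_L1 ==> T h = cls (FT1 (rep h))"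
  using sec_L1_extension[where 'a='a and 'b='b] by blast
 have ex: "?P T" using T(1) sec_L1_extension_tensor[OF T] by simp
 have un: "S = T" if "?P S" for S
  by (rule bounded_ops_eqI_tensor) (use that ex in simp_all)
 have "plancherel1 = (THE T. ?P T)" unfolding plancherel1_def ..
 also have "... = T" by (rule the_equality[of ?P, OF ex un])
 finally have eq: "plancherel1 = T" .
 show ?A unfolding eq by (rule T(1))
 show "plancherel1 h = cls (FT1 (rep h))" if "h \<in> sec_L1" for h :: "('a \<times> 'b, complex) L0"
  unfolding eq by (rule T(2)[OF that])
qed

subsection \<open>Fourier inversion in the first variable\<close>

definition cj :: "('a::euclidean_space, complex) L0 => ('a, complex) L0" where
 "cj f = cls (%x. cnj (rep f x))"

text \<open>Conjugating before and after turns the kernel \<open>exp(-i u \<bullet> xi)\<close> into that of the inverse transform.\<close>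

definition plancherel1_inv :: "('a::euclidean_space \<times> 'b::euclidean_space, complex) L0 => ('a \<times> 'b, complex) L0" where
 "plancherel1_inv f = cj (plancherel1 (cj f))"

definition bil :: "('a::euclidean_space, complex) L0 => ('a, complex) L0 => complex" where
 "bil f g = Imut (%x. rep f x * rep g x)"

lemma rep_cj: "AE x in lborel. rep (cj f) x = cnj (rep f x)"
 unfolding cj_def by (rule rep_cls) measurable

lemma cj_cls: "f \<in> bmeas ==> cj (cls f) = cls (%x. cnj (f x))"
 unfolding cj_def by (rule cls_eqI) (use rep_cls[of f] in \<open>auto elim!: eventually_mono\<close>)

lemma cj_cj [simp]: "cj (cj f) = f"
proof (rule L0_eqI)
 show "AE x in lborel. rep (cj (cj f)) x = rep f x"
  using rep_cj[of f] rep_cj[of "cj f"] by eventually_elim simp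
qed

lemma cj_carrier [simp]: "cj f \<in> H2 \<longleftrightarrow> f \<in> H2"
proof -
 have "cj f \<in> H2" if "f \<in> H2" for f :: "('a, complex) L0"
  unfolding cj_def by (rule L2_cls_carrier, rule sq_norm_bound[of "rep f" _ 1]) (use that in \<open>auto simp: L2_carrier_iff\<close>)
 from this[of f] this[of "cj f"] show ?thesis by auto
qed

lemma bil_cj: "hinner L2 f g = bil f (cj g)"
 unfolding bil_def L2_inner by (rule integral_cong_AE) (use rep_cj[of g] in \<open>auto elim!: eventually_mono\<close>)

lemma bil_inner: "bil f g = hinner L2 f (cj g)"
 by (simp add: bil_cj)

lemma bil_commute: "bil f g = bil g f"
 by (simp add: bil_def mult.commute)

lemma cnj_bil: "cnj (bil f g) = bil (cj f) (cj g)"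
proof -
 have "cnj (bil f g) = Imut (%x. cnj (rep f x) * cnj (rep g x))" by (simp add: bil_def flip: Bochner_Integration.integral_cnj)
 also have "... = bil (cj f) (cj g)" unfolding bil_def
 proof (rule integral_cong_AE)
  show "AE x in mut. cnj (rep f x) * cnj (rep g x) = rep (cj f) x * rep (cj g) x"
  unfolding AE_mut using rep_cj[of g] rep_cj[of f] by eventually_elim simp
 qed measurable
 finally show ?thesis .
qed

lemma bil_tends:
 assumes "L2.tends X f" "g \<in> H2"
 shows "(%n. bil (X n) g) ~~> bil f g"
 unfolding bil_inner by (rule L2.tends_inner[OF assms(1)]) (simp add: assms)

lemma P1_carrier [simp]: "f \<in> H2 ==> plancherel1 f \<in> H2"
 by (rule bounded_opsD(1)[OF plancherel1_props(1)])

lemma P1inv_carrier [simp]: "f \<in> H2 ==> plancherel1_inv f \<in> H2"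
 by (simp add: plancherel1_inv_def)

lemma P1_symmetric_sec:
 fixes f k :: "('a::euclidean_space \<times> 'b::euclidean_space, complex) L0"
 assumes f: "f \<in> sec_L1" and k: "k \<in> sec_L1"
 shows "bil (plancherel1 f) k = bil f (plancherel1 k)"
proof -
 have f': "sq (rep f)" "AE y in lborel. imut (%x. rep f (x, y))" using f by (auto simp: sec_L1_def L2_carrier_iff)
 have k': "sq (rep k)" "AE y in lborel. imut (%x. rep k (x, y))" using k by (auto simp: sec_L1_def L2_carrier_iff)
 note ff = sq_FT1(1)[OF f'(2,1)] and fk = sq_FT1(1)[OF k'(2,1)]
 have [measurable]: "FT1 (rep f) \<in> bmeas" "FT1 (rep k) \<in> bmeas" using ff fk by (auto simp: sq_def)
 have e: "bil (plancherel1 f) k = Imut (%p. FT1 (rep f) p * rep k p)"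
  unfolding bil_def plancherel1_props(2)[OF f]
  by (rule integral_cong_AE) (use rep_cls[of "FT1 (rep f)"] in \<open>auto elim!: eventually_mono\<close>)
 have e': "bil f (plancherel1 k) = Imut (%p. rep f p * FT1 (rep k) p)"
  unfolding bil_def plancherel1_props(2)[OF k]
  by (rule integral_cong_AE) (use rep_cls[of "FT1 (rep k)"] in \<open>auto elim!: eventually_mono\<close>)
 have i1: "imut (%p. FT1 (rep f) p * rep k p)" by (rule sq_product_integrable[OF ff k'(1)]) (auto simp: norm_mult)
 have i2: "imut (%p. rep f p * FT1 (rep k) p)" by (rule sq_product_integrable[OF f'(1) fk]) (auto simp: norm_mult)
 have fub: "Imut g = (LINT y|mut. LINT x|mut. g (x, y))" if "imut g" for g :: "'a \<times> 'b => complex"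
  using mutp.integral_snd[of "%x y. g (x, y)"] that by (simp add: mut_prod split_beta')
 show ?thesis unfolding e e' fub[OF i1] fub[OF i2]
 proof (rule integral_cong_AE)
  show "AE y in mut. (LINT x|mut. FT1 (rep f) (x, y) * rep k (x, y)) = (LINT x|mut. rep f (x, y) * FT1 (rep k) (x, y))"
  using f'(2) k'(2) unfolding AE_mut by eventually_elim (simp add: FT1_def FT_mult_formula)
 qed measurable
qed

lemma P1_symmetric:
 assumes f: "f \<in> H2" and k: "k \<in> H2"
 shows "bil (plancherel1 f) k = bil f (plancherel1 k)"
proof -
 have 1: "bil (plancherel1 f) k = bil f (plancherel1 k)" if f: "f \<in> H2" and k: "k \<in> sec_L1" for f k :: "('a \<times> 'b, complex) L0"
 proof -
  have k': "k \<in> H2" using k by (simp add: sec_L1_def)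
  obtain X where X: "!!n. X n \<in> sec_L1" "L2.tends X f" using sec_L1_dense[OF f] by blast
  have "(%n. bil (plancherel1 (X n)) k) ~~> bil (plancherel1 f) k"
  by (intro bil_tends bounded_ops_tends[OF L2_pre L2_pre plancherel1_props(1)] X k')
  moreover have "(%n. bil (X n) (plancherel1 k)) ~~> bil f (plancherel1 k)"
  by (intro bil_tends X P1_carrier k')
  ultimately show ?thesis unfolding P1_symmetric_sec[OF X(1) k] by (rule LIMSEQ_unique)
 qed
 obtain X where X: "!!n. X n \<in> sec_L1" "L2.tends X k" using sec_L1_dense[OF k] by blast
 have "(%n. bil (plancherel1 (X n)) f) ~~> bil (plancherel1 k) f"
  by (intro bil_tends bounded_ops_tends[OF L2_pre L2_pre plancherel1_props(1)] X f)
 moreover have "(%n. bil (X n) (plancherel1 f)) ~~> bil k (plancherel1 f)"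
  by (intro bil_tends X P1_carrier f)
 moreover have "bil (plancherel1 (X n)) f = bil (X n) (plancherel1 f)" for n
  using 1[OF f X(1)[of n]] by (simp add: bil_commute)
 ultimately have "bil (plancherel1 k) f = bil k (plancherel1 f)"
  by (intro LIMSEQ_unique[of "%n. bil (X n) (plancherel1 f)"]) simp_all
 then show ?thesis using bil_commute[of k "plancherel1 f"] bil_commute[of "plancherel1 k" f] by simp
qed

text \<open>On modulated Gaussians the inversion formula is an explicit computation; by symmetry of the
 transform it follows everywhere, because these Gaussians separate square integrable functions.\<close>

definition gtest :: "'a::euclidean_space \<times> 'b::euclidean_space => 'a \<times> 'b => complex" where
 "gtest w = (%p. exp (of_real (- (norm p)\<^sup>2 / 2) - \<i> * of_real (w \<bullet> p)))"

lemma norm_prod_sq: "(norm (x, y))\<^sup>2 = (norm x)^2 + (norm y)^2"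
 by (simp add: norm_Pair)

lemma gauss_sq:
 assumes [measurable]: "f \<in> bmeas" and b: "!!x::'a::euclidean_space. cmod (f x) <= C * exp (- (norm (x - a))\<^sup>2 / 2)"
 shows "sq f" "imut f"
proof -
 have g: "imut (%x::'a. exp (- (norm (x - a))\<^sup>2 / 2))"
 proof -
  have "imut (%x::'a. exp (- (norm x)\<^sup>2 / 2))"
  using gk_integral(1)[of 1, where 'a='a] by (simp add: gk_def[abs_def])
  then show ?thesis using mut_affine(1)[of 1 "%x::'a. exp (- (norm x)\<^sup>2 / 2)" "- a"] by (simp add: add.commute)
 qed
 show "imut f"
 proof (rule Bochner_Integration.integrable_bound)
  show "imut (%x::'a. C * exp (- (norm (x - a))\<^sup>2 / 2))" using g by simp
  show "AE x in mut. cmod (f x) <= norm (C * exp (- (norm (x - a))\<^sup>2 / 2))" by (rule AE_I2) (use b in \<open>auto intro: order_trans abs_ge_self\<close>)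
 qed simp
 show "sq f"
 proof (rule sq_bound)
  show "imut (%x::'a. C\<^sup>2 * exp (- (norm (x - a))\<^sup>2 / 2))" using g by simp
  have "(cmod (f x))\<^sup>2 <= C^2 * exp (- (norm (x - a))\<^sup>2 / 2)" for x
  proof -
  have "(cmod (f x))\<^sup>2 <= (C * exp (- (norm (x - a))\<^sup>2 / 2))^2" by (intro power_mono b) simp
  also have "... = C^2 * exp (- (norm (x - a))\<^sup>2)" by (simp add: power_mult_distrib power2_eq_square flip: exp_add)
  also have "... <= C^2 * exp (- (norm (x - a))\<^sup>2 / 2)" by (intro mult_left_mono) auto
  finally show ?thesis .
  qed
  then show "AE x in lborel. (cmod (f x))\<^sup>2 <= C^2 * exp (- (norm (x - a))\<^sup>2 / 2)" by auto
 qed simp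
qed

lemma gauss_fourier1:
 fixes w :: "'a::euclidean_space"
 shows "Imut (%x::'a. exp (of_real (- (norm x)\<^sup>2 / 2) - \<i> * of_real (w \<bullet> x))) = of_real (exp (- (norm w)\<^sup>2 / 2))"
 using gauss_fourier(2)[of 1 w] by simp

lemma P1_gtest:
 fixes w :: "'a::euclidean_space \<times> 'b::euclidean_space"
 shows "cls (gtest w) \<in> sec_L1"
  and "plancherel1 (cls (gtest w)) = cls (%(xi, y). of_real (exp (- (norm (xi + fst w))\<^sup>2 / 2)) * exp (of_real (- (norm y)\<^sup>2 / 2) - \<i> * of_real (snd w \<bullet> y)))"
  and "plancherel1_inv (plancherel1 (cls (gtest w))) = cls (gtest w)"
proof -
 have split: "gtest w (x, y) = exp (of_real (- (norm x)\<^sup>2 / 2) - \<i> * of_real (fst w \<bullet> x)) * exp (of_real (- (norm y)\<^sup>2 / 2) - \<i> * of_real (snd w \<bullet> y))" for x y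
  unfolding gtest_def exp_add[symmetric] norm_prod_sq by (rule arg_cong[where f=exp]) (simp add: inner_prod_def field_simps)
 have [measurable]: "gtest w \<in> bmeas" unfolding gtest_def by measurable
 have sq: "sq (gtest w)" by (rule gauss_sq(1)[of _ 1 0]) (auto simp: gtest_def)
 show s: "cls (gtest w) \<in> sec_L1"
 proof (rule cls_sec_L1[OF sq])
  show "AE y in lborel. imut (%x. gtest w (x, y))"
  unfolding split using gauss_fourier(1)[of 1 "fst w"] by simp
 qed
 have F: "FT1 (gtest w) = (%(xi, y). of_real (exp (- (norm (xi + fst w))\<^sup>2 / 2)) * exp (of_real (- (norm y)\<^sup>2 / 2) - \<i> * of_real (snd w \<bullet> y)))"
 proof (rule ext, clarify)
  fix xi y
  have "FT1 (gtest w) (xi, y) = Imut (%x. exp (of_real (- (norm x)\<^sup>2 / 2) - \<i> * of_real ((xi + fst w) \<bullet> x)) * exp (of_real (- (norm y)\<^sup>2 / 2) - \<i> * of_real (snd w \<bullet> y)))"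
  unfolding FT1_def FT_def prod.case split exp_add[symmetric]
  by (rule Bochner_Integration.integral_cong[OF refl], rule arg_cong[where f=exp]) (simp add: inner_add_left inner_commute algebra_simps)
  then show "FT1 (gtest w) (xi, y) = of_real (exp (- (norm (xi + fst w))\<^sup>2 / 2)) * exp (of_real (- (norm y)\<^sup>2 / 2) - \<i> * of_real (snd w \<bullet> y))"
  by (simp only: integral_mult_left_zero gauss_fourier1)
 qed
 let ?G = "%(xi, y). cor (exp (- (norm (xi + fst w))\<^sup>2 / 2)) * exp (of_real (- (norm y)\<^sup>2 / 2) - \<i> * of_real (snd w \<bullet> y))"
 show PG: "plancherel1 (cls (gtest w)) = cls ?G"
  unfolding plancherel1_props(2)[OF s] F[symmetric]
  by (rule cls_eqI) (auto intro!: FT1_measurable FT1_cong rep_cls)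
 have mG: "?G \<in> bmeas" unfolding F[symmetric] by (rule FT1_measurable) measurable
 let ?H = "%p. cnj (?G p)"
 have mH: "?H \<in> bmeas" using mG by measurable
 have sqH: "sq ?H"
 proof (rule gauss_sq(1)[OF mH, of 1 "(- fst w, 0)"])
  show "cmod (?H p) <= 1 * exp (- (norm (p - (- fst w, 0)))\<^sup>2 / 2)" for p
  by (cases p) (simp add: norm_mult norm_prod_sq exp_add[symmetric] add_divide_distrib)
 qed
 have Hs: "cls ?H \<in> sec_L1"
 proof (rule cls_sec_L1[OF sqH], rule AE_I2)
  fix y :: 'b
  have m: "(%x. ?H (x, y)) \<in> bmeas" using mH by measurable
  show "imut (%x. ?H (x, y))"
  by (rule gauss_sq(2)[OF m, of 1 "- fst w"]) (simp add: norm_mult)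
 qed
 have FH: "FT1 ?H = (%p. cnj (gtest w p))"
 proof (rule ext, clarify)
  fix x y
  let ?e = "exp (of_real (- (norm y)\<^sup>2 / 2) + \<i> * of_real (snd w \<bullet> y))"
  let ?f = "%xi. exp (of_real (- (norm (xi + fst w))\<^sup>2 / 2) - \<i> * of_real (x \<bullet> xi))"
  have "FT1 ?H (x, y) = Imut (%xi. ?f xi * ?e)"
  proof -
  have c: "?H (xi, y) = exp (of_real (- (norm (xi + fst w))\<^sup>2 / 2)) * ?e" for xi
  by (simp only: prod.case complex_cnj_mult complex_cnj_complex_of_real exp_cnj complex_cnj_diff complex_cnj_i exp_of_real) simp
  show ?thesis unfolding FT1_def FT_def prod.case c[unfolded prod.case] exp_add[symmetric]
  by (rule Bochner_Integration.integral_cong[OF refl], rule arg_cong[where f=exp]) (simp add: inner_commute)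
  qed
  also have "... = Imut ?f * ?e" by (rule integral_mult_left_zero)
  also have "Imut ?f = Imut (%xi. ?f (- fst w + 1 *\<^sub>R xi))"
  by (subst mut_affine(2)[of 1 ?f "- fst w"]) auto
  also have "... = Imut (%xi. exp (\<i> * of_real (fst w \<bullet> x)) * exp (of_real (- (norm xi)\<^sup>2 / 2) - \<i> * of_real (x \<bullet> xi)))"
  unfolding exp_add[symmetric]
  by (rule Bochner_Integration.integral_cong[OF refl], rule arg_cong[where f=exp]) (simp add: inner_add_right inner_diff_right inner_commute algebra_simps)
  also have "... = exp (\<i> * of_real (fst w \<bullet> x)) * of_real (exp (- (norm x)\<^sup>2 / 2))"
  by (simp only: integral_mult_right_zero gauss_fourier1)
  also have "... * ?e = cnj (gtest w (x, y))"
  unfolding gtest_def norm_prod_sq exp_of_real[symmetric] exp_add[symmetric] exp_cnj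
  by (rule arg_cong[where f=exp]) (simp add: inner_prod_def field_simps)
  finally show "FT1 ?H (x, y) = cnj (gtest w (x, y))" .
 qed
 have "plancherel1_inv (cls ?G) = cj (plancherel1 (cls ?H))"
  unfolding plancherel1_inv_def cj_cls[OF mG] ..
 also have "plancherel1 (cls ?H) = cls (%p. cnj (gtest w p))"
  unfolding plancherel1_props(2)[OF Hs] FH[symmetric]
  by (rule cls_eqI[OF FT1_measurable[OF rep_measurable] FT1_measurable[OF mH] FT1_cong[OF rep_cls[OF mH] rep_measurable mH]])
 also have "cj ... = cls (gtest w)" by (subst cj_cls) auto
 finally show "plancherel1_inv (plancherel1 (cls (gtest w))) = cls (gtest w)" unfolding PG .
qed

lemma P1inv_symmetric:
 assumes f: "f \<in> H2" and k: "k \<in> H2"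
 shows "bil (plancherel1_inv f) k = bil f (plancherel1_inv k)"
proof -
 have "bil (plancherel1_inv f) k = cnj (bil (plancherel1 (cj f)) (cj k))"
  by (simp add: cnj_bil plancherel1_inv_def)
 also have "... = cnj (bil (cj f) (plancherel1 (cj k)))" using f k by (simp add: P1_symmetric)
 also have "... = bil f (plancherel1_inv k)" by (simp add: cnj_bil plancherel1_inv_def)
 finally show ?thesis .
qed

lemma eqI_gtest:
 fixes f g :: "('a::euclidean_space \<times> 'b::euclidean_space, complex) L0"
 assumes f: "f \<in> H2" and g: "g \<in> H2"
  and eq: "!!w. bil f (cls (gtest w)) = bil g (cls (gtest w))"
 shows "f = g"
proof -
 let ?d = "%p. rep f p - rep g p"
 have sqd: "sq ?d" using f g by (intro sq_diff) (auto simp: L2_carrier_iff)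
 have [measurable]: "gtest w \<in> bmeas" for w :: "'a \<times> 'b" unfolding gtest_def by measurable
 have sqt: "sq (gtest w)" for w :: "'a \<times> 'b" by (rule gauss_sq(1)[of _ 1 0]) (auto simp: gtest_def)
 have i: "imut (%p. rep h p * gtest w p)" if "h \<in> H2" for h :: "('a \<times> 'b, complex) L0" and w
  by (rule sq_product_integrable[of "rep h" "gtest w"]) (use that sqt in \<open>auto simp: L2_carrier_iff norm_mult\<close>)
 have b: "bil h (cls (gtest w)) = Imut (%p. rep h p * gtest w p)" for h :: "('a \<times> 'b, complex) L0" and w
  unfolding bil_def by (rule integral_cong_AE) (use rep_cls[of "gtest w"] in \<open>auto elim!: eventually_mono\<close>)
 have "AE p in lborel. ?d p * gtest 0 p = 0"
 proof (rule fourier_L1_injective)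
  show "imut (%p. ?d p * gtest 0 p)"
  by (rule sq_product_integrable[OF sqd sqt[of 0]]) (auto simp: norm_mult)
  fix w :: "'a \<times> 'b"
  have "Imut (%p. ?d p * gtest 0 p * exp (- \<i> * of_real (p \<bullet> w))) = Imut (%p. rep f p * gtest w p - rep g p * gtest w p)"
  proof (rule Bochner_Integration.integral_cong[OF refl])
  fix p
  have "gtest w p = gtest 0 p * exp (- \<i> * of_real (p \<bullet> w))"
  unfolding gtest_def exp_add[symmetric] by (rule arg_cong[where f=exp]) (simp add: inner_commute)
  then show "?d p * gtest 0 p * exp (- \<i> * of_real (p \<bullet> w)) = rep f p * gtest w p - rep g p * gtest w p"
  by (simp add: left_diff_distrib mult.assoc)
  qed
  also have "... = 0" using eq[of w] i[OF f] i[OF g] by (simp add: b)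
  finally show "Imut (%p. ?d p * gtest 0 p * exp (- \<i> * of_real (p \<bullet> w))) = 0" .
 qed
 then show ?thesis by (intro L0_eqI) (auto elim!: eventually_mono simp: gtest_def)
qed

theorem P1_inverse:
 fixes g :: "('a::euclidean_space \<times> 'b::euclidean_space, complex) L0"
 assumes g: "g \<in> H2"
 shows "plancherel1 (plancherel1_inv g) = g"
proof (rule eqI_gtest)
 fix w :: "'a \<times> 'b"
 have w: "cls (gtest w) \<in> H2" using P1_gtest(1)[of w] by (simp add: sec_L1_def)
 have "bil (plancherel1 (plancherel1_inv g)) (cls (gtest w)) = bil g (plancherel1_inv (plancherel1 (cls (gtest w))))"
  using g w by (simp add: P1_symmetric P1inv_symmetric)
 then show "bil (plancherel1 (plancherel1_inv g)) (cls (gtest w)) = bil g (cls (gtest w))"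
  by (simp add: P1_gtest(3))
qed (use g in simp_all)

theorem P1_inner:
 assumes f: "f \<in> H2" and g: "g \<in> H2"
 shows "hinner L2 (plancherel1 f) (plancherel1 g) = hinner L2 f g"
proof -
 have "hinner L2 (plancherel1 f) (plancherel1 g) = bil (plancherel1 f) (plancherel1_inv (cj g))"
  by (simp add: bil_cj plancherel1_inv_def)
 also have "... = bil f (cj g)" using f g by (simp add: P1_symmetric P1_inverse)
 finally show ?thesis by (simp add: bil_cj)
qed

section \<open>Hermite functions\<close>

lemma hermite_rec: "hermite (Suc j) t = 2 * t * hermite j t - 2 * real j * hermite (j - 1) t"
 by (cases j) simp_all

lemma hermite_deriv: "(hermite k has_real_derivative 2 * real k * hermite (k - 1) t) (at t)"
proof (induction k arbitrary: t rule: less_induct)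
 case (less k)
 consider "k = 0" | "k = 1" | j where "k = Suc (Suc j)" by (metis One_nat_def not0_implies_Suc)
 then show ?case
 proof cases
  case 1
  have "hermite k = (%_. 1)" using 1 by (simp add: fun_eq_iff)
  then show ?thesis using 1 by simp
 next
  case 2
  have "hermite k = (%t. 2 * t)" using 2 by (simp add: fun_eq_iff)
  then show ?thesis using 2 by (auto intro!: derivative_eq_intros)
 next
  case 3
  have e: "hermite k = (%t. 2 * t * hermite (Suc j) t - 2 * real (Suc j) * hermite j t)" using 3 by (simp add: fun_eq_iff)
  have d1: "(hermite (Suc j) has_real_derivative 2 * real (Suc j) * hermite j t) (at t)" using less[of "Suc j" t] 3 by simp
  have d2: "(hermite j has_real_derivative 2 * real j * hermite (j - 1) t) (at t)" using less[of j t] 3 by simp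
  have "(hermite k has_real_derivative (2 * hermite (Suc j) t + 2 * t * (2 * real (Suc j) * hermite j t) - 2 * real (Suc j) * (2 * real j * hermite (j - 1) t))) (at t)"
  unfolding e by (rule derivative_eq_intros d1 d2 refl)+ (simp add: algebra_simps)
  also have "2 * hermite (Suc j) t + 2 * t * (2 * real (Suc j) * hermite j t) - 2 * real (Suc j) * (2 * real j * hermite (j - 1) t)
  = 2 * hermite (Suc j) t + 2 * real (Suc j) * hermite (Suc j) t"
  unfolding hermite_rec[of j t] by (simp add: algebra_simps)
  also have "... = 2 * real k * hermite (k - 1) t" unfolding 3 by (simp add: algebra_simps)
  finally show ?thesis .
 qed
qed

lemma hermite_continuous: "continuous_on UNIV (hermite k)"
 by (intro continuous_at_imp_continuous_on ballI DERIV_isCont[OF hermite_deriv])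

text \<open>Functions of at most exponential growth, which remain integrable after multiplication by a
 Gaussian.\<close>

definition temp :: "(real => complex) => bool" where
 "temp f \<longleftrightarrow> continuous_on UNIV f & (EX C a. ALL t. cmod (f t) <= C * exp (a * \<bar>t\<bar>))"

lemma tempI: "continuous_on UNIV f ==> (!!t. cmod (f t) <= C * exp (a * \<bar>t\<bar>)) ==> temp f"
 unfolding temp_def by blast

lemma temp_continuous: "temp f ==> continuous_on UNIV f"
 by (simp add: temp_def)

lemma tempE:
 assumes "temp f" obtains C a where "C >= 0" "a >= 0" "!!t. cmod (f t) <= C * exp (a * \<bar>t\<bar>)"
proof -
 obtain C a where C: "!!t. cmod (f t) <= C * exp (a * \<bar>t\<bar>)" using assms by (auto simp: temp_def)
 have "C >= 0" using order_trans[OF norm_ge_zero C[of 0]] by simp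
 moreover have "cmod (f t) <= C * exp (\<bar>a\<bar> * \<bar>t\<bar>)" for t
  by (rule order_trans[OF C]) (use \<open>C >= 0\<close> in \<open>auto intro!: mult_left_mono mult_right_mono\<close>)
 ultimately show ?thesis using that[of C "\<bar>a\<bar>"] by simp
qed

lemma temp_mult: assumes f: "temp f" and g: "temp g" shows "temp (%t. f t * g t)"
proof -
 obtain C a where C: "C >= 0" "a >= 0" "!!t. cmod (f t) <= C * exp (a * \<bar>t\<bar>)" using tempE[OF f] by metis
 obtain D b where D: "D >= 0" "b >= 0" "!!t. cmod (g t) <= D * exp (b * \<bar>t\<bar>)" using tempE[OF g] by metis
 have "cmod (f t * g t) <= (C * D) * exp ((a + b) * \<bar>t\<bar>)" for t
 proof -
  have "cmod (f t * g t) <= (C * exp (a * \<bar>t\<bar>)) * (D * exp (b * \<bar>t\<bar>))"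
  unfolding norm_mult using C D by (intro mult_mono) auto
  moreover have "exp ((a + b) * \<bar>t\<bar>) = exp (a * \<bar>t\<bar>) * exp (b * \<bar>t\<bar>)" by (simp add: distrib_right exp_add)
  ultimately show ?thesis by (simp add: mult_ac)
 qed
 then show ?thesis by (rule tempI[rotated]) (intro continuous_intros temp_continuous f g)
qed

lemma temp_add: assumes f: "temp f" and g: "temp g" shows "temp (%t. f t + g t)"
proof -
 obtain C a where C: "C >= 0" "a >= 0" "!!t. cmod (f t) <= C * exp (a * \<bar>t\<bar>)" using tempE[OF f] by metis
 obtain D b where D: "D >= 0" "b >= 0" "!!t. cmod (g t) <= D * exp (b * \<bar>t\<bar>)" using tempE[OF g] by metis
 have "cmod (f t + g t) <= (C + D) * exp ((a + b) * \<bar>t\<bar>)" for t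
 proof -
  have "cmod (f t + g t) <= C * exp (a * \<bar>t\<bar>) + D * exp (b * \<bar>t\<bar>)"
  by (rule norm_triangle_le) (intro add_mono C D)
  also have "... <= C * exp ((a + b) * \<bar>t\<bar>) + D * exp ((a + b) * \<bar>t\<bar>)"
  using C D by (intro add_mono mult_left_mono) (auto intro!: mult_right_mono)
  finally show ?thesis by (simp add: distrib_right)
 qed
 then show ?thesis by (rule tempI[rotated]) (intro continuous_intros temp_continuous f g)
qed

lemma temp_const: "temp (%_. c)"
 by (rule tempI[of _ "cmod c" 0]) auto

lemma temp_id: "temp (%t. of_real t)"
proof -
 have "\<bar>t\<bar> <= exp \<bar>t\<bar>" for t :: real
  using exp_ge_add_one_self[of "\<bar>t\<bar>"] by linarith
 then have "cmod (of_real t) <= 1 * exp (1 * \<bar>t\<bar>)" for t by simp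
 then show ?thesis by (rule tempI[rotated]) (intro continuous_intros)
qed

lemma temp_exp: "temp (%t. exp (b * of_real t))"
proof -
 have "cmod (exp (b * of_real t)) <= 1 * exp (\<bar>Re b\<bar> * \<bar>t\<bar>)" for t
  by (simp add: norm_exp_eq_Re) (metis abs_ge_self abs_mult)
 then show ?thesis by (rule tempI[rotated]) (intro continuous_intros)
qed

lemma temp_exp_abs: "temp (%t. of_real (exp (b * \<bar>t\<bar>)))"
 unfolding temp_def by (intro conjI exI[of _ 1] exI[of _ b] allI) (auto intro!: continuous_intros)

lemma temp_power: "temp f ==> temp (%t. f t ^ n)"
 by (induction n) (auto intro: temp_const temp_mult)

lemma temp_sum: "(!!i. i \<in> I ==> temp (f i)) ==> temp (%t. SUM i:I. f i t)"
 by (induction I rule: infinite_finite_induct) (auto intro: temp_const temp_add)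

lemma temp_hermite: "temp (%t. of_real (hermite k t))"
proof (induction k rule: less_induct)
 case (less k)
 consider "k = 0" | j where "k = Suc j" by (cases k) auto
 then show ?case
 proof cases
  case 1
  then show ?thesis using temp_const[of 1] by simp
 next
  case 2
  have "temp (%t. 2 * of_real t * of_real (hermite j t) + (- 2 * of_real j) * of_real (hermite (j - 1) t))"
  by (intro temp_add temp_mult temp_const temp_id less) (use 2 in auto)
  then show ?thesis unfolding 2 hermite_rec by simp
 qed
qed

lemma temp_gauss_integrable:
 assumes f: "temp f"
 shows "imut (%t. f t * of_real (exp (- t\<^sup>2 / 2)))"
proof -
 obtain C a where C: "C >= 0" "a >= 0" "!!t. cmod (f t) <= C * exp (a * \<bar>t\<bar>)" using tempE[OF f] by metis
 have [measurable]: "f \<in> bmeas" using f by (auto simp: temp_def intro: borel_measurable_continuous_onI)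
 have i: "imut (%t::real. exp (- t\<^sup>2 / 2 + b * t))" for b
  using integrable_norm[OF gauss_1d(1)[of "of_real b"]] by (simp add: norm_exp_eq_Re)
 show ?thesis
 proof (rule Bochner_Integration.integrable_bound)
  show "imut (%t::real. C * (exp (- t\<^sup>2 / 2 + a * t) + exp (- t\<^sup>2 / 2 + (- a) * t)))"
  by (intro integrable_mult_right Bochner_Integration.integrable_add i)
  have "cmod (f t * of_real (exp (- t\<^sup>2 / 2))) <= C * (exp (- t\<^sup>2 / 2 + a * t) + exp (- t\<^sup>2 / 2 + (- a) * t))" for t
  proof -
  have "cmod (f t * of_real (exp (- t\<^sup>2 / 2))) <= C * exp (a * \<bar>t\<bar>) * exp (- t\<^sup>2 / 2)"
  unfolding norm_mult using C by (intro mult_mono) auto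
  also have "... = C * exp (- t\<^sup>2 / 2 + a * \<bar>t\<bar>)" by (simp only: exp_add mult_ac)
  also have "... <= C * (exp (- t\<^sup>2 / 2 + a * t) + exp (- t\<^sup>2 / 2 + (- a) * t))"
  using C(1) by (intro mult_left_mono) (cases "t >= 0", auto)
  finally show ?thesis .
  qed
  then show "AE t in mut. cmod (f t * of_real (exp (- t\<^sup>2 / 2))) <= norm (C * (exp (- t\<^sup>2 / 2 + a * t) + exp (- t\<^sup>2 / 2 + (- a) * t)))"
  by (intro AE_I2) (use order_trans[OF _ abs_ge_self] in auto)
 qed measurable
qed

lemma temp_gauss_integrable2:
 assumes f: "temp f"
 shows "imut (%t. f t * of_real (exp (- t\<^sup>2)))"
proof (rule Bochner_Integration.integrable_bound[OF temp_gauss_integrable[OF f]])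
 have [measurable]: "f \<in> bmeas" using f by (auto simp: temp_def intro: borel_measurable_continuous_onI)
 show "(%t. f t * of_real (exp (- t\<^sup>2))) \<in> borel_measurable mut" by simp
 show "AE t in mut. cmod (f t * of_real (exp (- t\<^sup>2))) <= cmod (f t * of_real (exp (- t\<^sup>2 / 2)))"
  by (rule AE_I2) (auto simp: norm_mult intro!: mult_left_mono)
qed

lemma integral_deriv_real_eq_0:
 fixes g :: "real => complex"
 assumes d: "!!t. (g has_vector_derivative g' t) (at t)" and c: "continuous_on UNIV g'"
  and i: "imut g" "imut g'"
 shows "Imut g' = 0"
proof -
 have "Ilb (%x. 1 *\<^sub>R g' x) = 0"
  by (rule integral_directional_derivative_eq_0[of g "%t x. x *\<^sub>R g' t" 1])
  (use d c i in \<open>auto simp: has_vector_derivative_def integrable_mut\<close>)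
 then show ?thesis by (simp add: integral_mut)
qed

lemma hermite_gauss_rec:
 "Imut (%t. cor (hermite j t * hermite (Suc k) t) * of_real (exp (- t\<^sup>2))) =
 2 * of_nat j * Imut (%t. cor (hermite (j - 1) t * hermite k t) * of_real (exp (- t\<^sup>2)))"
proof -
 let ?I = "%j k t. cor (hermite j t * hermite k t) * of_real (exp (- t\<^sup>2))"
 have int: "imut (?I j k)" for j k
  using temp_gauss_integrable2[OF temp_mult[OF temp_hermite[of j] temp_hermite[of k]]] by simp
 let ?g' = "%t. 2 * of_nat j * ?I (j - 1) k t - ?I j (Suc k) t"
 have "Imut ?g' = 0"
 proof (rule integral_deriv_real_eq_0)
  fix t
  have "((%t. hermite j t * hermite k t * exp (- t\<^sup>2)) has_real_derivative
  (2 * real j * (hermite (j - 1) t * hermite k t * exp (- t\<^sup>2)) - hermite j t * hermite (Suc k) t * exp (- t\<^sup>2))) (at t)"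
  by (rule derivative_eq_intros hermite_deriv refl)+ (simp add: hermite_rec algebra_simps)
  from has_vector_derivative_of_real[OF this]
  show "(?I j k has_vector_derivative ?g' t) (at t)" by simp
 next
  show "continuous_on UNIV ?g'" unfolding of_real_mult by (intro continuous_intros hermite_continuous)
 qed (intro int Bochner_Integration.integrable_diff integrable_mult_right)+
 then show ?thesis using int by (subst (asm) Bochner_Integration.integral_diff) auto
qed

lemma hermite_orth:
 "Imut (%t. cor (hermite j t * hermite k t) * of_real (exp (- t\<^sup>2))) =
 (if j = k then 2 ^ k * fact k / of_real (sqrt 2) else 0)"
proof (induction k arbitrary: j)
 case 0
 show ?case
 proof (cases j)
  case (Suc i)
  then show ?thesis using hermite_gauss_rec[of 0 i] by (simp add: mult.commute)
 next
  case j: 0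
  let ?f = "%t::real. cor (exp (- t\<^sup>2))"
  have "1 = Imut (%t::real. cor (exp (- t\<^sup>2 / 2)))"
  using gauss_1d(2)[of 0] by (simp flip: exp_of_real)
  also have "... = \<bar>sqrt 2\<bar> ^ DIM(real) *\<^sub>R Imut (%t. cor (exp (- (0 + sqrt 2 *\<^sub>R t)\<^sup>2 / 2)))"
  by (rule mut_affine(2)) simp
  also have "... = of_real (sqrt 2) * Imut ?f"
  by (simp add: power_mult_distrib scaleR_conv_of_real)
  finally have "Imut ?f = 1 / of_real (sqrt 2)" by (simp add: field_simps)
  then show ?thesis using j by simp
 qed
next
 case (Suc k)
 show ?case
 proof (cases j)
  case 0
  then show ?thesis unfolding hermite_gauss_rec by simp
 next
  case (Suc i)
  then show ?thesis unfolding hermite_gauss_rec using Suc.IH[of i] by (auto simp: algebra_simps add_divide_distrib)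
 qed
qed

definition qc :: "nat => real" where
 "qc k = sqrt 2 * pi powr (1/4) * (2 ^ k * fact k * sqrt pi) powr (- 1 / 2)"

lemma qc_pos: "qc k > 0"
 by (simp add: qc_def)

lemma qc_sq: "(qc k)\<^sup>2 = 2 / (2 ^ k * fact k)"
proof -
 have a: "(pi powr (1/4))\<^sup>2 = sqrt pi"
  by (simp add: power2_eq_square powr_add[symmetric] powr_half_sqrt)
 have "((2 ^ k * fact k * sqrt pi) powr (- 1 / 2))\<^sup>2 = (2 ^ k * fact k * sqrt pi) powr (- 1)"
  unfolding power2_eq_square powr_add[symmetric] by simp
 also have "... = 1 / (2 ^ k * fact k * sqrt pi)" by (simp add: powr_minus_divide)
 finally have b: "((2 ^ k * fact k * sqrt pi) powr (- 1 / 2))\<^sup>2 = 1 / (2 ^ k * fact k * sqrt pi)" .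
 show ?thesis unfolding qc_def power_mult_distrib a b by simp
qed

definition q1 :: "nat => real => real" where
 "q1 k t = qc k * hermite k t * exp (- t\<^sup>2 / 2)"

lemma q_fun_eq: "q_fun k xi v = (PROD r:UNIV. q1 (k $ r) ((xi $ r + 2 * v $ r) / sqrt 2))"
proof -
 have a: "2 powr (real CARD('n) / 2) = (PROD r:(UNIV :: 'n set). sqrt 2)"
  by (simp add: powr_half_sqrt[symmetric] powr_powr powr_realpow[symmetric])
 have b: "pi powr (real CARD('n) / 4) = (PROD r:(UNIV :: 'n set). pi powr (1/4))"
  by (simp add: powr_powr powr_realpow[symmetric])
 have "q_fun k xi v = (PROD r:UNIV. sqrt 2 * pi powr (1/4) * hermite_fun (k $ r) ((xi $ r + 2 * v $ r) / sqrt 2))"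
  unfolding q_fun_def a b prod.distrib ..
 also have "... = (PROD r:UNIV. q1 (k $ r) ((xi $ r + 2 * v $ r) / sqrt 2))"
  by (intro prod.cong refl) (simp add: q1_def qc_def hermite_fun_def)
 finally show ?thesis .
qed

lemma shift_integral:
 fixes f :: "real => complex"
 shows "imut (%v. f ((x + 2 * v) / sqrt 2)) \<longleftrightarrow> imut f"
  "Imut (%v. f ((x + 2 * v) / sqrt 2)) = Imut f / of_real (sqrt 2)"
proof -
 have e: "(x + 2 * v) / sqrt 2 = x / sqrt 2 + sqrt 2 *\<^sub>R v" for v
  by (simp add: add_divide_distrib real_div_sqrt) (simp add: field_simps)
 show "imut (%v. f ((x + 2 * v) / sqrt 2)) \<longleftrightarrow> imut f"
  unfolding e by (rule mut_affine(1)) simp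
 show "Imut (%v. f ((x + 2 * v) / sqrt 2)) = Imut f / of_real (sqrt 2)"
  unfolding e using mut_affine(2)[of "sqrt 2" f "x / sqrt 2"] by (simp add: scaleR_conv_of_real)
qed

lemma q1_orth:
 "imut (%v. cor (q1 j ((x + 2 * v) / sqrt 2) * q1 k ((x + 2 * v) / sqrt 2)))"
 "Imut (%v. cor (q1 j ((x + 2 * v) / sqrt 2) * q1 k ((x + 2 * v) / sqrt 2))) = (if j = k then 1 else 0)"
proof -
 have e: "cor (q1 j t * q1 k t) = of_real (qc j * qc k) * (of_real (hermite j t * hermite k t) * of_real (exp (- t\<^sup>2)))" for t
  unfolding q1_def by (simp add: exp_add[symmetric] flip: of_real_mult)
 have int: "imut (%t. cor (hermite j t * hermite k t) * of_real (exp (- t\<^sup>2)))"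
  using temp_gauss_integrable2[OF temp_mult[OF temp_hermite[of j] temp_hermite[of k]]] by simp
 have i: "imut (%t. cor (q1 j t * q1 k t))"
  unfolding e by (rule integrable_mult_right[OF int])
 then show "imut (%v. cor (q1 j ((x + 2 * v) / sqrt 2) * q1 k ((x + 2 * v) / sqrt 2)))"
  by (subst shift_integral(1))
 have "Imut (%v. cor (q1 j ((x + 2 * v) / sqrt 2) * q1 k ((x + 2 * v) / sqrt 2))) =
  of_real (qc j * qc k) * (if j = k then 2 ^ k * fact k / of_real (sqrt 2) else 0) / of_real (sqrt 2)"
  unfolding shift_integral(2)[of "%t. cor (q1 j t * q1 k t)"] unfolding e integral_mult_right_zero hermite_orth ..
 also have "... = (if j = k then 1 else 0)"
 proof (cases "j = k")
  case True
  have "of_real (qc j * qc k) * (2 ^ k * fact k / cor (sqrt 2)) / of_real (sqrt 2) = cor (qc j * qc k * (2 ^ k * fact k / sqrt 2) / sqrt 2)"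
  by (simp only: of_real_mult of_real_divide of_real_power of_real_numeral of_real_fact)
  also have "qc j * qc k * (2 ^ k * fact k / sqrt 2) / sqrt 2 = (qc k)^2 * (2 ^ k * fact k) / (sqrt 2 * sqrt 2)"
  unfolding True power2_eq_square by simp
  finally show ?thesis using True unfolding qc_sq by simp
 qed simp
 finally show "Imut (%v. cor (q1 j ((x + 2 * v) / sqrt 2) * q1 k ((x + 2 * v) / sqrt 2))) = (if j = k then 1 else 0)" .
qed

lemma q_orthonormal:
 fixes xi :: "real^'n"
 shows "imut (%v. cor (q_fun k xi v * q_fun l xi v))"
  "Imut (%v. cor (q_fun k xi v * q_fun l xi v)) = (if k = l then 1 else 0)"
proof -
 let ?f = "%r v. cor (q1 (k $ r) ((xi $ r + 2 * v) / sqrt 2) * q1 (l $ r) ((xi $ r + 2 * v) / sqrt 2))"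
 have e: "cor (q_fun k xi v * q_fun l xi v) = (PROD r:UNIV. ?f r (v $ r))" for v
  by (simp add: q_fun_eq prod.distrib)
 show "imut (%v. cor (q_fun k xi v * q_fun l xi v))"
  unfolding e by (rule mut_prod_vec(1)) (rule q1_orth)
 have "Imut (%v. cor (q_fun k xi v * q_fun l xi v)) = (PROD r:UNIV. if k $ r = l $ r then 1 else 0)"
  unfolding e mut_prod_vec(2)[OF q1_orth(1)] q1_orth(2) ..
 also have "... = (if k = l then 1 else 0)"
  by (auto simp: vec_eq_iff prod_zero_iff)
 finally show "Imut (%v. cor (q_fun k xi v * q_fun l xi v)) = (if k = l then 1 else 0)" .
qed

lemma q_fun_continuous: "continuous_on UNIV (%p. q_fun k (fst p) (snd p))"
proof -
 have "continuous_on UNIV (%p::(real^'n) \<times> (real^'n). hermite j ((fst p $ r + 2 * snd p $ r) / sqrt 2))" for j r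
  by (intro continuous_on_compose2[OF hermite_continuous] continuous_intros) auto
 then show ?thesis unfolding q_fun_eq q1_def by (intro continuous_intros) auto
qed

lemma q_fun_measurable [measurable (raw)]:
 assumes "f \<in> borel_measurable M" "g \<in> borel_measurable M"
 shows "(%x. q_fun k (f x) (g x)) \<in> borel_measurable M"
proof -
 have "(%x. (f x, g x)) \<in> borel_measurable M" using assms by (rule borel_measurable_Pair)
 from measurable_compose[OF this borel_measurable_continuous_onI[OF q_fun_continuous[of k]]] show ?thesis by simp
qed

lemma sq_q_fun: "sq (%v. cor (q_fun k xi v))"
 unfolding sq_def
proof
 have "imut (%v. cor (q_fun k xi v * q_fun k xi v))" by (rule q_orthonormal)
 then have "imut (%v. q_fun k xi v * q_fun k xi v)" unfolding complex_of_real_integrable_eq .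
 then show "imut (%v. (cmod (cor (q_fun k xi v)))^2)" by (simp add: power2_eq_square)
qed measurable

subsection \<open>Completeness\<close>

lemma sq_temp_prod:
 fixes xi :: "real^'n" and f :: "'n => real => complex"
 assumes f: "!!r. temp (f r)"
 shows "sq (%y::real^'n. PROD r:UNIV. f r ((xi $ r + 2 * y $ r) / sqrt 2) * of_real (exp (- ((xi $ r + 2 * y $ r) / sqrt 2)\<^sup>2 / 2)))"
proof -
 have fm: "f r \<in> bmeas" for r using f[of r] by (auto simp: temp_def intro: borel_measurable_continuous_onI)
 have fm': "(%y::real^'n. f r ((xi $ r + 2 * y $ r) / sqrt 2)) \<in> bmeas" for r
  by (rule measurable_compose[OF _ fm]) measurable
 let ?F = "%r t. f r t * of_real (exp (- t\<^sup>2 / 2))"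
 have i1: "imut (%t. ?F r t * cnj (?F r t))" for r
 proof -
  have "temp (%t. cnj (f r t))" using f[of r] by (auto simp: temp_def intro!: continuous_intros)
  from temp_gauss_integrable2[OF temp_mult[OF f[of r] this]]
  have "imut (%t. f r t * cnj (f r t) * of_real (exp (- t\<^sup>2)))" .
  moreover have "?F r t * cnj (?F r t) = f r t * cnj (f r t) * of_real (exp (- t\<^sup>2))" for t
  proof -
  have "cor (exp (- t\<^sup>2 / 2)) * of_real (exp (- t\<^sup>2 / 2)) = of_real (exp (- t\<^sup>2))"
  by (simp add: exp_add[symmetric] flip: of_real_mult)
  then show ?thesis by (simp add: mult_ac)
  qed
  ultimately show ?thesis by (simp only:)
 qed
 have i: "imut (%y::real^'n. PROD r:UNIV. ?F r ((xi $ r + 2 * y $ r) / sqrt 2) * cnj (?F r ((xi $ r + 2 * y $ r) / sqrt 2)))"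
  by (rule mut_prod_vec(1)[of "%r y. ?F r ((xi $ r + 2 * y) / sqrt 2) * cnj (?F r ((xi $ r + 2 * y) / sqrt 2))"])
  (subst shift_integral(1)[of "%t. ?F _ t * cnj (?F _ t)"], rule i1)
 show ?thesis
  unfolding sq_def
 proof
  show "(%y::real^'n. PROD r:UNIV. ?F r ((xi $ r + 2 * y $ r) / sqrt 2)) \<in> bmeas"
  by (intro borel_measurable_prod borel_measurable_times fm') measurable
  have "cor ((cmod (PROD r:UNIV. ?F r ((xi $ r + 2 * y $ r) / sqrt 2)))^2) = (PROD r:UNIV. ?F r ((xi $ r + 2 * y $ r) / sqrt 2) * cnj (?F r ((xi $ r + 2 * y $ r) / sqrt 2)))" for y :: "real^'n"
  unfolding complex_norm_square cnj_prod by (rule prod.distrib[symmetric])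
  with i have "imut (%y::real^'n. cor ((cmod (PROD r:UNIV. ?F r ((xi $ r + 2 * y $ r) / sqrt 2)))^2))" by (simp only:)
  then show "imut (%y::real^'n. (cmod (PROD r:UNIV. ?F r ((xi $ r + 2 * y $ r) / sqrt 2)))\<^sup>2)" unfolding complex_of_real_integrable_eq .
 qed
qed

text \<open>If \<open>v\<close> is orthogonal to all shifted Hermite functions, it is orthogonal to all products of a
 polynomial with the Gaussian (the recursion turns each factor \<open>t\<^sub>r\<close> into Hermite polynomials of
 neighbouring degree), hence, by expanding the exponential, to all modulated Gaussians.\<close>

theorem q_complete:
 fixes v :: "real^'n => complex" and xi :: "real^'n"
 assumes v: "sq v" and orth: "!!k. Imut (%y. v y * of_real (q_fun k xi y)) = 0"
 shows "AE y in lborel. v y = 0"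
proof -
 have vm [measurable]: "v \<in> bmeas" using v by (simp add: sq_def)
 define t where "t y r = (xi $ r + 2 * y $ r) / sqrt 2" for y :: "real^'n" and r
 define G where "G f y = (PROD r:UNIV. f r (t y r) * of_real (exp (- (t y r)\<^sup>2 / 2)))" for f :: "'n => real => complex" and y
 have sqG: "sq (G f)" if "!!r. temp (f r)" for f
  unfolding G_def t_def by (rule sq_temp_prod) (rule that)
 have Gm: "G f \<in> bmeas" if "!!r. temp (f r)" for f using sqG[OF that] by (simp add: sq_def)
 have int: "imut (%y. v y * G f y)" if "!!r. temp (f r)" for f
  by (rule sq_product_integrable[OF v sqG[OF that]]) (use Gm[OF that] in \<open>auto simp: norm_mult\<close>)
 let ?h = "%a k r x. cor x ^ a r * cor (hermite (k r) x)"
 have th: "temp (?h a k r)" for a k :: "'n => nat" and r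
  by (intro temp_mult temp_power temp_id temp_hermite)
 have inth: "imut (%y. v y * G (?h a k) y)" for a k
  by (rule int) (rule th)
 have base: "Imut (%y. v y * G (?h (%_. 0) k) y) = 0" for k
 proof -
  have "of_real (q_fun (\<chi> r. k r) xi y) = of_real (PROD r:UNIV. qc (k r)) * G (?h (%_. 0) k) y" for y
  unfolding q_fun_eq q1_def G_def t_def by (simp add: prod.distrib mult_ac)
  then have "of_real (PROD r:UNIV. qc (k r)) * Imut (%y. v y * G (?h (%_. 0) k) y) = Imut (%y. v y * of_real (q_fun (\<chi> r. k r) xi y))"
  by (simp only: integral_mult_right_zero[symmetric] mult.left_commute)
  also have "... = 0" by (rule orth)
  finally show ?thesis using qc_pos by (auto simp: prod_zero_iff less_imp_neq[symmetric])
 qed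
 have poly: "Imut (%y. v y * G (?h a k) y) = 0" for a k
 proof (induction "SUM r:UNIV. a r" arbitrary: a k rule: less_induct)
  case less
  show ?case
  proof (cases "ALL r. a r = 0")
  case True
  then have "a = (%_. 0)" by auto
  then show ?thesis using base by simp
  next
  case False
  then obtain r where r: "a r > 0" by auto
  define b where "b = a(r := a r - 1)"
  have sm: "(SUM r:UNIV. b r) < (SUM r:UNIV. a r)"
  by (rule sum_strict_mono_ex1) (use r in \<open>auto simp: b_def\<close>)
  have e: "G (?h a k) y = 1/2 * G (?h b (k(r := Suc (k r)))) y + of_nat (k r) * G (?h b (k(r := k r - 1))) y" for y
  proof -
  let ?R = "%a k. PROD s:UNIV - {r}. ?h a k s (t y s) * of_real (exp (- (t y s)\<^sup>2 / 2))"
  let ?E = "cor (exp (- (t y r)\<^sup>2 / 2))" and ?x = "cor (t y r)"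
  have split: "G (?h a k) y = ?h a k r (t y r) * ?E * ?R a k" for a k
  unfolding G_def by (subst prod.remove[of _ r]) auto
  have R: "?R b (k(r := j)) = ?R a k" for j by (rule prod.cong) (auto simp: b_def)
  have p: "?x ^ a r = ?x ^ (a r - 1) * ?x" using r by (metis Suc_diff_1 power_Suc2)
  have hx: "2 * ?x * of_real (hermite (k r) (t y r)) = of_real (hermite (Suc (k r)) (t y r)) + 2 * of_nat (k r) * cor (hermite (k r - 1) (t y r))"
  unfolding hermite_rec by simp
  have "2 * G (?h a k) y = ?x ^ (a r - 1) * (2 * ?x * of_real (hermite (k r) (t y r))) * ?E * ?R a k"
  unfolding split p by (simp only: mult_ac)
  also have "... = G (?h b (k(r := Suc (k r)))) y + 2 * of_nat (k r) * G (?h b (k(r := k r - 1))) y"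
  unfolding hx split[of b] R by (simp add: b_def algebra_simps)
  finally show ?thesis by (simp add: field_simps)
  qed
  have "(%y. v y * G (?h a k) y) = (%y. 1/2 * (v y * G (?h b (k(r := Suc (k r)))) y) + of_nat (k r) * (v y * G (?h b (k(r := k r - 1))) y))"
  unfolding e by (simp add: algebra_simps)
  then show ?thesis
  using less[OF sm] inth[of b "k(r := Suc (k r))"] inth[of b "k(r := k r - 1)"]
  by (simp only: Bochner_Integration.integral_add integrable_mult_right integral_mult_right_zero) simp
  qed
 qed
 have mono: "Imut (%y. v y * G (%r x. cor x ^ a r) y) = 0" for a
  using poly[of a "%_. 0"] by simp
 have partial: "Imut (%y. v y * G (%r x. \<Sum>j<N. (\<i> * of_real (tau r * x)) ^ j / fact j) y) = 0" for N and tau :: "'n => real"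
 proof -
  have e: "G (%r x. \<Sum>j<N. (\<i> * of_real (tau r * x)) ^ j / fact j) y =
  (SUM a:(PiE UNIV (%_. {..<N})). (PROD r:UNIV. (\<i> * of_real (tau r)) ^ a r / fact (a r)) * G (%r x. cor x ^ a r) y)" for y
  proof -
  have "G (%r x. \<Sum>j<N. (\<i> * of_real (tau r * x)) ^ j / fact j) y = (PROD r:UNIV. \<Sum>j<N. ((\<i> * of_real (tau r)) ^ j / fact j) * (cor (t y r) ^ j * of_real (exp (- (t y r)\<^sup>2 / 2))))"
  unfolding G_def sum_distrib_right by (intro prod.cong sum.cong refl) (simp add: power_mult_distrib mult_ac)
  also have "... = (SUM a:(PiE UNIV (%_. {..<N})). PROD r:UNIV. ((\<i> * of_real (tau r)) ^ a r / fact (a r)) * (cor (t y r) ^ a r * of_real (exp (- (t y r)\<^sup>2 / 2))))"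
  by (rule prod_sum_PiE) auto
  finally show ?thesis unfolding G_def prod.distrib .
  qed
  have "Imut (%y. v y * G (%r x. \<Sum>j<N. (\<i> * of_real (tau r * x)) ^ j / fact j) y) =
  Imut (%y. SUM a:(PiE UNIV (%_. {..<N})). (PROD r:UNIV. (\<i> * of_real (tau r)) ^ a r / fact (a r)) * (v y * G (%r x. cor x ^ a r) y))"
  unfolding e sum_distrib_left by (simp only: mult.left_commute)
  also have "... = (SUM a:(PiE UNIV (%_. {..<N})). (PROD r:UNIV. (\<i> * of_real (tau r)) ^ a r / fact (a r)) * Imut (%y. v y * G (%r x. cor x ^ a r) y))"
  by (subst Bochner_Integration.integral_sum) (auto intro!: integrable_mult_right int temp_power temp_id)
  also have "... = 0" by (simp add: mono)
  finally show ?thesis .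
 qed
 have expo: "Imut (%y. v y * G (%r x. exp (\<i> * of_real (tau r * x))) y) = 0" for tau :: "'n => real"
 proof -
  have "(%N. Imut (%y. v y * G (%r x. \<Sum>j<N. (\<i> * of_real (tau r * x)) ^ j / fact j) y)) ~~>
  Imut (%y. v y * G (%r x. exp (\<i> * of_real (tau r * x))) y)"
  proof (rule integral_dominated_convergence[where w="%y. cmod (v y * G (%r x. of_real (exp (\<bar>tau r\<bar> * \<bar>x\<bar>))) y)"])
  show "imut (%y. cmod (v y * G (%r x. of_real (exp (\<bar>tau r\<bar> * \<bar>x\<bar>))) y))"
  by (intro integrable_norm int temp_exp_abs)
  have te: "temp (%x. exp (\<i> * of_real (tau r * x)))" for r
  using temp_exp[of "\<i> * of_real (tau r)"] by (simp add: mult.assoc)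
  have ts: "temp (%x. \<Sum>j<N. (\<i> * of_real (tau r * x)) ^ j / fact j)" for N r
  proof -
  have "temp (%x. \<Sum>j<N. (\<i> * of_real (tau r)) ^ j / fact j * of_real x ^ j)"
  by (intro temp_sum temp_mult temp_const temp_power temp_id)
  then show ?thesis by (simp add: power_mult_distrib mult_ac)
  qed
  show "(%y. v y * G (%r x. exp (\<i> * of_real (tau r * x))) y) \<in> borel_measurable mut"
  using Gm[OF te] by simp
  show "(%y. v y * G (%r x. \<Sum>j<N. (\<i> * of_real (tau r * x)) ^ j / fact j) y) \<in> borel_measurable mut" for N
  using Gm[OF ts] by simp
  show "AE y in mut. (%N. v y * G (%r x. \<Sum>j<N. (\<i> * of_real (tau r * x)) ^ j / fact j) y) ~~> v y * G (%r x. exp (\<i> * of_real (tau r * x))) y"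
  proof (rule AE_I2)
  fix y
  have "(%N. \<Sum>j<N. z ^ j / fact j) ~~> exp z" for z :: complex
  using exp_converges[of z] unfolding sums_def by (simp add: scaleR_conv_of_real divide_inverse mult.commute)
  then show "(%N. v y * G (%r x. \<Sum>j<N. (\<i> * of_real (tau r * x)) ^ j / fact j) y) ~~> v y * G (%r x. exp (\<i> * of_real (tau r * x))) y"
  unfolding G_def by (intro tendsto_intros)
  qed
  show "AE y in mut. cmod (v y * G (%r x. \<Sum>j<N. (\<i> * of_real (tau r * x)) ^ j / fact j) y) <= cmod (v y * G (%r x. of_real (exp (\<bar>tau r\<bar> * \<bar>x\<bar>))) y)" for N
  proof (rule AE_I2)
  fix y
  have b: "cmod (\<Sum>j<N. (\<i> * of_real (tau r * x)) ^ j / fact j) <= exp (\<bar>tau r\<bar> * \<bar>x\<bar>)" for r x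
  proof -
  have "cmod (\<Sum>j<N. (\<i> * of_real (tau r * x)) ^ j / fact j) <= (\<Sum>j<N. cmod ((\<i> * of_real (tau r * x)) ^ j / fact j))" by (rule norm_sum)
  also have "... = (\<Sum>j<N. (\<bar>tau r\<bar> * \<bar>x\<bar>) ^ j /\<^sub>R fact j)" by (simp add: norm_divide norm_power norm_mult abs_mult norm_inverse divide_inverse mult.commute)
  also have "... <= exp (\<bar>tau r\<bar> * \<bar>x\<bar>)"
  unfolding exp_def by (rule sum_le_suminf[OF summable_exp_generic]) auto
  finally show ?thesis .
  qed
  show "cmod (v y * G (%r x. \<Sum>j<N. (\<i> * of_real (tau r * x)) ^ j / fact j) y) <= cmod (v y * G (%r x. of_real (exp (\<bar>tau r\<bar> * \<bar>x\<bar>))) y)"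
  unfolding G_def norm_mult prod_norm[symmetric] by (intro mult_left_mono prod_mono) (use b in \<open>auto intro!: mult_right_mono\<close>)
  qed
  qed
  from LIMSEQ_unique[OF this[unfolded partial] tendsto_const] show ?thesis .
 qed
 have "AE y in lborel. v y * G (%r x. 1) y = 0"
 proof (rule fourier_L1_injective)
  show "imut (%y. v y * G (%r x. 1) y)" by (intro int temp_const)
  fix w :: "real^'n"
  define tau where "tau r = - (w $ r / sqrt 2)" for r
  have e: "exp (- \<i> * of_real (y \<bullet> w)) * G (%r x. 1) y = (PROD r:UNIV. exp (\<i> * of_real ((w $ r) * (xi $ r) / 2))) * G (%r x. exp (\<i> * of_real (tau r * x))) y" for y
  proof -
  have "exp (- \<i> * of_real (y \<bullet> w)) = (PROD r:UNIV. exp (- \<i> * of_real (y $ r * w $ r)))"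
  by (simp add: inner_vec_def exp_sum[symmetric] sum_distrib_left sum_negf)
  moreover have "exp (- \<i> * of_real (y $ r * w $ r)) = exp (\<i> * of_real ((w $ r) * (xi $ r) / 2)) * exp (\<i> * of_real (tau r * t y r))" for r
  proof -
  have re: "- (y $ r * w $ r) = (w $ r) * (xi $ r) / 2 + tau r * t y r" by (simp add: tau_def t_def field_simps)
  have "exp (- \<i> * of_real (y $ r * w $ r)) = exp (\<i> * of_real (- (y $ r * w $ r)))" by simp
  also have "... = exp (\<i> * of_real ((w $ r) * (xi $ r) / 2)) * exp (\<i> * of_real (tau r * t y r))"
  unfolding re of_real_add distrib_left exp_add ..
  finally show ?thesis .
  qed
  ultimately show ?thesis unfolding G_def by (simp add: prod.distrib mult.assoc)
  qed
  have "Imut (%y. v y * G (%r x. 1) y * exp (- \<i> * of_real (y \<bullet> w))) =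
  Imut (%y. v y * (exp (- \<i> * of_real (y \<bullet> w)) * G (%r x. 1) y))" by (simp only: mult_ac)
  also have "... =
  (PROD r:UNIV. exp (\<i> * of_real ((w $ r) * (xi $ r) / 2))) * Imut (%y. v y * G (%r x. exp (\<i> * of_real (tau r * x))) y)"
  unfolding integral_mult_right_zero[symmetric] e by (simp only: mult_ac)
  finally show "Imut (%y. v y * G (%r x. 1) y * exp (- \<i> * of_real (y \<bullet> w))) = 0" unfolding expo by simp
 qed
 then show ?thesis by (auto elim!: eventually_mono simp: G_def)
qed

subsection \<open>A Fourier integral\<close>

text \<open>The derivative of \<open>H\<^sub>k\<close> times the Gaussian has integral zero; with the recursion of \<open>H\<^sub>k\<close> this expresses
the integral for \<open>k + 1\<close> by that for \<open>k\<close>. The case \<open>k = 0\<close> is the Gaussian integral.\<close>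

lemma hermite_fourier_1d:
 fixes y :: real and \<beta> :: complex
 shows "imut (%x. cor (hermite k ((x + 2 * y) / sqrt 2)) * exp (of_real (- x\<^sup>2 / 2) + (\<beta> - of_real y) * of_real x))"
  "Imut (%x. cor (hermite k ((x + 2 * y) / sqrt 2)) * exp (of_real (- x\<^sup>2 / 2) + (\<beta> - of_real y) * of_real x)) =
  (of_real (sqrt 2) * (of_real y + \<beta>)) ^ k * exp ((\<beta> - of_real y)^2 / 2)"
proof -
 let ?E = "%x. exp (of_real (- x\<^sup>2 / 2) + (\<beta> - of_real y) * of_real x)"
 let ?H = "%k x. cor (hermite k ((x + 2 * y) / sqrt 2))"
 have tH: "temp (?H k)" for k
 proof -
  obtain C a where C: "C >= 0" "a >= 0" "!!t. cmod (of_real (hermite k t)) <= C * exp (a * \<bar>t\<bar>)" using tempE[OF temp_hermite[of k]] by metis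
  have "cmod (?H k x) <= (C * exp (a * \<bar>2 * y\<bar>)) * exp (a * \<bar>x\<bar>)" for x
  proof -
  have "cmod (?H k x) <= C * exp (a * \<bar>(x + 2 * y) / sqrt 2\<bar>)" by (rule C)
  also have "... <= C * exp (a * (\<bar>x\<bar> + \<bar>2 * y\<bar>))"
  proof -
  have "\<bar>(x + 2 * y) / sqrt 2\<bar> <= \<bar>x + 2 * y\<bar>" using divide_left_mono[of 1 "sqrt 2" "\<bar>x + 2 * y\<bar>"] by simp
  also have "... <= \<bar>x\<bar> + \<bar>2 * y\<bar>" by (rule abs_triangle_ineq)
  finally have "a * \<bar>(x + 2 * y) / sqrt 2\<bar> <= a * (\<bar>x\<bar> + \<bar>2 * y\<bar>)" using C(2) by (rule mult_left_mono)
  then show ?thesis using C(1) by (simp add: mult_left_mono)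
  qed
  finally show ?thesis by (simp add: distrib_left exp_add mult_ac)
  qed
  moreover have "continuous_on UNIV (?H k)" by (intro continuous_on_of_real continuous_on_compose2[OF hermite_continuous[of k]] continuous_intros) auto
  ultimately show ?thesis unfolding temp_def by blast
 qed
 have int: "imut (%x. f x * ?E x)" if "temp f" for f
  using temp_gauss_integrable[OF temp_mult[OF that temp_exp[of "\<beta> - of_real y"]]]
  by (simp only: exp_add exp_of_real mult_ac)
 show "imut (%x. ?H k x * ?E x)" by (rule int[OF tH])
 have rec: "Imut (%x. ?H (Suc k) x * ?E x) = of_real (sqrt 2) * (of_real y + \<beta>) * Imut (%x. ?H k x * ?E x)" for k
 proof -
  let ?g' = "%x. (of_real y + \<beta>) * (?H k x * ?E x) - (1 / of_real (sqrt 2)) * (?H (Suc k) x * ?E x)"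
  have "Imut ?g' = 0"
  proof (rule integral_deriv_real_eq_0[of "%x. ?H k x * ?E x"])
  fix x
  let ?t = "(x + 2 * y) / sqrt 2"
  have "((%x. hermite k ((x + 2 * y) / sqrt 2)) has_real_derivative (2 * real k * hermite (k - 1) ?t) * (1 / sqrt 2)) (at x)"
  proof (rule DERIV_chain2[OF hermite_deriv])
  have "((%x. x + 2 * y) has_real_derivative 1) (at x)" by (auto intro!: derivative_eq_intros)
  then show "((%x. (x + 2 * y) / sqrt 2) has_real_derivative 1 / sqrt 2) (at x)" by (rule DERIV_cdivide)
  qed
  from has_vector_derivative_of_real[OF this]
  have d1: "(?H k has_vector_derivative of_real (2 * real k * hermite (k - 1) ?t * (1 / sqrt 2))) (at x)" .
  have "((%z. exp (- z\<^sup>2 / 2 + (\<beta> - of_real y) * z)) has_field_derivative exp (- (of_real x)\<^sup>2 / 2 + (\<beta> - of_real y) * of_real x) * (- of_real x + (\<beta> - of_real y))) (at (of_real x))"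
  by (auto intro!: derivative_eq_intros)
  from has_vector_derivative_real_field[OF this]
  have d2: "(?E has_vector_derivative (?E x * (- of_real x + (\<beta> - of_real y)))) (at x)" by (simp add: o_def)
  have "((%x. ?H k x * ?E x) has_vector_derivative (?H k x * (?E x * (- of_real x + (\<beta> - of_real y))) + of_real (2 * real k * hermite (k - 1) ?t * (1 / sqrt 2)) * ?E x)) (at x)"
  by (rule has_vector_derivative_mult[OF d1 d2])
  moreover have "?H k x * (?E x * (- of_real x + (\<beta> - of_real y))) + of_real (2 * real k * hermite (k - 1) ?t * (1 / sqrt 2)) * ?E x = ?g' x"
  proof -
  have r: "(1 / sqrt 2) * (2 * T * h - 2 * real k * h') = (2 / sqrt 2) * T * h - 2 * real k * h' * (1 / sqrt 2)" for T h h'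
  by (simp only: right_diff_distrib times_divide_eq_left times_divide_eq_right mult_1_left mult_1_right mult_ac)
  have s2: "2 / sqrt 2 = sqrt 2" by (rule real_div_sqrt) simp
  have "(1 / sqrt 2) * hermite (Suc k) ?t = sqrt 2 * ?t * hermite k ?t - 2 * real k * hermite (k - 1) ?t * (1 / sqrt 2)"
  unfolding hermite_rec r s2 ..
  also have "sqrt 2 * ?t = x + 2 * y"
  unfolding times_divide_eq_right by (rule nonzero_mult_div_cancel_left) simp
  finally have "cor ((1 / sqrt 2) * hermite (Suc k) ?t) = of_real ((x + 2 * y) * hermite k ?t - 2 * real k * hermite (k - 1) ?t * (1 / sqrt 2))" by (rule arg_cong)
  then have hs: "(1 / of_real (sqrt 2)) * ?H (Suc k) x = of_real ((x + 2 * y) * hermite k ?t - 2 * real k * hermite (k - 1) ?t * (1 / sqrt 2))" by simp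
  have "?g' x = ((of_real y + \<beta>) * ?H k x - (1 / of_real (sqrt 2)) * ?H (Suc k) x) * ?E x" by (simp only: left_diff_distrib mult.assoc)
  also have "... = (?H k x * (- of_real x + (\<beta> - of_real y)) + of_real (2 * real k * hermite (k - 1) ?t * (1 / sqrt 2))) * ?E x"
  unfolding hs by (simp add: algebra_simps)
  finally have eq: "?g' x = ..." .
  have ring: "A * (E * B) + D * E = (A * B + D) * E" for A B D E :: complex by (simp add: algebra_simps)
  show ?thesis unfolding eq by (rule ring)
  qed
  ultimately show "((%x. ?H k x * ?E x) has_vector_derivative ?g' x) (at x)" by simp
  next
  have "continuous_on UNIV (%x. hermite j ((x + 2 * y) / sqrt 2))" for j
  by (intro continuous_on_compose2[OF hermite_continuous[of j]] continuous_intros) auto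
  then show "continuous_on UNIV ?g'" by (intro continuous_intros) auto
  qed (intro int tH Bochner_Integration.integrable_diff integrable_mult_right)+
  then have "(of_real y + \<beta>) * Imut (%x. ?H k x * ?E x) = (1 / of_real (sqrt 2)) * Imut (%x. ?H (Suc k) x * ?E x)"
  using int[OF tH] by (subst (asm) Bochner_Integration.integral_diff) (auto simp del: of_real_divide)
  then show ?thesis by (simp add: field_simps)
 qed
 show "Imut (%x. ?H k x * ?E x) = (of_real (sqrt 2) * (of_real y + \<beta>)) ^ k * exp ((\<beta> - of_real y)^2 / 2)"
 proof (induction k)
  case 0
  show ?case using gauss_1d(2)[of "\<beta> - of_real y"] by simp
 next
  case (Suc k)
  show ?case unfolding rec Suc by (simp only: power_Suc mult.assoc)
 qed
qed

section \<open>Differentiable functions and Wirtinger derivatives\<close>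

lemma C_k_SucI:
 assumes "!!x. (f has_derivative f' x) (at x)" "!!v. C_k k (%x. f' x v)"
 shows "C_k (Suc k) f"
proof -
 have "frechet_derivative f (at x) = f' x" for x using frechet_derivative_at[OF assms(1)[of x]] by simp
 then show ?thesis using assms by (auto simp: differentiable_def)
qed

lemma C_k_hd: "C_k (Suc k) f ==> (f has_derivative frechet_derivative f (at x)) (at x)"
 by (simp add: frechet_derivative_works)

lemma C_k_fd: "C_k (Suc k) f ==> C_k k (%x. frechet_derivative f (at x) v)"
 by simp

declare C_k.simps(2) [simp del]

lemma C_k_continuous: "C_k k f ==> continuous_on UNIV f"
proof (cases k)
 case (Suc j)
 assume "C_k k f"
 then show ?thesis unfolding Suc
  by (intro continuous_at_imp_continuous_on ballI has_derivative_continuous[OF C_k_hd])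
qed simp

lemma C_k_Suc_D: "C_k (Suc k) f ==> C_k k f"
proof (induction k arbitrary: f)
 case 0
 then show ?case using C_k_continuous by auto
next
 case (Suc k)
 then show ?case by (intro C_k_SucI[of f "%x. frechet_derivative f (at x)"] C_k_hd[OF Suc.prems] Suc.IH C_k_fd[OF Suc.prems])
qed

lemma C_k_mono: "C_k k f ==> j <= k ==> C_k j f"
 by (induction k) (auto simp: le_Suc_eq dest: C_k_Suc_D)

lemma C_k_const: "C_k k (%_. c)"
proof (induction k arbitrary: c)
 case (Suc k)
 show ?case by (rule C_k_SucI[of _ "%_ _. 0"]) (auto intro: Suc)
qed simp

lemma C_k_add: "C_k k f ==> C_k k g ==> C_k k (%x. f x + g x)"
proof (induction k arbitrary: f g)
 case 0
 then show ?case by (auto intro: continuous_intros)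
next
 case (Suc k)
 show ?case
  by (rule C_k_SucI[OF has_derivative_add[OF C_k_hd[OF Suc.prems(1)] C_k_hd[OF Suc.prems(2)]]])
  (intro Suc.IH C_k_fd Suc.prems)
qed

lemma C_k_mult:
 fixes f g :: "'a::real_normed_vector => complex"
 shows "C_k k f ==> C_k k g ==> C_k k (%x. f x * g x)"
proof (induction k arbitrary: f g)
 case 0
 then show ?case by (auto intro: continuous_intros)
next
 case (Suc k)
 show ?case
  by (rule C_k_SucI[OF has_derivative_mult[OF C_k_hd[OF Suc.prems(1)] C_k_hd[OF Suc.prems(2)]]])
  (intro C_k_add Suc.IH C_k_fd Suc.prems C_k_Suc_D)
qed

lemma C_k_linear:
 assumes "bounded_linear L" shows "C_k k L"
proof (cases k)
 case 0
 then show ?thesis using assms by (simp add: linear_continuous_on)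
next
 case (Suc j)
 show ?thesis unfolding Suc
  by (rule C_k_SucI[OF bounded_linear_imp_has_derivative[OF assms]]) (rule C_k_const)
qed

lemma C_k_sum: "(!!i. i \<in> I ==> C_k k (f i)) ==> C_k k (%x. SUM i:I. f i x)"
 by (induction I rule: infinite_finite_induct) (auto intro: C_k_const C_k_add)

lemma C_k_prod:
 fixes f :: "'i => 'a::real_normed_vector => complex"
 shows "(!!i. i \<in> I ==> C_k k (f i)) ==> C_k k (%x. PROD i:I. f i x)"
 by (induction I rule: infinite_finite_induct) (auto intro: C_k_const C_k_mult)

lemma C_k_power:
 fixes f :: "'a::real_normed_vector => complex"
 shows "C_k k f ==> C_k k (%x. f x ^ n)"
 by (induction n) (auto intro: C_k_const C_k_mult)

lemma C_k_exp:
 fixes f :: "'a::real_normed_vector => complex"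
 assumes "C_k k f" shows "C_k k (%x. exp (f x))"
 using assms
proof (induction k)
 case 0
 then show ?case by (auto intro: continuous_intros)
next
 case (Suc k)
 have "((%x. exp (f x)) has_derivative (%v. exp (f x) * frechet_derivative f (at x) v)) (at x)" for x
  by (rule has_derivative_compose[OF C_k_hd[OF Suc.prems, of x] DERIV_exp[unfolded has_field_derivative_def]])
 then show ?case by (rule C_k_SucI) (intro C_k_mult Suc.IH[OF C_k_Suc_D[OF Suc.prems]] C_k_fd[OF Suc.prems])
qed

lemma C_k_scale: "C_k k f ==> C_k k (%x. f (c *\<^sub>R x))"
proof (induction k arbitrary: f)
 case 0
 then show ?case by (auto intro!: continuous_on_compose2[of UNIV f] continuous_intros)
next
 case (Suc k)
 have "((%x. f (c *\<^sub>R x)) has_derivative (%v. frechet_derivative f (at (c *\<^sub>R x)) (c *\<^sub>R v))) (at x)" for x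
  by (rule has_derivative_compose[OF _ C_k_hd[OF Suc.prems]]) (auto intro!: derivative_eq_intros)
 then show ?case by (rule C_k_SucI) (intro Suc.IH C_k_fd[OF Suc.prems])
qed

lemma smoothD: "smooth f ==> C_k k f" by (simp add: smooth_def)
lemma smoothI: "(!!k. C_k k f) ==> smooth f" by (simp add: smooth_def)

lemma dbar_eq:
 assumes "(f has_derivative f') (at z)"
 shows "dbar r f z = (f' (axis r 1) + \<i> * f' (axis r \<i>)) / 2"
 unfolding dbar_def frechet_derivative_at[OF assms, symmetric] ..

lemma C_k_dbar:
 assumes "C_k (Suc k) f" shows "C_k k (dbar r f)"
proof -
 have "C_k k (%z. (1/2) * (frechet_derivative f (at z) (axis r 1) + \<i> * frechet_derivative f (at z) (axis r \<i>)))"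
  by (intro C_k_mult C_k_add C_k_const C_k_fd assms)
 then show ?thesis unfolding dbar_def by simp
qed

lemma smooth_dbar: "smooth f ==> smooth (dbar r f)"
 by (auto intro!: smoothI C_k_dbar dest: smoothD)

lemma dbar_add: "C_k (Suc k) f ==> C_k (Suc k) g ==> dbar r (%z. f z + g z) = (%z. dbar r f z + dbar r g z)"
proof (rule ext)
 fix z assume f: "C_k (Suc k) f" and g: "C_k (Suc k) g"
 show "dbar r (%z. f z + g z) z = dbar r f z + dbar r g z"
  unfolding dbar_eq[OF has_derivative_add[OF C_k_hd[OF f] C_k_hd[OF g]]] by (simp add: dbar_def algebra_simps add_divide_distrib)
qed

lemma dbar_mult: "C_k (Suc k) f ==> C_k (Suc k) g ==> dbar r (%z. f z * g z) = (%z. dbar r f z * g z + f z * dbar r g z)"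
proof (rule ext)
 fix z assume f: "C_k (Suc k) f" and g: "C_k (Suc k) g"
 show "dbar r (%z. f z * g z) z = dbar r f z * g z + f z * dbar r g z"
  unfolding dbar_eq[OF has_derivative_mult[OF C_k_hd[OF f] C_k_hd[OF g]]] by (simp add: dbar_def algebra_simps add_divide_distrib)
qed

lemma dbar_const [simp]: "dbar r (%_. c) = (%_. 0)"
 by (rule ext, subst dbar_eq[of _ "%_. 0"]) auto

lemma dbar_cmult: "C_k (Suc k) f ==> dbar r (%z. c * f z) = (%z. c * dbar r f z)"
 by (subst dbar_mult[OF C_k_const]) auto

lemma dbar_exp:
 assumes "C_k (Suc k) f" shows "dbar r (%z. exp (f z)) = (%z. exp (f z) * dbar r f z)"
proof
 fix z
 have "((%x. exp (f x)) has_derivative (%v. exp (f z) * frechet_derivative f (at z) v)) (at z)"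
  by (rule has_derivative_compose[OF C_k_hd[OF assms, of z] DERIV_exp[unfolded has_field_derivative_def]])
 from dbar_eq[OF this] show "dbar r (%z. exp (f z)) z = exp (f z) * dbar r f z"
  by (simp add: dbar_def algebra_simps)
qed

lemma dbar_scale:
 assumes "C_k (Suc k) f" shows "dbar r (%z. f (c *\<^sub>R z)) = (%z. of_real c * dbar r f (c *\<^sub>R z))"
proof
 fix z
 have h: "((%x. f (c *\<^sub>R x)) has_derivative (%v. frechet_derivative f (at (c *\<^sub>R z)) (c *\<^sub>R v))) (at z)"
  by (rule has_derivative_compose[OF _ C_k_hd[OF assms]]) (auto intro!: derivative_eq_intros)
 have l: "frechet_derivative f (at (c *\<^sub>R z)) (c *\<^sub>R v) = of_real c * frechet_derivative f (at (c *\<^sub>R z)) v" for v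
  using linear_cmul[OF has_derivative_linear[OF C_k_hd[OF assms, of "c *\<^sub>R z"]]] by (simp add: scaleR_conv_of_real)
 show "dbar r (%z. f (c *\<^sub>R z)) z = of_real c * dbar r f (c *\<^sub>R z)"
  unfolding dbar_eq[OF h] l by (simp add: dbar_def algebra_simps)
qed

lemma bl_coord: "bounded_linear (%z::complex^'n. z $ s)"
 by (rule bounded_linear_vec_nth)
lemma bl_cnj: "bounded_linear (%z::complex^'n. cnj (z $ s))"
 by (rule bounded_linear_compose[OF bounded_linear_cnj bl_coord])
lemma bl_Im: "bounded_linear (%z::complex^'n. cor (Im (z $ s)))"
 by (rule bounded_linear_compose[OF bounded_linear_of_real bounded_linear_compose[OF bounded_linear_Im bl_coord]])

lemma C_k_coord: "C_k k (%z::complex^'n. z $ s)" "C_k k (%z::complex^'n. cnj (z $ s))" "C_k k (%z::complex^'n. cor (Im (z $ s)))"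
 by (intro C_k_linear bl_coord bl_cnj bl_Im)+

lemma dbar_coord: "dbar r (%z. z $ s) = (%_. 0)"
 by (rule ext, subst dbar_eq[OF bounded_linear_imp_has_derivative[OF bl_coord]]) (auto simp: axis_def)
lemma dbar_cnj: "dbar r (%z. cnj (z $ s)) = (%_. if r = s then 1 else 0)"
 by (rule ext, subst dbar_eq[OF bounded_linear_imp_has_derivative[OF bl_cnj]]) (auto simp: axis_def)
lemma dbar_Im: "dbar r (%z. cor (Im (z $ s))) = (%_. if r = s then \<i> / 2 else 0)"
 by (rule ext, subst dbar_eq[OF bounded_linear_imp_has_derivative[OF bl_Im]]) (auto simp: axis_def)

lemma dbar_sum: "finite I ==> (!!i. i \<in> I ==> C_k (Suc k) (f i)) ==> dbar r (%z. SUM i:I. f i z) = (%z. SUM i:I. dbar r (f i) z)"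
proof (induction I rule: finite_induct)
 case (insert i I)
 then show ?case by (simp add: dbar_add[OF insert.prems C_k_sum] )
qed simp

subsection \<open>Constructing polyanalytic functions\<close>

text \<open>Functions annihilated by every word of \<open>m\<close> Wirtinger derivatives.\<close>

primrec An :: "nat => (complex^'n::finite => complex) => bool" where
 "An 0 f \<longleftrightarrow> (ALL z. f z = 0)"
| "An (Suc m) f \<longleftrightarrow> smooth f & (ALL r. An m (dbar r f))"

lemma An_smooth: "An m f ==> smooth f"
proof (cases m)
 case 0
 assume "An m f"
 then have "f = (%_. 0)" using 0 by auto
 then show ?thesis by (auto intro: smoothI C_k_const)
qed simp

lemma An_Suc: "An m f ==> An (Suc m) f"
proof (induction m arbitrary: f)
 case 0
 then have "f = (%_. 0)" by auto
 then show ?case by (auto intro: smoothI C_k_const)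
qed (auto)

lemma An_mono: "An m f ==> m <= k ==> An k f"
 by (induction k) (auto simp: le_Suc_eq simp del: An.simps intro: An_Suc)

lemma smooth_add: "smooth f ==> smooth g ==> smooth (%x. f x + g x)"
 by (auto intro!: smoothI C_k_add dest: smoothD)
lemma smooth_mult: "smooth f ==> smooth g ==> smooth (%x. f x * g x :: complex)"
 by (auto intro!: smoothI C_k_mult dest: smoothD)

lemma An_add: "An m f ==> An m g ==> An m (%z. f z + g z)"
proof (induction m arbitrary: f g)
 case (Suc m)
 then have s: "smooth f" "smooth g" by auto
 show ?case using Suc by (auto intro: smooth_add s simp: dbar_add[OF smoothD[OF s(1)] smoothD[OF s(2)]])
qed simp

lemma An_hol_mult:
 assumes h: "smooth h" "!!r. dbar r h = (%_. 0)"
 shows "An m f ==> An m (%z. h z * f z)"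
proof (induction m arbitrary: f)
 case (Suc m)
 then have s: "smooth f" by auto
 show ?case using Suc by (auto intro: smooth_mult s h simp: dbar_mult[OF smoothD[OF h(1)] smoothD[OF s]] h(2))
qed simp

lemma An_cmult: "An m f ==> An m (%z. c * f z)"
 by (rule An_hol_mult) (auto intro: smoothI C_k_const)

lemma An_sum: "(!!i. i \<in> I ==> An m (f i)) ==> finite I ==> An m (%z. SUM i:I. f i z)"
proof (induction I rule: infinite_finite_induct)
 case empty
 have "An m (%_. 0)" by (rule An_mono[of 0]) auto
 then show ?case by simp
qed (auto intro: An_add)

lemma An_Im_mult:
 fixes f :: "complex^'n::finite => complex"
 shows "An m f ==> An (Suc m) (%z. cor (Im (z $ s)) * f z)"
proof (induction m arbitrary: f)
 case 0
 then have "f = (%_. 0)" by auto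
 then show ?case by (auto intro: smoothI C_k_const)
next
 case (Suc m)
 have s: "smooth f" by (rule An_smooth[OF Suc.prems])
 have sI: "smooth (%z::complex^'n. cor (Im (z $ s)))" by (rule smoothI) (rule C_k_coord)
 have "An (Suc m) (%z. dbar r (%z. cor (Im (z $ s))) z * f z + cor (Im (z $ s)) * dbar r f z)" for r
 proof (rule An_add)
  show "An (Suc m) (%z. dbar r (%z. cor (Im (z $ s))) z * f z)"
  unfolding dbar_Im by (rule An_cmult[OF Suc.prems])
  show "An (Suc m) (%z. cor (Im (z $ s)) * dbar r f z)"
  by (rule Suc.IH) (use Suc.prems in simp)
 qed
 then have "An (Suc m) (dbar r (%z. cor (Im (z $ s)) * f z))" for r
  by (subst dbar_mult[OF smoothD[OF sI] smoothD[OF s]])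
 then show ?case using smooth_mult[OF sI s] by simp
qed

lemma An_scale: "An m f ==> An m (%z. f (c *\<^sub>R z))"
proof (induction m arbitrary: f)
 case (Suc m)
 have s: "smooth f" by (rule An_smooth[OF Suc.prems])
 have "An m (dbar r (%z. f (c *\<^sub>R z)))" for r
  unfolding dbar_scale[OF smoothD[OF s]] by (rule An_cmult[OF Suc.IH]) (use Suc.prems in simp)
 then show ?case using s by (auto intro!: smoothI C_k_scale dest: smoothD)
qed simp

lemma An_word: "An m f ==> m <= length ws ==> foldr dbar ws f z = 0"
proof (induction ws arbitrary: f m rule: rev_induct)
 case Nil
 then show ?case by simp
next
 case (snoc r ws)
 show ?case
 proof (cases m)
  case 0
  have "An (Suc 0) f" using snoc.prems 0 An_Suc by blast
  then have "An 0 (dbar r f)" by simp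
  from snoc.IH[OF this] show ?thesis by simp
 next
  case (Suc j)
  have "An j (dbar r f)" using snoc.prems Suc by simp
  from snoc.IH[OF this] show ?thesis using snoc.prems Suc by simp
 qed
qed

definition word :: "nat ^ 'n::{finite,linorder} => 'n list" where
 "word k = concat (map (%r. replicate (k $ r) r) (sorted_list_of_set UNIV))"

lemma dbar_multi_word: "dbar_multi k f = foldr dbar (word k) f"
proof -
 have r: "foldr dbar (replicate n r) g = (dbar r ^^ n) g" for n r and g :: "complex^'n => complex"
  by (induction n) auto
 have "foldr (%r. dbar r ^^ (k $ r)) rs f = foldr dbar (concat (map (%r. replicate (k $ r) r) rs)) f" for rs
  by (induction rs) (auto simp: r)
 then show ?thesis by (simp add: dbar_multi_def word_def)
qed

lemma count_word: "count_list (word k) r = k $ r"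
proof -
 have rep: "count_list (replicate n s) r = (if r = s then n else 0)" for n s by (induction n) auto
 have "distinct rs ==> count_list (concat (map (%r. replicate (k $ r) r) rs)) r = (if r \<in> set rs then k $ r else 0)" for rs
  by (induction rs) (auto simp: rep)
 from this[of "sorted_list_of_set UNIV"] show ?thesis by (simp add: word_def)
qed

lemma length_word: "length (word k) = mi_size k"
 using sum_count_set[of "word k" UNIV] by (simp add: count_word mi_size_def)

lemma An_m_analytic: "An m f ==> m_analytic m f"
 unfolding m_analytic_def dbar_multi_word by (auto intro: An_smooth An_word simp: length_word)

subsection \<open>Holomorphic Fourier integrals\<close>

definition pr :: "complex^'n => real^'n => complex" where
 "pr z xi = (SUM r:UNIV. z $ r * of_real (xi $ r))"

lemma norm_vec_of_real: "norm (vec_of_real xi) = norm xi"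
 by (simp add: vec_of_real_def norm_vec_def L2_set_def)

lemma pr_le: "cmod (pr z xi) <= norm z * norm xi"
 using cip_le[of z "vec_of_real xi"] by (simp add: norm_vec_of_real) (simp add: pr_def cip_def vec_of_real_def)

lemma pr_add: "pr (z + w) xi = pr z xi + pr w xi"
 by (simp add: pr_def algebra_simps sum.distrib)

lemma pr_measurable [measurable]: "pr z \<in> bmeas"
 unfolding pr_def by measurable

definition sexp :: "(real^'n => complex) => bool" where
 "sexp u \<longleftrightarrow> u \<in> bmeas & (ALL B. imut (%xi. cmod (u xi) * exp (B * norm xi)))"

lemma sexp_mult:
 assumes u: "sexp u" and g: "g \<in> bmeas" "!!xi. cmod (g xi) <= C * exp (c * norm xi)"
 shows "sexp (%xi. u xi * g xi)"
proof -
 have [measurable]: "u \<in> bmeas" using u by (simp add: sexp_def)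
 note [measurable] = g(1)
 have "imut (%xi. cmod (u xi * g xi) * exp (B * norm xi))" for B
 proof (rule Bochner_Integration.integrable_bound)
  show "imut (%xi. C * (cmod (u xi) * exp ((B + c) * norm xi)))" using u by (simp add: sexp_def)
  have "cmod (u xi * g xi) * exp (B * norm xi) <= C * (cmod (u xi) * exp ((B + c) * norm xi))" for xi
  proof -
  have "cmod (u xi * g xi) * exp (B * norm xi) <= (cmod (u xi) * (C * exp (c * norm xi))) * exp (B * norm xi)"
  unfolding norm_mult by (intro mult_right_mono mult_left_mono g) auto
  also have "... = C * (cmod (u xi) * (exp (B * norm xi) * exp (c * norm xi)))" by (simp only: mult_ac)
  also have "exp (B * norm xi) * exp (c * norm xi) = exp ((B + c) * norm xi)" by (simp only: distrib_right exp_add)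
  finally show ?thesis .
  qed
  then show "AE xi in mut. norm (cmod (u xi * g xi) * exp (B * norm xi)) <= norm (C * (cmod (u xi) * exp ((B + c) * norm xi)))"
  by (intro AE_I2) (use order_trans[OF _ abs_ge_self] in auto)
 qed measurable
 then show ?thesis by (simp add: sexp_def)
qed

lemma sexp_integrable:
 assumes u: "sexp u"
 shows "imut (%xi. u xi * exp (\<i> * pr z xi))"
proof (rule Bochner_Integration.integrable_bound)
 have [measurable]: "u \<in> bmeas" using u by (simp add: sexp_def)
 show "imut (%xi. cmod (u xi) * exp (norm z * norm xi))" using u by (simp add: sexp_def)
 show "(%xi. u xi * exp (\<i> * pr z xi)) \<in> borel_measurable mut" by simp
 have "cmod (exp (\<i> * pr z xi)) <= exp (norm z * norm xi)" for xi
  by (rule order_trans[OF norm_exp]) (use pr_le[of z xi] in \<open>simp add: norm_mult\<close>)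
 then show "AE xi in mut. cmod (u xi * exp (\<i> * pr z xi)) <= norm (cmod (u xi) * exp (norm z * norm xi))"
  by (intro AE_I2) (auto simp: norm_mult intro!: mult_left_mono)
qed

definition EE :: "(real^'n => complex) => complex^'n => complex" where
 "EE u z = Imut (%xi. u xi * exp (\<i> * pr z xi))"

lemma norm_exp_remainder: "cmod (exp w - 1 - w) <= (cmod w)^2 * exp (cmod w)"
proof -
 have e: "exp w - 1 - w = (\<Sum>n. w ^ (n + 2) /\<^sub>R fact (n + 2))"
  using exp_first_two_terms[of w] by (simp add: scaleR_conv_of_real)
 have s: "summable (%n. (cmod w) ^ (n + 2) /\<^sub>R fact (n + 2))"
  using summable_ignore_initial_segment[OF summable_exp_generic[of "cmod w"], of 2] by simp
 have s': "summable (%n. norm (w ^ (n + 2) /\<^sub>R fact (n + 2)))" using s by (simp add: norm_power norm_mult)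
 have "cmod (exp w - 1 - w) <= (\<Sum>n. norm (w ^ (n + 2) /\<^sub>R fact (n + 2)))"
  unfolding e by (rule summable_norm[OF s'])
 also have "... <= (\<Sum>n. (cmod w)\<^sup>2 * ((cmod w) ^ n /\<^sub>R fact n))"
 proof (rule suminf_le[OF _ s'])
  show "summable (%n. (cmod w)^2 * ((cmod w) ^ n /\<^sub>R fact n))" by (intro summable_mult summable_exp_generic)
  fix n
  have "fact n <= (fact (n + 2) :: real)" by (rule fact_mono) simp
  then have "inverse (fact (n + 2)) <= (inverse (fact n) :: real)" by (intro le_imp_inverse_le) auto
  then have "inverse (fact (n + 2)) * cmod w ^ (n + 2) <= inverse (fact n) * cmod w ^ (n + 2)"
  by (intro mult_right_mono) auto
  then show "norm (w ^ (n + 2) /\<^sub>R fact (n + 2)) <= (cmod w)^2 * ((cmod w) ^ n /\<^sub>R fact n)"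
  by (simp add: norm_power norm_mult power_add power2_eq_square mult_ac)
 qed
 also have "... = (cmod w)^2 * exp (cmod w)"
  unfolding exp_def by (rule suminf_mult[OF summable_exp_generic])
 finally show ?thesis .
qed

lemma sexp_coord:
 fixes u :: "real^'n => complex"
 shows "sexp u ==> sexp (%xi. u xi * (c * of_real (xi $ r)))"
proof (rule sexp_mult[where C="cmod c" and c=1])
 fix xi :: "real^'n"
 have "\<bar>xi $ r\<bar> <= exp (norm xi)"
  using component_le_norm_cart[of xi r] exp_ge_add_one_self[of "norm xi"] by linarith
 then show "cmod (c * of_real (xi $ r)) <= cmod c * exp (1 * norm xi)"
  by (simp add: norm_mult mult_left_mono)
qed simp_all

lemma has_derivativeI_quadratic:
 assumes L: "bounded_linear L" and b: "!!v. norm v <= 1 ==> norm (f (x + v) - f x - L v) <= C * (norm v)^2"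
 shows "(f has_derivative L) (at x)"
 unfolding has_derivative_at
proof (intro conjI L)
 have "((%h. C * norm h) \<longlongrightarrow> C * 0) (at 0)" by (intro tendsto_intros tendsto_norm_zero)
 then have l: "((%h. C * norm h) \<longlongrightarrow> 0) (at 0)" by simp
 show "(%h. norm (f (x + h) - f x - L h) / norm h) \<midarrow>0\<rightarrow> 0"
 proof (rule tendsto_sandwich[OF _ _ tendsto_const l])
  show "\<forall>\<^sub>F h in at 0. norm (f (x + h) - f x - L h) / norm h <= C * norm h"
  unfolding eventually_at
  proof (intro exI[of _ 1] conjI ballI impI)
  fix h :: 'a assume h: "h ~= 0 & dist h 0 < 1"
  then have "norm (f (x + h) - f x - L h) <= (C * norm h) * norm h"
  using b[of h] by (simp add: power2_eq_square mult.assoc)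
  then show "norm (f (x + h) - f x - L h) / norm h <= C * norm h" using h by (simp add: divide_le_eq)
  qed simp
 qed simp
qed

lemma EE_has_derivative:
 fixes u :: "real^'n => complex"
 assumes u: "sexp u"
 shows "(EE u has_derivative (%v. SUM r:UNIV. v $ r * EE (%xi. u xi * (\<i> * of_real (xi $ r))) z)) (at z)"
proof (rule has_derivativeI_quadratic)
 have [measurable]: "u \<in> bmeas" using u by (simp add: sexp_def)
 show "bounded_linear (%v. SUM r:UNIV. v $ r * EE (%xi. u xi * (\<i> * of_real (xi $ r))) z)"
  by (intro bounded_linear_sum bounded_linear_mult_const bl_coord)
 let ?C = "Imut (%xi. cmod (u xi) * exp ((norm z + 3) * norm xi))"
 fix v :: "complex^'n" assume v: "norm v <= 1"
 have s: "(SUM r:UNIV. v $ r * EE (%xi. u xi * (\<i> * of_real (xi $ r))) z) = Imut (%xi. u xi * (\<i> * pr v xi) * exp (\<i> * pr z xi))"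
 proof -
  have "(SUM r:UNIV. v $ r * EE (%xi. u xi * (\<i> * of_real (xi $ r))) z) = (SUM r:UNIV. Imut (%xi. v $ r * (u xi * (\<i> * of_real (xi $ r)) * exp (\<i> * pr z xi))))"
  unfolding EE_def by simp
  also have "... = Imut (%xi. SUM r:UNIV. v $ r * (u xi * (\<i> * of_real (xi $ r)) * exp (\<i> * pr z xi)))"
  by (rule Bochner_Integration.integral_sum[symmetric]) (intro integrable_mult_right sexp_integrable sexp_coord u)
  also have "... = Imut (%xi. u xi * (\<i> * pr v xi) * exp (\<i> * pr z xi))"
  unfolding pr_def[of v] sum_distrib_left sum_distrib_right by (simp only: mult_ac)
  finally show ?thesis .
 qed
 have i3: "imut (%xi. u xi * (\<i> * pr v xi) * exp (\<i> * pr z xi))"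
 proof -
  have "imut (%xi. SUM r:UNIV. v $ r * (u xi * (\<i> * of_real (xi $ r)) * exp (\<i> * pr z xi)))"
  by (intro Bochner_Integration.integrable_sum integrable_mult_right sexp_integrable sexp_coord u)
  moreover have "(SUM r:UNIV. v $ r * (u xi * (\<i> * of_real (xi $ r)) * exp (\<i> * pr z xi))) = u xi * (\<i> * pr v xi) * exp (\<i> * pr z xi)" for xi
  unfolding pr_def[of v] sum_distrib_left sum_distrib_right by (simp only: mult_ac)
  ultimately show ?thesis by simp
 qed
 have "EE u (z + v) - EE u z - (SUM r:UNIV. v $ r * EE (%xi. u xi * (\<i> * of_real (xi $ r))) z) =
  Imut (%xi. u xi * exp (\<i> * pr (z + v) xi) - u xi * exp (\<i> * pr z xi) - u xi * (\<i> * pr v xi) * exp (\<i> * pr z xi))"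
  unfolding s unfolding EE_def
  by (simp add: Bochner_Integration.integral_diff Bochner_Integration.integrable_diff sexp_integrable[OF u] i3)
 also have "... = Imut (%xi. u xi * exp (\<i> * pr z xi) * (exp (\<i> * pr v xi) - 1 - \<i> * pr v xi))"
  unfolding pr_add distrib_left exp_add by (rule arg_cong[where f="Imut"]) (simp add: fun_eq_iff algebra_simps)
 also have "norm ... <= Imut (%xi. (norm v)^2 * (cmod (u xi) * exp ((norm z + 3) * norm xi)))"
 proof -
  have "norm (u xi * exp (\<i> * pr z xi) * (exp (\<i> * pr v xi) - 1 - \<i> * pr v xi)) <= (norm v)^2 * (cmod (u xi) * exp ((norm z + 3) * norm xi))" for xi
  proof -
  have a: "cmod (exp (\<i> * pr z xi)) <= exp (norm z * norm xi)"
  by (rule order_trans[OF norm_exp]) (use pr_le[of z xi] in \<open>simp add: norm_mult\<close>)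
  have pv: "cmod (pr v xi) <= norm v * norm xi" by (rule pr_le)
  also have "... <= norm xi" using v by (simp add: mult_left_le_one_le)
  finally have pv1: "cmod (pr v xi) <= norm xi" .
  have x: "(norm xi)\<^sup>2 <= exp (2 * norm xi)"
  proof -
  have "norm xi <= exp (norm xi)" using exp_ge_add_one_self[of "norm xi"] by linarith
  then have "(norm xi)\<^sup>2 <= (exp (norm xi))^2" by (intro power_mono) auto
  then show ?thesis by (simp add: exp_double)
  qed
  have "cmod (exp (\<i> * pr v xi) - 1 - \<i> * pr v xi) <= (cmod (pr v xi))^2 * exp (cmod (pr v xi))"
  using norm_exp_remainder[of "\<i> * pr v xi"] by (simp add: norm_mult)
  also have "... <= (norm v * norm xi)^2 * exp (norm xi)"
  using pv pv1 by (intro mult_mono power_mono) auto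
  also have "... = (norm v)^2 * ((norm xi)^2 * exp (norm xi))" by (simp add: power_mult_distrib)
  also have "... <= (norm v)^2 * (exp (2 * norm xi) * exp (norm xi))" by (intro mult_left_mono mult_right_mono x) auto
  finally have b: "cmod (exp (\<i> * pr v xi) - 1 - \<i> * pr v xi) <= (norm v)^2 * (exp (2 * norm xi) * exp (norm xi))" .
  have "norm (u xi * exp (\<i> * pr z xi) * (exp (\<i> * pr v xi) - 1 - \<i> * pr v xi)) <= (cmod (u xi) * exp (norm z * norm xi)) * ((norm v)^2 * (exp (2 * norm xi) * exp (norm xi)))"
  unfolding norm_mult by (intro mult_mono a b order_refl mult_nonneg_nonneg) auto
  also have "... = (norm v)^2 * (cmod (u xi) * (exp (norm z * norm xi) * (exp (2 * norm xi) * exp (norm xi))))" by (simp only: mult_ac)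
  also have "exp (norm z * norm xi) * (exp (2 * norm xi) * exp (norm xi)) = exp ((norm z + 3) * norm xi)"
  unfolding exp_add[symmetric] by (rule arg_cong[where f=exp]) (simp add: algebra_simps)
  finally show ?thesis .
  qed note bound = this
  have i4: "imut (%xi. (norm v)^2 * (cmod (u xi) * exp ((norm z + 3) * norm xi)))" using u by (simp add: sexp_def)
  let ?F = "%xi. u xi * exp (\<i> * pr z xi) * (exp (\<i> * pr v xi) - 1 - \<i> * pr v xi)"
  have i5: "imut ?F"
  proof (rule Bochner_Integration.integrable_bound[OF i4])
  show "?F \<in> borel_measurable mut" by simp
  show "AE xi in mut. norm (?F xi) <= norm ((norm v)^2 * (cmod (u xi) * exp ((norm z + 3) * norm xi)))"
  by (intro AE_I2 order_trans[OF bound]) simp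
  qed
  have "norm (Imut ?F) <= Imut (%xi. norm (?F xi))" by (rule integral_norm_bound)
  also have "... <= Imut (%xi. (norm v)^2 * (cmod (u xi) * exp ((norm z + 3) * norm xi)))"
  by (intro integral_mono integrable_norm i5 i4 bound)
  finally show ?thesis .
 qed
 also have "... = ?C * (norm v)^2" by simp
 finally show "norm (EE u (z + v) - EE u z - (SUM r:UNIV. v $ r * EE (%xi. u xi * (\<i> * of_real (xi $ r))) z)) <= ?C * (norm v)^2" .
qed

lemma EE_C_k: "sexp u ==> C_k k (EE u)"
proof (induction k arbitrary: u)
 case 0
 show ?case using has_derivative_continuous[OF EE_has_derivative[OF 0]] by (auto intro: continuous_at_imp_continuous_on)
next
 case (Suc k)
 show ?case by (rule C_k_SucI[OF EE_has_derivative[OF Suc.prems]]) (intro C_k_sum C_k_mult C_k_const Suc.IH sexp_coord Suc.prems)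
qed

lemma EE_An:
 assumes u: "sexp u" shows "An 1 (EE u)"
proof -
 have "dbar s (EE u) z = 0" for s z
 proof -
  have a: "(SUM r:UNIV. axis s c $ r * EE (%xi. u xi * (\<i> * of_real (xi $ r))) z) = c * EE (%xi. u xi * (\<i> * of_real (xi $ s))) z" for c
  proof -
  have "(SUM r:UNIV. axis s c $ r * EE (%xi. u xi * (\<i> * of_real (xi $ r))) z) = (SUM r:UNIV. if r = s then c * EE (%xi. u xi * (\<i> * of_real (xi $ s))) z else 0)"
  by (intro sum.cong) (auto simp: axis_def)
  then show ?thesis by simp
  qed
  show ?thesis unfolding dbar_eq[OF EE_has_derivative[OF u]] a by simp
 qed
 then show ?thesis using EE_C_k[OF u] by (auto intro: smoothI)
qed

text \<open>Up to the factor \<open>exp(-|Im z|\<^sup>2)\<close>, this is how a combination of the functions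
\<open>q\<^bsub>k,xi\<^esub>\<close> looks after the inverse transform: the Gaussian in \<open>q\<close>
completes \<open>exp(i x \<bullet> xi)\<close> to the holomorphic \<open>exp(i z \<bullet> xi)\<close>.\<close>

definition HP :: "('n => nat) => (real^'n => complex) => complex^'n::finite => complex" where
 "HP k u z = Imut (%xi. u xi * (PROD r:UNIV. cor (hermite (k r) ((xi $ r + 2 * Im (z $ r)) / sqrt 2))) * exp (\<i> * pr z xi))"

lemma sexp_hermite:
 fixes u :: "real^'n => complex"
 assumes u: "sexp u"
 shows "sexp (%xi. u xi * (PROD r:UNIV. cor (hermite (k r) ((xi $ r + 2 * y r) / sqrt 2))))"
proof -
 have "sexp (%xi. u xi * (PROD r:R. cor (hermite (k r) ((xi $ r + 2 * y r) / sqrt 2))))" if "finite R" for R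
  using that
 proof (induction R)
  case empty
  then show ?case using u by simp
 next
  case (insert r R)
  obtain C a where C: "C >= 0" "a >= 0" "!!t. cmod (of_real (hermite (k r) t)) <= C * exp (a * \<bar>t\<bar>)" using tempE[OF temp_hermite[of "k r"]] by metis
  have "sexp (%xi. (u xi * (PROD r:R. cor (hermite (k r) ((xi $ r + 2 * y r) / sqrt 2)))) * cor (hermite (k r) ((xi $ r + 2 * y r) / sqrt 2)))"
  proof (rule sexp_mult[OF insert.IH, where C="C * exp (a * \<bar>2 * y r\<bar>)" and c=a])
  show "(%xi. cor (hermite (k r) ((xi $ r + 2 * y r) / sqrt 2))) \<in> bmeas"
  by (intro borel_measurable_continuous_onI continuous_on_of_real continuous_on_compose2[OF hermite_continuous] continuous_intros) auto
  fix xi :: "real^'n"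
  have "\<bar>(xi $ r + 2 * y r) / sqrt 2\<bar> <= \<bar>xi $ r + 2 * y r\<bar>" using divide_left_mono[of 1 "sqrt 2" "\<bar>xi $ r + 2 * y r\<bar>"] by simp
  also have "... <= norm xi + \<bar>2 * y r\<bar>" using abs_triangle_ineq[of "xi $ r" "2 * y r"] component_le_norm_cart[of xi r] by linarith
  finally have "a * \<bar>(xi $ r + 2 * y r) / sqrt 2\<bar> <= a * (norm xi + \<bar>2 * y r\<bar>)" using C(2) by (rule mult_left_mono)
  then have "C * exp (a * \<bar>(xi $ r + 2 * y r) / sqrt 2\<bar>) <= C * exp (a * (norm xi + \<bar>2 * y r\<bar>))" using C(1) by (simp add: mult_left_mono)
  with C(3) have "cmod (cor (hermite (k r) ((xi $ r + 2 * y r) / sqrt 2))) <= C * exp (a * (norm xi + \<bar>2 * y r\<bar>))" by (rule order_trans)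
  moreover have "exp (a * (norm xi + \<bar>2 * y r\<bar>)) = exp (a * \<bar>2 * y r\<bar>) * exp (a * norm xi)" by (simp only: distrib_left exp_add mult.commute)
  ultimately show "cmod (cor (hermite (k r) ((xi $ r + 2 * y r) / sqrt 2))) <= C * exp (a * \<bar>2 * y r\<bar>) * exp (a * norm xi)"
  by (simp only: mult.assoc)
  qed
  then show ?case unfolding prod.insert[OF insert(1,2)] by (simp only: mult_ac)
 qed
 then show ?thesis by simp
qed

text \<open>The Hermite factors contribute one degree in the imaginary parts \<open>y\<^sub>r\<close> each, by the three-term
 recursion; everything else is holomorphic.\<close>

lemma HP_An:
 fixes k :: "'n::finite => nat"
 shows "sexp u ==> An (Suc (SUM r:UNIV. k r)) (HP k u)"
proof (induction "SUM r:UNIV. k r" arbitrary: k u rule: less_induct)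
 case less
 show ?case
 proof (cases "ALL r. k r = 0")
  case True
  then have "HP k u = EE u" by (simp add: HP_def EE_def fun_eq_iff)
  then show ?thesis using EE_An[OF less.prems] True by simp
 next
  case False
  then obtain r j where r: "k r = Suc j" using not0_implies_Suc by blast
  define k' where "k' = k(r := j)"
  define k'' where "k'' = k(r := j - 1)"
  have sum_split: "(SUM s:UNIV. l s) = l r + (SUM s:UNIV - {r}. l s)" for l :: "'n => nat"
  by (rule sum.remove) auto
  have c: "(SUM s:UNIV - {r}. k' s) = (SUM s:UNIV - {r}. k s)" "(SUM s:UNIV - {r}. k'' s) = (SUM s:UNIV - {r}. k s)"
  by (auto intro!: sum.cong simp: k'_def k''_def)
  have s': "Suc (SUM s:UNIV. k' s) = (SUM s:UNIV. k s)" "(SUM s:UNIV. k'' s) <= (SUM s:UNIV. k' s)"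
  unfolding sum_split[of k] sum_split[of k'] sum_split[of k''] c by (simp_all add: r k'_def k''_def)
  let ?P = "%k z xi. PROD s:UNIV. cor (hermite (k s) ((xi $ s + 2 * Im (z $ s)) / sqrt 2))"
  have P: "?P k z xi = of_real (sqrt 2) * of_real (xi $ r) * ?P k' z xi + 2 * of_real (sqrt 2) * of_real (Im (z $ r)) * ?P k' z xi - 2 * of_nat j * ?P k'' z xi" for z xi
  proof -
  let ?R = "PROD s:UNIV - {r}. cor (hermite (k s) ((xi $ s + 2 * Im (z $ s)) / sqrt 2))"
  let ?t = "(xi $ r + 2 * Im (z $ r)) / sqrt 2"
  have sp: "?P l z xi = of_real (hermite (l r) ?t) * (PROD s:UNIV - {r}. cor (hermite (l s) ((xi $ s + 2 * Im (z $ s)) / sqrt 2)))" for l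
  by (rule prod.remove) auto
  have R: "(PROD s:UNIV - {r}. cor (hermite (k' s) ((xi $ s + 2 * Im (z $ s)) / sqrt 2))) = ?R"
  "(PROD s:UNIV - {r}. cor (hermite (k'' s) ((xi $ s + 2 * Im (z $ s)) / sqrt 2))) = ?R"
  by (auto intro!: prod.cong simp: k'_def k''_def)
  have s2: "2 / sqrt 2 = sqrt 2" by (rule real_div_sqrt) simp
  have "2 * ?t = (2 / sqrt 2) * (xi $ r + 2 * Im (z $ r))" by (simp only: times_divide_eq_left times_divide_eq_right)
  then have t: "2 * ?t = sqrt 2 * (xi $ r) + 2 * sqrt 2 * Im (z $ r)" unfolding s2 by (simp add: algebra_simps)
  have "hermite (Suc j) ?t = (sqrt 2 * (xi $ r) + 2 * sqrt 2 * Im (z $ r)) * hermite j ?t - 2 * real j * hermite (j - 1) ?t"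
  unfolding hermite_rec t ..
  then have h: "cor (hermite (k r) ?t) = (of_real (sqrt 2) * of_real (xi $ r) + 2 * of_real (sqrt 2) * of_real (Im (z $ r))) * of_real (hermite j ?t) - 2 * of_nat j * of_real (hermite (j - 1) ?t)"
  unfolding r by simp
  show ?thesis unfolding sp[of k] sp[of k'] sp[of k''] R h
  by (simp add: k'_def k''_def left_diff_distrib distrib_right mult.assoc)
  qed
  have i: "sexp u ==> imut (%xi. u xi * ?P k z xi * exp (\<i> * pr z xi))" for u k z
  by (intro sexp_integrable sexp_hermite)
  let ?u = "%xi. u xi * (of_real (sqrt 2) * of_real (xi $ r))"
  have su: "sexp ?u" by (rule sexp_coord[OF less.prems])
  have eq: "HP k u = (%z. (HP k' ?u z + 2 * of_real (sqrt 2) * (of_real (Im (z $ r)) * HP k' u z)) + (- 2 * of_nat j) * HP k'' u z)"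
  proof
  fix z
  have "u xi * ?P k z xi * exp (\<i> * pr z xi) = ?u xi * ?P k' z xi * exp (\<i> * pr z xi) + (2 * of_real (sqrt 2) * of_real (Im (z $ r))) * (u xi * ?P k' z xi * exp (\<i> * pr z xi))
  + (- 2 * of_nat j) * (u xi * ?P k'' z xi * exp (\<i> * pr z xi))" for xi
  unfolding P by (simp add: algebra_simps)
  then show "HP k u z = (HP k' ?u z + 2 * of_real (sqrt 2) * (of_real (Im (z $ r)) * HP k' u z)) + (- 2 * of_nat j) * HP k'' u z"
  unfolding HP_def using i[OF su, of k' z] i[OF less.prems, of k' z] i[OF less.prems, of k'' z]
  by (simp only: Bochner_Integration.integral_add Bochner_Integration.integrable_add integrable_mult_right integral_mult_right_zero mult.assoc)
  qed
  show ?thesis unfolding eq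
  proof (intro An_add)
  show "An (Suc (SUM s:UNIV. k s)) (HP k' ?u)"
  by (rule An_mono[OF less.hyps[OF _ su]]) (use s' in auto)
  show "An (Suc (SUM s:UNIV. k s)) (%z. 2 * of_real (sqrt 2) * (of_real (Im (z $ r)) * HP k' u z))"
  by (rule An_cmult, rule An_mono[OF An_Im_mult[OF less.hyps[OF _ less.prems]]]) (use s' in auto)
  show "An (Suc (SUM s:UNIV. k s)) (%z. (- 2 * of_nat j) * HP k'' u z)"
  by (rule An_cmult, rule An_mono[OF less.hyps[OF _ less.prems]]) (use s' in auto)
  qed
 qed
qed

section \<open>Integration by parts against Gaussians\<close>

definition csupp :: "('a::real_normed_vector => complex) => bool" where
 "csupp f \<longleftrightarrow> (EX R. ALL z. R < norm z --> f z = 0)"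

lemma csupp_integrable:
 fixes g :: "'a::euclidean_space => complex"
 assumes c: "continuous_on UNIV g" and s: "csupp g"
 shows "integrable lborel g"
proof -
 obtain R where R: "!!z. R < norm z ==> g z = 0" using s by (auto simp: csupp_def)
 have "integrable lborel (%z. indicator (cball 0 R) z *\<^sub>R g z)"
  by (rule borel_integrable_compact) (auto intro: continuous_on_subset[OF c])
 moreover have "indicator (cball 0 R) z *\<^sub>R g z = g z" for z using R[of z] by (auto simp: indicator_def)
 ultimately show ?thesis by simp
qed

lemma csupp_mult: "csupp g ==> csupp (%z. f z * g z)" "csupp g ==> csupp (%z. g z * f z)"
 by (auto simp: csupp_def)

lemma csupp_fd:
 assumes s: "csupp f" and f: "C_k (Suc k) f"
 shows "EX R. ALL z. R < norm z --> (ALL v. frechet_derivative f (at z) v = 0)"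
proof -
 obtain R where R: "!!z. R < norm z ==> f z = 0" using s by (auto simp: csupp_def)
 have o: "open {z. R < norm z}" by (intro open_Collect_less continuous_intros)
 have "frechet_derivative f (at z) v = 0" if z: "R < norm z" for z v
 proof -
  have "((%_. 0) has_derivative (%_. 0)) (at z)" by simp
  then have "(f has_derivative (%_. 0)) (at z)"
  by (rule has_derivative_transform_within_open[OF _ o]) (use z R in auto)
  from frechet_derivative_at[OF this] show ?thesis by (metis)
 qed
 then show ?thesis by blast
qed

lemma csupp_dbar: "csupp f ==> C_k (Suc k) f ==> csupp (dbar r f)"
 using csupp_fd[of f k] unfolding csupp_def dbar_def by (metis add_0 div_0 mult_zero_right)

lemma csupp_scale:
 assumes "csupp f" "c > 0" shows "csupp (%z. f (c *\<^sub>R z))"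
proof -
 obtain R where R: "!!z. R < norm z ==> f z = 0" using assms by (auto simp: csupp_def)
 show ?thesis unfolding csupp_def
  by (rule exI[of _ "R / c"]) (use R assms in \<open>auto simp: divide_less_eq mult.commute\<close>)
qed

lemma integral_dbar_mult:
 fixes F \<Phi> :: "complex^'n => complex"
 assumes F: "C_k (Suc 0) F" and P: "C_k (Suc 0) \<Phi>" and s: "csupp \<Phi>"
 shows "Ilb (%z. dbar r F z * \<Phi> z) = - Ilb (%z. F z * dbar r \<Phi> z)"
proof -
 let ?G = "%z. F z * \<Phi> z"
 have G: "C_k (Suc 0) ?G" by (intro C_k_mult F P)
 have sG: "csupp ?G" by (rule csupp_mult(1)[OF s])
 have fd: "integrable lborel (%z. frechet_derivative ?G (at z) v)" "Ilb (%z. frechet_derivative ?G (at z) v) = 0" for v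
 proof -
  have c: "continuous_on UNIV (%z. frechet_derivative ?G (at z) v)" by (rule C_k_continuous[OF C_k_fd[OF G]])
  have "csupp (%z. frechet_derivative ?G (at z) v)" using csupp_fd[OF sG G] unfolding csupp_def by metis
  then show i: "integrable lborel (%z. frechet_derivative ?G (at z) v)" by (rule csupp_integrable[OF c])
  show "Ilb (%z. frechet_derivative ?G (at z) v) = 0"
  by (rule integral_directional_derivative_eq_0[OF C_k_hd[OF G] c csupp_integrable[OF C_k_continuous[OF G] sG] i])
 qed
 have "Ilb (dbar r ?G) = 0"
  unfolding dbar_def using fd by simp
 moreover have "dbar r ?G = (%z. dbar r F z * \<Phi> z + F z * dbar r \<Phi> z)" by (rule dbar_mult[OF F P])
 moreover have "integrable lborel (%z. dbar r F z * \<Phi> z)" "integrable lborel (%z. F z * dbar r \<Phi> z)"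
  by (intro csupp_integrable csupp_mult s csupp_dbar[OF s P] continuous_intros C_k_continuous[OF F] C_k_continuous[OF P] C_k_continuous[OF C_k_dbar[OF F]] C_k_continuous[OF C_k_dbar[OF P]])+
 ultimately show ?thesis by (simp add: eq_neg_iff_add_eq_0)
qed

lemma smooth_foldr_dbar: "smooth f ==> smooth (foldr dbar ws f)"
 by (induction ws) (auto intro: smooth_dbar)

lemma C_k_fold_dbar: "C_k (length ws + k) f ==> C_k k (fold dbar ws f)"
 by (induction ws arbitrary: f) (auto intro: C_k_dbar)

lemma csupp_fold_dbar: "C_k (length ws) f ==> csupp f ==> csupp (fold dbar ws f)"
 by (induction ws arbitrary: f) (auto intro: C_k_dbar csupp_dbar)

lemma fold_dbar_add: "C_k (length ws) f ==> C_k (length ws) g ==> fold dbar ws (%z. f z + g z) = (%z. fold dbar ws f z + fold dbar ws g z)"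
 by (induction ws arbitrary: f g) (auto simp: dbar_add intro: C_k_dbar)

lemma fold_dbar_cmult: "C_k (length ws) f ==> fold dbar ws (%z. c * f z) = (%z. c * fold dbar ws f z)"
 by (induction ws arbitrary: f) (auto simp: dbar_cmult intro: C_k_dbar)

lemma integral_dbar_word:
 fixes f \<Phi> :: "complex^'n => complex"
 assumes f: "smooth f"
 shows "C_k (length ws) \<Phi> ==> csupp \<Phi> ==>
  Ilb (%z. foldr dbar ws f z * \<Phi> z) = (-1) ^ length ws * Ilb (%z. f z * fold dbar ws \<Phi> z)"
proof (induction ws arbitrary: \<Phi>)
 case (Cons r ws)
 have P1: "C_k (Suc 0) \<Phi>" by (rule C_k_mono[OF Cons.prems(1)]) simp
 have P: "C_k (Suc (length ws)) \<Phi>" using Cons.prems(1) by simp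
 have "Ilb (%z. foldr dbar (r # ws) f z * \<Phi> z) = - Ilb (%z. foldr dbar ws f z * dbar r \<Phi> z)"
  using integral_dbar_mult[OF smoothD[OF smooth_foldr_dbar[OF f]] P1 Cons.prems(2)] by simp
 also have "... = - ((-1) ^ length ws * Ilb (%z. f z * fold dbar ws (dbar r \<Phi>) z))"
  using Cons.IH[OF C_k_dbar[OF P] csupp_dbar[OF Cons.prems(2) P]] by simp
 finally show ?case by simp
qed simp

subsection \<open>Cut-off functions\<close>

lemma max_power_deriv:
 assumes N: "N >= 2" shows "((%t::real. max 0 t ^ N) has_real_derivative real N * max 0 t ^ (N - 1)) (at t)"
proof -
 consider "t > 0" | "t < 0" | "t = 0" by linarith
 then show ?thesis
 proof cases
  case 1
  have "((%t. t ^ N) has_real_derivative real N * t ^ (N - 1)) (at t)" by (auto intro!: derivative_eq_intros)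
  then have "((%t. max 0 t ^ N) has_real_derivative real N * t ^ (N - 1)) (at t)"
  by (rule has_field_derivative_transform_within_open[of _ _ _ "{0<..}"]) (use 1 in auto)
  then show ?thesis using 1 by simp
 next
  case 2
  have "((%t. 0) has_real_derivative 0) (at t)" by simp
  then have "((%t. max 0 t ^ N) has_real_derivative 0) (at t)"
  by (rule has_field_derivative_transform_within_open[of _ _ _ "{..<0}"]) (use 2 N in auto)
  moreover have "N - 1 ~= 0" using N by simp
  ultimately show ?thesis using 2 by (simp add: power_0_left)
 next
  case 3
  have "((%t::real. max 0 t ^ N) has_derivative (%_. 0)) (at 0)"
  proof (rule has_derivativeI_quadratic[where C=1])
  fix v :: real assume v: "norm v <= 1"
  have "max 0 v ^ N <= max 0 v ^ 2" by (rule power_decreasing) (use N v in auto)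
  also have "... <= v^2" by (cases "v >= 0") auto
  finally have "max 0 v ^ N <= v^2" .
  then show "norm (max 0 (0 + v) ^ N - max 0 0 ^ N - 0) <= 1 * (norm v)^2" using N by (simp add: power_0_left)
  qed simp
  then have "((%t. max 0 t ^ N) has_real_derivative 0) (at 0)" by (simp add: has_field_derivative_def lambda_zero)
  moreover have "N - 1 ~= 0" using N by simp
  ultimately show ?thesis using 3 by (simp add: power_0_left)
 qed
qed

lemma cutoff_C_k:
 fixes p :: "'a::euclidean_space => complex"
 shows "k + 1 <= N ==> C_k k p ==> C_k k (%z. cor (max 0 (1 - z \<bullet> z) ^ N) * p z)"
proof (induction k arbitrary: N p)
 case 0
 then show ?case by (auto intro!: continuous_intros)
next
 case (Suc k)
 have N: "N >= 2" using Suc.prems by simp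
 have d1: "((%z::'a. cor (max 0 (1 - z \<bullet> z) ^ N)) has_derivative (%v. cor ((real N * max 0 (1 - z \<bullet> z) ^ (N - 1)) * (- 2 * (z \<bullet> v))))) (at z)" for z
 proof -
  have "((%z. 1 - z \<bullet> z) has_derivative (%v. - 2 * (z \<bullet> v))) (at z)"
  by (auto intro!: derivative_eq_intros simp: inner_commute)
  from has_derivative_compose[OF this max_power_deriv[OF N, of "1 - z \<bullet> z", unfolded has_field_derivative_def]]
  have "((%z. max 0 (1 - z \<bullet> z) ^ N) has_derivative (%v. (real N * max 0 (1 - z \<bullet> z) ^ (N - 1)) * (- 2 * (z \<bullet> v)))) (at z)" .
  from has_derivative_of_real[OF this] show ?thesis .
 qed
 have l: "C_k k (%z::'a. cor (z \<bullet> v))" for v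
  by (rule C_k_linear) (intro bounded_linear_compose[OF bounded_linear_of_real] bounded_linear_inner_left)
 show ?case
 proof (rule C_k_SucI[OF has_derivative_mult[OF d1 C_k_hd[OF Suc.prems(2)]]])
  fix v
  have "C_k k (%z. cor (max 0 (1 - z \<bullet> z) ^ N) * frechet_derivative p (at z) v + cor (max 0 (1 - z \<bullet> z) ^ (N - 1)) * (of_real (real N) * (-2) * of_real (z \<bullet> v) * p z))"
  using Suc.prems by (intro C_k_add Suc.IH C_k_mult C_k_const C_k_fd[OF Suc.prems(2)] l C_k_Suc_D[OF Suc.prems(2)]) auto
  then show "C_k k (%z. cor (max 0 (1 - z \<bullet> z) ^ N) * frechet_derivative p (at z) v + cor (real N * max 0 (1 - z \<bullet> z) ^ (N - 1) * (- 2 * (z \<bullet> v))) * p z)"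
  by (simp add: mult_ac)
 qed
qed

lemma cutoff_exists:
 obtains eta :: "'a::euclidean_space => complex" where "C_k k eta" "csupp eta" "eta 0 = 1"
proof
 let ?eta = "%z::'a. cor (max 0 (1 - z \<bullet> z) ^ (k + 1)) * 1"
 show "C_k k ?eta" by (rule cutoff_C_k[OF _ C_k_const]) simp
 show "csupp ?eta" unfolding csupp_def
 proof (intro exI[of _ 1] allI impI)
  fix z :: 'a assume "1 < norm z"
  then have "1 <= z \<bullet> z" by (simp add: dot_square_norm)
  then show "?eta z = 0" by simp
 qed
 show "?eta 0 = 1" by simp
qed

subsection \<open>Raising operators on Gaussians\<close>

text \<open>The functions that arise, up to scalars, from the exponential below by repeated Wirtinger derivatives:
each derivative raises one exponent \<open>k r\<close> by one.\<close>

definition Pf :: "real => real^'n => ('n => nat) => complex^'n => complex" where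
 "Pf al c k z = (PROD r:UNIV. (of_real (sqrt al) * z $ r - of_real (c $ r)) ^ k r) *
  exp (SUM r:UNIV. - of_real al * (z $ r * cnj (z $ r)) + of_real (sqrt al) * of_real (c $ r) * cnj (z $ r))"

lemma C_k_affine: "C_k j (%z::complex^'n. a * z $ r - b)"
proof -
 have "C_k j (%z::complex^'n. a * z $ r + (- b))" by (intro C_k_add C_k_mult C_k_const C_k_coord)
 then show ?thesis by simp
qed

lemma C_k_Q: "C_k j (%z::complex^'n. - of_real al * (z $ r * cnj (z $ r)) + of_real (sqrt al) * of_real (c $ r) * cnj (z $ r))"
 by (intro C_k_add C_k_mult C_k_const C_k_coord)

lemma Pf_C_k: "C_k j (Pf al c k)"
 unfolding Pf_def[abs_def] by (intro C_k_mult C_k_prod C_k_power C_k_affine C_k_exp C_k_sum C_k_Q)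

lemma dbar_power_hol: "C_k (Suc j) f ==> dbar r f = (%_. 0) ==> dbar r (%z. f z ^ n) = (%_. 0)"
proof (induction n)
 case (Suc n)
 have "C_k (Suc j) (%z. f z ^ n)" by (rule C_k_power[OF Suc.prems(1)])
 from dbar_mult[OF Suc.prems(1) this, of r] Suc show ?case by simp
qed (simp add: dbar_const)

lemma dbar_prod_hol: "(!!i. i \<in> I ==> C_k (Suc j) (f i)) ==> (!!i. i \<in> I ==> dbar r (f i) = (%_. 0)) ==> dbar r (%z. PROD i:I. f i z) = (%_. 0)"
proof (induction I rule: infinite_finite_induct)
 case (insert i I)
 then show ?case by (simp add: dbar_mult[OF insert.prems(1) C_k_prod[OF insert.prems(1)]])
qed auto

lemma dbar_affine: "dbar s (%z::complex^'n. a * z $ r - b) = (%_. 0)"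
proof -
 have "dbar s (%z::complex^'n. a * z $ r + (- b)) = (%z. dbar s (%z. a * z $ r) z + dbar s (%_. - b) z)"
  by (rule dbar_add[of 0]) (intro C_k_mult C_k_const C_k_coord)+
 also have "dbar s (%z::complex^'n. a * z $ r) = (%z. a * dbar s (%z. z $ r) z)" by (rule dbar_cmult[of 0]) (rule C_k_coord)
 finally show ?thesis by (simp add: dbar_coord)
qed

lemma dbar_Q: "dbar s (%z::complex^'n. - of_real al * (z $ r * cnj (z $ r)) + of_real (sqrt al) * of_real (c $ r) * cnj (z $ r)) =
 (%z. if s = r then - of_real al * z $ r + of_real (sqrt al) * of_real (c $ r) else 0)"
proof -
 have 1: "dbar s (%z::complex^'n. - of_real al * (z $ r * cnj (z $ r))) = (%z. - of_real al * dbar s (%z. z $ r * cnj (z $ r)) z)"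
  by (rule dbar_cmult[of 0]) (intro C_k_mult C_k_coord)
 have 2: "dbar s (%z::complex^'n. z $ r * cnj (z $ r)) = (%z. dbar s (%z. z $ r) z * cnj (z $ r) + z $ r * dbar s (%z. cnj (z $ r)) z)"
  by (rule dbar_mult[of 0]) (intro C_k_coord)+
 have 3: "dbar s (%z::complex^'n. of_real (sqrt al) * of_real (c $ r) * cnj (z $ r)) = (%z. of_real (sqrt al) * of_real (c $ r) * dbar s (%z. cnj (z $ r)) z)"
  by (rule dbar_cmult[of 0]) (intro C_k_coord)
 have "dbar s (%z::complex^'n. - of_real al * (z $ r * cnj (z $ r)) + of_real (sqrt al) * of_real (c $ r) * cnj (z $ r)) =
  (%z. dbar s (%z. - of_real al * (z $ r * cnj (z $ r))) z + dbar s (%z. of_real (sqrt al) * of_real (c $ r) * cnj (z $ r)) z)"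
  by (rule dbar_add[of 0]) (intro C_k_mult C_k_const C_k_coord)+
 then show ?thesis unfolding 1 2 3 dbar_coord dbar_cnj by (simp add: fun_eq_iff)
qed

lemma dbar_Pf:
 fixes c :: "real^'n"
 assumes a: "al > 0"
 shows "dbar r (Pf al c k) = (%z. - of_real (sqrt al) * Pf al c (k(r := Suc (k r))) z)"
proof
 fix z
 let ?A = "%k (z::complex^'n). PROD s:UNIV. (of_real (sqrt al) * z $ s - of_real (c $ s)) ^ k s"
 let ?Q = "%z::complex^'n. SUM s:UNIV. - of_real al * (z $ s * cnj (z $ s)) + of_real (sqrt al) * of_real (c $ s) * cnj (z $ s)"
 have A0: "dbar r (?A k) = (%_. 0)"
  by (rule dbar_prod_hol[of _ 0]) (auto intro!: C_k_power C_k_affine dbar_power_hol[of 0] dbar_affine)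
 have CA: "C_k j (?A k)" for j by (intro C_k_prod C_k_power C_k_affine)
 have CQ: "C_k j ?Q" for j by (intro C_k_sum C_k_Q)
 have Q: "dbar r ?Q z = - of_real al * z $ r + of_real (sqrt al) * of_real (c $ r)"
  by (subst dbar_sum[of _ 0, OF _ C_k_Q]) (simp_all only: dbar_Q finite, simp)
 have ss: "cor al = of_real (sqrt al) * of_real (sqrt al)" using a by (simp flip: of_real_mult)
 have Q': "dbar r ?Q z = - of_real (sqrt al) * (of_real (sqrt al) * z $ r - of_real (c $ r))"
  unfolding Q unfolding ss by (simp add: algebra_simps)
 have e: "?A (k(r := Suc (k r))) z = (of_real (sqrt al) * z $ r - of_real (c $ r)) * ?A k z"
 proof -
  have sp: "?A l z = (of_real (sqrt al) * z $ r - of_real (c $ r)) ^ l r * (PROD s:UNIV - {r}. (of_real (sqrt al) * z $ s - of_real (c $ s)) ^ l s)" for l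
  by (rule prod.remove) auto
  have "(PROD s:UNIV - {r}. (of_real (sqrt al) * z $ s - of_real (c $ s)) ^ (k(r := Suc (k r))) s) = (PROD s:UNIV - {r}. (of_real (sqrt al) * z $ s - of_real (c $ s)) ^ k s)"
  by (rule prod.cong) auto
  then show ?thesis unfolding sp[of k] sp[of "k(r := Suc (k r))"] by simp
 qed
 have "dbar r (Pf al c k) z = dbar r (?A k) z * exp (?Q z) + ?A k z * (exp (?Q z) * dbar r ?Q z)"
  unfolding Pf_def[abs_def] dbar_mult[OF CA C_k_exp[OF CQ, of "Suc 0"]] dbar_exp[OF CQ[of "Suc 0"]] ..
 then show "dbar r (Pf al c k) z = - of_real (sqrt al) * Pf al c (k(r := Suc (k r))) z"
  unfolding A0 Q' Pf_def e by (simp add: mult_ac)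
qed

lemma Pf_bound:
 assumes a: "al > 0"
 obtains C b where "C >= 0" "!!z. cmod (Pf al c k z) <= C * exp (b * norm z) * exp (- al * (norm z)^2)"
proof -
 define B where "B = (SUM r:UNIV. \<bar>c $ r\<bar>)"
 define K where "K = (SUM r:UNIV. k r)"
 have B0: "B >= 0" by (simp add: B_def sum_nonneg)
 have cB: "\<bar>c $ r\<bar> <= B" for r unfolding B_def by (rule member_le_sum) auto
 have zr: "cmod (z $ r) <= norm z" for z :: "complex^'a" and r by (rule Finite_Cartesian_Product.norm_nth_le)
 have "cmod (Pf al c k z) <= exp (B * real K) * exp ((sqrt al * real K + sqrt al * B) * norm z) * exp (- al * (norm z)^2)" for z
 proof -
  let ?w = "sqrt al * norm z + B"
  have "cmod (PROD r:UNIV. (of_real (sqrt al) * z $ r - of_real (c $ r)) ^ k r) = (PROD r:UNIV. cmod (of_real (sqrt al) * z $ r - of_real (c $ r)) ^ k r)"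
  by (simp add: prod_norm[symmetric] norm_power)
  also have "... <= (PROD r:UNIV. exp ?w ^ k r)"
  proof (rule prod_mono, intro conjI power_mono)
  fix r
  have "cmod (of_real (sqrt al) * z $ r - of_real (c $ r)) <= sqrt al * cmod (z $ r) + \<bar>c $ r\<bar>"
  by (rule order_trans[OF norm_triangle_ineq4]) (use a in \<open>simp add: norm_mult\<close>)
  also have "... <= ?w" using a zr[of z r] cB[of r] by (intro add_mono mult_left_mono) auto
  also have "... <= exp ?w" using exp_ge_add_one_self[of ?w] by linarith
  finally show "cmod (of_real (sqrt al) * z $ r - of_real (c $ r)) <= exp ?w" .
  qed auto
  also have "... = exp (real K * ?w)" by (simp only: K_def power_sum[symmetric] exp_of_nat_mult)
  finally have 1: "cmod (PROD r:UNIV. (of_real (sqrt al) * z $ r - of_real (c $ r)) ^ k r) <= exp (real K * ?w)" .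
  have "Re (SUM r:UNIV. - of_real al * (z $ r * cnj (z $ r)) + of_real (sqrt al) * of_real (c $ r) * cnj (z $ r)) =
  (SUM r:UNIV. - al * (cmod (z $ r))^2 + sqrt al * (c $ r) * Re (z $ r))"
  by (simp add: cmod_power2) (simp add: power2_eq_square)
  also have "... <= (SUM r:UNIV. - al * (cmod (z $ r))^2 + sqrt al * \<bar>c $ r\<bar> * norm z)"
  proof (rule sum_mono)
  fix r
  have "(c $ r) * Re (z $ r) <= \<bar>c $ r\<bar> * norm z"
  proof -
  have "\<bar>Re (z $ r)\<bar> <= norm z" using abs_Re_le_cmod[of "z $ r"] zr[of z r] by linarith
  then have "\<bar>(c $ r) * Re (z $ r)\<bar> <= \<bar>c $ r\<bar> * norm z" unfolding abs_mult by (intro mult_left_mono) auto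
  then show ?thesis by linarith
  qed
  then show "- al * (cmod (z $ r))^2 + sqrt al * (c $ r) * Re (z $ r) <= - al * (cmod (z $ r))^2 + sqrt al * \<bar>c $ r\<bar> * norm z"
  using a by (simp add: mult.assoc)
  qed
  also have "... = - al * (norm z)^2 + sqrt al * B * norm z"
  by (simp add: sum.distrib B_def norm_vec_def L2_set_def sum_nonneg sum_distrib_left sum_distrib_right sum_negf sum_subtractf)
  finally have 2: "cmod (exp (SUM r:UNIV. - of_real al * (z $ r * cnj (z $ r)) + of_real (sqrt al) * of_real (c $ r) * cnj (z $ r))) <= exp (- al * (norm z)^2 + sqrt al * B * norm z)"
  by (simp add: norm_exp_eq_Re)
  have "cmod (Pf al c k z) <= exp (real K * ?w) * exp (- al * (norm z)^2 + sqrt al * B * norm z)"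
  unfolding Pf_def norm_mult by (intro mult_mono 1 2) auto
  also have "... = exp (B * real K) * exp ((sqrt al * real K + sqrt al * B) * norm z) * exp (- al * (norm z)^2)"
  unfolding exp_add[symmetric] by (rule arg_cong[where f=exp]) (simp add: algebra_simps)
  finally show ?thesis .
 qed
 then show ?thesis using that[of "exp (B * real K)" "sqrt al * real K + sqrt al * B"] by simp
qed

lemma fock_Pf_integrable:
 fixes f :: "complex^'n => complex"
 assumes a: "al > 0" and f: "continuous_on UNIV f" and i: "integrable lborel (%z. (cmod (f z))^2 * exp (- al * (norm z)^2))"
 shows "integrable lborel (%z. f z * Pf al c k z)"
proof -
 obtain C b where C: "C >= 0" "!!z. cmod (Pf al c k z) <= C * exp (b * norm z) * exp (- al * (norm z)^2)"
  using Pf_bound[OF a] by blast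
 have fm: "f \<in> bmeas" by (rule borel_measurable_continuous_onI[OF f])
 have Pm: "Pf al c k \<in> bmeas" by (rule borel_measurable_continuous_onI[OF C_k_continuous[OF Pf_C_k]])
 have g: "integrable lborel (%z::complex^'n. exp (- al * (norm z)^2 / 2))"
  using integrable_norm[OF gauss_fourier(1)[of "sqrt al" "0::complex^'n"]] a
  by (simp add: integrable_mut power_mult_distrib)
 show ?thesis
 proof (rule Bochner_Integration.integrable_bound)
  show "integrable lborel (%z. ((cmod (f z))^2 * exp (- al * (norm z)^2) + (C^2 * exp (2 * b^2 / al)) * exp (- al * (norm z)^2 / 2)) / 2)"
  by (intro integrable_divide Bochner_Integration.integrable_add i integrable_mult_right g)
  show "(%z. f z * Pf al c k z) \<in> borel_measurable lborel" using fm Pm by simp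
  have "cmod (f z * Pf al c k z) <= ((cmod (f z))^2 * exp (- al * (norm z)^2) + (C^2 * exp (2 * b^2 / al)) * exp (- al * (norm z)^2 / 2)) / 2" for z
  proof -
  define t where "t = norm z"
  define E where "E = exp (- al * t^2 / 2)"
  have EE: "exp (- al * t^2) = E * E" unfolding E_def exp_add[symmetric] by simp
  have "cmod (f z * Pf al c k z) <= cmod (f z) * (C * exp (b * t) * (E * E))"
  unfolding norm_mult EE[symmetric] t_def by (intro mult_left_mono C) auto
  also have "... = norm (cmod (f z) * E) * norm (C * exp (b * t) * E)" using C(1) by (simp add: E_def mult_ac)
  also have "... <= ((norm (cmod (f z) * E))^2 + (norm (C * exp (b * t) * E))^2) / 2" by (rule mult_le_sq)
  also have "(norm (cmod (f z) * E))\<^sup>2 = (cmod (f z))^2 * exp (- al * t^2)" unfolding EE by (simp add: power2_eq_square mult_ac)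
  also have "(norm (C * exp (b * t) * E))\<^sup>2 = C^2 * exp (2 * b * t - al * t^2)"
  proof -
  have "exp (2 * b * t - al * t^2) = (exp (b * t) * exp (b * t)) * (E * E)" unfolding EE[symmetric] exp_add[symmetric] by (rule arg_cong[where f=exp]) simp
  then show ?thesis by (simp add: power2_eq_square mult_ac)
  qed
  also have "C\<^sup>2 * exp (2 * b * t - al * t^2) <= C^2 * exp (2 * b^2 / al + - al * t^2 / 2)"
  proof -
  have "0 <= (2 * b - al * t)^2 / (2 * al)" using a by simp
  also have "(2 * b - al * t)\<^sup>2 / (2 * al) = 2 * b^2 / al + al * t^2 / 2 - 2 * b * t"
  using a by (simp add: power2_eq_square field_simps)
  finally have "2 * b * t - al * t^2 <= 2 * b^2 / al + - al * t^2 / 2" by simp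
  then show ?thesis by (intro mult_left_mono) auto
  qed
  finally show ?thesis unfolding exp_add t_def by (simp add: divide_right_mono mult.assoc)
  qed
  then show "AE z in lborel. cmod (f z * Pf al c k z) <= norm (((cmod (f z))^2 * exp (- al * (norm z)^2) + (C^2 * exp (2 * b^2 / al)) * exp (- al * (norm z)^2 / 2)) / 2)"
  unfolding real_norm_def by (intro AE_I2 order_trans[OF _ abs_ge_self])
 qed
qed

definition adds :: "'n list => ('n => nat) => 'n => nat" where
 "adds ws k = (%r. k r + count_list ws r)"

lemma adds_Cons: "adds (r # ws) k = adds ws (k(r := Suc (k r)))"
 by (auto simp: adds_def fun_eq_iff)

text \<open>One derivative at a time is moved onto a cut-off Gaussian. A derivative that hits the cut-off
 function gains a factor \<open>1/R\<close>, so in the limit only the derivatives of the Gaussian survive.\<close>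

lemma cutoff_limit:
 fixes f :: "complex^'n => complex"
 assumes a: "al > 0" and f: "continuous_on UNIV f" and i: "integrable lborel (%z. (cmod (f z))^2 * exp (- al * (norm z)^2))"
 shows "C_k (length ws) eta ==> csupp eta ==>
  (%j. Ilb (%z. f z * fold dbar ws (%z. eta ((1 / real (Suc j)) *\<^sub>R z) * Pf al c k z) z)) ~~>
  eta 0 * (- of_real (sqrt al)) ^ length ws * Ilb (%z. f z * Pf al c (adds ws k) z)"
proof (induction ws arbitrary: eta k)
 case Nil
 have ci: "continuous_on UNIV eta" using Nil.prems by simp
 obtain R where R: "!!z. R < norm z ==> eta z = 0" using Nil.prems by (auto simp: csupp_def)
 have "compact (eta ` cball 0 R)" by (intro compact_continuous_image continuous_on_subset[OF ci]) auto
 then obtain M where M: "!!z. z \<in> cball 0 R ==> cmod (eta z) <= M" using compact_imp_bounded[of "eta ` cball 0 R"] unfolding bounded_iff by (meson imageI)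
 have M': "cmod (eta z) <= \<bar>M\<bar>" for z using M[of z] R[of z] by (cases "norm z <= R") auto
 have int: "integrable lborel (%z. f z * Pf al c k z)" by (rule fock_Pf_integrable[OF a f i])
 have [measurable]: "f \<in> bmeas" "Pf al c k \<in> bmeas" "eta \<in> bmeas"
  by (intro borel_measurable_continuous_onI f ci C_k_continuous[OF Pf_C_k])+
 have "(%j. Ilb (%z. f z * (eta ((1 / real (Suc j)) *\<^sub>R z) * Pf al c k z))) ~~> Ilb (%z. f z * (eta 0 * Pf al c k z))"
 proof (rule integral_dominated_convergence[where w="%z. \<bar>M\<bar> * cmod (f z * Pf al c k z)"])
  show "integrable lborel (%z. \<bar>M\<bar> * cmod (f z * Pf al c k z))" using int by (intro integrable_mult_right integrable_norm)
  show "AE z in lborel. (%j. f z * (eta ((1 / real (Suc j)) *\<^sub>R z) * Pf al c k z)) ~~> f z * (eta 0 * Pf al c k z)"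
  proof (rule AE_I2)
  fix z :: "complex^'n"
  have "(%j. (1 / real (Suc j)) *\<^sub>R z) ~~> 0 *\<^sub>R z" by (intro tendsto_intros LIMSEQ_Suc[OF lim_1_over_n])
  then have "(%j. eta ((1 / real (Suc j)) *\<^sub>R z)) ~~> eta 0"
  by (intro continuous_on_tendsto_compose[OF ci]) auto
  then show "(%j. f z * (eta ((1 / real (Suc j)) *\<^sub>R z) * Pf al c k z)) ~~> f z * (eta 0 * Pf al c k z)" by (intro tendsto_intros)
  qed
  show "AE z in lborel. cmod (f z * (eta ((1 / real (Suc j)) *\<^sub>R z) * Pf al c k z)) <= \<bar>M\<bar> * cmod (f z * Pf al c k z)" for j
  proof (rule AE_I2)
  fix z
  have "cmod (f z * (eta ((1 / real (Suc j)) *\<^sub>R z) * Pf al c k z)) = cmod (eta ((1 / real (Suc j)) *\<^sub>R z)) * cmod (f z * Pf al c k z)" by (simp add: norm_mult)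
  also have "... <= \<bar>M\<bar> * cmod (f z * Pf al c k z)" by (intro mult_right_mono M') simp
  finally show "cmod (f z * (eta ((1 / real (Suc j)) *\<^sub>R z) * Pf al c k z)) <= \<bar>M\<bar> * cmod (f z * Pf al c k z)" .
  qed
 qed measurable
 also have "Ilb (%z. f z * (eta 0 * Pf al c k z)) = eta 0 * Ilb (%z. f z * Pf al c k z)"
  by (simp only: mult.left_commute integral_mult_right_zero)
 finally show ?case by (simp add: adds_def)
next
 case (Cons r ws)
 have X: "C_k (Suc (length ws)) eta" using Cons.prems by simp
 let ?k = "k(r := Suc (k r))"
 let ?F = "%eta k j z. eta ((1 / real (Suc j)) *\<^sub>R z) * Pf al c k z"
 let ?I = "%eta k j. Ilb (%z. f z * fold dbar ws (?F eta k j) z)"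
 have C1: "C_k (length ws) (?F (dbar r eta) k j)" for j by (intro C_k_mult C_k_scale C_k_dbar X Pf_C_k)
 have C2: "C_k (length ws) (?F eta ?k j)" for j by (intro C_k_mult C_k_scale C_k_Suc_D[OF X] Pf_C_k)
 have S: "csupp (%z. ph ((1 / real (Suc j)) *\<^sub>R z))" if "csupp ph" for ph :: "complex^'n => complex" and j by (rule csupp_scale[OF that]) simp
 have int: "integrable lborel (%z. f z * fold dbar ws \<Phi> z)" if "C_k (length ws) \<Phi>" "csupp \<Phi>" for \<Phi>
  by (intro csupp_integrable csupp_mult csupp_fold_dbar that continuous_intros f C_k_continuous[of 0] C_k_fold_dbar) (use that in simp)
 have d: "dbar r (?F eta k j) = (%z. of_real (1 / real (Suc j)) * ?F (dbar r eta) k j z + (- of_real (sqrt al)) * ?F eta ?k j z)" for j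
  unfolding dbar_mult[OF C_k_scale[OF X] Pf_C_k] dbar_scale[OF X] dbar_Pf[OF a] by (simp add: fun_eq_iff mult_ac)
 have "Ilb (%z. f z * fold dbar (r # ws) (?F eta k j) z) = of_real (1 / real (Suc j)) * ?I (dbar r eta) k j + (- of_real (sqrt al)) * ?I eta ?k j" for j
 proof -
  have "fold dbar (r # ws) (?F eta k j) = (%z. of_real (1 / real (Suc j)) * fold dbar ws (?F (dbar r eta) k j) z + (- of_real (sqrt al)) * fold dbar ws (?F eta ?k j) z)"
  unfolding fold_simps d
  by (subst fold_dbar_add) (intro C_k_mult[OF C_k_const] C1 C2 | simp only: fold_dbar_cmult[OF C1] fold_dbar_cmult[OF C2])+
  then have "(%z. f z * fold dbar (r # ws) (?F eta k j) z) = (%z. of_real (1 / real (Suc j)) * (f z * fold dbar ws (?F (dbar r eta) k j) z) + (- of_real (sqrt al)) * (f z * fold dbar ws (?F eta ?k j) z))"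
  by (simp only: distrib_left mult.left_commute)
  then show ?thesis
  using int[OF C1[of j] csupp_mult(2)[OF S[OF csupp_dbar[OF Cons.prems(2) X]]]] int[OF C2[of j] csupp_mult(2)[OF S[OF Cons.prems(2)]]]
  by (simp only: Bochner_Integration.integral_add integrable_mult_right integral_mult_right_zero)
 qed
 moreover have "(%j. of_real (1 / real (Suc j)) * ?I (dbar r eta) k j + (- of_real (sqrt al)) * ?I eta ?k j) ~~>
  of_real 0 * (dbar r eta 0 * (- of_real (sqrt al)) ^ length ws * Ilb (%z. f z * Pf al c (adds ws k) z))
  + (- of_real (sqrt al)) * (eta 0 * (- of_real (sqrt al)) ^ length ws * Ilb (%z. f z * Pf al c (adds ws ?k) z))"
  by (intro tendsto_add tendsto_mult tendsto_const tendsto_of_real LIMSEQ_Suc[OF lim_1_over_n] Cons.IH C_k_dbar X csupp_dbar[OF Cons.prems(2) X] C_k_Suc_D[OF X] Cons.prems(2))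
 ultimately show ?case by (simp add: adds_Cons mult_ac)
qed

text \<open>Only \<open>m\<close> of the available derivatives may be moved to \<open>f\<close>, so a multi-index of
size exactly \<open>m\<close> is needed below a larger one.\<close>

lemma exists_sub_index:
 fixes K :: "'n::finite => nat"
 assumes "m <= (SUM r:UNIV. K r)"
 shows "EX k. (ALL r. k r <= K r) & (SUM r:UNIV. k r) = m"
 using assms
proof (induction "(SUM r:UNIV. K r) - m" arbitrary: K)
 case 0
 then show ?case by (intro exI[of _ K]) auto
next
 case (Suc d)
 then have "(SUM r:UNIV. K r) > 0" by linarith
 then obtain r where r: "K r > 0" by (metis finite_class.finite_UNIV sum_eq_0_iff gr0I)
 let ?L = "K(r := K r - 1)"
 have "(SUM s:UNIV. ?L s) = ?L r + (SUM s:UNIV - {r}. ?L s)" "(SUM s:UNIV. K s) = K r + (SUM s:UNIV - {r}. K s)"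
  by (rule sum.remove; simp)+
 moreover have "(SUM s:UNIV - {r}. ?L s) = (SUM s:UNIV - {r}. K s)" by (rule sum.cong) auto
 ultimately have "(SUM s:UNIV. ?L s) + 1 = (SUM s:UNIV. K s)" using r by simp
 then have "d = (SUM s:UNIV. ?L s) - m" "m <= (SUM s:UNIV. ?L s)" using Suc by linarith+
 from Suc.hyps(1)[OF this] obtain k where "ALL s. k s <= ?L s" "(SUM s:UNIV. k s) = m" by blast
 then have "k s <= K s" for s using diff_le_self[of "K r" 1] by (metis fun_upd_apply le_trans)
 with \<open>(SUM s:UNIV. k s) = m\<close> show ?case by blast
qed

text \<open>Write \<open>Pf\<close> as \<open>m\<close> derivatives of a \<open>Pf\<close> of lower order and move
them to \<open>f\<close>, where they give zero. That there are no boundary terms at infinity is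
\<open>cutoff_limit\<close>.\<close>

theorem fock_orthogonal:
 fixes f :: "complex^'n::{finite,linorder} => complex"
 assumes a: "al > 0" and f: "f \<in> hcarrier (Fock al m)" and K: "m <= (SUM r:UNIV. K r)"
 shows "Ilb (%z. f z * Pf al c K z) = 0"
proof -
 have an: "m_analytic m f" and i: "integrable lborel (%z. (cmod (f z))^2 * exp (- al * (norm z)^2))"
  using f by (auto simp: Fock_def)
 have s: "smooth f" using an by (simp add: m_analytic_def)
 have fc: "continuous_on UNIV f" using smoothD[OF s, of 0] by simp
 obtain k where k: "!!r. k r <= K r" "(SUM r:UNIV. k r) = m" using exists_sub_index[OF K] by blast
 define ws where "ws = word (\<chi> r. k r)"
 have fw: "foldr dbar ws f z = 0" for z
 proof -
  have "mi_size (\<chi> r. k r) = m" using k(2) by (simp add: mi_size_def)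
  then have "dbar_multi (\<chi> r. k r) f z = 0" using an by (simp add: m_analytic_def)
  then show ?thesis by (simp add: dbar_multi_word ws_def)
 qed
 define k0 where "k0 r = K r - k r" for r
 have ad: "adds ws k0 = K" using k(1) by (auto simp: adds_def ws_def count_word k0_def fun_eq_iff)
 obtain eta :: "complex^'n::{finite,linorder} => complex" where eta: "C_k (length ws) eta" "csupp eta" "eta 0 = 1" using cutoff_exists by blast
 have z: "Ilb (%z. f z * fold dbar ws (%z. eta ((1 / real (Suc j)) *\<^sub>R z) * Pf al c k0 z) z) = 0" for j
 proof -
  have P: "C_k (length ws) (%z. eta ((1 / real (Suc j)) *\<^sub>R z) * Pf al c k0 z)" by (intro C_k_mult C_k_scale eta Pf_C_k)
  have sP: "csupp (%z. eta ((1 / real (Suc j)) *\<^sub>R z) * Pf al c k0 z)" by (rule csupp_mult(2)[OF csupp_scale[OF eta(2)]]) simp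
  from integral_dbar_word[OF s P sP] show ?thesis by (simp add: fw)
 qed
 from cutoff_limit[OF a fc i eta(1,2), of c k0] have "(%j::nat. 0) ~~> eta 0 * (- of_real (sqrt al)) ^ length ws * Ilb (%z. f z * Pf al c (adds ws k0) z)"
  unfolding z .
 from LIMSEQ_unique[OF this tendsto_const] show ?thesis using a unfolding ad by (simp add: eta(3))
qed

section \<open>The space \<open>\<H>\<^sub>m\<close> and the Hermite expansion in the second variable\<close>

definition toC :: "(real^'n) \<times> (real^'n) => complex^'n" where
 "toC p = (\<chi> r. Complex (fst p $ r) (snd p $ r))"

lemma toC_inner: "toC p \<bullet> toC q = p \<bullet> q"
 by (simp add: toC_def inner_vec_def inner_prod_def inner_complex_def sum.distrib)

lemma toC_surj: "toC (\<chi> r. Re (z $ r), \<chi> r. Im (z $ r)) = z"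
 by (simp add: toC_def vec_eq_iff)

lemma toC_Basis: "bij_betw toC (Basis :: ((real^'n) \<times> (real^'n)) set) (Basis :: (complex^'n) set)"
proof (rule bij_betwI')
 fix p q :: "(real^'n) \<times> (real^'n)" show "(toC p = toC q) = (p = q)"
  by (auto simp: toC_def vec_eq_iff prod_eq_iff)
next
 have 1: "toC (axis i 1, 0) = axis i 1" "toC (0, axis i 1) = axis i \<i>" for i :: 'n
  by (auto simp: toC_def vec_eq_iff axis_def complex_eq_iff)
 fix p :: "(real^'n) \<times> (real^'n)" assume "p \<in> Basis"
 then consider i where "p = (axis i 1, 0)" | i where "p = (0, axis i 1)" by (auto simp: Basis_prod_def Basis_vec_real)
 then show "toC p \<in> Basis" by cases (auto simp: 1 Basis_vec_def Basis_complex_def)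
next
 have 1: "toC (axis i 1, 0) = axis i 1" "toC (0, axis i 1) = axis i \<i>" for i :: 'n
  by (auto simp: toC_def vec_eq_iff axis_def complex_eq_iff)
 fix z :: "complex^'n" assume "z \<in> Basis"
 then consider i where "z = axis i 1" | i where "z = axis i \<i>" by (auto simp: Basis_vec_def Basis_complex_def)
 then show "EX p:Basis. z = toC p"
 proof cases
  case 1 then show ?thesis by (intro bexI[of _ "(axis i 1, 0)"]) (auto simp: 1(1) toC_def vec_eq_iff axis_def complex_eq_iff Basis_prod_def Basis_vec_real)
 next
  case 2 then show ?thesis by (intro bexI[of _ "(0, axis i 1)"]) (auto simp: 2(1) toC_def vec_eq_iff axis_def complex_eq_iff Basis_prod_def Basis_vec_real)
 qed
qed

lemma toC_linear: "bounded_linear (toC :: (real^'n) \<times> (real^'n) => complex^'n)"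
proof (rule bounded_linear_intro[where K=1])
 fix p :: "(real^'n) \<times> (real^'n)"
 show "norm (toC p) <= norm p * 1" by (simp add: norm_eq_sqrt_inner toC_inner)
qed (auto simp: toC_def vec_eq_iff complex_eq_iff)

lemma toC_continuous: "continuous_on UNIV toC" using linear_continuous_on[OF toC_linear] .

lemma toC_measurable [measurable]: "toC \<in> bmeas" by (rule borel_measurable_continuous_onI[OF toC_continuous])

text \<open>The identification maps the standard basis to the standard basis, so it maps boxes to boxes with the same
side lengths.\<close>

lemma distr_toC: "(lborel :: (complex^'n) measure) = distr (lborel :: ((real^'n) \<times> (real^'n)) measure) borel toC"
proof (rule lborel_eqI)
 fix l u :: "complex^'n" assume le: "!!b. b \<in> Basis ==> l \<bullet> b <= u \<bullet> b"
 define t :: "complex^'n => (real^'n) \<times> (real^'n)" where "t z = (\<chi> r. Re (z $ r), \<chi> r. Im (z $ r))" for z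
 have t: "z \<bullet> toC b = t z \<bullet> b" for z b using toC_inner[of "t z" b] by (simp add: t_def toC_surj)
 have im: "(Basis :: (complex^'n) set) = toC ` Basis" by (rule bij_betw_imp_surj_on[OF toC_Basis, symmetric])
 have "toC -` box l u = box (t l) (t u)" by (auto simp: box_def im toC_inner simp flip: t)
 then have "emeasure (distr lborel borel toC) (box l u) = emeasure lborel (box (t l) (t u))" by (simp add: emeasure_distr)
 also have "... = (PROD b:Basis. (t u - t l) \<bullet> b)" by (rule emeasure_lborel_box) (use le in \<open>simp add: im flip: t\<close>)
 also have "(PROD b:Basis. (t u - t l) \<bullet> b) = (PROD b:Basis. (u - l) \<bullet> toC b)" by (simp only: inner_diff_left t[symmetric])
 also have "... = (PROD b:Basis. (u - l) \<bullet> b)" by (rule prod.reindex_bij_betw[OF toC_Basis])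
 finally show "emeasure (distr lborel borel toC) (box l u) = (PROD b:Basis. (u - l) \<bullet> b)" .
qed simp

lemma complex_change_of_variables:
 fixes F :: "complex^'n => 'b::{banach,second_countable_topology}"
 assumes a: "al > 0" and [measurable]: "F \<in> bmeas"
 shows "integrable lborel F \<longleftrightarrow> imut (%p. F ((1 / sqrt al) *\<^sub>R toC p))"
  and "Ilb F = (2 * pi / al) ^ CARD('n) *\<^sub>R Imut (%p. F ((1 / sqrt al) *\<^sub>R toC p))"
proof -
 have c: "1 / sqrt al ~= 0" using a by simp
 note aff = lborel_euclid_affine[OF c, of F 0, simplified add_0]
 have ds: "integrable lborel G \<longleftrightarrow> integrable lborel (%p. G (toC p))" "Ilb G = Ilb (%p. G (toC p))"
  if [measurable]: "G \<in> bmeas" for G :: "complex^'n => 'b"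
  by (subst distr_toC, subst integrable_distr_eq integral_distr; simp)+
 have D: "DIM(complex^'n) = 2 * CARD('n)" "DIM((real^'n) \<times> (real^'n)) = 2 * CARD('n)" by simp_all
 have mc: "mutc TYPE((real^'n) \<times> (real^'n)) = (1 / (2 * pi)) ^ CARD('n)"
  unfolding mutc_def D by (simp add: powr_minus powr_realpow power_divide divide_simps)
 show "integrable lborel F \<longleftrightarrow> imut (%p. F ((1 / sqrt al) *\<^sub>R toC p))"
  unfolding aff(1)[symmetric] integrable_mut by (rule ds) simp
 have p: "\<bar>1 / sqrt al\<bar> ^ (2 * CARD('n)) = (1 / al) ^ CARD('n)" using a by (simp add: power_mult power_divide)
 have q: "(2 * pi / al) ^ CARD('n) * (1 / (2 * pi)) ^ CARD('n) = (1 / al) ^ CARD('n)"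
  unfolding power_mult_distrib[symmetric] by simp
 have "Ilb F = (1 / al) ^ CARD('n) *\<^sub>R Ilb (%p. F ((1 / sqrt al) *\<^sub>R toC p))"
  unfolding aff(2) D p by (subst ds(2)) simp_all
 then show "Ilb F = (2 * pi / al) ^ CARD('n) *\<^sub>R Imut (%p. F ((1 / sqrt al) *\<^sub>R toC p))"
  unfolding integral_mut mc scaleR_scaleR q .
qed

subsection \<open>The unitary map from the Fock space\<close>

definition hweight :: "(real^'n) \<times> (real^'n) => complex" where
 "hweight p = of_real (2 powr (real CARD('n) / 2)) *
  exp (of_real (- (norm (fst p))\<^sup>2 / 2 - (norm (snd p))\<^sup>2 / 2) - \<i> * of_real (fst p \<bullet> snd p))"

lemma Fock_to_H_eq: "Fock_to_H al f p = hweight p * f ((1 / sqrt al) *\<^sub>R toC p)"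
proof -
 have "(\<chi> r. Complex (fst p $ r) (snd p $ r) / of_real (sqrt al)) = (1 / sqrt al) *\<^sub>R toC p"
  by (simp add: vec_eq_iff toC_def complex_eq_iff Re_divide_of_real Im_divide_of_real)
 then show ?thesis by (simp add: Fock_to_H_def hweight_def split_beta)
qed

lemma hweight_nz: "hweight p ~= 0" by (simp add: hweight_def)

lemma hweight_continuous: "continuous_on UNIV hweight"
 unfolding hweight_def[abs_def] by (intro continuous_intros) simp_all

lemma hweight_measurable [measurable]: "hweight \<in> bmeas" by (rule borel_measurable_continuous_onI[OF hweight_continuous])

text \<open>The weight turns the Gaussian density of the Fock space into Lebesgue measure.\<close>

lemma hweight_sq:
 fixes p :: "(real^'n) \<times> (real^'n)"
 assumes a: "al > 0"
 shows "(cmod (hweight p))\<^sup>2 = 2 ^ CARD('n) * exp (- al * (norm ((1 / sqrt al) *\<^sub>R toC p))^2)"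
proof -
 have n: "al * (norm ((1 / sqrt al) *\<^sub>R toC p))^2 = (norm (fst p))^2 + (norm (snd p))^2"
  using a by (simp add: power_mult_distrib power_divide norm_eq_sqrt_inner toC_inner inner_prod_def)
 have two: "(2 powr (real CARD('n) / 2))\<^sup>2 = 2 ^ CARD('n)" by (simp add: powr_powr powr_realpow flip: powr_numeral)
 have "cmod (hweight p) = 2 powr (real CARD('n) / 2) * exp (- ((norm (fst p))^2 + (norm (snd p))^2) / 2)"
  unfolding hweight_def norm_mult norm_of_real norm_exp_eq_Re by (simp add: diff_divide_distrib)
 then have "(cmod (hweight p))\<^sup>2 = (2 powr (real CARD('n) / 2))^2 * exp (- ((norm (fst p))^2 + (norm (snd p))^2) / 2)^2" by (simp only: power_mult_distrib)
 also have "exp (- ((norm (fst p))^2 + (norm (snd p))^2) / 2)^2 = exp (- al * (norm ((1 / sqrt al) *\<^sub>R toC p))^2)"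
  unfolding exp_double[symmetric] mult_minus_left n by (rule arg_cong[where f=exp]) simp
 finally show ?thesis unfolding two .
qed

lemma Fock_continuous: "f \<in> hcarrier (Fock al m) ==> continuous_on UNIV f"
 by (rule C_k_continuous[OF smoothD[of _ 0]]) (simp add: Fock_def m_analytic_def)

lemma Fock_to_H_continuous:
 assumes "continuous_on UNIV f" shows "continuous_on UNIV (Fock_to_H al f)"
proof -
 have "continuous_on UNIV (%p. f ((1 / sqrt al) *\<^sub>R toC p))"
  by (rule continuous_on_compose2[OF assms continuous_on_scaleR[OF continuous_on_const toC_continuous]]) auto
 then show ?thesis unfolding Fock_to_H_eq[abs_def] by (intro continuous_on_mult hweight_continuous)
qed

lemma Fock_to_H_inj:
 fixes f g :: "complex^'n => complex"
 assumes "al > 0" "Fock_to_H al f = Fock_to_H al g" shows "f = g"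
proof
 fix z :: "complex^'n"
 obtain p where p: "sqrt al *\<^sub>R z = toC p" using toC_surj[of "sqrt al *\<^sub>R z"] by metis
 have "z = (1 / sqrt al) *\<^sub>R toC p" unfolding p[symmetric] using assms(1) by simp
 with fun_cong[OF assms(2), of p] show "f z = g z" by (simp add: Fock_to_H_eq hweight_nz)
qed

lemma Fock_to_H_inner:
 fixes f g :: "complex^'n::{finite,linorder} => complex"
 assumes a: "al > 0" and f: "continuous_on UNIV f" and g: "continuous_on UNIV g"
 shows "hinner (Hsp al m) (Fock_to_H al f) (Fock_to_H al g) = hinner (Fock al m) f g"
proof -
 have [measurable]: "f \<in> bmeas" "g \<in> bmeas" using f g by (auto intro: borel_measurable_continuous_onI)
 have "Fock_to_H al f p * cnj (Fock_to_H al g p) = of_real (2 ^ CARD('n)) * (%z. f z * cnj (g z) * of_real (exp (- al * (norm z)^2))) ((1 / sqrt al) *\<^sub>R toC p)" for p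
 proof -
  have "hweight p * cnj (hweight p) = of_real ((cmod (hweight p))^2)" by (simp add: complex_norm_square[symmetric])
  then show ?thesis unfolding Fock_to_H_eq hweight_sq[OF a] by (simp add: mult_ac)
 qed
 then have "hinner (Hsp al m) (Fock_to_H al f) (Fock_to_H al g) = of_real (2 ^ CARD('n)) * (LINT p|mut. (%z. f z * cnj (g z) * of_real (exp (- al * (norm z)^2))) ((1 / sqrt al) *\<^sub>R toC p))"
  unfolding Hsp_def by (simp only: hilb.simps integral_mult_right_zero)
 also have "... = of_real (al ^ CARD('n) / pi ^ CARD('n)) * (LINT z|lborel. f z * cnj (g z) * of_real (exp (- al * (norm z)^2)))"
  by (subst complex_change_of_variables(2)[OF a]) (use a in \<open>simp_all add: scaleR_conv_of_real power_divide power_mult_distrib\<close>)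
 finally show ?thesis by (simp add: Fock_def)
qed

lemma Fock_to_H_sq:
 fixes f :: "complex^'n::{finite,linorder} => complex"
 assumes a: "al > 0" and f: "continuous_on UNIV f"
 shows "sq (Fock_to_H al f) \<longleftrightarrow> integrable lborel (%z. (cmod (f z))^2 * exp (- al * (norm z)^2))"
proof -
 have [measurable]: "f \<in> bmeas" using f by (auto intro: borel_measurable_continuous_onI)
 have m: "Fock_to_H al f \<in> bmeas" by (rule borel_measurable_continuous_onI[OF Fock_to_H_continuous[OF f]])
 have e: "(cmod (Fock_to_H al f p))\<^sup>2 = 2 ^ CARD('n) *\<^sub>R (%z. (cmod (f z))^2 * exp (- al * (norm z)^2)) ((1 / sqrt al) *\<^sub>R toC p)" for p
  unfolding Fock_to_H_eq norm_mult power_mult_distrib hweight_sq[OF a] by simp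
 have m2: "(%z. (cmod (f z))^2 * exp (- al * (norm z)^2)) \<in> bmeas" by measurable
 show ?thesis unfolding sq_def e complex_change_of_variables(1)[OF a m2] by (subst integrable_scaleR_iff) (auto simp: m)
qed

lemma HspE:
 assumes "u \<in> hcarrier (Hsp al m)"
 obtains f where "u = Fock_to_H al f" "f \<in> hcarrier (Fock al m)" "continuous_on UNIV f"
proof -
 have "u \<in> Fock_to_H al ` hcarrier (Fock al m)" using assms by (simp only: Hsp_def hilb.simps)
 then obtain f where "u = Fock_to_H al f" "f \<in> hcarrier (Fock al m)" by (rule imageE)
 with Fock_continuous[OF this(2)] show thesis by (intro that)
qed

lemma Hsp_sq: assumes "al > 0" "u \<in> hcarrier (Hsp al m)" shows "sq u"
proof -
 from assms(2) obtain f where f: "u = Fock_to_H al f" "f \<in> hcarrier (Fock al m)" "continuous_on UNIV f" by (rule HspE)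
 then show ?thesis using Fock_to_H_sq[OF assms(1) f(3)] by (simp add: Fock_def)
qed

lemma Hsp_continuous: assumes "u \<in> hcarrier (Hsp al m)" shows "continuous_on UNIV u"
 using assms by (rule HspE) (simp only: Fock_to_H_continuous)

text \<open>Elements of \<open>\<H>\<^sub>m\<close> are functions, not classes; this makes the passage to classes
injective on them.\<close>

lemma continuous_AE_eq:
 fixes u v :: "'a::euclidean_space => complex"
 assumes u: "continuous_on UNIV u" and v: "continuous_on UNIV v" and e: "AE x in lborel. u x = v x"
 shows "u = v"
proof -
 let ?S = "{x. u x ~= v x}"
 have o: "open ?S" by (intro open_Collect_neq u v)
 have "negligible ?S" using AE_iff_null[of lborel "%x. u x = v x"] e o
  by (simp add: negligible_iff_null_sets null_sets_completionI borel_open)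
 then have "?S = {}" using open_not_negligible[OF o] by blast
 then show ?thesis by auto
qed

subsection \<open>Expansions in the functions \<open>q\<^sub>k\<close>\<close>

lemma fubini:
 fixes g :: "'a::euclidean_space \<times> 'b::euclidean_space => complex"
 assumes "imut g"
 shows "Imut g = (LINT x|mut. LINT y|mut. g (x, y))" "imut (%x. LINT y|mut. g (x, y))"
 using mutp.integral_fst'[of g] mutp.integrable_fst'[of g] assms by (simp_all add: mut_prod)

lemma AE_pair_I:
 fixes P :: "'a::euclidean_space \<times> 'b::euclidean_space => bool"
 assumes [measurable]: "Measurable.pred borel P" and ae: "AE x in lborel. AE y in lborel. P (x, y)"
 shows "AE p in lborel. P p"
proof -
 have "{p \<in> space borel. P p} \<in> sets borel" by measurable
 then have "{p \<in> space (mut \<Otimes>\<^sub>M mut). P p} \<in> sets (mut \<Otimes>\<^sub>M mut)" by (simp only: mut_prod sets_mut space_mut space_borel)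
 from mutp.AE_pair_measure[OF this] ae have "AE p in (mut \<Otimes>\<^sub>M mut). P p" by simp
 then show ?thesis unfolding mut_prod AE_mut .
qed

definition Qsum :: "('d::finite => nat ^ 'n) => (real^'n => complex^'d) => (real^'n) \<times> (real^'n) => complex" where
 "Qsum ph h = (%(xi, v). SUM j:UNIV. h xi $ j * of_real (q_fun (ph j) xi v))"

lemma component_measurable [measurable (raw)]:
 assumes "h \<in> borel_measurable M" shows "(%x. (h x :: complex^'d) $ j) \<in> borel_measurable M"
 using measurable_compose[OF assms, of "%v. v $ j" borel] borel_measurable_continuous_onI[OF linear_continuous_on[OF bl_coord]] by blast

lemma Qsum_measurable [measurable]:
 fixes h :: "real^'n => complex^'d"
 assumes [measurable]: "h \<in> bmeas" shows "Qsum ph h \<in> bmeas"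
proof -
 have [measurable]: "fst \<in> borel_measurable (borel :: ((real^'n) \<times> (real^'n)) measure)" "snd \<in> borel_measurable (borel :: ((real^'n) \<times> (real^'n)) measure)"
  by (intro borel_measurable_continuous_onI continuous_on_fst continuous_on_snd continuous_on_id)+
 have "(%p::(real^'n) \<times> (real^'n). SUM j:UNIV. h (fst p) $ j * of_real (q_fun (ph j) (fst p) (snd p))) \<in> bmeas"
  by (intro borel_measurable_sum borel_measurable_times measurable_compose[OF _ borel_measurable_of_real] q_fun_measurable component_measurable measurable_compose[OF _ assms]) measurable
 then show ?thesis unfolding Qsum_def split_beta .
qed

text \<open>Orthonormality of the \<open>q\<^bsub>k,xi\<^esub>\<close> for each fixed \<open>xi\<close>: the sections
of \<open>Qsum\<close> have the inner products of their coefficient vectors.\<close>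

lemma Qsum_section:
 assumes inj: "inj ph"
 shows "imut (%v. Qsum ph h (xi, v) * cnj (Qsum ph k (xi, v)))"
  and "Imut (%v. Qsum ph h (xi, v) * cnj (Qsum ph k (xi, v))) = cip (h xi) (k xi)"
proof -
 let ?t = "%i j v. h xi $ i * cnj (k xi $ j) * cor (q_fun (ph i) xi v * q_fun (ph j) xi v)"
 have e: "Qsum ph h (xi, v) * cnj (Qsum ph k (xi, v)) = (SUM i:UNIV. SUM j:UNIV. ?t i j v)" for v
  unfolding Qsum_def by (simp add: sum_product mult_ac)
 have i: "imut (?t i j)" for i j by (intro integrable_mult_right q_orthonormal)
 show "imut (%v. Qsum ph h (xi, v) * cnj (Qsum ph k (xi, v)))" unfolding e by (intro Bochner_Integration.integrable_sum i)
 have "Imut (%v. Qsum ph h (xi, v) * cnj (Qsum ph k (xi, v))) = (SUM i:UNIV. SUM j:UNIV. Imut (?t i j))"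
  unfolding e by (subst Bochner_Integration.integral_sum, intro Bochner_Integration.integrable_sum i) (intro sum.cong refl Bochner_Integration.integral_sum i)
 also have "... = (SUM i:UNIV. SUM j:UNIV. if i = j then h xi $ i * cnj (k xi $ j) else 0)"
  unfolding integral_mult_right_zero q_orthonormal(2) using inj by (intro sum.cong refl) (auto simp: inj_def)
 finally show "Imut (%v. Qsum ph h (xi, v) * cnj (Qsum ph k (xi, v))) = cip (h xi) (k xi)" by (simp add: cip_def)
qed

lemma Qsum_sq:
 assumes inj: "inj ph" and [measurable]: "h \<in> bmeas"
 shows "sq (Qsum ph h) \<longleftrightarrow> sq h"
proof -
 have s: "(\<integral>\<^sup>+v. ennreal ((norm (Qsum ph h (xi, v)))^2) \<partial>mut) = ennreal ((norm (h xi))^2)" for xi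
 proof -
  have e: "Qsum ph h (xi, v) * cnj (Qsum ph h (xi, v)) = of_real ((norm (Qsum ph h (xi, v)))^2)" for v by (simp add: complex_norm_square[symmetric])
  have i: "imut (%v. (norm (Qsum ph h (xi, v)))^2)" using Qsum_section(1)[OF inj, of h xi h] unfolding e complex_of_real_integrable_eq .
  have "cor (Imut (%v. (norm (Qsum ph h (xi, v)))^2)) = of_real ((norm (h xi))^2)"
  using Qsum_section(2)[OF inj, of h xi h] unfolding e cip_self integral_complex_of_real .
  then have "Imut (%v. (norm (Qsum ph h (xi, v)))^2) = (norm (h xi))^2" unfolding of_real_eq_iff .
  then show ?thesis using nn_integral_eq_integral[OF i] by simp
 qed
 have "(\<integral>\<^sup>+p. ennreal ((norm (Qsum ph h p))^2) \<partial>mut) = (\<integral>\<^sup>+xi. ennreal ((norm (h xi))^2) \<partial>mut)"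
  by (subst nn_integral_mut_pair(2)) (simp_all add: s)
 then show ?thesis by (simp add: sq_nn)
qed

lemma Qsum_inner:
 assumes inj: "inj ph" and h: "sq h" and k: "sq k"
 shows "Imut (%p. Qsum ph h p * cnj (Qsum ph k p)) = Imut (%xi. cip (h xi) (k xi))"
proof -
 have [measurable]: "h \<in> bmeas" "k \<in> bmeas" using h k by (auto simp: sq_def)
 have "imut (%p. Qsum ph h p * cnj (Qsum ph k p))"
  by (rule sq_product_integrable[of "Qsum ph h" "Qsum ph k"]) (auto simp: Qsum_sq inj h k norm_mult)
 from fubini(1)[OF this] show ?thesis by (simp add: Qsum_section(2)[OF inj])
qed

lemma Qsum_cong:
 assumes "AE xi in lborel. h xi = k xi"
 shows "AE p in lborel. Qsum ph h p = Qsum ph k p"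
 using AE_fst_lborel[OF assms] by eventually_elim (simp add: Qsum_def split_beta)

lemma q_fun_swap: "q_fun k xi y = q_fun k (2 *\<^sub>R y) ((1/2) *\<^sub>R xi)"
 unfolding q_fun_def by (simp add: add.commute)

lemma sq_q_fun_first: "sq (%xi. cor (q_fun k xi y))"
proof -
 have "imut (%v. (cmod (cor (q_fun k (2 *\<^sub>R y) (0 + (1/2) *\<^sub>R v))))^2)"
  using sq_q_fun[of k "2 *\<^sub>R y"] by (subst mut_affine(1)) (auto simp: sq_def)
 then show ?thesis unfolding sq_def by (subst q_fun_swap) (simp del: of_real_power)
qed

lemma sq_coord: "sq h ==> sq (%x. (h x :: complex^'d) $ j)"
 by (rule sq_norm_bound[where C=1]) (auto simp: Finite_Cartesian_Product.norm_nth_le sq_def)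

lemma Qsum_section_L1:
 assumes h: "sq h" shows "imut (%xi. Qsum ph h (xi, y))"
 unfolding Qsum_def split
proof (intro Bochner_Integration.integrable_sum)
 fix j
 have [measurable]: "h \<in> bmeas" using h by (auto simp: sq_def)
 show "imut (%xi. h xi $ j * cor (q_fun (ph j) xi y))"
  by (rule sq_product_integrable[OF sq_coord[OF h] sq_q_fun_first]) (auto simp: norm_mult)
qed

section \<open>The operator \<open>R\<close> is unitary\<close>

lemma norm_sq_vec: "(norm (x :: real^'n))\<^sup>2 = (SUM r:UNIV. (x $ r)\<^sup>2)"
 by (simp add: norm_vec_def L2_set_def sum_nonneg)

text \<open>Test functions that extract the \<open>k\<close>-th coefficient: pairing with \<open>wtest c k\<close>
evaluates, at \<open>-c\<close>, the Fourier transform of the coefficient damped by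
\<open>exp(-|xi|\<^sup>2/4)\<close>. With this damping the transform of \<open>wtest\<close> in the first
variable is elementary.\<close>

definition wtest :: "real^'n => nat ^ 'n => (real^'n) \<times> (real^'n) => complex" where
 "wtest c k = (%(xi, y). exp (of_real (- (norm xi)\<^sup>2 / 4) + \<i> * of_real (c \<bullet> xi)) * of_real (q_fun k xi y))"

lemma exp_q1:
 "cor (q1 k ((x + 2 * y) / sqrt 2)) = of_real (qc k) * of_real (hermite k ((x + 2 * y) / sqrt 2)) * exp (of_real (- (x + 2 * y)\<^sup>2 / 4))"
proof -
 have "- ((x + 2 * y) / sqrt 2)\<^sup>2 / 2 = - (x + 2 * y)\<^sup>2 / 4" by (simp add: power_divide)
 then show ?thesis unfolding q1_def by (simp only: of_real_mult exp_of_real)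
qed

lemma wtest_factor:
 "wtest c k (xi, y) * exp (- \<i> * of_real (xi \<bullet> x)) =
 (PROD r:UNIV. of_real (qc (k $ r)) * exp (of_real (- (y $ r)\<^sup>2)) * (cor (hermite (k $ r) ((xi $ r + 2 * y $ r) / sqrt 2)) *
  exp (of_real (- (xi $ r)\<^sup>2 / 2) + (\<i> * of_real (c $ r - x $ r) - of_real (y $ r)) * of_real (xi $ r))))"
proof -
 have "of_real (- (norm xi)\<^sup>2 / 4) + \<i> * of_real (c \<bullet> xi) + - \<i> * of_real (xi \<bullet> x) =
  (SUM r:UNIV. of_real (- (xi $ r)\<^sup>2 / 4) + \<i> * of_real (c $ r * xi $ r) + - \<i> * of_real (xi $ r * x $ r))"
  by (simp add: norm_sq_vec inner_vec_def sum.distrib sum_subtractf sum_distrib_left sum_divide_distrib sum_negf)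
 then have e: "exp (of_real (- (norm xi)\<^sup>2 / 4) + \<i> * of_real (c \<bullet> xi)) * exp (- \<i> * of_real (xi \<bullet> x)) =
  (PROD r:UNIV. exp (of_real (- (xi $ r)\<^sup>2 / 4) + \<i> * of_real (c $ r * xi $ r) + - \<i> * of_real (xi $ r * x $ r)))"
  unfolding exp_add[symmetric] by (simp only: exp_sum finite)
 have "wtest c k (xi, y) * exp (- \<i> * of_real (xi \<bullet> x)) = (exp (of_real (- (norm xi)\<^sup>2 / 4) + \<i> * of_real (c \<bullet> xi)) * exp (- \<i> * of_real (xi \<bullet> x))) * of_real (q_fun k xi y)"
  by (simp add: wtest_def)
 also have "... = (PROD r:UNIV. exp (of_real (- (xi $ r)\<^sup>2 / 4) + \<i> * of_real (c $ r * xi $ r) + - \<i> * of_real (xi $ r * x $ r)) * of_real (q1 (k $ r) ((xi $ r + 2 * y $ r) / sqrt 2)))"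
  unfolding e q_fun_eq of_real_prod prod.distrib ..
 also have "... = (PROD r:UNIV. of_real (qc (k $ r)) * exp (of_real (- (y $ r)\<^sup>2)) * (cor (hermite (k $ r) ((xi $ r + 2 * y $ r) / sqrt 2)) *
  exp (of_real (- (xi $ r)\<^sup>2 / 2) + (\<i> * of_real (c $ r - x $ r) - of_real (y $ r)) * of_real (xi $ r))))"
 proof (rule prod.cong[OF refl])
  fix r
  have "exp (of_real (- (xi $ r)\<^sup>2 / 4) + \<i> * of_real (c $ r * xi $ r) + - \<i> * of_real (xi $ r * x $ r)) * exp (cor (- (xi $ r + 2 * y $ r)\<^sup>2 / 4)) =
  exp (of_real (- (y $ r)\<^sup>2)) * exp (of_real (- (xi $ r)\<^sup>2 / 2) + (\<i> * of_real (c $ r - x $ r) - of_real (y $ r)) * of_real (xi $ r))"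
  unfolding exp_add[symmetric] by (rule arg_cong[where f=exp]) (simp add: complex_eq_iff power2_eq_square field_simps)
  then show "exp (of_real (- (xi $ r)\<^sup>2 / 4) + \<i> * of_real (c $ r * xi $ r) + - \<i> * of_real (xi $ r * x $ r)) * of_real (q1 (k $ r) ((xi $ r + 2 * y $ r) / sqrt 2)) =
  of_real (qc (k $ r)) * exp (of_real (- (y $ r)\<^sup>2)) * (cor (hermite (k $ r) ((xi $ r + 2 * y $ r) / sqrt 2)) *
  exp (of_real (- (xi $ r)\<^sup>2 / 2) + (\<i> * of_real (c $ r - x $ r) - of_real (y $ r)) * of_real (xi $ r)))"
  unfolding exp_q1 by (metis (no_types, lifting) mult.assoc mult.commute mult.left_commute)
 qed
 finally show ?thesis .
qed

lemma FT1_wtest: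
 "imut (%xi. wtest c k (xi, y))"
 "FT1 (wtest c k) (x, y) = (PROD r:UNIV. of_real (qc (k $ r)) * exp (of_real (- (y $ r)\<^sup>2)) *
  ((of_real (sqrt 2) * (of_real (y $ r) + \<i> * of_real (c $ r - x $ r))) ^ (k $ r) * exp ((\<i> * of_real (c $ r - x $ r) - of_real (y $ r))^2 / 2)))"
proof -
 let ?f = "%x r t. of_real (qc (k $ r)) * exp (of_real (- (y $ r)\<^sup>2)) * (cor (hermite (k $ r) ((t + 2 * y $ r) / sqrt 2)) *
  exp (of_real (- t\<^sup>2 / 2) + (\<i> * of_real (c $ r - x $ r) - of_real (y $ r)) * of_real t))"
 have i: "imut (?f x r)" for x :: "real ^ 'a" and r by (intro integrable_mult_right hermite_fourier_1d)
 have "imut (%xi. wtest c k (xi, y) * exp (- \<i> * of_real (xi \<bullet> 0)))"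
  unfolding wtest_factor by (rule mut_prod_vec(1)[of "?f 0"]) (rule i)
 then show "imut (%xi. wtest c k (xi, y))" by simp
 have "FT1 (wtest c k) (x, y) = (LINT xi|mut. (PROD r:UNIV. ?f x r (xi $ r)))"
  unfolding FT1_def split FT_def wtest_factor ..
 also have "... = (PROD r:UNIV. Imut (?f x r))" by (rule mut_prod_vec(2)) (rule i)
 finally show "FT1 (wtest c k) (x, y) = (PROD r:UNIV. of_real (qc (k $ r)) * exp (of_real (- (y $ r)\<^sup>2)) *
  ((of_real (sqrt 2) * (of_real (y $ r) + \<i> * of_real (c $ r - x $ r))) ^ (k $ r) * exp ((\<i> * of_real (c $ r - x $ r) - of_real (y $ r))^2 / 2)))"
  unfolding integral_mult_right_zero hermite_fourier_1d(2) .
qed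

lemma sq_wtest:
 fixes c :: "real^'n"
 shows "sq (wtest c k)"
proof -
 define h :: "real^'n => complex ^ unit" where "h xi = (\<chi> _. exp (of_real (- (norm xi)\<^sup>2 / 4) + \<i> * of_real (c \<bullet> xi)))" for xi
 have [measurable]: "h \<in> bmeas"
  unfolding h_def by (intro borel_measurable_continuous_onI continuous_intros) auto
 have n: "(norm (h xi))\<^sup>2 = cmod (exp (of_real (- (1 * norm xi)\<^sup>2 / 2) - \<i> * of_real (0 \<bullet> xi)))" for xi
  by (simp add: h_def norm_vec_def L2_set_def UNIV_unit norm_exp_eq_Re flip: exp_double)
 have "sq h" unfolding sq_def n using integrable_norm[OF gauss_fourier(1)[of 1 "0 :: real^'n"]] by simp
 then have "sq (Qsum (%_::unit. k) h)" by (subst Qsum_sq) (auto simp: inj_def)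
 moreover have "Qsum (%_::unit. k) h = wtest c k" by (auto simp: Qsum_def wtest_def h_def UNIV_unit)
 ultimately show ?thesis by simp
qed

text \<open>The weight is \<open>exp(-z\<^sup>2/2 - |y|\<^sup>2)\<close> and the transform contributes \<open>exp(-w\<^sup>2/2 - |y|\<^sup>2)\<close> with \<open>w\<close> the
conjugate of \<open>z - c\<close>; the exponents add up to \<open>-|z|\<^sup>2\<close> plus a linear term and a constant.\<close>

lemma hweight_FT1:
 fixes c :: "real^'n"
 assumes a: "al > 0"
 shows "hweight p * FT1 (wtest c k) p = (of_real (2 powr (real CARD('n) / 2)) * (PROD r:UNIV. of_real (qc (k $ r)) * (of_real (sqrt 2) * (- \<i>)) ^ (k $ r) * exp (- of_real ((c $ r)^2) / 2)))
  * Pf al c (%r. k $ r) ((1 / sqrt al) *\<^sub>R toC p)"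
proof -
 obtain x y where p: "p = (x, y)" by force
 define zeta where "zeta r = Complex (x $ r) (y $ r)" for r
 have z: "of_real (sqrt al) * ((1 / sqrt al) *\<^sub>R toC p) $ r = zeta r" for r
  using a by (simp add: toC_def p zeta_def complex_eq_iff)
 have sa: "cor al = of_real (sqrt al) * of_real (sqrt al)" using a by (simp flip: of_real_mult)
 have z2: "- of_real al * (((1 / sqrt al) *\<^sub>R toC p) $ r * cnj (((1 / sqrt al) *\<^sub>R toC p) $ r)) + of_real (sqrt al) * of_real (c $ r) * cnj (((1 / sqrt al) *\<^sub>R toC p) $ r)
  = - (zeta r * cnj (zeta r)) + of_real (c $ r) * cnj (zeta r)" for r
 proof -
  have "cnj (zeta r) = of_real (sqrt al) * cnj (((1 / sqrt al) *\<^sub>R toC p) $ r)" unfolding z[symmetric] by simp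
  then show ?thesis unfolding sa z[of r, symmetric] by (simp only: complex_cnj_mult complex_cnj_complex_of_real mult_ac mult_minus_left mult_minus_right)
 qed
 have Pf: "Pf al c (%r. k $ r) ((1 / sqrt al) *\<^sub>R toC p) = (PROD r:UNIV. (zeta r - of_real (c $ r)) ^ (k $ r) * exp (- (zeta r * cnj (zeta r)) + of_real (c $ r) * cnj (zeta r)))"
  unfolding Pf_def z z2 by (simp only: exp_sum finite prod.distrib)
 have "of_real (- (norm x)\<^sup>2 / 2 - (norm y)\<^sup>2 / 2) - \<i> * of_real (x \<bullet> y) = (SUM r:UNIV. of_real (- (x $ r)\<^sup>2 / 2 - (y $ r)\<^sup>2 / 2) - \<i> * of_real (x $ r * y $ r))"
  by (simp add: norm_sq_vec inner_vec_def sum.distrib sum_subtractf sum_distrib_left sum_divide_distrib sum_negf)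
 then have h: "hweight p = of_real (2 powr (real CARD('n) / 2)) * (PROD r:UNIV. exp (of_real (- (x $ r)\<^sup>2 / 2 - (y $ r)\<^sup>2 / 2) - \<i> * of_real (x $ r * y $ r)))"
  unfolding hweight_def p fst_conv snd_conv by (simp only: exp_sum finite)
 have r: "exp (of_real (- (x $ r)\<^sup>2 / 2 - (y $ r)\<^sup>2 / 2) - \<i> * of_real (x $ r * y $ r)) * (of_real (qc (k $ r)) * exp (of_real (- (y $ r)\<^sup>2)) *
  ((of_real (sqrt 2) * (of_real (y $ r) + \<i> * of_real (c $ r - x $ r))) ^ (k $ r) * exp ((\<i> * of_real (c $ r - x $ r) - of_real (y $ r))^2 / 2))) =
  (of_real (qc (k $ r)) * (of_real (sqrt 2) * (- \<i>)) ^ (k $ r) * exp (- of_real ((c $ r)^2) / 2)) * ((zeta r - of_real (c $ r)) ^ (k $ r) * exp (- (zeta r * cnj (zeta r)) + of_real (c $ r) * cnj (zeta r)))" for r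
 proof -
  have b: "of_real (sqrt 2) * (of_real (y $ r) + \<i> * of_real (c $ r - x $ r)) = (of_real (sqrt 2) * (- \<i>)) * (zeta r - of_real (c $ r))"
  unfolding mult.assoc by (rule arg_cong[where f="(*) _"]) (simp add: zeta_def complex_eq_iff)
  have "exp (of_real (- (x $ r)\<^sup>2 / 2 - (y $ r)\<^sup>2 / 2) - \<i> * of_real (x $ r * y $ r)) * exp (of_real (- (y $ r)\<^sup>2)) * exp ((\<i> * of_real (c $ r - x $ r) - of_real (y $ r))^2 / 2) =
  exp (- of_real ((c $ r)^2) / 2) * exp (- (zeta r * cnj (zeta r)) + of_real (c $ r) * cnj (zeta r))"
  unfolding exp_add[symmetric] by (rule arg_cong[where f=exp]) (simp add: complex_eq_iff zeta_def power2_eq_square field_simps)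
  then have "of_real (qc (k $ r)) * ((of_real (sqrt 2) * (- \<i>)) ^ (k $ r) * (zeta r - of_real (c $ r)) ^ (k $ r)) * (exp (of_real (- (x $ r)\<^sup>2 / 2 - (y $ r)\<^sup>2 / 2) - \<i> * of_real (x $ r * y $ r)) * exp (of_real (- (y $ r)\<^sup>2)) * exp ((\<i> * of_real (c $ r - x $ r) - of_real (y $ r))^2 / 2)) =
  of_real (qc (k $ r)) * ((of_real (sqrt 2) * (- \<i>)) ^ (k $ r) * (zeta r - of_real (c $ r)) ^ (k $ r)) * (exp (- of_real ((c $ r)^2) / 2) * exp (- (zeta r * cnj (zeta r)) + of_real (c $ r) * cnj (zeta r)))"
  by (rule arg_cong[where f="(*) _"])
  then show ?thesis unfolding b power_mult_distrib[of "of_real (sqrt 2) * (- \<i>)"] by (simp only: mult_ac)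
 qed
 show ?thesis unfolding p FT1_wtest(2) unfolding p[symmetric] Pf h by (simp only: mult.assoc[of "cor (2 powr (real CARD('n) / 2))"] prod.distrib[symmetric] r)
qed

lemma Fock_to_H_orthogonal:
 fixes f :: "complex^'n::{finite,linorder} => complex"
 assumes a: "al > 0" and f: "f \<in> hcarrier (Fock al m)" and k: "m <= mi_size k"
 shows "Imut (%p. Fock_to_H al f p * FT1 (wtest c k) p) = 0"
proof -
 let ?F = "%z. f z * Pf al c (%r. k $ r) z"
 have c: "continuous_on UNIV ?F" by (intro continuous_intros Fock_continuous[OF f] C_k_continuous[OF Pf_C_k])
 have "Ilb ?F = 0" by (rule fock_orthogonal[OF a f]) (use k in \<open>simp add: mi_size_def\<close>)
 then have "Imut (%p. ?F ((1 / sqrt al) *\<^sub>R toC p)) = 0"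
  unfolding complex_change_of_variables(2)[OF a borel_measurable_continuous_onI[OF c]] using a by simp
 moreover obtain K where "!!p. hweight p * FT1 (wtest c k) p = K * Pf al c (%r. k $ r) ((1 / sqrt al) *\<^sub>R toC p)"
  using hweight_FT1[OF a] by blast
 then have "Fock_to_H al f p * FT1 (wtest c k) p = K * ?F ((1 / sqrt al) *\<^sub>R toC p)" for p
  unfolding Fock_to_H_eq by (metis (no_types, lifting) mult.assoc mult.commute)
 ultimately show ?thesis by (simp only: integral_mult_right_zero mult_zero_right)
qed

lemma L2_inner_cls:
 assumes [measurable]: "f \<in> bmeas" "g \<in> bmeas"
 shows "hinner L2 (cls f) (cls g) = Imut (%p. f p * cnj (g p))"
 unfolding L2_inner
proof (rule integral_cong_AE)
 show "AE x in mut. rep (cls f) x * cnj (rep (cls g) x) = f x * cnj (g x)"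
  using rep_cls[OF assms(1)] rep_cls[OF assms(2)] unfolding AE_mut by eventually_elim simp
qed measurable

lemma bil_cls:
 assumes [measurable]: "f \<in> bmeas" "g \<in> bmeas"
 shows "bil (cls f) (cls g) = Imut (%p. f p * g p)"
 unfolding bil_def
proof (rule integral_cong_AE)
 show "AE x in mut. rep (cls f) x * rep (cls g) x = f x * g x"
  using rep_cls[OF assms(1)] rep_cls[OF assms(2)] unfolding AE_mut by eventually_elim simp
qed measurable

lemma plancherel1_cls:
 assumes "sq f" and i: "!!y. imut (%x. f (x, y))"
 shows "plancherel1 (cls f) = cls (FT1 f)"
proof -
 have [measurable]: "f \<in> bmeas" using assms by (simp add: sq_def)
 have [measurable]: "FT1 (rep (cls f)) \<in> bmeas" "FT1 f \<in> bmeas" by (intro FT1_measurable; simp)+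
 have "plancherel1 (cls f) = cls (FT1 (rep (cls f)))" by (rule plancherel1_props(2)[OF cls_sec_L1[OF assms(1)]]) (simp add: i)
 also have "... = cls (FT1 f)" by (intro cls_eqI FT1_cong rep_cls) measurable
 finally show ?thesis .
qed

lemma P1_injective:
 assumes f: "f \<in> H2" and g: "g \<in> H2" and "plancherel1 f = plancherel1 g"
 shows "f = g"
 by (rule L2.inner_sep[OF f g]) (metis P1_inner assms)

lemma integral_snd_measurable:
 fixes F :: "'a::euclidean_space \<times> 'b::euclidean_space => complex"
 assumes "F \<in> bmeas"
 shows "(%x. LINT v|mut. F (x, v)) \<in> bmeas"
proof -
 have "F \<in> borel_measurable (mut \<Otimes>\<^sub>M mut)" using assms by (simp add: borel_pair_mut)
 then have "case_prod (%x v. F (x, v)) \<in> borel_measurable (mut \<Otimes>\<^sub>M mut)" by simp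
 from mut.borel_measurable_lebesgue_integral[OF this] show ?thesis by simp
qed

definition ncoef :: "((real^'n) \<times> (real^'n) => complex) => nat ^ 'n => real^'n => complex" where
 "ncoef G k xi = Imut (%v. G (xi, v) * of_real (q_fun k xi v))"

lemma fstsnd_borel [measurable]:
 "fst \<in> borel_measurable (borel :: ('a::euclidean_space \<times> 'b::euclidean_space) measure)"
 "snd \<in> borel_measurable (borel :: ('a::euclidean_space \<times> 'b::euclidean_space) measure)"
 by (intro borel_measurable_continuous_onI continuous_on_fst continuous_on_snd continuous_on_id)+

lemma q_fun_pair [measurable]: "(%p. cor (q_fun k (fst p) (snd p))) \<in> bmeas"
 by (intro measurable_compose[OF _ borel_measurable_of_real] q_fun_measurable) measurable

lemma ncoef_measurable [measurable]:
 assumes [measurable]: "G \<in> bmeas" shows "ncoef G k \<in> bmeas"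
proof -
 have "(%p. G p * cor (q_fun k (fst p) (snd p))) \<in> bmeas" by measurable
 from integral_snd_measurable[OF this] show ?thesis by (simp add: ncoef_def[abs_def])
qed

text \<open>By symmetry of the transform, the pairing of the transform of \<open>u\<close> with \<open>wtest c
k\<close> is the pairing of \<open>u\<close> with the transform of \<open>wtest c k\<close>, which
vanishes for every \<open>c\<close>; so the damped coefficient has Fourier transform zero.\<close>

theorem ncoef_vanishes:
 fixes u :: "(real^'n::{finite,linorder}) \<times> (real^'n::{finite,linorder}) => complex"
 assumes a: "al > 0" and u: "u \<in> hcarrier (Hsp al m)" and k: "m <= mi_size k"
 shows "AE xi in lborel. ncoef (rep (plancherel1 (cls u))) k xi = 0"
proof -
 have su: "sq u" by (rule Hsp_sq[OF a u])
 have [measurable]: "u \<in> bmeas" using su by (simp add: sq_def)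
 have uc: "cls u \<in> H2" by (rule L2_cls_carrier[OF su])
 define G where "G = rep (plancherel1 (cls u))"
 have sG: "sq G" using P1_carrier[OF uc] by (simp add: G_def L2_carrier_iff)
 have [measurable]: "G \<in> bmeas" using sG by (simp add: sq_def)
 have wm[measurable]: "wtest c k \<in> bmeas" for c using sq_wtest[of c k] by (simp add: sq_def)
 obtain f where f: "u = Fock_to_H al f" "f \<in> hcarrier (Fock al m)" using u by (rule HspE)
 have iG: "imut (%p. G p * wtest c k p)" for c by (rule sq_product_integrable[OF sG sq_wtest]) (auto simp: norm_mult)
 have zG: "Imut (%p. G p * wtest c k p) = 0" for c
 proof -
  have [measurable]: "FT1 (wtest c k) \<in> bmeas" by (rule FT1_measurable) measurable
  have "Imut (%p. G p * wtest c k p) = bil (cls G) (cls (wtest c k))" by (rule bil_cls[symmetric]) measurable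
  also have "... = bil (cls u) (plancherel1 (cls (wtest c k)))" unfolding G_def cls_rep by (rule P1_symmetric[OF uc L2_cls_carrier[OF sq_wtest]])
  also have "... = Imut (%p. u p * FT1 (wtest c k) p)" unfolding plancherel1_cls[OF sq_wtest FT1_wtest(1)] by (rule bil_cls) measurable
  also have "... = 0" unfolding f(1) by (rule Fock_to_H_orthogonal[OF a f(2) k])
  finally show ?thesis .
 qed
 define W where "W xi = of_real (exp (- (norm xi)\<^sup>2 / 4)) * ncoef G k xi" for xi
 have e: "(LINT v|mut. G (xi, v) * wtest c k (xi, v)) = W xi * exp (\<i> * of_real (c \<bullet> xi))" for c xi
 proof -
  have "G (xi, v) * wtest c k (xi, v) = (exp (of_real (- (norm xi)\<^sup>2 / 4)) * exp (\<i> * of_real (c \<bullet> xi))) * (G (xi, v) * of_real (q_fun k xi v))" for v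
  unfolding wtest_def split exp_add by (simp only: mult_ac)
  then show ?thesis unfolding W_def ncoef_def by (simp only: integral_mult_right_zero exp_of_real) (simp add: mult_ac)
 qed
 have "AE xi in lborel. W xi = 0"
 proof (rule fourier_L1_injective)
  show "imut W" using fubini(2)[OF iG[of 0]] unfolding e by simp
  show "Imut (%x. W x * exp (- \<i> * of_real (x \<bullet> y))) = 0" for y
  using fubini(1)[OF iG[of "- y"]] unfolding e zG by (simp add: inner_commute)
 qed
 then show ?thesis unfolding G_def[symmetric] by eventually_elim (simp add: W_def)
qed

lemma Qsum_section_sq:
 assumes inj: "inj ph" shows "sq (%v. Qsum ph h (xi, v))"
proof -
 have e: "Qsum ph h (xi, v) * cnj (Qsum ph h (xi, v)) = of_real ((norm (Qsum ph h (xi, v)))^2)" for v by (simp add: complex_norm_square[symmetric])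
 have "(%v. Qsum ph h (xi, v)) \<in> bmeas" unfolding Qsum_def split by measurable
 then show ?thesis unfolding sq_def using Qsum_section(1)[OF inj, of h xi h] unfolding e complex_of_real_integrable_eq by simp
qed

lemma Qsum_coef:
 assumes inj: "inj ph"
 shows "Imut (%v. Qsum ph h (xi, v) * of_real (q_fun l xi v)) = (SUM j:UNIV. if ph j = l then h xi $ j else 0)"
proof -
 let ?t = "%j v. h xi $ j * cor (q_fun (ph j) xi v * q_fun l xi v)"
 have e: "Qsum ph h (xi, v) * of_real (q_fun l xi v) = (SUM j:UNIV. ?t j v)" for v unfolding Qsum_def by (simp add: sum_distrib_left mult_ac)
 have "Imut (%v. Qsum ph h (xi, v) * of_real (q_fun l xi v)) = (SUM j:UNIV. Imut (?t j))"
  unfolding e by (intro Bochner_Integration.integral_sum integrable_mult_right q_orthonormal)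
 also have "... = (SUM j:UNIV. if ph j = l then h xi $ j else 0)" unfolding integral_mult_right_zero q_orthonormal(2) by (intro sum.cong) auto
 finally show ?thesis .
qed

lemma Qsum_inj:
 assumes inj: "inj ph" and h: "sq h" and k: "sq k" and e: "AE p in lborel. Qsum ph h p = Qsum ph k p"
 shows "AE xi in lborel. h xi = k xi"
proof -
 let ?d = "%xi. h xi - k xi"
 have d: "sq ?d" by (rule sq_diff[OF h k])
 have [measurable]: "?d \<in> bmeas" using d by (simp add: sq_def)
 have "Qsum ph ?d p = Qsum ph h p - Qsum ph k p" for p by (simp add: Qsum_def split_beta left_diff_distrib sum_subtractf)
 with e have z: "AE p in lborel. Qsum ph ?d p * cnj (Qsum ph ?d p) = 0" by (auto elim: eventually_mono)
 have "Imut (%p. Qsum ph ?d p * cnj (Qsum ph ?d p)) = integral\<^sup>L (mut :: ((real ^ 'b) \<times> (real ^ 'b)) measure) (%p. 0)"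
  by (rule integral_cong_AE) (use z in \<open>simp_all\<close>)
 then have "Imut (%xi. cip (?d xi) (?d xi)) = 0" unfolding Qsum_inner[OF inj d d] by simp
 then have "Imut (%xi. (norm (?d xi))^2) = 0" unfolding cip_self by (simp del: of_real_power)
 moreover have "imut (%xi. (norm (?d xi))^2)" using d by (simp add: sq_def)
 ultimately have "AE xi in mut. (norm (?d xi))\<^sup>2 = 0" by (subst (asm) integral_nonneg_eq_0_iff_AE) auto
 then show ?thesis by (simp)
qed

lemma smult_measurable [measurable (raw)]:
 assumes "f \<in> borel_measurable M" "g \<in> borel_measurable M"
 shows "(%x. f x *s (g x :: complex^'d)) \<in> borel_measurable M"
proof -
 have "continuous_on UNIV (%p :: complex \<times> (complex^'d). fst p *s snd p)"
  unfolding vector_scalar_mult_def by (intro continuous_intros)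
 from borel_measurable_continuous_Pair[OF assms this] show ?thesis .
qed

definition chi :: "'a::euclidean_space => ('a, complex^'d) L0 => ('a, complex^'d) L0" where
 "chi a h = cls (%xi. exp (- \<i> * of_real (a \<bullet> xi)) *s rep h xi)"

lemma rep_chi: "AE xi in lborel. rep (chi a h) xi = exp (- \<i> * of_real (a \<bullet> xi)) *s rep h xi"
 unfolding chi_def by (rule rep_cls) measurable

lemmas L2vec_carrier = vec.L2g_carrier[folded L2vec_eq]

lemma chi_carrier: "h \<in> HV ==> chi a h \<in> HV"
 unfolding L2vec_carrier
 by (rule sq_norm_bound[where C=1]) (use rep_chi[of a h] in \<open>auto simp: vec.norm_sc norm_exp_eq_Re elim: eventually_mono\<close>)

lemma vec_lambda_measurable [measurable (raw)]:
 fixes f :: "'d::finite => 'a => 'b::euclidean_space"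
 assumes [measurable]: "!!j. f j \<in> borel_measurable M" shows "(%x. \<chi> j. f j x) \<in> borel_measurable M"
proof -
 have "(%x. f j x \<bullet> w) \<in> borel_measurable M" for j w by measurable
 then show ?thesis by (subst borel_measurable_euclidean_space) (auto simp: Basis_vec_def inner_axis)
qed

locale fock_setting =
 fixes al :: real and m :: nat and ph :: "'d::{finite,linorder} => nat ^ 'n::{finite,linorder}"
 assumes a: "al > 0" and m: "m >= 1" and enum: "ph = lex_enum m" and bij: "bij_betw ph UNIV (J_set m)"
begin

abbreviation R :: "((real^'n::{finite,linorder}) \<times> (real^'n::{finite,linorder}) => complex) => (real^'n::{finite,linorder}, complex^'d::{finite,linorder}) L0"
 where "R \<equiv> R_H al m"

abbreviation H where "H \<equiv> Hsp al m :: ((real^'n::{finite,linorder}) \<times> (real^'n::{finite,linorder}) => complex) hilb"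

lemma inj: "inj ph" using bij by (simp add: bij_betw_def)

lemma not_J: "l \<notin> range ph \<longleftrightarrow> m <= mi_size l"
 using bij m by (auto simp: bij_betw_def J_set_def)

text \<open>For almost every \<open>xi\<close> the difference of the section and of its finite expansion is
orthogonal to all \<open>q\<^bsub>k,xi\<^esub>\<close>: for \<open>|k| < m\<close> by construction, for
\<open>|k| \<ge> m\<close> because the coefficient vanishes.\<close>

lemma R_expansion:
 assumes u: "u \<in> hcarrier H"
 shows "R u \<in> HV" "plancherel1 (cls u) = cls (Qsum ph (rep (R u)))"
proof -
 have su: "sq u" by (rule Hsp_sq[OF a u])
 have uc: "cls u \<in> H2" by (rule L2_cls_carrier[OF su])
 define G where "G = rep (plancherel1 (cls u))"
 have sG: "sq G" using P1_carrier[OF uc] by (simp add: G_def L2_carrier_iff)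
 have [measurable]: "G \<in> bmeas" using sG by (simp add: sq_def)
 define h where "h xi = (\<chi> j. ncoef G (ph j) xi)" for xi
 have hm[measurable]: "h \<in> bmeas" unfolding h_def[abs_def] by (intro vec_lambda_measurable ncoef_measurable) measurable
 have "plancherel1 (cls u) \<in> H_hat al m" using u by (auto simp: H_hat_def)
 then have Ru: "R u = cls h" using u by (simp add: R_H_def N_op_def h_def[abs_def] ncoef_def G_def enum)
 have "AE xi in lborel. ALL l. m <= mi_size l --> ncoef G l xi = 0"
  unfolding AE_all_countable using ncoef_vanishes[OF a u] by (auto simp: G_def)
 then have "AE xi in lborel. AE v in lborel. G (xi, v) = Qsum ph h (xi, v)"
  using sq_sections(2)[OF sG]
 proof eventually_elim
  case (elim xi)
  note sQ = Qsum_section_sq[OF inj, of h xi]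
  have "AE v in lborel. G (xi, v) - Qsum ph h (xi, v) = 0"
  proof (rule q_complete[OF sq_diff[OF elim(2) sQ]])
  fix l
  have i: "imut (%v. F v * of_real (q_fun l xi v))" if "sq F" for F :: "real^'n::{finite,linorder} => complex"
  by (rule sq_product_integrable[OF that sq_q_fun[of l xi]]) (use that in \<open>auto simp: norm_mult sq_def\<close>)
  have "(SUM j:UNIV. if ph j = l then h xi $ j else 0) = ncoef G l xi"
  proof (cases "l \<in> range ph")
  case True
  then obtain i where "l = ph i" by blast
  then show ?thesis using inj by (simp add: inj_eq h_def)
  next
  case False
  then show ?thesis using elim(1) not_J[of l] by (auto intro!: sum.neutral)
  qed
  then show "Imut (%v. (G (xi, v) - Qsum ph h (xi, v)) * of_real (q_fun l xi v)) = 0"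
  using i[OF elim(2)] i[OF sQ] by (simp add: left_diff_distrib Qsum_coef[OF inj] ncoef_def)
  qed
  then show ?case by eventually_elim simp
 qed
 then have GQ: "AE p in lborel. G p = Qsum ph h p" by (intro AE_pair_I) measurable
 have "sq (Qsum ph h)" by (rule sq_cong_AE[OF sG]) (use GQ in \<open>auto elim: eventually_mono\<close>)
 then have sh: "sq h" by (simp add: Qsum_sq[OF inj hm])
 show "R u \<in> HV" unfolding Ru L2vec_eq by (rule vec.cls_carrier[OF sh])
 have "plancherel1 (cls u) = cls G" by (simp add: G_def)
 also have "... = cls (Qsum ph h)" by (rule cls_eqI[OF _ _ GQ]) measurable
 also have "... = cls (Qsum ph (rep (R u)))"
  unfolding Ru by (rule cls_eqI[OF _ _ Qsum_cong]) (use rep_cls[OF hm] in \<open>auto elim: eventually_mono\<close>)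
 finally show "plancherel1 (cls u) = cls (Qsum ph (rep (R u)))" .
qed

lemma Qcls_carrier: "h \<in> HV ==> cls (Qsum ph (rep h)) \<in> H2"
 by (rule L2_cls_carrier) (simp add: Qsum_sq[OF inj] L2vec_carrier)

lemma Qcls_inj:
 assumes "h \<in> HV" "k \<in> HV" "cls (Qsum ph (rep h)) = cls (Qsum ph (rep k))"
 shows "h = k"
proof (rule L0_eqI)
 have "AE p in lborel. Qsum ph (rep h) p = Qsum ph (rep k) p" by (rule cls_eqD[OF _ _ assms(3)]) measurable
 then show "AE x in lborel. rep h x = rep k x" using assms(1,2) by (intro Qsum_inj[OF inj]) (simp_all add: L2vec_carrier)
qed

text \<open>The inverse of \<open>R\<close>, as an absolutely convergent integral at every point.\<close>

definition S :: "(real^'n::{finite,linorder}, complex^'d::{finite,linorder}) L0 => (real^'n::{finite,linorder}) \<times> (real^'n::{finite,linorder}) => complex" where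
 "S h = (%(x, y). Imut (%xi. Qsum ph (rep h) (xi, y) * exp (\<i> * of_real (xi \<bullet> x))))"

lemma S_cls:
 assumes h: "h \<in> HV"
 shows "plancherel1_inv (cls (Qsum ph (rep h))) = cls (S h)"
proof -
 let ?Q = "Qsum ph (rep h)" and ?Q' = "%p. cnj (Qsum ph (rep h) p)"
 have sh: "sq (rep h)" using h by (simp add: L2vec_carrier)
 have [measurable]: "?Q' \<in> bmeas" by measurable
 have "sq ?Q" by (simp add: Qsum_sq[OF inj] sh)
 then have sQ': "sq ?Q'" by (rule sq_norm_bound[where C=1]) auto
 have i: "imut (%x. ?Q' (x, y))" for y using Qsum_section_L1[OF sh] by (simp only: integrable_cnj)
 have [measurable]: "FT1 ?Q' \<in> bmeas" by (rule FT1_measurable) measurable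
 have "plancherel1_inv (cls ?Q) = cj (plancherel1 (cls ?Q'))" unfolding plancherel1_inv_def by (subst cj_cls) measurable
 also have "... = cls (%p. cnj (FT1 ?Q' p))" unfolding plancherel1_cls[OF sQ' i] by (rule cj_cls) measurable
 also have "(%p. cnj (FT1 ?Q' p)) = S h"
  unfolding S_def FT1_def FT_def split_beta Bochner_Integration.integral_cnj[symmetric] by (simp add: exp_cnj fun_eq_iff)
 finally show ?thesis .
qed

end

lemma char_pr: "\<i> * of_real (xi \<bullet> x) - of_real (xi \<bullet> y) = \<i> * pr (toC (x, y)) xi"
 by (simp add: pr_def toC_def inner_vec_def complex_eq_iff sum_negf sum_subtractf mult.commute)

lemma q_fun_exp:
 "of_real (q_fun k xi y) * exp (\<i> * of_real (xi \<bullet> x)) = of_real (exp (- (norm y)\<^sup>2)) * (PROD r:UNIV. of_real (qc (k $ r))) *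
  (of_real (exp (- (norm xi)\<^sup>2 / 4)) * (PROD r:UNIV. cor (hermite (k $ r) ((xi $ r + 2 * Im (toC (x, y) $ r)) / sqrt 2))) * exp (\<i> * pr (toC (x, y)) xi))"
proof -
 have "(SUM r:UNIV. - (xi $ r + 2 * y $ r)\<^sup>2 / 4) = - (norm xi)\<^sup>2 / 4 - xi \<bullet> y - (norm y)\<^sup>2"
  unfolding norm_sq_vec inner_vec_def inner_real_def sum_negf[symmetric] sum_divide_distrib sum_subtractf[symmetric]
  by (rule sum.cong) (simp_all add: power2_eq_square field_simps)
 then have "(SUM r:UNIV. cor (- (xi $ r + 2 * y $ r)\<^sup>2 / 4)) = of_real (- (norm xi)\<^sup>2 / 4 - xi \<bullet> y - (norm y)\<^sup>2)"
  by (simp only: of_real_sum[symmetric])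
 then have "(PROD r:UNIV. exp (cor (- (xi $ r + 2 * y $ r)\<^sup>2 / 4))) = exp (of_real (- (norm xi)\<^sup>2 / 4 - xi \<bullet> y - (norm y)\<^sup>2))"
  by (simp only: exp_sum[symmetric] finite)
 then have q: "of_real (q_fun k xi y) = (PROD r:UNIV. of_real (qc (k $ r))) * (PROD r:UNIV. cor (hermite (k $ r) ((xi $ r + 2 * y $ r) / sqrt 2))) * exp (of_real (- (norm xi)\<^sup>2 / 4 - xi \<bullet> y - (norm y)\<^sup>2))"
  unfolding q_fun_eq of_real_prod exp_q1 prod.distrib by simp
 have e: "exp (of_real (- (norm xi)\<^sup>2 / 4 - xi \<bullet> y - (norm y)\<^sup>2)) * exp (\<i> * of_real (xi \<bullet> x)) = exp (of_real (- (norm y)\<^sup>2)) * exp (of_real (- (norm xi)\<^sup>2 / 4)) * exp (\<i> * pr (toC (x, y)) xi)"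
  unfolding char_pr[symmetric] exp_add[symmetric] by (rule arg_cong[where f=exp]) simp
 have "Im (toC (x, y) $ r) = y $ r" for r by (simp add: toC_def)
 then show ?thesis unfolding q mult.assoc e unfolding exp_of_real by (simp only: mult_ac)
qed

lemma sexp_gauss:
 fixes h :: "real^'n => complex"
 assumes h: "sq h"
 shows "sexp (%xi. h xi * of_real (exp (- (norm xi)\<^sup>2 / 4)))"
proof -
 have [measurable]: "h \<in> bmeas" using h by (simp add: sq_def)
 have "imut (%xi. cmod (h xi * of_real (exp (- (norm xi)\<^sup>2 / 4))) * exp (B * norm xi))" for B
 proof -
  let ?g = "%xi::real^'n. exp (- (norm xi)\<^sup>2 / 4) * exp (B * norm xi)"
  have "sq ?g"
  proof (rule sq_bound)
  have "imut (%xi::real^'n. exp (- ((1 / sqrt 2) * norm xi)\<^sup>2 / 2))"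
  using integrable_norm[OF gauss_fourier(1)[of "1 / sqrt 2" "0::real^'n"]] by simp
  then show "imut (%xi::real^'n. exp (4 * B^2) * exp (- ((1 / sqrt 2) * norm xi)\<^sup>2 / 2))" by (rule integrable_mult_right)
  have "(norm (?g xi))\<^sup>2 <= exp (4 * B^2) * exp (- ((1 / sqrt 2) * norm xi)\<^sup>2 / 2)" for xi :: "real^'n"
  proof -
  define t where "t = norm xi"
  have "(norm (?g xi))\<^sup>2 = exp (- t\<^sup>2 / 2 + 2 * B * t)" unfolding t_def exp_add[symmetric]
  by (simp flip: exp_double add: algebra_simps)
  also have "... <= exp (4 * B^2 + - t\<^sup>2 / 4)"
  proof -
  have "0 <= (t / 2 - 2 * B)^2" by simp
  then show ?thesis by (simp add: power2_eq_square field_simps)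
  qed
  finally show ?thesis unfolding exp_add t_def by (simp add: power_mult_distrib power_divide)
  qed
  then show "AE xi in lborel. (norm (?g xi))\<^sup>2 <= exp (4 * B^2) * exp (- ((1 / sqrt 2) * norm xi)\<^sup>2 / 2)" by simp
  qed measurable
  then show ?thesis by (rule sq_product_integrable[OF h]) (auto simp: norm_mult)
 qed
 then show ?thesis unfolding sexp_def by simp
qed

context fock_setting
begin

text \<open>\<open>S h\<close> is the image of \<open>exp(\<alpha> z\<^sup>2/2)\<close> times a sum of functions
\<open>HP\<close>; the first factor is holomorphic, so it does not change the order of analyticity.\<close>

lemma S_in: assumes h: "h \<in> HV" shows "S h \<in> hcarrier H"
proof -
 have sh: "sq (rep h)" using h by (simp add: L2vec_carrier)
 define u where "u j xi = rep h xi $ j * of_real (exp (- (norm xi)\<^sup>2 / 4))" for j xi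
 have su: "sexp (u j)" for j unfolding u_def[abs_def] by (rule sexp_gauss[OF sq_coord[OF sh]])
 define c where "c j = of_real (2 powr (- real CARD('n) / 2)) * (PROD r:UNIV. cor (qc (ph j $ r)))" for j
 define f where "f z = exp (SUM r:UNIV. of_real (al / 2) * (z $ r)^2) * (SUM j:UNIV. c j * HP (%r. ph j $ r) (u j) (sqrt al *\<^sub>R z))" for z :: "complex^'n::{finite,linorder}"
 have An: "An m f" unfolding f_def[abs_def]
 proof (rule An_hol_mult)
  have c: "C_k k (%z::complex^ 'n::{finite,linorder}. SUM r:UNIV. of_real (al / 2) * (z $ r)^2)" for k
  by (intro C_k_sum C_k_mult C_k_const C_k_power C_k_coord)
  show "smooth (%z::complex^ 'n::{finite,linorder}. exp (SUM r:UNIV. of_real (al / 2) * (z $ r)^2))" by (intro smoothI C_k_exp c)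
  have "dbar s (%z::complex^ 'n::{finite,linorder}. of_real (al / 2) * (z $ r)^2) = (%_. 0)" for s r
  unfolding dbar_cmult[OF C_k_power[OF C_k_coord(1), of "Suc 0"]]
  by (simp add: dbar_power_hol[OF C_k_coord(1)[of "Suc 0"] dbar_coord])
  then have "dbar s (%z::complex^ 'n::{finite,linorder}. SUM r:UNIV. of_real (al / 2) * (z $ r)^2) = (%_. 0)" for s
  by (subst dbar_sum[of _ 0]) (simp_all del: of_real_divide add: C_k_mult C_k_const C_k_power C_k_coord)
  then show "dbar s (%z::complex^ 'n::{finite,linorder}. exp (SUM r:UNIV. of_real (al / 2) * (z $ r)^2)) = (%_. 0)" for s
  unfolding dbar_exp[OF c[of "Suc 0"]] by simp
  show "An m (%z. SUM j:UNIV. c j * HP (%r. ph j $ r) (u j) (sqrt al *\<^sub>R z))"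
  proof (intro An_sum An_cmult An_scale finite)
  fix j
  have "Suc (SUM r:UNIV. ph j $ r) <= m" using not_J[of "ph j"] by (simp add: mi_size_def)
  then show "An m (HP (%r. ph j $ r) (u j))" by (rule An_mono[OF HP_An[OF su]])
  qed
 qed
 have S: "S h p = Fock_to_H al f p" for p
 proof -
  obtain x y where p: "p = (x, y)" by force
  let ?I = "%j xi. rep h xi $ j * of_real (q_fun (ph j) xi y) * exp (\<i> * of_real (xi \<bullet> x))"
  have i: "imut (?I j)" for j
  by (rule sq_product_integrable[OF sq_coord[OF sh, of j] sq_q_fun_first[of "ph j" y]]) (auto simp: norm_mult)
  have t: "sqrt al *\<^sub>R ((1 / sqrt al) *\<^sub>R toC p) = toC p" using a by simp
  have I: "Imut (?I j) = of_real (exp (- (norm y)\<^sup>2)) * (PROD r:UNIV. of_real (qc (ph j $ r))) * HP (%r. ph j $ r) (u j) (toC p)" for j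
  proof -
  have "?I j xi = of_real (exp (- (norm y)\<^sup>2)) * (PROD r:UNIV. of_real (qc (ph j $ r))) *
  (u j xi * (PROD r:UNIV. cor (hermite (ph j $ r) ((xi $ r + 2 * Im (toC p $ r)) / sqrt 2))) * exp (\<i> * pr (toC p) xi))" for xi
  unfolding mult.assoc[of "rep h xi $ j"] q_fun_exp p u_def by (simp only: mult_ac)
  then show ?thesis unfolding HP_def by (simp only: integral_mult_right_zero)
  qed
  have "S h p = (SUM j:UNIV. Imut (?I j))" unfolding p S_def split Qsum_def sum_distrib_right
  by (intro Bochner_Integration.integral_sum i)
  also have "... = of_real (exp (- (norm y)\<^sup>2)) * (SUM j:UNIV. (PROD r:UNIV. of_real (qc (ph j $ r))) * HP (%r. ph j $ r) (u j) (toC p))"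
  unfolding I by (simp only: sum_distrib_left mult.assoc)
  also have "of_real (exp (- (norm y)\<^sup>2)) = of_real (2 powr (- real CARD('n) / 2)) * (hweight p * exp (SUM r:UNIV. of_real (al / 2) * (((1 / sqrt al) *\<^sub>R toC p) $ r)^2))"
  proof -
  have ar: "cor (al / 2) * (((1 / sqrt al) *\<^sub>R toC p) $ r)^2 = (toC p $ r)^2 / 2" for r
  proof -
  have s: "cor al = (of_real (sqrt al))^2" using a by (simp flip: of_real_power)
  have "toC p $ r = of_real (sqrt al) * ((1 / sqrt al) *\<^sub>R toC p) $ r" by (subst t[symmetric]) (simp only: vector_scaleR_component scaleR_conv_of_real[where 'a=complex])
  then have "(toC p $ r)\<^sup>2 = of_real al * (((1 / sqrt al) *\<^sub>R toC p) $ r)^2" unfolding s by (simp only: power_mult_distrib)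
  then show ?thesis by simp
  qed
  have tc: "(toC p $ r)\<^sup>2 / 2 = of_real ((x $ r)^2 / 2 - (y $ r)\<^sup>2 / 2) + \<i> * of_real (x $ r * y $ r)" for r
  by (simp add: toC_def p complex_eq_iff power2_eq_square)
  have "(SUM r:UNIV. (toC p $ r)\<^sup>2 / 2) = of_real ((norm x)^2 / 2 - (norm y)\<^sup>2 / 2) + \<i> * of_real (x \<bullet> y)"
  unfolding tc by (simp add: norm_sq_vec inner_vec_def sum.distrib sum_subtractf sum_distrib_left sum_divide_distrib)
  then have "of_real (- (norm x)\<^sup>2 / 2 - (norm y)\<^sup>2 / 2) - \<i> * of_real (x \<bullet> y) + (SUM r:UNIV. (toC p $ r)\<^sup>2 / 2) = of_real (- (norm y)\<^sup>2)"
  by (simp add: complex_eq_iff)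
  then have "hweight p * exp (SUM r:UNIV. (toC p $ r)\<^sup>2 / 2) = of_real (2 powr (real CARD('n) / 2)) * of_real (exp (- (norm y)\<^sup>2))"
  unfolding hweight_def p fst_conv snd_conv mult.assoc exp_add[symmetric] by (simp only: exp_of_real)
  moreover have "cor (2 powr (- real CARD('n) / 2)) * of_real (2 powr (real CARD('n) / 2)) = 1"
  by (simp add: powr_add[symmetric] flip: of_real_mult)
  ultimately show ?thesis unfolding ar by (simp add: mult.assoc[symmetric])
  qed
  finally show ?thesis unfolding Fock_to_H_eq f_def t c_def mult.assoc sum_distrib_left[symmetric] by (simp only: mult.left_commute)
 qed
 have fc: "continuous_on UNIV f" by (rule C_k_continuous[OF smoothD[OF An_smooth[OF An], of 0]])
 have [measurable]: "S h \<in> bmeas" unfolding S[abs_def]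
  by (rule borel_measurable_continuous_onI[OF Fock_to_H_continuous[OF fc]])
 have "cls (S h) \<in> H2" unfolding S_cls[OF h, symmetric] by (rule P1inv_carrier[OF Qcls_carrier[OF h]])
 then have "sq (S h)" unfolding L2_carrier_iff
  by (rule sq_cong_AE) (use rep_cls[of "S h"] in \<open>auto elim: eventually_mono\<close>)
 then have "sq (Fock_to_H al f)" using S by (simp add: S[abs_def])
 then have "f \<in> hcarrier (Fock al m)" using An_m_analytic[OF An] by (simp add: Fock_def Fock_to_H_sq[OF a fc])
 moreover have "S h = Fock_to_H al f" by (rule ext) (rule S)
 ultimately show ?thesis unfolding Hsp_def hilb.simps by (intro image_eqI[of _ _ f])
qed

lemma R_S: assumes h: "h \<in> HV" shows "R (S h) = h"
proof (rule Qcls_inj[OF R_expansion(1)[OF S_in[OF h]] h])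
 show "cls (Qsum ph (rep (R (S h)))) = cls (Qsum ph (rep h))"
  unfolding R_expansion(2)[OF S_in[OF h], symmetric] S_cls[OF h, symmetric] by (rule P1_inverse[OF Qcls_carrier[OF h]])
qed

lemma H_cls_inj:
 assumes "sq u" "sq v" "continuous_on UNIV u" "continuous_on UNIV v" "plancherel1 (cls u) = plancherel1 (cls v)"
 shows "u = v"
proof (rule continuous_AE_eq[OF assms(3,4)])
 have "cls u = cls v" by (rule P1_injective[OF L2_cls_carrier[OF assms(1)] L2_cls_carrier[OF assms(2)] assms(5)])
 then show "AE x in lborel. u x = v x" by (rule cls_eqD[rotated -1]) (use assms in \<open>simp_all add: sq_def\<close>)
qed

lemma H_sqc: assumes "u \<in> hcarrier H" shows "sq u" "continuous_on UNIV u" "u \<in> bmeas" "cls u \<in> H2"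
 using Hsp_sq[OF a assms] Hsp_continuous[OF assms] by (simp_all add: sq_def L2_cls_carrier)

lemma R_bij: "bij_betw R (hcarrier H) (HV)"
proof (rule bij_betwI')
 fix u v assume u: "u \<in> hcarrier H" and v: "v \<in> hcarrier H"
 have "u = v" if "R u = R v"
  by (rule H_cls_inj[OF H_sqc(1)[OF u] H_sqc(1)[OF v] H_sqc(2)[OF u] H_sqc(2)[OF v]]) (simp add: R_expansion(2) u v that)
 then show "(R u = R v) = (u = v)" by blast
next
 fix h :: "(real^'n::{finite,linorder}, complex^'d::{finite,linorder}) L0" assume "h \<in> HV"
 then show "EX u:hcarrier H. h = R u" by (intro bexI[of _ "S h"]) (simp_all add: R_S S_in)
qed (rule R_expansion(1))

lemma S_R: assumes "u \<in> hcarrier H" shows "S (R u) = u"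
 by (rule inj_onD[OF bij_betw_imp_inj_on[OF R_bij] R_S[OF R_expansion(1)[OF assms]] S_in[OF R_expansion(1)[OF assms]] assms])

lemma R_inner:
 assumes u: "u \<in> hcarrier H" and v: "v \<in> hcarrier H"
 shows "hinner L2vec (R u) (R v) = hinner H u v"
proof -
 have s: "sq (rep (R u))" "sq (rep (R v))" using R_expansion(1)[OF u] R_expansion(1)[OF v] by (simp_all add: L2vec_carrier)
 have "hinner L2vec (R u) (R v) = Imut (%p. Qsum ph (rep (R u)) p * cnj (Qsum ph (rep (R v)) p))"
  unfolding Qsum_inner[OF inj s] by (simp add: L2vec_def)
 also have "... = hinner L2 (plancherel1 (cls u)) (plancherel1 (cls v))" unfolding R_expansion(2)[OF u] R_expansion(2)[OF v] by (rule L2_inner_cls[symmetric]) measurable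
 also have "... = hinner L2 (cls u) (cls v)" by (rule P1_inner[OF H_sqc(4)[OF u] H_sqc(4)[OF v]])
 also have "... = hinner H u v" using H_sqc(3)[OF u] H_sqc(3)[OF v] by (simp add: L2_inner_cls Hsp_def)
 finally show ?thesis .
qed

text \<open>The preimage of \<open>R u + R v\<close> and the function \<open>u + v\<close> have the same transform
and are continuous, so they agree. This also shows that \<open>\<H>\<^sub>m\<close> is closed under
addition.\<close>

lemma R_add:
 assumes u: "u \<in> hcarrier H" and v: "v \<in> hcarrier H"
 shows "hadd H u v \<in> hcarrier H" "R (hadd H u v) = hadd L2vec (R u) (R v)"
proof -
 let ?k = "hadd L2vec (R u) (R v)"
 have k: "?k \<in> HV" using vec.L2g_prehilbert[folded L2vec_eq] R_expansion(1) u v by (intro prehilbert.add_closed) auto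
 have [measurable]: "u \<in> bmeas" "v \<in> bmeas" using H_sqc(3) u v by auto
 have uv: "hadd H u v = (%p. u p + v p)" by (simp add: Hsp_def)
 have "AE xi in lborel. rep ?k xi = rep (R u) xi + rep (R v) xi" using vec.rep_add unfolding L2vec_eq .
 from Qsum_cong[OF this, of ph] have "AE p in lborel. Qsum ph (rep ?k) p = Qsum ph (rep (R u)) p + Qsum ph (rep (R v)) p"
  by eventually_elim (simp add: Qsum_def split_beta distrib_right sum.distrib)
 then have "cls (Qsum ph (rep ?k)) = cls (%p. Qsum ph (rep (R u)) p + Qsum ph (rep (R v)) p)"
  by (intro cls_eqI) measurable
 also have "... = hadd L2 (plancherel1 (cls u)) (plancherel1 (cls v))" unfolding R_expansion(2)[OF u] R_expansion(2)[OF v] by (rule L2_cls_add[symmetric]) measurable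
 also have "... = plancherel1 (hadd L2 (cls u) (cls v))" using H_sqc(4) u v by (simp add: bounded_opsD(2)[OF plancherel1_props(1)])
 also have "hadd L2 (cls u) (cls v) = cls (hadd H u v)" unfolding uv by (rule L2_cls_add) measurable
 finally have "S ?k = hadd H u v" using H_sqc(1,2)[OF u] H_sqc(1,2)[OF v] unfolding uv
  by (intro H_cls_inj H_sqc(1,2)[OF S_in[OF k]] sq_add continuous_on_add) (simp_all add: R_expansion(2)[OF S_in[OF k]] R_S[OF k])
 then show "hadd H u v \<in> hcarrier H" "R (hadd H u v) = ?k" using S_in[OF k] R_S[OF k] by simp_all
qed

lemma R_scale:
 assumes u: "u \<in> hcarrier H"
 shows "hscale H c u \<in> hcarrier H" "R (hscale H c u) = hscale L2vec c (R u)"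
proof -
 let ?k = "hscale L2vec c (R u)"
 have k: "?k \<in> HV" using vec.L2g_prehilbert[folded L2vec_eq] R_expansion(1) u by (intro prehilbert.scale_closed) auto
 have [measurable]: "u \<in> bmeas" using H_sqc(3) u by auto
 have cu: "hscale H c u = (%p. c * u p)" by (simp add: Hsp_def)
 have "AE xi in lborel. rep ?k xi = c *s rep (R u) xi" using vec.rep_scale unfolding L2vec_eq .
 from Qsum_cong[OF this, of ph] have "AE p in lborel. Qsum ph (rep ?k) p = c * Qsum ph (rep (R u)) p"
  by eventually_elim (simp add: Qsum_def split_beta sum_distrib_left mult.assoc)
 then have "cls (Qsum ph (rep ?k)) = cls (%p. c * Qsum ph (rep (R u)) p)"
  by (intro cls_eqI) measurable
 also have "... = hscale L2 c (plancherel1 (cls u))" unfolding R_expansion(2)[OF u] by (rule L2_cls_scale[symmetric]) measurable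
 also have "... = plancherel1 (hscale L2 c (cls u))" using H_sqc(4) u by (simp add: bounded_opsD(3)[OF plancherel1_props(1)])
 also have "hscale L2 c (cls u) = cls (hscale H c u)" unfolding cu by (rule L2_cls_scale) measurable
 finally have "cls (Qsum ph (rep ?k)) = plancherel1 (cls (hscale H c u))" .
 moreover have "sq (%p. c * u p)" by (rule sq_norm_bound[OF H_sqc(1)[OF u], of _ "cmod c"]) (auto simp: norm_mult)
 ultimately have "S ?k = hscale H c u" using H_sqc(2)[OF u] unfolding cu
  by (intro H_cls_inj H_sqc(1,2)[OF S_in[OF k]] continuous_on_mult continuous_on_const) (simp_all add: R_expansion(2)[OF S_in[OF k]] R_S[OF k])
 then show "hscale H c u \<in> hcarrier H" "R (hscale H c u) = ?k" using S_in[OF k] R_S[OF k] by simp_all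
qed

lemma S_chi: "S (chi b h) = rho_H b (S h)"
proof (rule ext)
 fix p :: "(real^'n::{finite,linorder}) \<times> (real^'n::{finite,linorder})"
 obtain x y where p: "p = (x, y)" by force
 have "S (chi b h) (x, y) = Imut (%xi. Qsum ph (rep h) (xi, y) * exp (\<i> * of_real (xi \<bullet> (x - b))))"
  unfolding S_def split
 proof (rule integral_cong_AE)
  show "AE xi in mut. Qsum ph (rep (chi b h)) (xi, y) * exp (\<i> * of_real (xi \<bullet> x)) = Qsum ph (rep h) (xi, y) * exp (\<i> * of_real (xi \<bullet> (x - b)))"
  using rep_chi[of b h] unfolding AE_mut
  proof eventually_elim
  case (elim xi)
  have "exp (\<i> * of_real (xi \<bullet> (x - b))) = exp (- \<i> * of_real (b \<bullet> xi)) * exp (\<i> * of_real (xi \<bullet> x))"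
  unfolding exp_add[symmetric] by (rule arg_cong[where f=exp]) (simp add: inner_diff_right inner_commute algebra_simps)
  moreover have "Qsum ph (rep (chi b h)) (xi, y) = exp (- \<i> * of_real (b \<bullet> xi)) * Qsum ph (rep h) (xi, y)"
  unfolding Qsum_def split elim vector_smult_component sum_distrib_left mult.assoc ..
  ultimately show ?case by (simp only: mult_ac)
  qed
 qed measurable
 then show "S (chi b h) p = rho_H b (S h) p" by (simp add: p rho_H_def S_def)
qed

lemma R_rho:
 assumes u: "u \<in> hcarrier H"
 shows "rho_H b u \<in> hcarrier H" "R (rho_H b u) = chi b (R u)"
proof -
 note c = chi_carrier[OF R_expansion(1)[OF u]]
 have "rho_H b u = S (chi b (R u))" unfolding S_chi S_R[OF u] ..
 then show "rho_H b u \<in> hcarrier H" "R (rho_H b u) = chi b (R u)" using S_in[OF c] R_S[OF c] by simp_all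
qed

end

section \<open>Operators that commute with all characters\<close>

lemma (in hilbert) adjoint_exists:
 assumes T: "T \<in> bounded_ops H H" and k: "k \<in> hcarrier H"
 shows "EX k':hcarrier H. ALL f:hcarrier H. hinner H (T f) k = hinner H f k'"
proof -
 note T1 = bounded_opsD[OF T]
 obtain B where B: "!!f. f \<in> hcarrier H ==> hnorm H (T f) <= B * hnorm H f" using T1(4) by blast
 obtain k' where "k' \<in> hcarrier H" "!!f. f \<in> hcarrier H ==> hinner H (T f) k = hinner H f k'"
 proof (rule riesz[of "%f. hinner H (T f) k" "B * hnorm H k"])
  fix f assume f: "f \<in> hcarrier H"
  have "cmod (hinner H (T f) k) <= hnorm H (T f) * hnorm H k" by (rule cauchy_schwarz[OF T1(1)[OF f] k])
  also have "... <= (B * hnorm H f) * hnorm H k" by (rule mult_right_mono[OF B[OF f] norm_nonneg[OF k]])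
  finally show "cmod (hinner H (T f) k) <= B * hnorm H k * hnorm H f" by (simp add: mult_ac)
 qed (use k T1(1) in \<open>auto simp: T1(2,3) inner_simps'\<close>)
 then show ?thesis by blast
qed

interpretation V: hilbert "L2vec :: ('a::euclidean_space, complex^'d) L0 hilb"
 unfolding L2vec_eq by (rule vec.L2g_hilbert)

lemmas L2vec_cls = vec.cls_carrier[folded L2vec_eq]
lemmas L2vec_rep_add = vec.rep_add[folded L2vec_eq]
lemmas L2vec_rep_scale = vec.rep_scale[folded L2vec_eq]
lemmas L2vec_inner = vec.inner_eq[folded L2vec_eq]
lemmas L2vec_norm = vec.norm_eq[folded L2vec_eq]

declare vec.ip_measurable [measurable (raw)]

subsection \<open>Essentially bounded matrix functions\<close>

lemma matrix_vector_continuous: "continuous_on UNIV (%p :: (complex^'d ^ 'd) \<times> (complex^'d). fst p *v snd p)"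
 unfolding matrix_vector_mult_def
 by (intro continuous_on_vec_lambda continuous_on_sum continuous_on_mult continuous_on_component continuous_on_fst continuous_on_snd continuous_on_id)

lemma mv_measurable [measurable (raw)]:
 assumes "s \<in> borel_measurable M" "f \<in> borel_measurable M"
 shows "(%x. (s x :: complex^'d ^ 'd) *v f x) \<in> borel_measurable M"
 by (rule borel_measurable_continuous_Pair[OF assms matrix_vector_continuous])

lemma mv_norm_le: "norm ((A :: complex^'d ^ 'd) *v v) <= real CARD('d) * norm A * norm v"
proof -
 have "norm (A *v v) <= (SUM i:UNIV. cmod ((A *v v) $ i))" by (simp add: norm_vec_def L2_set_le_sum)
 also have "... <= (SUM i:(UNIV::'d set). norm A * norm v)"
 proof (rule sum_mono)
  fix i
  have "(A *v v) $ i = cip (A $ i) (\<chi> j. cnj (v $ j))" by (simp add: matrix_vector_mult_def cip_def)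
  then have "cmod ((A *v v) $ i) <= norm (A $ i) * norm (\<chi> j. cnj (v $ j))" by (simp add: cip_le)
  also have "norm (\<chi> j. cnj (v $ j)) = norm v" by (simp add: norm_vec_def)
  also have "norm (A $ i) * norm v <= norm A * norm v" by (intro mult_right_mono Finite_Cartesian_Product.norm_nth_le) simp
  finally show "cmod ((A *v v) $ i) <= norm A * norm v" .
 qed
 finally show ?thesis by simp
qed

lemma mv_scaleC: "(A :: complex^'d ^ 'd) *v (c *s v) = c *s (A *v v)"
 by (simp add: matrix_vector_mult_def vec_eq_iff sum_distrib_left mult_ac)

lemma mv_linear: "bounded_linear ((*v) (A :: complex^'d ^ 'd))"
proof (rule bounded_linear_intro[where K="real CARD('d) * norm A"])
 show "A *v (r *\<^sub>R v) = r *\<^sub>R (A *v v)" for r v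
  by (simp add: matrix_vector_mult_def vec_eq_iff scaleR_sum_right)
 show "norm (A *v v) <= norm v * (real CARD('d) * norm A)" for v using mv_norm_le[of A v] by (simp add: mult_ac)
qed (simp add: matrix_vector_right_distrib)

lemma onorm_mv_continuous: "continuous_on UNIV (%A :: complex^'d ^ 'd. onorm ((*v) A))"
proof -
 have "dist (onorm ((*v) A)) (onorm ((*v) B)) <= real CARD('d) * dist A B" for A B :: "complex^'d ^ 'd"
 proof -
  have d: "onorm ((*v) A) <= onorm ((*v) B) + real CARD('d) * norm (A - B)" for A B :: "complex^'d ^ 'd"
  proof -
  have "onorm ((*v) A) = onorm (%v. B *v v + (A - B) *v v)"
  by (rule arg_cong[where f=onorm]) (simp add: fun_eq_iff matrix_vector_mult_add_rdistrib[symmetric])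
  also have "... <= onorm ((*v) B) + onorm ((*v) (A - B))" by (rule onorm_triangle[OF mv_linear mv_linear])
  also have "onorm ((*v) (A - B)) <= real CARD('d) * norm (A - B)" by (rule onorm_le[OF mv_norm_le])
  finally show ?thesis by simp
  qed
  show ?thesis using d[of A B] d[of B A] by (simp add: dist_norm norm_minus_commute abs_le_iff)
 qed
 then have "(real CARD('d))-lipschitz_on UNIV (%A :: complex^'d ^ 'd. onorm ((*v) A))" by (intro lipschitz_onI) auto
 then show ?thesis by (rule lipschitz_on_continuous_on)
qed

lemma onorm_rep_measurable [measurable]: "(%xi. onorm ((*v) (rep (sgm :: ('a::euclidean_space, complex^'d ^ 'd) L0) xi))) \<in> bmeas"
 by (rule borel_measurable_continuous_on[OF onorm_mv_continuous]) simp

lemma esssup_norm_le: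
 fixes sgm :: "('a::euclidean_space, complex^'d ^ 'd) L0"
 shows "esssup_norm sgm <= ereal C \<longleftrightarrow> (AE xi in lborel. ALL v. norm (rep sgm xi *v v) <= C * norm v)"
proof
 assume e: "esssup_norm sgm <= ereal C"
 have "AE xi in lborel. ereal (onorm ((*v) (rep sgm xi))) <= esssup_norm sgm" unfolding esssup_norm_def by (rule esssup_AE)
 then show "AE xi in lborel. ALL v. norm (rep sgm xi *v v) <= C * norm v"
 proof eventually_elim
  case (elim xi)
  then have "onorm ((*v) (rep sgm xi)) <= C" using e by (metis ereal_less_eq(3) order_trans)
  then show ?case using onorm[OF mv_linear] by (meson mult_right_mono norm_ge_zero order_trans)
 qed
next
 assume a: "AE xi in lborel. ALL v. norm (rep sgm xi *v v) <= C * norm v"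
 show "esssup_norm sgm <= ereal C" unfolding esssup_norm_def
 proof (rule esssup_I)
  show "AE xi in lborel. ereal (onorm ((*v) (rep sgm xi))) <= ereal C" using a by eventually_elim (simp add: onorm_le)
 qed simp
qed

lemma esssup_norm_real:
 assumes "esssup_norm (sgm :: ('a::euclidean_space, complex^'d ^ 'd) L0) < \<infinity>"
 obtains C where "esssup_norm sgm = ereal C" "0 <= C"
proof -
 have "AE xi in (lborel :: 'a measure). 0 <= esssup_norm sgm"
  using esssup_AE[of "%xi. ereal (onorm ((*v) (rep sgm xi)))" lborel]
 proof eventually_elim
  case (elim xi)
  have "0 <= ereal (onorm ((*v) (rep sgm xi)))" by (simp add: onorm_pos_le mv_linear)
  with elim show ?case unfolding esssup_norm_def by (rule order_trans[rotated])
 qed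
 then have "0 <= esssup_norm sgm"
  by (cases "0 <= esssup_norm sgm") (simp_all add: eventually_False ae_filter_eq_bot_iff)
 with assms show thesis using that by (cases "esssup_norm sgm") auto
qed

lemma Linf_iff: "sgm \<in> acarrier Linf_mat \<longleftrightarrow> (EX C>=0. AE xi in lborel. ALL v. norm (rep sgm xi *v v) <= C * norm v)"
proof
 assume "sgm \<in> acarrier Linf_mat"
 then obtain C where "esssup_norm sgm = ereal C" "0 <= C" using esssup_norm_real by (auto simp: Linf_mat_def)
 then show "EX C>=0. AE xi in lborel. ALL v. norm (rep sgm xi *v v) <= C * norm v" using esssup_norm_le[of sgm C] by auto
next
 assume "EX C>=0. AE xi in lborel. ALL v. norm (rep sgm xi *v v) <= C * norm v"
 then obtain C where "esssup_norm sgm <= ereal C" by (auto simp: esssup_norm_le)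
 then show "sgm \<in> acarrier Linf_mat" by (auto simp: Linf_mat_def intro: le_less_trans)
qed

definition mstar :: "complex^'d ^ 'd => complex^'d ^ 'd" where
 "mstar A = map_matrix cnj (transpose A)"

lemma cip_mstar: "cip (A *v u) w = cip u (mstar A *v w)"
proof -
 have "cip (A *v u) w = (SUM i:UNIV. SUM j:UNIV. A $ i $ j * u $ j * cnj (w $ i))"
  by (simp add: cip_def matrix_vector_mult_def sum_distrib_right)
 also have "... = (SUM j:UNIV. SUM i:UNIV. A $ i $ j * u $ j * cnj (w $ i))" by (rule sum.swap)
 also have "... = cip u (mstar A *v w)"
  by (simp add: cip_def mstar_def matrix_vector_mult_def map_matrix_def transpose_def sum_distrib_left mult_ac)
 finally show ?thesis .
qed

text \<open>\<open>|A\<^sup>*v|\<^sup>2 = \<langle>A A\<^sup>*v, v\<rangle> \<le> C |A\<^sup>*v| |v|\<close>.\<close>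

lemma mstar_bound: assumes "!!v. norm (A *v v) <= C * norm v" shows "norm (mstar A *v v) <= C * norm v"
proof -
 let ?w = "mstar A *v v"
 have "(norm ?w)\<^sup>2 = cmod (cip ?w ?w)" by (simp add: cip_self del: of_real_power)
 also have "... = cmod (cip (A *v ?w) v)" by (simp add: cip_mstar)
 also have "... <= norm (A *v ?w) * norm v" by (rule cip_le)
 also have "... <= (C * norm ?w) * norm v" by (intro mult_right_mono assms) simp
 finally have "norm ?w * norm ?w <= norm ?w * (C * norm v)" by (simp add: power2_eq_square mult_ac)
 moreover have "0 <= C * norm v" using assms[of v] norm_ge_zero order_trans by blast
 ultimately show ?thesis by (cases "norm ?w = 0") auto
qed

lemma map_matrix_continuous: "continuous_on UNIV g ==> continuous_on UNIV (map_matrix g :: complex^'d ^ 'd => complex^'d ^ 'd)"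
 unfolding map_matrix_def
 by (intro continuous_on_vec_lambda, erule continuous_on_compose2) (auto intro!: continuous_on_component continuous_on_id)

lemma transpose_continuous: "continuous_on UNIV (transpose :: complex^'d ^ 'd => complex^'d ^ 'd)"
 unfolding transpose_def by (intro continuous_on_vec_lambda continuous_on_component continuous_on_id)

lemma mm_continuous: "continuous_on UNIV (%p :: (complex^'d ^ 'd) \<times> (complex^'d ^ 'd). fst p ** snd p)"
 unfolding matrix_matrix_mult_def
 by (intro continuous_on_vec_lambda continuous_on_sum continuous_on_mult continuous_on_component continuous_on_fst continuous_on_snd continuous_on_id)

lemma rep_mult_op:
 assumes "f \<in> HV"
 shows "AE xi in lborel. rep (mult_op sgm f) xi = rep sgm xi *v rep f xi"
proof -
 have "(%(A, v). A *v v) \<in> borel_measurable (borel :: ((complex ^ 'b ^ 'b) \<times> (complex ^ 'b)) measure)"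
  unfolding split_beta by (rule borel_measurable_continuous_onI[OF matrix_vector_continuous])
 from rep_L0_map2[OF this] show ?thesis using assms by (simp add: mult_op_def)
qed

lemma rep_Linf:
 fixes sgm tau :: "('a::euclidean_space, complex^'d ^ 'd) L0"
 shows "AE xi in lborel. rep (aadd Linf_mat sgm tau) xi = rep sgm xi + rep tau xi"
  "AE xi in lborel. rep (amult Linf_mat sgm tau) xi = rep sgm xi ** rep tau xi"
  "AE xi in lborel. rep (ascale Linf_mat c sgm) xi = map_matrix ((*) c) (rep sgm xi)"
  "AE xi in lborel. rep (astar Linf_mat sgm) xi = mstar (rep sgm xi)"
  "AE xi in lborel. rep (aone Linf_mat :: ('a, complex^'d ^ 'd) L0) xi = mat 1"
proof -
 show "AE xi in lborel. rep (aadd Linf_mat sgm tau) xi = rep sgm xi + rep tau xi" unfolding Linf_mat_def staralg.simps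
  by (rule rep_L0_map2) (auto simp: split_beta intro!: borel_measurable_continuous_onI continuous_intros)
 show "AE xi in lborel. rep (amult Linf_mat sgm tau) xi = rep sgm xi ** rep tau xi" unfolding Linf_mat_def staralg.simps
  by (rule rep_L0_map2) (unfold split_beta, rule borel_measurable_continuous_onI[OF mm_continuous])
 have "continuous_on UNIV ((*) c)" by (intro continuous_intros)
 then show "AE xi in lborel. rep (ascale Linf_mat c sgm) xi = map_matrix ((*) c) (rep sgm xi)" unfolding Linf_mat_def staralg.simps
  by (intro rep_L0_map borel_measurable_continuous_onI map_matrix_continuous)
 have "continuous_on UNIV (%A :: complex^'d ^ 'd. map_matrix cnj (transpose A))"
  by (rule continuous_on_compose2[OF map_matrix_continuous transpose_continuous]) (auto intro: continuous_intros)
 then show "AE xi in lborel. rep (astar Linf_mat sgm) xi = mstar (rep sgm xi)" unfolding Linf_mat_def staralg.simps mstar_def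
  by (intro rep_L0_map borel_measurable_continuous_onI)
 show "AE xi in lborel. rep (aone Linf_mat :: ('a, complex^'d ^ 'd) L0) xi = mat 1" unfolding Linf_mat_def staralg.simps
  by (rule rep_cls) simp
qed

lemma map_matrix_mv: "map_matrix ((*) c) A *v v = c *s (A *v v)"
 by (simp add: map_matrix_def matrix_vector_mult_def vec_eq_iff sum_distrib_left mult_ac)

lemma Linf_closed:
 fixes sgm tau :: "('a::euclidean_space, complex^'d ^ 'd) L0"
 assumes s: "sgm \<in> acarrier Linf_mat" and t: "tau \<in> acarrier Linf_mat"
 shows "aadd Linf_mat sgm tau \<in> acarrier Linf_mat" "amult Linf_mat sgm tau \<in> acarrier Linf_mat"
  "ascale Linf_mat c sgm \<in> acarrier Linf_mat" "astar Linf_mat sgm \<in> acarrier Linf_mat"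
proof -
 obtain C where C: "C >= 0" "AE xi in lborel. ALL v. norm (rep sgm xi *v v) <= C * norm v" using s unfolding Linf_iff by blast
 obtain D where D: "D >= 0" "AE xi in lborel. ALL v. norm (rep tau xi *v v) <= D * norm v" using t unfolding Linf_iff by blast
 show "aadd Linf_mat sgm tau \<in> acarrier Linf_mat" unfolding Linf_iff
 proof (intro exI[of _ "C + D"] conjI)
  show "AE xi in lborel. ALL v. norm (rep (aadd Linf_mat sgm tau) xi *v v) <= (C + D) * norm v"
  using C(2) D(2) rep_Linf(1)[of sgm tau]
  by eventually_elim (auto simp: matrix_vector_mult_add_rdistrib distrib_right intro!: norm_triangle_mono)
 qed (use C D in simp)
 show "amult Linf_mat sgm tau \<in> acarrier Linf_mat" unfolding Linf_iff
 proof (intro exI[of _ "C * D"] conjI)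
  show "AE xi in lborel. ALL v. norm (rep (amult Linf_mat sgm tau) xi *v v) <= (C * D) * norm v"
  using C(2) D(2) rep_Linf(2)[of sgm tau]
  proof eventually_elim
  case (elim xi)
  have "norm (rep sgm xi *v (rep tau xi *v v)) <= C * (D * norm v)" for v
  using elim(1)[rule_format, of "rep tau xi *v v"] mult_left_mono[OF elim(2)[rule_format, of v] C(1)] by linarith
  then show ?case unfolding elim(3) matrix_vector_mul_assoc[symmetric] mult.assoc by blast
  qed
 qed (use C D in simp)
 show "ascale Linf_mat c sgm \<in> acarrier Linf_mat" unfolding Linf_iff
 proof (intro exI[of _ "cmod c * C"] conjI)
  show "AE xi in lborel. ALL v. norm (rep (ascale Linf_mat c sgm) xi *v v) <= (cmod c * C) * norm v"
  using C(2) rep_Linf(3)[of c sgm]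
  by eventually_elim (auto simp: map_matrix_mv vec.norm_sc mult.assoc intro: mult_left_mono)
 qed (use C in simp)
 show "astar Linf_mat sgm \<in> acarrier Linf_mat" unfolding Linf_iff
 proof (intro exI[of _ C] conjI)
  show "AE xi in lborel. ALL v. norm (rep (astar Linf_mat sgm) xi *v v) <= C * norm v"
  using C(2) rep_Linf(4)[of sgm] by eventually_elim (auto intro: mstar_bound)
 qed (use C in simp)
qed

lemma Linf_one: "(aone Linf_mat :: ('a::euclidean_space, complex^'d ^ 'd) L0) \<in> acarrier Linf_mat" unfolding Linf_iff
 proof (intro exI[of _ 1] conjI)
  show "AE xi in lborel. ALL v. norm (rep (aone Linf_mat :: ('a, complex^'d ^ 'd) L0) xi *v v) <= 1 * norm v"
  using rep_Linf(5)[where ?'a='a and ?'d='d] by eventually_elim simp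
 qed simp

subsection \<open>Multiplication operators\<close>

lemma mult_op_sq:
 assumes C: "C >= 0" "AE xi in lborel. ALL v. norm (rep sgm xi *v v) <= C * norm v" and f: "f \<in> HV"
 shows "mult_op sgm f \<in> HV" "hnorm L2vec (mult_op sgm f) <= C * hnorm L2vec f"
proof -
 have sf: "sq (rep f)" using f by (simp add: L2vec_carrier)
 have b: "AE xi in lborel. norm (rep (mult_op sgm f) xi) <= C * norm (rep f xi)"
  using C(2) rep_mult_op[OF f, of sgm] by eventually_elim simp
 have s: "sq (rep (mult_op sgm f))" by (rule sq_norm_bound[OF sf _ b]) simp
 then show "mult_op sgm f \<in> HV" by (simp add: L2vec_carrier)
 have "Imut (%xi. (norm (rep (mult_op sgm f) xi))^2) <= Imut (%xi. C^2 * (norm (rep f xi))^2)"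
 proof (rule integral_mono_AE)
  show "AE xi in mut. (norm (rep (mult_op sgm f) xi))\<^sup>2 <= C^2 * (norm (rep f xi))^2"
  using b unfolding AE_mut power_mult_distrib[symmetric] by eventually_elim (simp add: power_mono)
 qed (use s sf in \<open>simp_all add: sq_def\<close>)
 then have "sqrt (Imut (%xi. (norm (rep (mult_op sgm f) xi))^2)) <= sqrt (C^2 * Imut (%xi. (norm (rep f xi))^2))" by simp
 then show "hnorm L2vec (mult_op sgm f) <= C * hnorm L2vec f" unfolding L2vec_norm using C(1) by (simp add: real_sqrt_mult)
qed

lemma mult_op_bounded:
 fixes sgm :: "('a::euclidean_space, complex^'d ^ 'd) L0"
 assumes s: "sgm \<in> acarrier Linf_mat"
 shows "mult_op sgm \<in> acarrier (commutant L2vec chi)"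
proof -
 obtain C where C: "C >= 0" "AE xi in lborel. ALL v. norm (rep sgm xi *v v) <= C * norm v" using s unfolding Linf_iff by blast
 note b = mult_op_sq[OF C]
 have "mult_op sgm (hadd L2vec f g) = hadd L2vec (mult_op sgm f) (mult_op sgm g)" if f: "f \<in> HV" and g: "g \<in> HV" for f g
  by (rule L0_eqI) (use rep_mult_op[OF f, of sgm] rep_mult_op[OF g, of sgm] rep_mult_op[OF V.add_closed[OF f g], of sgm] L2vec_rep_add[of f g] L2vec_rep_add[of "mult_op sgm f" "mult_op sgm g"]
  in \<open>eventually_elim, simp add: matrix_vector_right_distrib\<close>)
 moreover have "mult_op sgm (hscale L2vec c f) = hscale L2vec c (mult_op sgm f)" if f: "f \<in> HV" for c f
  by (rule L0_eqI) (use rep_mult_op[OF f, of sgm] rep_mult_op[OF V.scale_closed[OF f, of c], of sgm] L2vec_rep_scale[of c f] L2vec_rep_scale[of c "mult_op sgm f"]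
  in \<open>eventually_elim, simp add: mv_scaleC\<close>)
 moreover have "mult_op sgm (chi a f) = chi a (mult_op sgm f)" if f: "f \<in> HV" for a f
  by (rule L0_eqI) (use rep_mult_op[OF f, of sgm] rep_mult_op[OF chi_carrier[OF f], of sgm a] rep_chi[of a f] rep_chi[of a "mult_op sgm f"]
  in \<open>eventually_elim, simp add: mv_scaleC\<close>)
 moreover have "mult_op sgm \<in> extensional (HV)" by (simp add: mult_op_def)
 moreover have "EX C. ALL x:HV. hnorm L2vec (mult_op sgm x) <= C * hnorm L2vec x" using b(2) by blast
 ultimately show ?thesis unfolding commutant_def bounded_ops_def PiE_def Pi_def using b(1) by simp
qed

text \<open>A matrix function whose multiplication operator is bounded by \<open>C\<close> is bounded by \<open>C\<close> almost
 everywhere: otherwise some \<open>v\<close> from a countable dense set would be stretched by more than \<open>C\<close> on a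
 set \<open>E\<close> of positive measure, and the function that is \<open>v\<close> on a bounded part of \<open>E\<close> would be too.\<close>

lemma mult_op_bound_imp:
 fixes sgm :: "('a::euclidean_space, complex^'d ^ 'd) L0"
 assumes C: "C >= 0"
  and b: "!!f. f \<in> HV ==> mult_op sgm f \<in> HV & hnorm L2vec (mult_op sgm f) <= C * hnorm L2vec f"
 shows "AE xi in lborel. ALL v. norm (rep sgm xi *v v) <= C * norm v"
proof -
 have v: "AE xi in lborel. xi \<in> cball 0 (real N) --> norm (rep sgm xi *v v) <= C * norm v" for v N
 proof -
  define E where "E = {xi. C * norm v < norm (rep sgm xi *v v)} \<inter> cball 0 (real N)"
  have "(%xi. norm (rep sgm xi *v v)) \<in> bmeas" by (intro measurable_compose[OF _ borel_measurable_norm] mv_measurable rep_measurable borel_measurable_const)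
  from borel_measurable_less[OF borel_measurable_const this, of "C * norm v"]
  have Em[measurable]: "E \<in> sets borel" unfolding E_def by (intro sets.Int) (simp_all add: borel_closed)
  define f :: "'a => complex^'d" where "f xi = indicator E xi *\<^sub>R v" for xi
  have fm[measurable]: "f \<in> bmeas" unfolding f_def[abs_def] by (intro borel_measurable_scaleR borel_measurable_indicator Em borel_measurable_const)
  have "emeasure lborel E <= emeasure lborel (cball 0 (real N) :: 'a set)" by (rule emeasure_mono) (auto simp: E_def)
  also have "... < \<infinity>" by (rule emeasure_bounded_finite) simp
  finally have iE: "imut (indicator E :: 'a => real)" by (intro finite_mut) auto
  have nf: "(norm (f xi))\<^sup>2 = indicator E xi * (norm v)^2" for xi by (simp add: f_def indicator_def)
  have sf: "sq f" unfolding sq_def nf by (intro conjI fm integrable_mult_left iE)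
  have fc: "cls f \<in> HV" by (rule L2vec_cls[OF sf])
  let ?g = "rep (mult_op sgm (cls f))"
  have g: "AE xi in lborel. ?g xi = rep sgm xi *v f xi" using rep_mult_op[OF fc, of sgm] rep_cls[OF fm] by eventually_elim simp
  have sg: "sq ?g" using b[OF fc] by (simp add: L2vec_carrier)
  have i1: "imut (%xi. (norm (?g xi))^2)" and i2: "imut (%xi. (norm (rep (cls f) xi))^2)"
  using sg fc by (simp_all add: sq_def L2vec_carrier)
  have "sqrt (Imut (%xi. (norm (?g xi))^2)) <= sqrt (C^2 * Imut (%xi. (norm (rep (cls f) xi))^2))"
  using b[OF fc] C unfolding L2vec_norm by (simp add: real_sqrt_mult)
  then have le: "Imut (%xi. (norm (?g xi))^2 - C\<^sup>2 * (norm (rep (cls f) xi))^2) <= 0" using i1 i2 by simp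
  have pos: "AE xi in mut. 0 <= (norm (?g xi))^2 - C\<^sup>2 * (norm (rep (cls f) xi))^2"
  using g rep_cls[OF fm] unfolding AE_mut
  proof eventually_elim
  case (elim xi)
  have "(C * norm v)\<^sup>2 <= (norm (rep sgm xi *v v))^2" if "xi \<in> E" using that C by (intro power_mono) (auto simp: E_def)
  then show ?case using elim by (cases "xi \<in> E") (auto simp: f_def power_mult_distrib)
  qed
  have "Imut (%xi. (norm (?g xi))^2 - C\<^sup>2 * (norm (rep (cls f) xi))^2) = 0" using le integral_nonneg_AE[OF pos] by linarith
  then have "AE xi in mut. (norm (?g xi))\<^sup>2 - C\<^sup>2 * (norm (rep (cls f) xi))^2 = 0"
  by (rule iffD1[OF integral_nonneg_eq_0_iff_AE[OF _ pos], rotated]) (intro Bochner_Integration.integrable_diff integrable_mult_right i1 i2)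
  then show ?thesis using g rep_cls[OF fm] unfolding AE_mut
  proof eventually_elim
  case (elim xi)
  have "xi \<notin> E"
  proof
  assume E: "xi \<in> E"
  then have "(C * norm v)\<^sup>2 < (norm (rep sgm xi *v v))^2" using C by (intro power_strict_mono) (auto simp: E_def)
  then show False using elim E by (simp add: f_def power_mult_distrib)
  qed
  then show ?case by (auto simp: E_def)
  qed
 qed
 obtain D :: "(complex^'d) set" where D: "countable D" "!!X. open X ==> X ~= {} ==> EX d:D. d \<in> X"
  by (rule countable_dense_setE) blast
 have "AE xi in lborel. ALL N. ALL v:D. xi \<in> cball 0 (real N) --> norm (rep sgm xi *v v) <= C * norm v"
  unfolding AE_all_countable AE_ball_countable[OF D(1)] using v by blast
 then show ?thesis
 proof eventually_elim
  case (elim xi)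
  obtain N where "norm xi <= real N" using real_arch_simple by blast
  then have "xi \<in> cball 0 (real N)" by simp
  then have d: "norm (rep sgm xi *v v) <= C * norm v" if "v \<in> D" for v using elim that by blast
  have "open {v. C * norm v < norm (rep sgm xi *v v)}"
  by (intro open_Collect_less continuous_intros linear_continuous_on[OF mv_linear])
  moreover have "v \<notin> {v. C * norm v < norm (rep sgm xi *v v)}" if "v \<in> D" for v using d[OF that] by simp
  ultimately have "{v. C * norm v < norm (rep sgm xi *v v)} = {}" using D(2)[of "{v. C * norm v < norm (rep sgm xi *v v)}"] by blast
  then show ?case by (simp add: not_less)
 qed
qed

subsection \<open>The commutant of the characters\<close>

text \<open>Gaussian multiples of the unit vectors, which are square integrable and vanish nowhere.\<close>

definition gvec :: "'d => 'a::euclidean_space => complex^'d" where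
 "gvec j xi = of_real (exp (- (norm xi)\<^sup>2 / 2)) *s axis j 1"

lemma gvec_carrier: "cls (gvec j :: 'a::euclidean_space => complex^'d) \<in> HV" "AE xi in (lborel :: 'a measure). rep (cls (gvec j)) xi = (gvec j xi :: complex^'d)"
proof -
 have m: "(gvec j :: 'a => complex^'d) \<in> bmeas" unfolding gvec_def[abs_def] by measurable
 have "norm (axis j (1::complex)) = 1"
  by (simp add: norm_vec_def L2_set_def axis_def if_distrib[of cmod] if_distrib[of "%x. x ^ 2"] cong: if_cong)
 then have n: "(norm (gvec j xi))\<^sup>2 = exp (- (sqrt 2 * norm xi)\<^sup>2 / 2)" for xi :: 'a
  unfolding gvec_def vec.norm_sc by (simp add: power_mult_distrib flip: exp_double)
 have "sq (gvec j :: 'a => complex^'d)" unfolding sq_def n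
  using m integrable_norm[OF gauss_fourier(1)[of "sqrt 2" "0::'a"]] by simp
 then show "cls (gvec j :: 'a => complex^'d) \<in> HV" by (rule L2vec_cls)
 show "AE xi in (lborel :: 'a measure). rep (cls (gvec j)) xi = (gvec j xi :: complex^'d)" by (rule rep_cls[OF m])
qed

lemma cip_gvec: "cip u (gvec j xi) = u $ j * of_real (exp (- (norm xi)\<^sup>2 / 2))" "cip (gvec j xi) u = of_real (exp (- (norm xi)\<^sup>2 / 2)) * cnj (u $ j)"
 by (simp_all add: cip_def gvec_def axis_def if_distrib[of "%x. _ * x"] if_distrib[of cnj] if_distrib[of "%x. x * _"] cong: if_cong)

lemma mv_gvec: "((A :: complex^'d ^ 'd) *v gvec j xi) $ i = of_real (exp (- (norm xi)\<^sup>2 / 2)) * A $ i $ j"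
 by (simp add: matrix_vector_mult_def gvec_def axis_def if_distrib[of "%x. _ * x"] cong: if_cong)

theorem commutant_is_mult:
 fixes A :: "('a::euclidean_space, complex^'d) L0 => ('a, complex^'d) L0"
 assumes A: "A \<in> acarrier (commutant L2vec chi)"
 shows "EX sgm:acarrier Linf_mat. A = mult_op sgm"
proof -
 have Ab: "A \<in> bounded_ops L2vec L2vec" and com: "!!a f. f \<in> HV ==> A (chi a f) = chi a (A f)"
  using A by (auto simp: commutant_def)
 note A1 = bounded_opsD[OF Ab]
 obtain B0 where B0: "!!f. f \<in> HV ==> hnorm L2vec (A f) <= B0 * hnorm L2vec f" using A1(4) by blast
 have B: "hnorm L2vec (A f) <= \<bar>B0\<bar> * hnorm L2vec f" if "f \<in> HV" for f
  using B0[OF that] V.norm_nonneg[OF that] by (meson abs_ge_self mult_right_mono order_trans)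
  \<comment> \<open>Pointwise, \<open>\<langle>A f, k\<rangle> - \<langle>f, A\<^sup>* k\<rangle>\<close> is integrable, and its Fourier transform at \<open>y\<close> is
  \<open>\<langle>A (chi y f), k\<rangle> - \<langle>chi y f, A\<^sup>* k\<rangle> = 0\<close>.\<close>
 have "EX k':HV. ALL f:HV. AE xi in lborel. cip (rep (A f) xi) (rep k xi) = cip (rep f xi) (rep k' xi)"
  if k: "k \<in> HV" for k
 proof -
  obtain k' where k': "k' \<in> HV" "!!f. f \<in> HV ==> hinner L2vec (A f) k = hinner L2vec f k'"
  using V.adjoint_exists[OF Ab k] by blast
  have "AE xi in lborel. cip (rep (A f) xi) (rep k xi) = cip (rep f xi) (rep k' xi)" if f: "f \<in> HV" for f
  proof -
  have s: "sq (rep f)" "sq (rep k)" "sq (rep k')" "sq (rep (A f))" using f k k'(1) A1(1)[OF f] by (simp_all add: L2vec_carrier)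
  note i1 = vec.ip_integrable[OF s(4,2)] and i2 = vec.ip_integrable[OF s(1,3)]
  have ch: "hinner L2vec (chi y u) w = Imut (%x. cip (rep u x) (rep w x) * exp (- \<i> * of_real (x \<bullet> y)))" for y and u w :: "('a, complex^'d) L0"
  unfolding L2vec_inner
  proof (rule integral_cong_AE)
  show "AE x in mut. cip (rep (chi y u) x) (rep w x) = cip (rep u x) (rep w x) * exp (- \<i> * of_real (x \<bullet> y))"
  using rep_chi[of y u] unfolding AE_mut by eventually_elim (simp add: vec.ip_sc inner_commute mult.commute)
  qed (simp_all add: vec.ip_measurable)
  have "AE xi in lborel. cip (rep (A f) xi) (rep k xi) - cip (rep f xi) (rep k' xi) = 0"
  proof (rule fourier_L1_injective)
  show "imut (%xi. cip (rep (A f) xi) (rep k xi) - cip (rep f xi) (rep k' xi))" using i1 i2 by simp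
  show "Imut (%x. (cip (rep (A f) x) (rep k x) - cip (rep f x) (rep k' x)) * exp (- \<i> * of_real (x \<bullet> y))) = 0" for y
  unfolding left_diff_distrib
  by (subst Bochner_Integration.integral_diff) (simp_all only: FT_integrable i1 i2 ch[symmetric] com[OF f, symmetric] k'(2) chi_carrier[OF f] diff_self)
  qed
  then show ?thesis by eventually_elim simp
  qed
  with k'(1) show ?thesis by blast
 qed
 then have "ALL k:HV. EX k'. k' \<in> HV & (ALL f:HV. AE xi in lborel. cip (rep (A f) xi) (rep k xi) = cip (rep f xi) (rep k' xi))"
  by blast
 from bchoice[OF this] obtain st where st: "!!k. k \<in> HV ==> st k \<in> HV"
  "!!k f. k \<in> HV ==> f \<in> HV ==> AE xi in lborel. cip (rep (A f) xi) (rep k xi) = cip (rep f xi) (rep (st k) xi)"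
  by blast
 define e where "e j = cls (gvec j :: 'a => complex^'d)" for j
 have e: "e j \<in> HV" for j unfolding e_def by (rule gvec_carrier)
 have re: "AE xi in lborel. rep (e j) xi = gvec j xi" for j unfolding e_def by (rule gvec_carrier)
 let ?g = "%xi::'a. cor (exp (- (norm xi)\<^sup>2 / 2))"
 have pt: "AE xi in lborel. ALL i:UNIV. rep (A f) xi $ i * ?g xi = cip (rep f xi) (rep (st (e i)) xi)" if f: "f \<in> HV" for f
 proof (rule AE_finite_allI[OF finite])
  fix i show "AE xi in lborel. rep (A f) xi $ i * ?g xi = cip (rep f xi) (rep (st (e i)) xi)"
  using st(2)[OF e f, of i] re[of i] by eventually_elim (simp add: cip_gvec)
 qed
 have ab: "AE xi in lborel. ALL j:UNIV. ALL i:UNIV. rep (A (e j)) xi $ i = cnj (rep (st (e i)) xi $ j)"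
 proof (rule AE_finite_allI[OF finite])
  fix j show "AE xi in lborel. ALL i:UNIV. rep (A (e j)) xi $ i = cnj (rep (st (e i)) xi $ j)"
  using pt[OF e[of j]] re[of j] by eventually_elim (auto simp: cip_gvec)
 qed
 define sgm0 where "sgm0 xi = (\<chi> i. \<chi> j. rep (A (e j)) xi $ i / ?g xi)" for xi
 have sm: "sgm0 \<in> bmeas" unfolding sgm0_def[abs_def] by measurable
 have Af: "A f = mult_op (cls sgm0) f" if f: "f \<in> HV" for f
 proof (rule L0_eqI)
  show "AE xi in lborel. rep (A f) xi = rep (mult_op (cls sgm0) f) xi"
  using pt[OF f] ab rep_mult_op[OF f, of "cls sgm0"] rep_cls[OF sm]
  proof eventually_elim
  case (elim xi)
  have "rep (A f) xi $ i = (sgm0 xi *v rep f xi) $ i" for i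
  proof -
  have "rep (A f) xi $ i * ?g xi = (SUM j:UNIV. rep f xi $ j * rep (A (e j)) xi $ i)" using elim(1,2) by (simp add: cip_def)
  also have "... = (sgm0 xi *v rep f xi) $ i * ?g xi"
  unfolding sgm0_def matrix_vector_mult_def vec_lambda_beta sum_distrib_right by (rule sum.cong) simp_all    finally show ?thesis by simp
  qed
  then show ?case unfolding elim(3,4) by (simp add: vec_eq_iff)
  qed
 qed
 have "AE xi in lborel. ALL v. norm (rep (cls sgm0) xi *v v) <= \<bar>B0\<bar> * norm v"
  by (rule mult_op_bound_imp) (use A1(1) B in \<open>simp_all add: Af[symmetric]\<close>)
 then have "cls sgm0 \<in> acarrier Linf_mat" unfolding Linf_iff by (intro exI[of _ "\<bar>B0\<bar>"]) simp
 moreover have "A = mult_op (cls sgm0)"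
  by (rule extensionalityI[of _ "HV"]) (simp_all add: Af A1(5), simp add: mult_op_def)
 ultimately show ?thesis by blast
qed

lemma mult_op_inj:
 fixes sgm tau :: "('a::euclidean_space, complex^'d ^ 'd) L0"
 assumes "mult_op sgm = mult_op tau"
 shows "sgm = tau"
proof (rule L0_eqI)
 have "AE xi in lborel. ALL j:UNIV. ALL i. rep sgm xi $ i $ j = rep tau xi $ i $ j"
 proof (rule AE_finite_allI[OF finite])
  fix j :: 'd
  show "AE xi in lborel. ALL i. rep sgm xi $ i $ j = rep tau xi $ i $ j"
  using rep_mult_op[OF gvec_carrier(1)[of j], of sgm] rep_mult_op[OF gvec_carrier(1)[of j], of tau] gvec_carrier(2)[of j]
  proof eventually_elim
  case (elim xi)
  then have "rep sgm xi *v gvec j xi = rep tau xi *v gvec j xi" using assms by simp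
  then show ?case unfolding vec_eq_iff mv_gvec by simp
  qed
 qed
 then show "AE xi in lborel. rep sgm xi = rep tau xi" by eventually_elim (simp add: vec_eq_iff)
qed

lemma mult_op_star:
 fixes sgm :: "('a::euclidean_space, complex^'d ^ 'd) L0"
 assumes s: "sgm \<in> acarrier Linf_mat"
 shows "mult_op (astar Linf_mat sgm) = hadjoint L2vec L2vec (mult_op sgm)"
proof (rule extensionalityI[of _ "HV"])
 fix f :: "('a, complex^'d) L0" assume f: "f \<in> HV"
 let ?x = "mult_op (astar Linf_mat sgm) f"
 have x: "?x \<in> HV" using mult_op_bounded[OF Linf_closed(4)[OF s s]] f by (auto simp: commutant_def dest: bounded_opsD(1))
 have i: "hinner L2vec (mult_op sgm z) f = hinner L2vec z ?x" if z: "z \<in> HV" for z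
  unfolding L2vec_inner
 proof (rule integral_cong_AE)
  show "AE xi in mut. cip (rep (mult_op sgm z) xi) (rep f xi) = cip (rep z xi) (rep ?x xi)"
  using rep_mult_op[OF z, of sgm] rep_mult_op[OF f, of "astar Linf_mat sgm"] rep_Linf(4)[of sgm]
  unfolding AE_mut by eventually_elim (simp add: cip_mstar)
 qed (simp_all add: vec.ip_measurable)
 have "hadjoint L2vec L2vec (mult_op sgm) f = ?x" unfolding hadjoint_def using f
 proof (simp, intro the_equality conjI ballI x i)
  fix y assume y: "y \<in> HV & (ALL z:HV. hinner L2vec (mult_op sgm z) f = hinner L2vec z y)"
  show "y = ?x"
  proof (rule V.inner_sep)
  fix z :: "('a, complex^'d) L0" assume "z \<in> HV"
  then show "hinner L2vec y z = hinner L2vec ?x z" using y x i V.inner_sym by metis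
  qed (use x y in auto)
 qed
 then show "?x = hadjoint L2vec L2vec (mult_op sgm) f" ..
qed (simp_all add: mult_op_def hadjoint_def)

lemma mult_op_norm:
 fixes sgm :: "('a::euclidean_space, complex^'d ^ 'd) L0"
 assumes s: "sgm \<in> acarrier Linf_mat"
 shows "opnorm L2vec L2vec (mult_op sgm) = anorm Linf_mat sgm"
proof -
 obtain C where C: "esssup_norm sgm = ereal C" "0 <= C" using s esssup_norm_real by (auto simp: Linf_mat_def)
 have "AE xi in lborel. ALL v. norm (rep sgm xi *v v) <= C * norm v" using esssup_norm_le[of sgm C] C by simp
 note b = mult_op_sq[OF C(2) this]
 define X where "X = {hnorm L2vec (mult_op sgm x) | x. x \<in> HV & hnorm L2vec x <= 1}"
 have ub: "y <= C" if "y \<in> X" for y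
 proof -
  from that obtain x where "x \<in> HV" "hnorm L2vec x <= 1" "y = hnorm L2vec (mult_op sgm x)" by (auto simp: X_def)
  then show ?thesis using b(2)[of x] mult_left_mono[of "hnorm L2vec x" 1 C] C(2) by simp
 qed
 have bdd: "bdd_above X" using ub by (rule bdd_aboveI)
 have upper: "hnorm L2vec (mult_op sgm x) <= Sup X" if "x \<in> HV" "hnorm L2vec x <= 1" for x
  by (rule cSup_upper[OF _ bdd]) (use that in \<open>auto simp: X_def\<close>)
 obtain x0 :: "('a, complex^'d) L0" where x0: "x0 \<in> HV" "hnorm L2vec x0 = 0"
  using V.scale_closed[OF gvec_carrier(1), of 0] V.norm_scale[OF gvec_carrier(1), of 0] by fastforce
 have S0: "0 <= Sup X" using upper[OF x0(1)] x0(2) V.norm_nonneg[OF b(1)[OF x0(1)]] by linarith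
 have "X ~= {}" using x0 by (force simp: X_def)
 then have 1: "Sup X <= C" using ub by (rule cSup_least)
 have "AE xi in lborel. ALL v. norm (rep sgm xi *v v) <= Sup X * norm v"
 proof (rule mult_op_bound_imp[OF S0], intro conjI b(1))
  fix f :: "('a, complex^'d) L0" assume f: "f \<in> HV"
  show "hnorm L2vec (mult_op sgm f) <= Sup X * hnorm L2vec f"
  proof (cases "hnorm L2vec f = 0")
  case True
  then show ?thesis using b(2)[OF f] by simp
  next
  case False
  then have p: "hnorm L2vec f > 0" using V.norm_nonneg[OF f] by simp
  let ?c = "cor (1 / hnorm L2vec f)"
  have "mult_op sgm \<in> bounded_ops L2vec L2vec" using mult_op_bounded[OF s] by (simp add: commutant_def)
  from bounded_opsD(3)[OF this f, of ?c]
  have "hnorm L2vec (mult_op sgm (hscale L2vec ?c f)) = cmod ?c * hnorm L2vec (mult_op sgm f)" by (simp only: V.norm_scale[OF b(1)[OF f]])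
  moreover have "hnorm L2vec (hscale L2vec ?c f) <= 1" unfolding V.norm_scale[OF f] using p by (simp add: norm_divide)
  ultimately have "cmod ?c * hnorm L2vec (mult_op sgm f) <= Sup X" using upper[OF V.scale_closed[OF f, of ?c]] by simp
  then show ?thesis using p by (simp add: divide_simps norm_divide mult_ac)
  qed
 qed
 then have "C <= Sup X" using esssup_norm_le[of sgm "Sup X"] C(1) by simp
 with 1 have "Sup X = C" by simp
 then show ?thesis unfolding opnorm_def X_def[symmetric] by (simp add: Linf_mat_def C(1))
qed

theorem mult_op_iso: "isometric_star_iso (Linf_mat :: ('a::euclidean_space, complex^'d ^ 'd) L0 staralg) (commutant L2vec chi) mult_op"
 unfolding isometric_star_iso_def
proof (intro conjI ballI allI)
 show "bij_betw mult_op (acarrier (Linf_mat :: ('a, complex^'d ^ 'd) L0 staralg)) (acarrier (commutant L2vec chi))"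
  unfolding bij_betw_def
 proof (intro conjI equalityI subsetI inj_onI)
  show "A \<in> mult_op ` acarrier (Linf_mat :: ('a, complex^'d ^ 'd) L0 staralg)" if "A \<in> acarrier (commutant L2vec chi)" for A
  using commutant_is_mult[OF that] by blast
 qed (use mult_op_inj mult_op_bounded in auto)
 fix sgm tau :: "('a, complex^'d ^ 'd) L0" and c
 have r: "mult_op sgm f = L0_map2 (*v) sgm f" if "f \<in> HV" for sgm :: "('a, complex^'d ^ 'd) L0" and f using that by (simp add: mult_op_def)
 show "mult_op (aadd Linf_mat sgm tau) = aadd (commutant L2vec chi) (mult_op sgm) (mult_op tau)"
 proof (rule extensionalityI[of _ "HV"])
  fix f :: "('a, complex^'d) L0" assume f: "f \<in> HV"
  have "mult_op (aadd Linf_mat sgm tau) f = hadd L2vec (mult_op sgm f) (mult_op tau f)"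
  by (rule L0_eqI) (use rep_mult_op[OF f, of "aadd Linf_mat sgm tau"] rep_mult_op[OF f, of sgm] rep_mult_op[OF f, of tau] rep_Linf(1)[of sgm tau] L2vec_rep_add[of "mult_op sgm f" "mult_op tau f"]
  in \<open>eventually_elim, simp add: matrix_vector_mult_add_rdistrib\<close>)
  then show "mult_op (aadd Linf_mat sgm tau) f = aadd (commutant L2vec chi) (mult_op sgm) (mult_op tau) f" using f by (simp add: commutant_def)
 qed (simp_all add: mult_op_def commutant_def)
 show "mult_op (ascale Linf_mat c sgm) = ascale (commutant L2vec chi) c (mult_op sgm)"
 proof (rule extensionalityI[of _ "HV"])
  fix f :: "('a, complex^'d) L0" assume f: "f \<in> HV"
  have "mult_op (ascale Linf_mat c sgm) f = hscale L2vec c (mult_op sgm f)"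
  by (rule L0_eqI) (use rep_mult_op[OF f, of "ascale Linf_mat c sgm"] rep_mult_op[OF f, of sgm] rep_Linf(3)[of c sgm] L2vec_rep_scale[of c "mult_op sgm f"]
  in \<open>eventually_elim, simp add: map_matrix_mv\<close>)
  then show "mult_op (ascale Linf_mat c sgm) f = ascale (commutant L2vec chi) c (mult_op sgm) f" using f by (simp add: commutant_def)
 qed (simp_all add: mult_op_def commutant_def)
 show "mult_op (aone Linf_mat) = (aone (commutant L2vec chi) :: ('a, complex^'d) L0 => _)"
 proof (rule extensionalityI[of _ "HV"])
  fix f :: "('a, complex^'d) L0" assume f: "f \<in> HV"
  have "mult_op (aone Linf_mat) f = f"
  by (rule L0_eqI) (use rep_mult_op[OF f, of "aone Linf_mat"] rep_Linf(5)[where ?'a='a and ?'d='d] in \<open>eventually_elim, simp\<close>)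
  then show "mult_op (aone Linf_mat) f = aone (commutant L2vec chi) f" using f by (simp add: commutant_def)
 qed (simp_all add: mult_op_def commutant_def)
 assume s: "sgm \<in> acarrier Linf_mat"
 show "mult_op (astar Linf_mat sgm) = astar (commutant L2vec chi) (mult_op sgm)" by (simp add: mult_op_star[OF s] commutant_def)
 show "anorm (commutant L2vec chi) (mult_op sgm) = anorm Linf_mat sgm" by (simp add: mult_op_norm[OF s] commutant_def)
 assume t: "tau \<in> acarrier Linf_mat"
 show "mult_op (amult Linf_mat sgm tau) = amult (commutant L2vec chi) (mult_op sgm) (mult_op tau)"
 proof (rule extensionalityI[of _ "HV"])
  fix f :: "('a, complex^'d) L0" assume f: "f \<in> HV"
  have tf: "mult_op tau f \<in> HV" using mult_op_bounded[OF t] f by (auto simp: commutant_def dest: bounded_opsD(1))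
  have "mult_op (amult Linf_mat sgm tau) f = mult_op sgm (mult_op tau f)"
  by (rule L0_eqI) (use rep_mult_op[OF f, of "amult Linf_mat sgm tau"] rep_mult_op[OF f, of tau] rep_mult_op[OF tf, of sgm] rep_Linf(2)[of sgm tau]
  in \<open>eventually_elim, simp add: matrix_vector_mul_assoc\<close>)
  then show "mult_op (amult Linf_mat sgm tau) f = amult (commutant L2vec chi) (mult_op sgm) (mult_op tau) f" using f by (simp add: commutant_def compose_def)
 qed (simp_all add: mult_op_def commutant_def compose_def)
qed

section \<open>The lexicographic enumeration\<close>

text \<open>A slack entry \<open>m - 1 - |k|\<close> turns multi-indices of size at most \<open>m - 1\<close> into
lists with sum exactly \<open>m - 1\<close>.\<close>

lemma card_J_set:
 assumes "m >= 1" shows "card (J_set m :: (nat ^ 'n::{finite,linorder}) set) = (CARD('n) + m - 1) choose CARD('n)" "finite (J_set m :: (nat ^ 'n::{finite,linorder}) set)"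
proof -
 define us :: "'n list" where "us = sorted_list_of_set UNIV"
 have us: "distinct us" "set us = UNIV" "length us = CARD('n)" by (simp_all add: us_def)
 let ?L = "{l::nat list. length l = CARD('n) + 1 & sum_list l = m - 1}"
 define F where "F k = (m - 1 - mi_size k) # map (($) k) us" for k :: "nat ^ 'n::{finite,linorder}"
 have sl: "sum_list (map (($) k) us) = mi_size k" for k :: "nat ^ 'n::{finite,linorder}"
  unfolding mi_size_def sum_list_distinct_conv_sum_set[OF us(1)] us(2) ..
 have "bij_betw F (J_set m) ?L"
 proof (rule bij_betwI')
  fix k l :: "nat ^ 'n::{finite,linorder}"
  have "k = l" if "F k = F l" using that by (simp add: F_def us(2) vec_eq_iff)
  then show "(F k = F l) = (k = l)" by blast
 next
  fix k :: "nat ^ 'n::{finite,linorder}" assume "k \<in> J_set m"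
  then show "F k \<in> ?L" by (simp add: F_def sl us(3) J_set_def)
 next
  fix l assume l: "l \<in> ?L"
  then obtain x t where t: "l = x # t" by (cases l) auto
  have inj: "inj_on ((!) us) {..<CARD('n)}" using us by (auto simp: inj_on_def nth_eq_iff_index_eq)
  define k :: "nat ^ 'n::{finite,linorder}" where "k = (\<chi> r. t ! (inv_into {..<CARD('n)} ((!) us) r))"
  have "map (($) k) us = t"
  by (rule nth_equalityI) (use l t us(3) in \<open>auto simp: k_def inv_into_f_f[OF inj]\<close>)
  then show "EX k:J_set m. l = F k" using l t sl[of k] by (intro bexI[of _ k]) (auto simp: F_def J_set_def)
 qed
 moreover have "card ?L = (m - 1 + (CARD('n) + 1) - 1) choose (m - 1)" by (rule card_length_sum_list)
 moreover have "... = (CARD('n) + m - 1) choose CARD('n)" using binomial_symmetric[of "m - 1" "CARD('n) + m - 1"] assms by (simp add: add.commute)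
 moreover have "... > 0" using assms by (simp add: zero_less_binomial_iff)
 ultimately show "card (J_set m :: (nat ^ 'n::{finite,linorder}) set) = (CARD('n) + m - 1) choose CARD('n)" "finite (J_set m :: (nat ^ 'n::{finite,linorder}) set)"
  using bij_betw_same_card[of F "J_set m" ?L] by (metis card_gt_0_iff)+
qed

lemma lex_less_irrefl: "\<not> lex_less k k" by (simp add: lex_less_def)

lemma lex_less_trans: assumes "lex_less k l" "lex_less l p" shows "lex_less k p"
proof -
 obtain r s where r: "k $ r < l $ r" "!!t. t < r ==> k $ t = l $ t" and s: "l $ s < p $ s" "!!t. t < s ==> l $ t = p $ t"
  using assms by (auto simp: lex_less_def)
 have "k $ (min r s) < p $ (min r s)" using r(1) s(1) r(2)[of s] s(2)[of r] by (cases r s rule: linorder_cases) (auto simp: min_def)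
 then show ?thesis using r(2) s(2) unfolding lex_less_def by (intro exI[of _ "min r s"]) auto
qed

lemma lex_less_total: assumes "k ~= l" shows "lex_less k l \<or> lex_less l k"
proof -
 let ?D = "{r. k $ r ~= l $ r}"
 have "?D ~= {}" using assms by (auto simp: vec_eq_iff)
 then have "Min ?D \<in> ?D" by (intro Min_in) auto
 moreover have "k $ t = l $ t" if "t < Min ?D" for t using that Min_le[of ?D t] by (auto simp: not_le[symmetric])
 ultimately show ?thesis unfolding lex_less_def by (metis (mono_tags, lifting) linorder_neqE_nat mem_Collect_eq)
qed

text \<open>An order isomorphism from a finite linear order must send an element with \<open>p\<close> predecessors to
 the element with \<open>p\<close> predecessors; counting predecessors also constructs it.\<close>

lemma finite_order_iso_ex1:
 fixes less :: "'b => 'b => bool"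
 assumes fin: "finite A" and card: "CARD('d::{finite,linorder}) = card A"
  and irr: "!!x. \<not> less x x" and trans: "!!x y z. less x y ==> less y z ==> less x z"
  and total: "!!x y. x ~= y ==> less x y \<or> less y x"
 shows "\<exists>!ph :: 'd => 'b. bij_betw ph UNIV A & (ALL i j. i < j --> less (ph i) (ph j))"
proof -
 define rk where "rk x = card {y\<in>A. less y x}" for x
 define rd where "rd i = card {j. j < i}" for i :: 'd
 have rk: "rk x < rk y" if "x \<in> A" "less x y" for x y unfolding rk_def
  by (rule psubset_card_mono, use fin in simp, use that irr trans in blast)
 have rd: "rd i < rd j" if "i < j" for i j unfolding rd_def
  by (rule psubset_card_mono) (use that in auto)
 have rkinj: "inj_on rk A" by (rule inj_onI) (metis rk total less_irrefl)
 have "rk x < card A" if "x \<in> A" for x unfolding rk_def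
  by (rule psubset_card_mono[OF fin]) (use that irr in blast)
 then have "rk ` A = {..<card A}" by (intro card_subset_eq) (auto simp: card_image[OF rkinj])
 then have rkb: "bij_betw rk A {..<card A}" using rkinj by (simp add: bij_betw_def)
 have rdinj: "inj rd" by (rule injI) (metis rd linorder_neqE less_irrefl)
 have "rd i < card A" for i unfolding rd_def card[symmetric] by (rule psubset_card_mono) auto
 then have "rd ` UNIV = {..<card A}" by (intro card_subset_eq) (auto simp: card_image[OF rdinj] card)
 then have rdb: "bij_betw rd UNIV {..<card A}" using rdinj by (simp add: bij_betw_def)
 define ph where "ph = inv_into A rk \<circ> rd"
 have b: "bij_betw ph UNIV A" unfolding ph_def by (rule bij_betw_trans[OF rdb bij_betw_inv_into[OF rkb]])
 have rp: "rk (ph i) = rd i" for i unfolding ph_def using rkb rdb by (auto simp: bij_betw_def intro!: f_inv_into_f)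
 have inA: "ph i \<in> A" for i using b by (auto simp: bij_betw_def)
 have "less (ph i) (ph j)" if "i < j" for i j
  using rd[OF that] rk[OF inA[of j], of "ph i"] total[of "ph i" "ph j"] rp by (metis less_asym less_irrefl)
 moreover have "\<psi> = ph" if "bij_betw \<psi> UNIV A & (ALL i j. i < j --> less (\<psi> i) (\<psi> j))" for \<psi> :: "'d => 'b"
 proof
  fix i
  have "less (\<psi> j) (\<psi> i) \<longleftrightarrow> j < i" for j using that irr trans by (metis linorder_neqE)
  then have "{y\<in>A. less y (\<psi> i)} = \<psi> ` {j. j < i}" using that by (auto simp: bij_betw_def)
  then have "rk (\<psi> i) = rd i" using that unfolding rk_def rd_def by (simp add: card_image bij_betw_def inj_on_def)
  then show "\<psi> i = ph i" using rp[of i] inA[of i] that by (metis bij_betw_apply UNIV_I rkinj inj_onD)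
 qed
 ultimately show ?thesis using b by (intro ex1I[of _ ph]) blast+
qed

lemma lex_enum_bij:
 assumes "m >= 1" and "CARD('d::{finite,linorder}) = (CARD('n::{finite,linorder}) + m - 1) choose CARD('n)"
 shows "bij_betw (lex_enum m :: 'd => nat ^ 'n::{finite,linorder}) UNIV (J_set m)"
proof -
 have "\<exists>!ph :: 'd => nat ^ 'n::{finite,linorder}. bij_betw ph UNIV (J_set m) & (ALL i j. i < j --> lex_less (ph i) (ph j))"
  using assms card_J_set[OF assms(1), where ?'n='n] lex_less_irrefl lex_less_trans lex_less_total
  by (intro finite_order_iso_ex1) (simp_all, blast)
 from theI'[OF this] show ?thesis by (simp add: lex_enum_def)
qed

section \<open>Transport along a unitary operator\<close>

definition star_closed :: "'a staralg => bool" where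
 "star_closed A \<longleftrightarrow> (ALL s:acarrier A. ALL t:acarrier A. aadd A s t \<in> acarrier A & amult A s t \<in> acarrier A) &
  (ALL c. ALL s:acarrier A. ascale A c s \<in> acarrier A) & (ALL s:acarrier A. astar A s \<in> acarrier A) & aone A \<in> acarrier A"

lemma isometric_star_iso_compose:
 assumes "isometric_star_iso A B \<Phi>" "isometric_star_iso B C \<Psi>" "star_closed A" "!!s. s \<in> acarrier A ==> \<Theta> s = \<Psi> (\<Phi> s)"
 shows "isometric_star_iso A C \<Theta>"
proof -
 have m: "\<Phi> s \<in> acarrier B" if "s \<in> acarrier A" for s using assms(1) that by (auto simp: isometric_star_iso_def bij_betw_def)
 have "bij_betw \<Phi> (acarrier A) (acarrier B)" "bij_betw \<Psi> (acarrier B) (acarrier C)" using assms(1,2) by (simp_all add: isometric_star_iso_def)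
 then have "bij_betw (\<Psi> \<circ> \<Phi>) (acarrier A) (acarrier C)" by (rule bij_betw_trans)
 moreover have "bij_betw \<Theta> (acarrier A) (acarrier C) \<longleftrightarrow> bij_betw (\<Psi> \<circ> \<Phi>) (acarrier A) (acarrier C)" by (rule bij_betw_cong) (simp add: assms(4))
 ultimately show ?thesis using assms m unfolding isometric_star_iso_def star_closed_def by simp
qed

lemma isometric_star_iso_inverse:
 assumes iso: "isometric_star_iso A B \<Phi>" and cl: "star_closed A"
 shows "isometrically_isomorphic B A"
proof -
 let ?J = "inv_into (acarrier A) \<Phi>"
 have b: "bij_betw \<Phi> (acarrier A) (acarrier B)" using iso by (simp add: isometric_star_iso_def)
 have J: "?J t \<in> acarrier A" "\<Phi> (?J t) = t" if "t \<in> acarrier B" for t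
  using that b by (auto simp: bij_betw_def inv_into_into f_inv_into_f)
 have I: "?J t = s" if "s \<in> acarrier A" "\<Phi> s = t" for s t using that b by (auto simp: bij_betw_def)
 have "ALL s:acarrier A. anorm B (\<Phi> s) = anorm A s" using iso by (simp add: isometric_star_iso_def)
 then have n: "anorm A (?J t) = anorm B t" if "t \<in> acarrier B" for t using J[OF that] by metis
 have "isometric_star_iso B A ?J" unfolding isometric_star_iso_def
  using bij_betw_inv_into[OF b] iso cl J n unfolding isometric_star_iso_def star_closed_def by (auto intro!: I)
 then show ?thesis unfolding isometrically_isomorphic_def by blast
qed

text \<open>The map \<open>s\<close> reparametrises the group. It is onto, so commuting with all \<open>\<rho>
g\<close> amounts to commuting with all \<open>\<chi>' h\<close>.\<close>

locale unitary_transport =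
 fixes H :: "'a hilb" and K :: "'b hilb" and R :: "'a => 'b" and \<rho> :: "'g => 'a => 'a" and \<chi>' :: "'h => 'b => 'b" and s :: "'g => 'h"
 assumes K: "hilbert K" and bij: "bij_betw R (hcarrier H) (hcarrier K)"
  and inner: "!!u v. u \<in> hcarrier H ==> v \<in> hcarrier H ==> hinner K (R u) (R v) = hinner H u v"
  and add: "!!u v. u \<in> hcarrier H ==> v \<in> hcarrier H ==> hadd H u v \<in> hcarrier H & R (hadd H u v) = hadd K (R u) (R v)"
  and scale: "!!c u. u \<in> hcarrier H ==> hscale H c u \<in> hcarrier H & R (hscale H c u) = hscale K c (R u)"
  and rep: "!!g u. u \<in> hcarrier H ==> \<rho> g u \<in> hcarrier H & R (\<rho> g u) = \<chi>' (s g) (R u)"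
  and surj: "surj s"
begin

interpretation K: hilbert K by (rule K)

definition J where "J = inv_into (hcarrier H) R"

lemma R_in [simp]: "u \<in> hcarrier H ==> R u \<in> hcarrier K" using bij by (auto simp: bij_betw_def)
lemma J_in [simp]: "k \<in> hcarrier K ==> J k \<in> hcarrier H" using bij by (auto simp: bij_betw_def J_def inv_into_into)
lemma RJ [simp]: "k \<in> hcarrier K ==> R (J k) = k" using bij by (auto simp: bij_betw_def J_def f_inv_into_f)
lemma JR [simp]: "u \<in> hcarrier H ==> J (R u) = u" using bij by (auto simp: bij_betw_def J_def)

lemma J_add: "k \<in> hcarrier K ==> l \<in> hcarrier K ==> J (hadd K k l) = hadd H (J k) (J l)" by (metis JR J_in RJ add)
lemma J_scale: "k \<in> hcarrier K ==> J (hscale K c k) = hscale H c (J k)" by (metis JR J_in RJ scale)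
lemma J_inner: "k \<in> hcarrier K ==> u \<in> hcarrier H ==> hinner H (J k) u = hinner K k (R u)" using inner[of "J k" u] by simp
lemma R_norm: "u \<in> hcarrier H ==> hnorm K (R u) = hnorm H u" by (simp add: hnorm_def inner)
lemma J_norm: "k \<in> hcarrier K ==> hnorm H (J k) = hnorm K k" using R_norm[of "J k"] by simp

lemma adjoint_R: assumes "k \<in> hcarrier K" shows "hadjoint H K R k = J k"
 unfolding hadjoint_def using assms
proof (simp, intro the_equality conjI ballI)
 fix x assume x: "x \<in> hcarrier H & (ALL z:hcarrier H. hinner K (R z) k = hinner H z x)"
 have "R x = k"
 proof (rule K.inner_sep)
  fix z assume z: "z \<in> hcarrier K"
  then have "hinner K z k = hinner K z (R x)" using x inner[of "J z" x] J_in[OF z] RJ[OF z] by metis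
  then show "hinner K (R x) z = hinner K k z" using K.inner_sym x z assms by (metis R_in)
 qed (use x assms in auto)
 then show "x = J k" using x by auto
qed (use inner[of _ "J k"] in auto)

definition conj where "conj T = (\<lambda>f\<in>hcarrier H. J (T (R f)))"

lemma bounded_conj:
 assumes T: "T \<in> acarrier (commutant K \<chi>')" shows "conj T \<in> acarrier (commutant H \<rho>)"
proof -
 have Tb: "T \<in> bounded_ops K K" and com: "!!a f. f \<in> hcarrier K ==> T (\<chi>' a f) = \<chi>' a (T f)" using T by (auto simp: commutant_def)
 note T1 = bounded_opsD[OF Tb]
 obtain C where "ALL x:hcarrier K. hnorm K (T x) <= C * hnorm K x" using T1(4) by blast
 then have "EX C. ALL x:hcarrier H. hnorm H (J (T (R x))) <= C * hnorm H x" by (intro exI[of _ C]) (simp add: J_norm T1(1) flip: R_norm)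
 moreover have "J (T (R (\<rho> g f))) = \<rho> g (J (T (R f)))" if f: "f \<in> hcarrier H" for g f
 proof -
  have "T (R (\<rho> g f)) = R (\<rho> g (J (T (R f))))" using rep[of f g] rep[of "J (T (R f))" g] com[of "R f" "s g"] T1(1)[of "R f"] f by simp
  moreover have "\<rho> g (J (T (R f))) \<in> hcarrier H" using rep[of "J (T (R f))" g] T1(1)[of "R f"] f by simp
  ultimately show ?thesis by (simp only: JR)
 qed
 ultimately show ?thesis unfolding commutant_def bounded_ops_def conj_def using add scale rep
  by (auto simp: T1 J_add J_scale)
qed

lemma conj_surj:
 assumes U: "U \<in> acarrier (commutant H \<rho>)" shows "EX T:acarrier (commutant K \<chi>'). U = conj T"
proof -
 have Ub: "U \<in> bounded_ops H H" and com: "!!a f. f \<in> hcarrier H ==> U (\<rho> a f) = \<rho> a (U f)" using U by (auto simp: commutant_def)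
 note U1 = bounded_opsD[OF Ub]
 let ?T = "\<lambda>k\<in>hcarrier K. R (U (J k))"
 obtain C where "ALL x:hcarrier H. hnorm H (U x) <= C * hnorm H x" using U1(4) by blast
 then have b: "EX C. ALL x:hcarrier K. hnorm K (R (U (J x))) <= C * hnorm K x" by (intro exI[of _ C]) (simp add: R_norm U1(1) flip: J_norm)
 have c: "\<chi>' a k \<in> hcarrier K & R (U (J (\<chi>' a k))) = \<chi>' a (R (U (J k)))" if k: "k \<in> hcarrier K" for a k
 proof -
  obtain g where g: "a = s g" using surj by blast
  have 1: "\<chi>' a k = R (\<rho> g (J k))" using rep[of "J k" g] k by (simp add: g)
  have m: "\<rho> g (J k) \<in> hcarrier H" using rep[of "J k" g] k by simp
  have "R (U (\<rho> g (J k))) = \<chi>' a (R (U (J k)))" using com[of "J k" g] rep[of "U (J k)" g] U1(1)[of "J k"] k by (simp add: g)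
  then show ?thesis unfolding 1 JR[OF m] by (intro conjI R_in m)
 qed
 have "?T \<in> acarrier (commutant K \<chi>')" unfolding commutant_def bounded_ops_def using b c add scale K.closed
  by (auto simp: U1 J_add J_scale)
 moreover have "U = conj ?T" by (rule extensionalityI[of _ "hcarrier H"]) (simp_all add: U1 conj_def)
 ultimately show ?thesis by blast
qed

lemma conj_star:
 assumes Tb: "T \<in> bounded_ops K K"
 shows "conj (hadjoint K K T) = hadjoint H H (conj T)"
proof (rule extensionalityI[of _ "hcarrier H"])
 fix f assume f: "f \<in> hcarrier H"
 note T1 = bounded_opsD(1)[OF Tb]
 obtain y where y: "y \<in> hcarrier K" "!!w. w \<in> hcarrier K ==> hinner K (T w) (R f) = hinner K w y"
  using K.adjoint_exists[OF Tb R_in[OF f]] by blast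
 have u: "y' = y" if "y' \<in> hcarrier K" "!!w. w \<in> hcarrier K ==> hinner K (T w) (R f) = hinner K w y'" for y'
  by (rule K.inner_sep) (use that y K.inner_sym in metis)+
 have "(THE x. x \<in> hcarrier K & (ALL z:hcarrier K. hinner K (T z) (R f) = hinner K z x)) = y"
  by (rule the_equality) (use y u in blast)+
 then have "hadjoint K K T (R f) = y" using f by (simp add: hadjoint_def)
 moreover have "hadjoint H H (conj T) f = J y" unfolding hadjoint_def using f
 proof (simp, intro the_equality conjI ballI)
  show "hinner H (conj T z) f = hinner H z (J y)" if "z \<in> hcarrier H" for z
  using that f y T1 inner[of z "J y"] by (simp add: conj_def J_inner)
  fix x assume x: "x \<in> hcarrier H & (ALL z:hcarrier H. hinner H (conj T z) f = hinner H z x)"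
  have "R x = y"
  proof (rule u)
  fix w assume w: "w \<in> hcarrier K"
  then have "hinner H (conj T (J w)) f = hinner H (J w) x" using x by simp
  then show "hinner K (T w) (R f) = hinner K w (R x)" using w x f T1 by (simp add: conj_def J_inner)
  qed (use x in simp)
  then show "x = J y" using x by auto
 qed (use y in simp)
 ultimately show "conj (hadjoint K K T) f = hadjoint H H (conj T) f" using f by (simp add: conj_def)
qed (simp_all add: conj_def hadjoint_def)

lemma conj_norm:
 assumes Tb: "T \<in> bounded_ops K K" shows "opnorm H H (conj T) = opnorm K K T"
proof -
 note T1 = bounded_opsD(1)[OF Tb]
 have "{hnorm H (conj T x) |x. x \<in> hcarrier H & hnorm H x <= 1} = {hnorm K (T x) |x. x \<in> hcarrier K & hnorm K x <= 1}" (is "?X = ?Y")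
 proof (intro equalityI subsetI)
  fix t assume "t \<in> ?X"
  then obtain x where x: "x \<in> hcarrier H" "hnorm H x <= 1" "t = hnorm H (conj T x)" by blast
  then have "t = hnorm K (T (R x))" "R x \<in> hcarrier K" "hnorm K (R x) <= 1" using T1 by (simp_all add: conj_def J_norm R_norm)
  then show "t \<in> ?Y" by blast
 next
  fix t assume "t \<in> ?Y"
  then obtain x where x: "x \<in> hcarrier K" "hnorm K x <= 1" "t = hnorm K (T x)" by blast
  then have "t = hnorm H (conj T (J x))" "J x \<in> hcarrier H" "hnorm H (J x) <= 1" using T1 by (simp_all add: conj_def J_norm)
  then show "t \<in> ?X" by blast
 qed
 then show ?thesis by (simp add: opnorm_def)
qed

lemma conj_iso: "isometric_star_iso (commutant K \<chi>') (commutant H \<rho>) conj"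
 unfolding isometric_star_iso_def
proof (intro conjI ballI allI)
 have cb: "T \<in> bounded_ops K K" if "T \<in> acarrier (commutant K \<chi>')" for T using that by (simp add: commutant_def)
 show "bij_betw conj (acarrier (commutant K \<chi>')) (acarrier (commutant H \<rho>))"
  unfolding bij_betw_def
 proof (intro conjI equalityI subsetI inj_onI)
  fix S T assume S: "S \<in> acarrier (commutant K \<chi>')" and T: "T \<in> acarrier (commutant K \<chi>')" and e: "conj S = conj T"
  show "S = T"
  proof (rule extensionalityI[of _ "hcarrier K"])
  fix k assume k: "k \<in> hcarrier K"
  then have "J (S k) = J (T k)" using fun_cong[OF e, of "J k"] by (simp add: conj_def)
  then show "S k = T k" using bounded_opsD(1)[OF cb[OF S] k] bounded_opsD(1)[OF cb[OF T] k] by (metis RJ)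
  qed (use bounded_opsD(5)[OF cb] S T in auto)
 next
  show "U \<in> conj ` acarrier (commutant K \<chi>')" if "U \<in> acarrier (commutant H \<rho>)" for U using conj_surj[OF that] by blast
 qed (use bounded_conj in auto)
 show "conj (aone (commutant K \<chi>')) = aone (commutant H \<rho>)" by (auto simp: conj_def commutant_def)
 fix S c assume S: "S \<in> acarrier (commutant K \<chi>')"
 note S1 = bounded_opsD(1)[OF cb[OF S]]
 show "conj (ascale (commutant K \<chi>') c S) = ascale (commutant H \<rho>) c (conj S)"
  using S1 by (auto simp: conj_def commutant_def J_scale)
 show "conj (astar (commutant K \<chi>') S) = astar (commutant H \<rho>) (conj S)" using conj_star[OF cb[OF S]] by (simp add: commutant_def)
 show "anorm (commutant H \<rho>) (conj S) = anorm (commutant K \<chi>') S" using conj_norm[OF cb[OF S]] by (simp add: commutant_def)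
 fix T assume T: "T \<in> acarrier (commutant K \<chi>')"
 note T1 = bounded_opsD(1)[OF cb[OF T]]
 show "conj (aadd (commutant K \<chi>') S T) = aadd (commutant H \<rho>) (conj S) (conj T)"
  using S1 T1 by (auto simp: conj_def commutant_def J_add)
 show "conj (amult (commutant K \<chi>') S T) = amult (commutant H \<rho>) (conj S) (conj T)"
  using S1 T1 by (auto simp: conj_def commutant_def compose_def)
qed

theorem transport:
 assumes iso: "isometric_star_iso A (commutant K \<chi>') \<Phi>" and cl: "star_closed A"
 shows "isometric_star_iso A (commutant H \<rho>) (%sgm. \<lambda>f\<in>hcarrier H. hadjoint H K R (\<Phi> sgm (R f)))"
proof (rule isometric_star_iso_compose[OF iso conj_iso cl])
 fix sgm assume "sgm \<in> acarrier A"
 then have "\<Phi> sgm \<in> bounded_ops K K" using iso by (auto simp: isometric_star_iso_def bij_betw_def commutant_def)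
 then show "(\<lambda>f\<in>hcarrier H. hadjoint H K R (\<Phi> sgm (R f))) = conj (\<Phi> sgm)"
  unfolding conj_def by (intro restrict_ext adjoint_R) (simp add: bounded_opsD(1)[of _ K K])
qed

end

section \<open>The two commutants\<close>

lemma Linf_star_closed: "star_closed (Linf_mat :: ('a::euclidean_space, complex^'d ^ 'd) L0 staralg)"
 unfolding star_closed_def
proof (intro conjI ballI allI Linf_one)
 fix sgm tau :: "('a, complex^'d ^ 'd) L0" and c assume s: "sgm \<in> acarrier Linf_mat"
 show "ascale Linf_mat c sgm \<in> acarrier Linf_mat" "astar Linf_mat sgm \<in> acarrier Linf_mat" by (rule Linf_closed[OF s s])+
 assume t: "tau \<in> acarrier Linf_mat"
 show "aadd Linf_mat sgm tau \<in> acarrier Linf_mat" "amult Linf_mat sgm tau \<in> acarrier Linf_mat" by (rule Linf_closed[OF s t])+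
qed

text \<open>The exponential factor of the Fock representation is the quotient of the weights at \<open>(x, y)\<close>
and at the translated point.\<close>

lemma Fock_to_H_rho:
 fixes b :: "real^'n"
 assumes a: "al > 0"
 shows "Fock_to_H al (rho_F al b f) = rho_H (sqrt al *\<^sub>R b) (Fock_to_H al f)"
proof
 fix p :: "(real^'n) \<times> (real^'n)"
 obtain x y where p: "p = (x, y)" by force
 define c where "c = sqrt al *\<^sub>R b"
 let ?z = "(1 / sqrt al) *\<^sub>R toC (x, y)"
 have z: "?z - vec_of_real b = (1 / sqrt al) *\<^sub>R toC (x - c, y)"
  using a by (simp add: vec_eq_iff complex_eq_iff vec_of_real_def toC_def c_def field_simps)
 have "of_real al * (?z $ r * of_real (b $ r)) = of_real (x $ r * c $ r) + \<i> * of_real (y $ r * c $ r)" for r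
 proof -
  have k: "al * w / sqrt al = sqrt al * w" for w using real_div_sqrt[of al] a by (metis less_imp_le times_divide_eq_left)
  show ?thesis by (simp add: complex_eq_iff toC_def c_def mult_ac k)
 qed
 then have "of_real al * cip ?z (vec_of_real b) = (SUM r:UNIV. of_real (x $ r * c $ r) + \<i> * of_real (y $ r * c $ r))"
  unfolding cip_def vec_of_real_def sum_distrib_left by simp
 then have e: "of_real al * cip ?z (vec_of_real b) = of_real (x \<bullet> c) + \<i> * of_real (y \<bullet> c)"
  by (simp add: inner_vec_def sum.distrib sum_distrib_left)
 have n: "al / 2 * (norm b)^2 = (norm c)^2 / 2" using a by (simp add: c_def power_mult_distrib)
 have nx: "(norm (x - c))\<^sup>2 = (norm x)^2 - 2 * (x \<bullet> c) + (norm c)^2"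
  by (simp add: power2_norm_eq_inner inner_diff_left inner_diff_right inner_commute)
 have ex: "(of_real (- (norm x)\<^sup>2 / 2 - (norm y)\<^sup>2 / 2) - \<i> * of_real (x \<bullet> y)) + (of_real (x \<bullet> c) + \<i> * of_real (y \<bullet> c) - of_real ((norm c)^2 / 2)) =
  of_real (- (norm (x - c))\<^sup>2 / 2 - (norm y)\<^sup>2 / 2) - \<i> * of_real ((x - c) \<bullet> y)"
  unfolding nx by (simp add: complex_eq_iff inner_diff_left inner_diff_right inner_commute field_simps)
 have h: "hweight (x, y) * exp (of_real al * cip ?z (vec_of_real b) - of_real (al / 2 * (norm b)^2)) = hweight (x - c, y)"
  unfolding e n hweight_def fst_conv snd_conv mult.assoc exp_add[symmetric] ex ..
 show "Fock_to_H al (rho_F al b f) p = rho_H (sqrt al *\<^sub>R b) (Fock_to_H al f) p"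
  unfolding p rho_H_def split Fock_to_H_eq c_def[symmetric] rho_F_def z h[symmetric] by (simp only: mult_ac)
qed

context fock_setting
begin

abbreviation F where "F \<equiv> Fock al m :: (complex^'n::{finite,linorder} => complex) hilb"

abbreviation RF :: "(complex^'n::{finite,linorder} => complex) => (real^'n::{finite,linorder}, complex^'d::{finite,linorder}) L0"
 where "RF \<equiv> R_F al m"

lemma RF_eq: "f \<in> hcarrier F ==> RF f = R (Fock_to_H al f)" by (simp add: R_F_def)

lemma U_mem: "Fock_to_H al f \<in> hcarrier H \<longleftrightarrow> f \<in> hcarrier F"
proof
 assume "Fock_to_H al f \<in> hcarrier H"
 then obtain g where "Fock_to_H al f = Fock_to_H al g" "g \<in> hcarrier F" by (rule HspE)
 then show "f \<in> hcarrier F" using Fock_to_H_inj[OF a, of f g] by simp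
qed (simp add: Hsp_def)

lemma U_bij: "bij_betw (Fock_to_H al) (hcarrier F) (hcarrier H)"
 by (rule bij_betw_imageI, rule inj_onI, erule Fock_to_H_inj[OF a], simp add: Hsp_def)

lemma H_transport: "unitary_transport H L2vec R rho_H chi id"
proof
 show "bij_betw R (hcarrier H) (HV)" by (rule R_bij)
qed (simp_all add: R_inner R_add R_scale R_rho)

lemma F_transport: "unitary_transport F L2vec RF (rho_F al) chi (%b. sqrt al *\<^sub>R b)"
proof
 have U: "Fock_to_H al f \<in> hcarrier H" if "f \<in> hcarrier F" for f using that by (simp add: U_mem)
 have "bij_betw (R \<circ> Fock_to_H al) (hcarrier F) (HV)" by (rule bij_betw_trans[OF U_bij R_bij])
 then show "bij_betw RF (hcarrier F) (HV)" by (subst bij_betw_cong[of _ _ "R \<circ> Fock_to_H al"]) (simp_all add: RF_eq)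
 fix f g c b assume f: "f \<in> hcarrier F"
 have s: "Fock_to_H al (hscale F c f) = hscale H c (Fock_to_H al f)" by (rule ext) (simp add: Fock_to_H_eq Hsp_def Fock_def)
 have "hscale F c f \<in> hcarrier F" unfolding U_mem[symmetric] s by (rule R_scale(1)[OF U[OF f]])
 then show "hscale F c f \<in> hcarrier F & RF (hscale F c f) = hscale L2vec c (RF f)" by (simp add: RF_eq f s R_scale(2)[OF U[OF f]])
 note r = Fock_to_H_rho[OF a, of b f]
 have "rho_F al b f \<in> hcarrier F" unfolding U_mem[symmetric] r by (rule R_rho(1)[OF U[OF f]])
 then show "rho_F al b f \<in> hcarrier F & RF (rho_F al b f) = chi (sqrt al *\<^sub>R b) (RF f)" by (simp add: RF_eq f r R_rho(2)[OF U[OF f]])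
 assume g: "g \<in> hcarrier F"
 have ad: "Fock_to_H al (hadd F f g) = hadd H (Fock_to_H al f) (Fock_to_H al g)" by (rule ext) (simp add: Fock_to_H_eq Hsp_def Fock_def distrib_left)
 have "hadd F f g \<in> hcarrier F" unfolding U_mem[symmetric] ad by (rule R_add(1)[OF U[OF f] U[OF g]])
 then show "hadd F f g \<in> hcarrier F & RF (hadd F f g) = hadd L2vec (RF f) (RF g)" by (simp add: RF_eq f g ad R_add(2)[OF U[OF f] U[OF g]])
 show "hinner L2vec (RF f) (RF g) = hinner F f g"
  by (simp add: RF_eq f g R_inner U Fock_to_H_inner[OF a Fock_continuous[OF f] Fock_continuous[OF g]])
next
 show "surj (%b :: real^'n::{finite,linorder}. sqrt al *\<^sub>R b)"
  by (rule surjI[of _ "%b. (1 / sqrt al) *\<^sub>R b"]) (use a in simp)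
qed

end

theorem theorem10p2:
 fixes m :: nat and \<alpha> :: real
 assumes "m \<ge> 1" and "\<alpha> > 0"
  and "CARD('d::{finite,linorder}) = (CARD('n::{finite,linorder}) + m - 1) choose CARD('n)"
 shows
  "isometric_star_iso
   (Linf_mat :: (real ^ 'n::{finite,linorder}, complex ^ 'd::{finite,linorder} ^ 'd::{finite,linorder}) L0 staralg)
   (commutant (Hsp \<alpha> m) rho_H)
   (Lambda_H \<alpha> m) \<and>
  isometric_star_iso
   (Linf_mat :: (real ^ 'n::{finite,linorder}, complex ^ 'd::{finite,linorder} ^ 'd::{finite,linorder}) L0 staralg)
   (commutant (Fock \<alpha> m) (rho_F \<alpha>))
   (Lambda_F \<alpha> m) \<and>
  isometrically_isomorphic
   (commutant (Fock \<alpha> m :: (complex ^ 'n::{finite,linorder} \<Rightarrow> complex) hilb) (rho_F \<alpha>))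
   (Linf_mat :: (real ^ 'n::{finite,linorder}, complex ^ 'd::{finite,linorder} ^ 'd::{finite,linorder}) L0 staralg) \<and>
  isometrically_isomorphic
   (commutant (Hsp \<alpha> m :: ((real ^ 'n::{finite,linorder}) \<times> (real ^ 'n::{finite,linorder}) \<Rightarrow> complex) hilb) rho_H)
   (Linf_mat :: (real ^ 'n::{finite,linorder}, complex ^ 'd::{finite,linorder} ^ 'd::{finite,linorder}) L0 staralg)"
proof -
 interpret fock_setting \<alpha> m "lex_enum m :: 'd => nat ^ 'n::{finite,linorder}"
  using assms(1,2) lex_enum_bij[OF assms(1,3)] by unfold_locales simp_all
 interpret TH: unitary_transport H L2vec R rho_H chi id by (rule H_transport)
 interpret TF: unitary_transport F L2vec RF "rho_F \<alpha>" chi "%b. sqrt \<alpha> *\<^sub>R b" by (rule F_transport)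
 have LH: "isometric_star_iso Linf_mat (commutant H rho_H) (Lambda_H \<alpha> m :: (real^'n::{finite,linorder}, complex^'d::{finite,linorder} ^ 'd::{finite,linorder}) L0 => _)"
  using TH.transport[OF mult_op_iso Linf_star_closed] unfolding Lambda_H_def[abs_def] .
 have LF: "isometric_star_iso Linf_mat (commutant F (rho_F \<alpha>)) (Lambda_F \<alpha> m :: (real^'n::{finite,linorder}, complex^'d::{finite,linorder} ^ 'd::{finite,linorder}) L0 => _)"
  using TF.transport[OF mult_op_iso Linf_star_closed] unfolding Lambda_F_def[abs_def] .
 show ?thesis
  using LH LF isometric_star_iso_inverse[OF LH Linf_star_closed] isometric_star_iso_inverse[OF LF Linf_star_closed] by blast
qed

end
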